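(* Under the standing assumptions listed in the context (in particular $u_0=(u_{1,0},\dots,u_{m,0})\in\mathrm{BUC}(\mathbb{R}^n;\mathbb{R}^m)$), for each $\omega\in\Omega_3$ the solutions $u^\epsilon=(u^\epsilon_1,\dots,u^\epsilon_m)$ of $$\begin{cases} u^\epsilon_{k,t}-\epsilon\,\mathrm{tr}\big(A_k(\tfrac{x}{\epsilon},\omega)D^2u^\epsilon_k\big)+H_k\big(Du^\epsilon_k,u^\epsilon,\tfrac{u^\epsilon_k-u^\epsilon_j}{\epsilon},\tfrac{x}{\epsilon},\omega\big)=0 & \text{on } \mathbb{R}^n\times(0,\infty),\ k=1,\dots,m,\\ u^\epsilon=u_0 & \text{on } \mathbb{R}^n\times\{0\},\end{cases}$$ satisfy, as $\epsilon\to0$, for each $k\in\{1,\dots,m\}$, $u^\epsilon_k\to\overline{u}$ locally uniformly on $\mathbb{R}^n\times(0,\infty)$, where $\overline{u}$ is the solution of the scalar problem $$\begin{cases}\overline{u}_t+\overline{H}(D\overline{u},\overline{u})=0 & \text{on } \mathbb{R}^n\times(0,\infty),\\ \overline{u}=\underline{u}_0 & \text{on } \mathbb{R}^n\times\{0\},\end{cases}\qquad \underline{u}_0=\min_{1\le k\le m}u_{k,0}.$$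
   Context: Setting. The index $k$ ranges over $\{1,\dots,m\}$; $B_R$ is the open ball of radius $R$ centered at $0$ in the relevant Euclidean space; for $r\in\mathbb{R}$, $\hat r=(r,\dots,r)\in\mathbb{R}^m$. In the $k$-th equation $s=(s_i)_{i\ne k}\in\mathbb{R}^{m-1}$, and $u_k-u_j$ (resp. $\frac{u_k-u_j}{\epsilon}$) inside $H_k$ denotes the vector $(u_k-u_j)_{j\ne k}$ (resp. divided by $\epsilon$). $(\Omega,\mathcal F,\mathbb P)$ is a probability space with a group $(\tau_y)_{y\in\mathbb{R}^n}$ of measure-preserving transformations which is ergodic (if $\tau_yE=E$ for all $y$ then $\mathbb P(E)\in\{0,1\}$). A process $f$ on $\mathbb{R}^n\times\Omega$ is stationary if $f(y+z,\omega)=f(y,\tau_z\omega)$ for all $y,z$. Standing assumptions on $A_k=A_k(y,\omega)$ (symmetric $n\times n$ matrices) and $H_k=H_k(p,r,s,y,\omega)$, $p\in\mathbb{R}^n$, $r\in\mathbb{R}^m$, $s\in\mathbb{R}^{m-1}$, $y\in\mathbb{R}^n$, $\omega\in\Omega$ (each for all $k$ and globally in the variables unless indicated): (1) $A_k$ and, for fixed $(p,r,s)$, $H_k(p,r,s,\cdot,\cdot)$ are stationary. (2) $p\mapsto H_k(p,r,s,y,\omega)$ is convex, and $s\mapsto H_k(p,r,s,y,\omega)$ is convex (other variables fixed). (3) There are $\gamma_k>1$ such that for each $R>0$ there are $C_1,C_2,C_3>0$ with $C_1|p|^{\gamma_k}+C_2\max_{i\ne k}(s_i)_+-C_3\le H_k(p,r,s,y,\omega)$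 for all $r\in B_R$. (4) $A_k=\Sigma_k\Sigma_k^t$ with $\Sigma_k(y,\omega)$ an $n\times d_k$ matrix and $\|\Sigma_k(\cdot,\omega)\|_{C^{0,1}(\mathbb{R}^n)}\le C$ for all $\omega$. (5) $H_k$ is nondecreasing in $r_k$ and in each $s_i$, and nonincreasing in $r_i$ for $i\ne k$. (6) For each $R>0$ there is $C_4(R)$ with $|H_k|\le C_4$ for $(p,r,s)\in B_R\times B_R\times B_R$. (7) For each $R>0$ there is $C_5(R)$ such that for $(r_i,s_i)\in B_R\times B_R$, $i=1,2$, $|H_k(p_1,r_1,s_1,y_1,\omega)-H_k(p_2,r_2,s_2,y_2,\omega)|\le C_5[(1+|p_1|+|p_2|)^{\gamma_k-1}|p_1-p_2|+|r_1-r_2|+|s_1-s_2|+|y_1-y_2|]$. (8) If $r,q\in\mathbb{R}^m$ and $r_k-q_k=\max_i|r_i-q_i|$ then $H_k(p,r,s,y,\omega)-H_k(p,q,s,y,\omega)\ge0$. (9) $u_0\in\mathrm{BUC}(\mathbb{R}^n;\mathbb{R}^m)$ (bounded uniformly continuous). Solutions, sub- and supersolutions are in the viscosity sense (for systems: $u$ is a subsolution if each $k$-th inequality holds with the derivatives of $u_k$ replaced by those of a $C^2$ test function touching $u_k$ from above, the values of all components being taken at the touching point; supersolutions analogously). The system has, for each $\epsilon,\omega$, a unique solution $u^\epsilon$ lying in $\mathrm{BUC}(\mathbb{R}^n\times[0,T);\mathbb{R}^m)$ for every $T>0$, and the scalar problem has a unique solution $\overline u$ lying in $\mathrm{BUC}(\mathbb{R}^n\times[0,T))$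 for every $T>0$; these are the solutions meant. Effective Hamiltonian. For $(p,r)\in\mathbb{R}^n\times\mathbb{R}$, $\delta>0$, $\omega\in\Omega$, $v^\delta=(v^\delta_1,\dots,v^\delta_m)$ is the unique solution, with all $v^\delta_k$ and $Dv^\delta_k$ bounded, of $\delta v^\delta_k-\mathrm{tr}(A_k(y,\omega)D^2v^\delta_k)+H_k(p+Dv^\delta_k,\hat r,v^\delta_k-v^\delta_j,y,\omega)=0$ on $\mathbb{R}^n$. $\overline H(p,r)$ is the deterministic number with $\overline H(p,r)=\limsup_{\delta\to0}-\delta v^\delta_1(0,\omega)$ for almost every $\omega$. $\Omega_3\subset\Omega$ is a fixed set of full probability such that for every $\omega\in\Omega_3$, $R>0$ and $(p,r)\in\mathbb{R}^n\times\mathbb{R}$, $\lim_{\delta\to0}\sup_{y\in B_{R/\delta}}|\delta v^\delta_1(y,\omega)+\overline H(p,r)|=0$ (such a set exists). *)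

theory Defs
  imports "HOL-Probability.Probability"
begin

text \<open>
  The dimensions are \<open>n = CARD('n)\<close> and \<open>m = CARD('m)\<close>; the indices \<open>k = 1, \<dots>, m\<close> are the
  elements of \<open>'m\<close>.

  The space \<open>\<real>\<^bsup>m-1\<^esup>\<close> in which the argument \<open>s = (s\<^sub>i)\<^bsub>i \<noteq> k\<^esub>\<close> of the k-th Hamiltonian lives is
  identified, isometrically, with the hyperplane of all \<open>s\<close> in \<open>real ^ 'm\<close> with \<open>s $ k = 0\<close>.
  All hypotheses on \<open>H k\<close> are restricted to that hyperplane, and the differences
  \<open>\<chi> j. u $ k - u $ j\<close> belong to it, so \<open>H k\<close> is never evaluated off it.
\<close>

definition others :: "'m \<Rightarrow> (real ^ 'm::finite) set" where
  "others k = {s. s $ k = 0}"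

definition vec_upd :: "real ^ 'm \<Rightarrow> 'm \<Rightarrow> real \<Rightarrow> real ^ 'm::finite" where
  "vec_upd r i a = (\<chi> j. if j = i then a else r $ j)"


section \<open>Random environment\<close>

locale ergodic_environment = prob_space M
  for M :: "'w measure" +
  fixes \<tau> :: "real ^ 'n::finite \<Rightarrow> 'w \<Rightarrow> 'w"
  assumes tau_measurable: "\<And>y. \<tau> y \<in> measurable M M"
    and tau_zero: "\<And>\<omega>. \<omega> \<in> space M \<Longrightarrow> \<tau> 0 \<omega> = \<omega>"
    and tau_add: "\<And>y z \<omega>. \<omega> \<in> space M \<Longrightarrow> \<tau> (y + z) \<omega> = \<tau> y (\<tau> z \<omega>)"
    and measure_preserving: "\<And>y. distr M M (\<tau> y) = M"
    and ergodic: "\<And>E. E \<in> sets M \<Longrightarrow> (\<And>y. \<tau> y ` E = E) \<Longrightarrow> prob E \<in> {0, 1}"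

text \<open>A process is a family of random variables, whence the measurability clause.\<close>

definition stationary_process ::
    "'w measure \<Rightarrow> (real ^ 'n::finite \<Rightarrow> 'w \<Rightarrow> 'w) \<Rightarrow>
     (real ^ 'n \<Rightarrow> 'w \<Rightarrow> 'b::topological_space) \<Rightarrow> bool" where
  "stationary_process M \<tau> f \<longleftrightarrow>
     (\<forall>y. f y \<in> borel_measurable M) \<and>
     (\<forall>y z. \<forall>\<omega>\<in>space M. f (y + z) \<omega> = f y (\<tau> z \<omega>))"


section \<open>Standing assumptions on the coefficients\<close>

text \<open>
  In \<open>A_factor\<close>, \<open>\<Sigma> k y \<omega> j\<close> is the j-th column, \<open>j < d k\<close>, of the \<open>n \<times> d\<^sub>k\<close> matrix
  \<open>\<Sigma>\<^sub>k(y, \<omega>)\<close>, and the \<open>L2_set\<close> expressions are Frobenius norms. In \<open>H_coercive\<close>, inserting 0 does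
  not change the maximum over \<open>i \<noteq> k\<close> of the positive parts, except that it is 0 for \<open>m = 1\<close>.
\<close>

locale hj_system = ergodic_environment M \<tau>
  for M :: "'w measure" and \<tau> :: "real ^ 'n::finite \<Rightarrow> 'w \<Rightarrow> 'w" +
  fixes A :: "'m::finite \<Rightarrow> real ^ 'n \<Rightarrow> 'w \<Rightarrow> real ^ 'n ^ 'n"
    and H :: "'m \<Rightarrow> real ^ 'n \<Rightarrow> real ^ 'm \<Rightarrow> real ^ 'm \<Rightarrow> real ^ 'n \<Rightarrow> 'w \<Rightarrow> real"
    and \<gamma> :: "'m \<Rightarrow> real"
  assumes A_stationary: "\<And>k. stationary_process M \<tau> (A k)"
    and H_stationary: "\<And>k p r s. s \<in> others k \<Longrightarrow> stationary_process M \<tau> (H k p r s)"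
    and H_convex_p: "\<And>k r s y \<omega>. s \<in> others k \<Longrightarrow> \<omega> \<in> space M \<Longrightarrow>
        convex_on UNIV (\<lambda>p. H k p r s y \<omega>)"
    and H_convex_s: "\<And>k p r y \<omega>. \<omega> \<in> space M \<Longrightarrow> convex_on (others k) (\<lambda>s. H k p r s y \<omega>)"
    and gamma_gt_1: "\<And>k. \<gamma> k > 1"
    and H_coercive: "\<And>k R. R > 0 \<Longrightarrow> \<exists>C1>0. \<exists>C2>0. \<exists>C3>0.
        \<forall>p. \<forall>r\<in>ball 0 R. \<forall>s\<in>others k. \<forall>y. \<forall>\<omega>\<in>space M.
          C1 * norm p powr \<gamma> k + C2 * Max (insert 0 ((\<lambda>i. max (s $ i) 0) ` (- {k}))) - C3
            \<le> H k p r s y \<omega>"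
    and A_factor: "\<exists>d \<Sigma>.
        (\<forall>k y. \<forall>\<omega>\<in>space M.
           A k y \<omega> = (\<chi> a b. \<Sum>j<(d k :: nat). \<Sigma> k y \<omega> j $ a * \<Sigma> k y \<omega> j $ b)) \<and>
        (\<forall>k. \<exists>C. \<forall>\<omega>\<in>space M.
           (\<forall>y. L2_set (\<lambda>j. norm (\<Sigma> k y \<omega> j)) {..<d k} \<le> C) \<and>
           (\<forall>y z. L2_set (\<lambda>j. norm (\<Sigma> k y \<omega> j - \<Sigma> k z \<omega> j)) {..<d k} \<le> C * norm (y - z)))"
    and H_mono_r_diag: "\<And>k p r s y \<omega>. s \<in> others k \<Longrightarrow> \<omega> \<in> space M \<Longrightarrow>
        mono (\<lambda>a. H k p (vec_upd r k a) s y \<omega>)"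
    and H_mono_s: "\<And>k i p r s y \<omega>. i \<noteq> k \<Longrightarrow> s \<in> others k \<Longrightarrow> \<omega> \<in> space M \<Longrightarrow>
        mono (\<lambda>a. H k p r (vec_upd s i a) y \<omega>)"
    and H_antimono_r_off_diag: "\<And>k i p r s y \<omega>. i \<noteq> k \<Longrightarrow> s \<in> others k \<Longrightarrow> \<omega> \<in> space M \<Longrightarrow>
        antimono (\<lambda>a. H k p (vec_upd r i a) s y \<omega>)"
    and H_locally_bounded: "\<And>k R. R > 0 \<Longrightarrow> \<exists>C4.
        \<forall>p\<in>ball 0 R. \<forall>r\<in>ball 0 R. \<forall>s\<in>ball 0 R \<inter> others k. \<forall>y. \<forall>\<omega>\<in>space M.
          \<bar>H k p r s y \<omega>\<bar> \<le> C4"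
    and H_locally_Lipschitz: "\<And>k R. R > 0 \<Longrightarrow> \<exists>C5.
        \<forall>p1 p2. \<forall>r1\<in>ball 0 R. \<forall>r2\<in>ball 0 R.
        \<forall>s1\<in>ball 0 R \<inter> others k. \<forall>s2\<in>ball 0 R \<inter> others k. \<forall>y1 y2. \<forall>\<omega>\<in>space M.
          \<bar>H k p1 r1 s1 y1 \<omega> - H k p2 r2 s2 y2 \<omega>\<bar>
            \<le> C5 * ((1 + norm p1 + norm p2) powr (\<gamma> k - 1) * norm (p1 - p2)
                    + norm (r1 - r2) + norm (s1 - s2) + norm (y1 - y2))"
    and H_monotone_system: "\<And>k p r q s y \<omega>. s \<in> others k \<Longrightarrow> \<omega> \<in> space M \<Longrightarrow>
        r $ k - q $ k = Max (range (\<lambda>i. \<bar>r $ i - q $ i\<bar>)) \<Longrightarrow>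
        H k p r s y \<omega> - H k p q s y \<omega> \<ge> 0"


section \<open>Viscosity solutions\<close>

text \<open>\<open>\<phi>\<close> is of class \<open>C\<^sup>2\<close> on the open set \<open>S\<close>, with first and second derivatives \<open>\<phi>'\<close> and \<open>\<phi>''\<close>.\<close>

definition C2_on ::
    "'a::real_normed_vector set \<Rightarrow> ('a \<Rightarrow> real) \<Rightarrow> ('a \<Rightarrow> 'a \<Rightarrow>\<^sub>L real) \<Rightarrow>
     ('a \<Rightarrow> 'a \<Rightarrow>\<^sub>L 'a \<Rightarrow>\<^sub>L real) \<Rightarrow> bool" where
  "C2_on S \<phi> \<phi>' \<phi>'' \<longleftrightarrow>
     (\<forall>z\<in>S. (\<phi> has_derivative blinfun_apply (\<phi>' z)) (at z)) \<and>
     (\<forall>z\<in>S. (\<phi>' has_derivative blinfun_apply (\<phi>'' z)) (at z)) \<and>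
     continuous_on S \<phi>''"

definition touches_from_above :: "('a::topological_space \<Rightarrow> real) \<Rightarrow> ('a \<Rightarrow> real) \<Rightarrow> 'a \<Rightarrow> bool" where
  "touches_from_above \<phi> w z \<longleftrightarrow> \<phi> z = w z \<and> (\<forall>\<^sub>F z' in nhds z. w z' \<le> \<phi> z')"

definition touches_from_below :: "('a::topological_space \<Rightarrow> real) \<Rightarrow> ('a \<Rightarrow> real) \<Rightarrow> 'a \<Rightarrow> bool" where
  "touches_from_below \<phi> w z \<longleftrightarrow> \<phi> z = w z \<and> (\<forall>\<^sub>F z' in nhds z. \<phi> z' \<le> w z')"

text \<open>
  A scalar inequality for \<open>w\<close> on the open set \<open>S\<close>. The operator \<open>G\<close> receives the point and the first
  and second derivatives of the test function. For the k-th equation of a system with unknown \<open>u\<close>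
  one takes \<open>w = (\<lambda>z. u z $ k)\<close>, and \<open>G\<close> reads off all components of \<open>u\<close> at the point of touching.
\<close>

definition visc_le_zero ::
    "'a::real_normed_vector set \<Rightarrow> ('a \<Rightarrow> ('a \<Rightarrow>\<^sub>L real) \<Rightarrow> ('a \<Rightarrow>\<^sub>L 'a \<Rightarrow>\<^sub>L real) \<Rightarrow> real) \<Rightarrow>
     ('a \<Rightarrow> real) \<Rightarrow> bool" where
  "visc_le_zero S G w \<longleftrightarrow>
     (\<forall>\<phi> \<phi>' \<phi>''. \<forall>z\<in>S. C2_on S \<phi> \<phi>' \<phi>'' \<longrightarrow> touches_from_above \<phi> w z \<longrightarrow>
        G z (\<phi>' z) (\<phi>'' z) \<le> 0)"

definition visc_ge_zero ::
    "'a::real_normed_vector set \<Rightarrow> ('a \<Rightarrow> ('a \<Rightarrow>\<^sub>L real) \<Rightarrow> ('a \<Rightarrow>\<^sub>L 'a \<Rightarrow>\<^sub>L real) \<Rightarrow> real) \<Rightarrow>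
     ('a \<Rightarrow> real) \<Rightarrow> bool" where
  "visc_ge_zero S G w \<longleftrightarrow>
     (\<forall>\<phi> \<phi>' \<phi>''. \<forall>z\<in>S. C2_on S \<phi> \<phi>' \<phi>'' \<longrightarrow> touches_from_below \<phi> w z \<longrightarrow>
        G z (\<phi>' z) (\<phi>'' z) \<ge> 0)"

definition visc_eq_zero ::
    "'a::real_normed_vector set \<Rightarrow> ('a \<Rightarrow> ('a \<Rightarrow>\<^sub>L real) \<Rightarrow> ('a \<Rightarrow>\<^sub>L 'a \<Rightarrow>\<^sub>L real) \<Rightarrow> real) \<Rightarrow>
     ('a \<Rightarrow> real) \<Rightarrow> bool" where
  "visc_eq_zero S G w \<longleftrightarrow> visc_le_zero S G w \<and> visc_ge_zero S G w"

definition grad :: "((real ^ 'n) \<Rightarrow>\<^sub>L real) \<Rightarrow> real ^ 'n::finite" where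
  "grad L = (\<chi> i. L (axis i 1))"

definition hessian :: "((real ^ 'n) \<Rightarrow>\<^sub>L (real ^ 'n) \<Rightarrow>\<^sub>L real) \<Rightarrow> real ^ 'n ^ 'n::finite" where
  "hessian B = (\<chi> i j. B (axis i 1) (axis j 1))"

text \<open>Time derivative, spatial gradient and spatial Hessian on space-time \<open>\<real>\<^sup>n \<times> \<real>\<close>.\<close>

definition time_deriv :: "(((real ^ 'n::finite) \<times> real) \<Rightarrow>\<^sub>L real) \<Rightarrow> real" where
  "time_deriv L = L (0, 1)"

definition space_grad :: "(((real ^ 'n) \<times> real) \<Rightarrow>\<^sub>L real) \<Rightarrow> real ^ 'n::finite" where
  "space_grad L = (\<chi> i. L (axis i 1, 0))"

definition space_hessian ::
    "(((real ^ 'n) \<times> real) \<Rightarrow>\<^sub>L ((real ^ 'n) \<times> real) \<Rightarrow>\<^sub>L real) \<Rightarrow> real ^ 'n ^ 'n::finite" where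
  "space_hessian B = (\<chi> i j. B (axis i 1, 0) (axis j 1, 0))"

definition BUC_on :: "'a::metric_space set \<Rightarrow> ('a \<Rightarrow> 'b::metric_space) \<Rightarrow> bool" where
  "BUC_on S f \<longleftrightarrow> bounded (f ` S) \<and> uniformly_continuous_on S f"


section \<open>The problems\<close>

text \<open>
  Solution of the oscillating Cauchy problem for one \<open>\<omega>\<close>; the argument \<open>(x, t)\<close> of \<open>u\<close> is only
  relevant for \<open>t \<ge> 0\<close>.
\<close>

definition solves_system ::
    "('m::finite \<Rightarrow> real ^ 'n::finite \<Rightarrow> 'w \<Rightarrow> real ^ 'n ^ 'n) \<Rightarrow>
     ('m \<Rightarrow> real ^ 'n \<Rightarrow> real ^ 'm \<Rightarrow> real ^ 'm \<Rightarrow> real ^ 'n \<Rightarrow> 'w \<Rightarrow> real) \<Rightarrow>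
     (real ^ 'n \<Rightarrow> real ^ 'm) \<Rightarrow> real \<Rightarrow> 'w \<Rightarrow> ((real ^ 'n) \<times> real \<Rightarrow> real ^ 'm) \<Rightarrow> bool" where
  "solves_system A H u0 \<epsilon> \<omega> u \<longleftrightarrow>
     (\<forall>T>0. BUC_on (UNIV \<times> {0..<T}) u) \<and>
     (\<forall>k. visc_eq_zero (UNIV \<times> {0<..})
        (\<lambda>z L B. time_deriv L - \<epsilon> * trace (A k (fst z /\<^sub>R \<epsilon>) \<omega> ** space_hessian B)
           + H k (space_grad L) (u z) (\<chi> j. (u z $ k - u z $ j) / \<epsilon>) (fst z /\<^sub>R \<epsilon>) \<omega>)
        (\<lambda>z. u z $ k)) \<and>
     (\<forall>x. u (x, 0) = u0 x)"

text \<open>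
  Approximate corrector. The solutions need not be differentiable; boundedness of the gradient means
  Lipschitz continuity.
\<close>

definition approx_corrector ::
    "('m::finite \<Rightarrow> real ^ 'n::finite \<Rightarrow> 'w \<Rightarrow> real ^ 'n ^ 'n) \<Rightarrow>
     ('m \<Rightarrow> real ^ 'n \<Rightarrow> real ^ 'm \<Rightarrow> real ^ 'm \<Rightarrow> real ^ 'n \<Rightarrow> 'w \<Rightarrow> real) \<Rightarrow>
     real ^ 'n \<Rightarrow> real \<Rightarrow> real \<Rightarrow> 'w \<Rightarrow> (real ^ 'n \<Rightarrow> real ^ 'm) \<Rightarrow> bool" where
  "approx_corrector A H p r \<delta> \<omega> v \<longleftrightarrow>
     bounded (range v) \<and> (\<exists>C. C-lipschitz_on UNIV v) \<and>
     (\<forall>k. visc_eq_zero UNIV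
        (\<lambda>y L B. \<delta> * v y $ k - trace (A k y \<omega> ** hessian B)
           + H k (p + grad L) (vec r) (\<chi> j. v y $ k - v y $ j) y \<omega>)
        (\<lambda>y. v y $ k))"

text \<open>
  \<open>Hbar\<close> is the effective Hamiltonian; \<open>v p r \<delta> \<omega>\<close> are the approximate correctors and \<open>i1\<close> is the
  component called 1.
\<close>

definition effective_Hamiltonian ::
    "'w measure \<Rightarrow> (real ^ 'n::finite \<Rightarrow> real \<Rightarrow> real \<Rightarrow> 'w \<Rightarrow> real ^ 'n \<Rightarrow> real ^ 'm::finite) \<Rightarrow> 'm \<Rightarrow>
     (real ^ 'n \<Rightarrow> real \<Rightarrow> real) \<Rightarrow> bool" where
  "effective_Hamiltonian M v i1 Hbar \<longleftrightarrow>
     (\<forall>p r. AE \<omega> in M.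
        Limsup (at_right 0) (\<lambda>\<delta>. ereal (- \<delta> * v p r \<delta> \<omega> 0 $ i1)) = ereal (Hbar p r))"

definition solves_effective ::
    "(real ^ 'n::finite \<Rightarrow> real \<Rightarrow> real) \<Rightarrow> (real ^ 'n \<Rightarrow> real) \<Rightarrow> ((real ^ 'n) \<times> real \<Rightarrow> real) \<Rightarrow> bool" where
  "solves_effective Hbar g u \<longleftrightarrow>
     (\<forall>T>0. BUC_on (UNIV \<times> {0..<T}) u) \<and>
     visc_eq_zero (UNIV \<times> {0<..}) (\<lambda>z L B. time_deriv L + Hbar (space_grad L) (u z)) u \<and>
     (\<forall>x. u (x, 0) = g x)"

definition locally_uniform_limit ::
    "'a::topological_space set \<Rightarrow> ('i \<Rightarrow> 'a \<Rightarrow> real) \<Rightarrow> ('a \<Rightarrow> real) \<Rightarrow> 'i filter \<Rightarrow> bool" where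
  "locally_uniform_limit S f l F \<longleftrightarrow> (\<forall>K. compact K \<longrightarrow> K \<subseteq> S \<longrightarrow> uniform_limit K f l F)"

end

theory Submission
  imports Defs
begin

text \<open>
  The proof is by the perturbed test function method, applied to the relaxed upper half-limits of the
  components of \<open>u\<^sup>\<epsilon>\<close> and of \<open>- u\<^sup>\<epsilon>\<close>, which are treated together by a sign \<open>sg \<in> {1, - 1}\<close>.

  The approximate correctors have oscillation between components bounded uniformly in \<open>\<delta>\<close>, so that
  \<open>\<delta> v\<^sub>k\<close> converges to \<open>- Hbar\<close> for every \<open>k\<close>, locally uniformly at scale \<open>1 / \<delta>\<close>. If a smooth
  function touches a half-limit, the variables are doubled between \<open>u\<^sup>\<epsilon>\<close> and \<open>1 \<plusminus> \<mu>\<close> times the rescaled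
  corrector, and convexity of the Hamiltonian in \<open>p\<close> shows that the half-limit satisfies the effective
  inequality up to \<open>O(\<mu>)\<close>. No comparison principle for the limit equation is required: the effective
  solution itself is given, and doubling variables between a half-limit and \<open>ubar\<close> gives, for both
  functions, the value of \<open>Hbar\<close> at the same point \<open>(p, r)\<close>. Barriers show that the half-limits have
  the initial value \<open>min u\<^sub>k\<^sub>,\<^sub>0\<close>.

  Second-order information on merely continuous solutions comes from the theorem on sums, which is
  proved from Rademacher's theorem by regularising with sup-convolutions and paraboloid envelopes.
\<close>

section \<open>Rademacher's theorem\<close>

text \<open>Two things are missing: any regularity of \<open>Hbar\<close> in \<open>(p, r)\<close>,
  and any control of the Lipschitz constants of the correctors as \<delta> tends to 0. Hence
  \<open>p\<close> is dictated by the doubling with \<open>ubar\<close> and \<open>r\<close> is a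
  value of \<open>ubar\<close>. The passage from \<open>r\<close> to the value of the half-limit is
  made inside \<open>H\<close>, which is monotone along constant vectors, and gradient errors are
  absorbed inside \<open>H\<close> by convexity. The doublings for the system maximise over the
  component as well as over the points: at such a maximum the differences of components of the two
  functions are ordered, so that the monotone coupling terms can be compared although no bound on
  \<open>(u_k - u_j) / \<epsilon>\<close> is available. The minimum of the data appears because the
  coupling pulls down every component that exceeds another one by much more than \<epsilon>, while
  nothing lifts the lowest one. In the theorem on sums the regularised functions have Lipschitz
  gradients; Rademacher's theorem for these gradients takes the place of Alexandrov's theorem on
  second derivatives of convex functions.\<close>

lemma negligible_if_null_on_lines:
  fixes N :: "'a::euclidean_space set"
  assumes N: "N \<in> sets borel" and null: "\<And>x. negligible {t::real. x + t *\<^sub>R v \<in> N}"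
  shows "negligible N"
proof -
  \<comment> \<open>Fubini for a set in space times parameter: for fixed t the sections are
    translates of \<open>N\<close>, for fixed x they are null, so \<infinity> times the measure of
    \<open>N\<close> is 0. This avoids coordinates adapted to \<open>v\<close>.\<close>
  let ?B = "{z :: 'a \<times> real. fst z + snd z *\<^sub>R v \<in> N}"
  have "(\<lambda>z :: 'a \<times> real. fst z + snd z *\<^sub>R v) \<in> borel_measurable borel"
    by (intro borel_measurable_continuous_onI continuous_intros)
  then have "?B \<in> sets borel"
    using N by (auto simp: measurable_def vimage_def)
  then have B: "?B \<in> sets (lborel \<Otimes>\<^sub>M lborel)"
    by (subst lborel_prod) simp
  have line: "emeasure lborel (Pair x -` ?B) = 0" for x
  proof -
    have "(\<lambda>t. x + t *\<^sub>R v) \<in> borel_measurable borel"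
      by (intro borel_measurable_continuous_onI continuous_intros)
    then have "{t::real. x + t *\<^sub>R v \<in> N} \<in> sets borel"
      using N by (auto simp: measurable_def vimage_def)
    then have "emeasure lborel {t::real. x + t *\<^sub>R v \<in> N} = 0"
      using null[of x] by (simp add: negligible_iff_null_sets null_sets_def)
    then show ?thesis
      by (simp add: vimage_def)
  qed
  have trans: "emeasure lborel ((\<lambda>x. (x, t)) -` ?B) = emeasure lborel N" for t
  proof -
    have "emeasure lborel N = emeasure (distr lborel borel ((+) (t *\<^sub>R v))) N"
      by (simp add: lborel_distr_plus)
    also have "\<dots> = emeasure lborel ((+) (t *\<^sub>R v) -` N)"
      using N by (subst emeasure_distr) auto
    finally show ?thesis
      by (simp add: vimage_def add.commute)
  qed
  have "emeasure lborel N * \<infinity> = (\<integral>\<^sup>+t. emeasure lborel ((\<lambda>x. (x, t)) -` ?B) \<partial>(lborel :: real measure))"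
    unfolding trans by simp
  also have "\<dots> = emeasure (lborel \<Otimes>\<^sub>M lborel) ?B"
    by (rule lborel_pair.emeasure_pair_measure_alt2[OF B, symmetric])
  also have "\<dots> = (\<integral>\<^sup>+x. emeasure lborel (Pair x -` ?B) \<partial>lborel)"
    by (rule lborel.emeasure_pair_measure_alt[OF B])
  also have "\<dots> = 0"
    unfolding line by simp
  finally have "emeasure lborel N = 0"
    by (metis ennreal_mult_eq_top_iff ennreal_top_neq_zero infinity_ennreal_def)
  then show ?thesis
    using N by (simp add: negligible_iff_null_sets null_sets_def)
qed

text \<open>For \<open>p < q\<close>, membership certifies that the two-sided difference quotients
  along \<open>v\<close> have no limit. The strict inequalities make the set a countable
  intersection of open sets when \<open>f\<close> is continuous.\<close>

definition oscillation_set :: "('a::real_normed_vector \<Rightarrow> real) \<Rightarrow> 'a \<Rightarrow> real \<Rightarrow> real \<Rightarrow> 'a set" where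
  "oscillation_set f v p q =
    {x. (\<forall>e>0. \<exists>h. h \<noteq> 0 \<and> \<bar>h\<bar> < e \<and> (f (x + h *\<^sub>R v) - f x) / h < p) \<and>
        (\<forall>e>0. \<exists>h. h \<noteq> 0 \<and> \<bar>h\<bar> < e \<and> (f (x + h *\<^sub>R v) - f x) / h > q)}"

lemma borel_oscillation_set:
  assumes "continuous_on UNIV f"
  shows "oscillation_set f v p q \<in> sets borel"
proof -
  let ?r = "\<lambda>x h. (f (x + h *\<^sub>R v) - f x) / h"
  let ?L = "\<lambda>n::nat. \<Union>h\<in>{h. h \<noteq> 0 \<and> \<bar>h\<bar> < 1 / Suc n}. {x. ?r x h < p}"
  let ?U = "\<lambda>n::nat. \<Union>h\<in>{h. h \<noteq> 0 \<and> \<bar>h\<bar> < 1 / Suc n}. {x. ?r x h > q}"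
  have cont: "continuous_on UNIV (\<lambda>x. ?r x h)" for h
    by (cases "h = 0") (auto intro!: continuous_intros continuous_on_compose2[OF assms])
  have "open (?L n)" "open (?U n)" for n
    by (intro open_UN ballI open_Collect_less cont continuous_intros)+
  then have "(\<Inter>n. ?L n) \<inter> (\<Inter>n. ?U n) \<in> sets borel"
    by (intro sets.Int sets.countable_INT' borel_open) auto
  moreover have *: "(\<forall>e>0. \<exists>h. h \<noteq> 0 \<and> \<bar>h\<bar> < e \<and> P h) \<longleftrightarrow>
      (\<forall>n::nat. \<exists>h. h \<noteq> 0 \<and> \<bar>h\<bar> < 1 / Suc n \<and> P h)" for P :: "real \<Rightarrow> bool"
  proof (intro iffI allI impI)
    fix e :: real assume n: "\<forall>n::nat. \<exists>h. h \<noteq> 0 \<and> \<bar>h\<bar> < 1 / Suc n \<and> P h" and "e > 0"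
    then obtain n :: nat where "1 / Suc n < e"
      by (metis inverse_eq_divide of_nat_Suc reals_Archimedean)
    then show "\<exists>h. h \<noteq> 0 \<and> \<bar>h\<bar> < e \<and> P h"
      using n by (meson less_trans)
  qed auto
  have "oscillation_set f v p q = (\<Inter>n. ?L n) \<inter> (\<Inter>n. ?U n)"
    unfolding oscillation_set_def * by auto
  ultimately show ?thesis
    by simp
qed

text \<open>Vitali covering. Arbitrarily short intervals at the points of \<open>S\<close> are
  stretched by \<open>G\<close> by a factor at most \<open>p\<close>. A disjoint subfamily, inside a
  neighbourhood of \<open>S\<close> of nearly the same measure, covers almost all of
  \<open>S\<close>; its images are again disjoint, and the null remainder stays null because
  \<open>G\<close> is Lipschitz.\<close>

lemma emeasure_image_le_slope:
  fixes G :: "real \<Rightarrow> real"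
  assumes G: "strict_mono G" "L-lipschitz_on UNIV G" and p: "0 \<le> p"
    and S: "S \<in> sets borel" "emeasure lborel S < \<infinity>" "G ` S \<in> sets borel"
    and slope: "\<And>x e. x \<in> S \<Longrightarrow> e > 0 \<Longrightarrow> \<exists>h. h \<noteq> 0 \<and> \<bar>h\<bar> < e \<and> (G (x + h) - G x) / h < p"
  shows "emeasure lborel (G ` S) \<le> ennreal p * emeasure lborel S"
proof -
  have "emeasure lborel (G ` S) \<le> ennreal p * emeasure lborel S + ennreal (p * e)" if e: "e > 0" for e :: real
  proof -
    obtain U where U: "open U" "S \<subseteq> U" "emeasure lborel (U - S) < e"
      using outer_regular_lborel[OF S(1) e] by blast
    \<comment> \<open>The index \<open>(x, h)\<close> stands for the interval between
      \<open>x\<close> and \<open>x + h\<close>, with \<open>h\<close> of either sign;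
      \<open>a\<close> and \<open>r\<close> present it as a ball for the covering theorem.\<close>
    define lo where "lo i = min (fst i) (fst i + snd i)" for i :: "real \<times> real"
    define hi where "hi i = max (fst i) (fst i + snd i)" for i :: "real \<times> real"
    define a where "a i = fst i + snd i / 2" for i :: "real \<times> real"
    define r where "r i = \<bar>snd i\<bar> / 2" for i :: "real \<times> real"
    define K where "K = {i. snd i \<noteq> 0 \<and> {lo i..hi i} \<subseteq> U \<and> G (hi i) - G (lo i) \<le> p * (hi i - lo i)}"
    have ball: "cball (a i) (r i) = {lo i..hi i}" for i
      by (auto simp: a_def r_def lo_def hi_def dist_real_def abs_if min_def max_def cball_def field_simps)
    have lohi: "lo i \<le> hi i" for i
      by (auto simp: lo_def hi_def)
    have cover: "\<exists>i. i \<in> K \<and> x \<in> cball (a i) (r i) \<and> r i < d" if x: "x \<in> S" and d: "d > 0" for x d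
    proof -
      obtain e' where e': "e' > 0" "cball x e' \<subseteq> U"
        using U x open_contains_cball by (metis subsetD)
      then obtain h where h: "h \<noteq> 0" "\<bar>h\<bar> < min e' d" "(G (x + h) - G x) / h < p"
        using slope[OF x, of "min e' d"] d by auto
      have "{lo (x, h)..hi (x, h)} \<subseteq> cball x e'"
        using h by (auto simp: lo_def hi_def dist_real_def cball_def)
      moreover have "G (hi (x, h)) - G (lo (x, h)) \<le> p * (hi (x, h) - lo (x, h))"
        using h by (cases "h > 0") (auto simp: lo_def hi_def divide_simps min_def max_def split: if_splits)
      ultimately have "(x, h) \<in> K"
        using h e' by (auto simp: K_def)
      moreover have "x \<in> cball (a (x, h)) (r (x, h))" "r (x, h) < d"
        using h(1,2) d unfolding ball by (auto simp add: r_def lo_def hi_def)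
      ultimately show ?thesis
        by blast
    qed
    have pos: "0 < r i" if "i \<in> K" for i
      using that by (auto simp: K_def r_def)
    obtain C where C: "countable C" "C \<subseteq> K"
      "pairwise (\<lambda>i j. disjnt (cball (a i) (r i)) (cball (a j) (r j))) C"
      "negligible (S - (\<Union>i\<in>C. cball (a i) (r i)))"
      by (rule Vitali_covering_theorem_cballs[of K r S a, OF pos cover])
    define V where "V = (\<Union>i\<in>C. {lo i..hi i})"
    define W where "W = (\<Union>i\<in>C. {G (lo i)..G (hi i)})"
    have disj: "disjoint_family_on (\<lambda>i. {lo i..hi i}) C"
      using C(3) by (auto simp: disjoint_family_on_def pairwise_def disjnt_def ball)
    have disjW: "disjoint_family_on (\<lambda>i. {G (lo i)..G (hi i)}) C"
      unfolding disjoint_family_on_def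
    proof (intro ballI impI)
      fix i j assume ij: "i \<in> C" "j \<in> C" "i \<noteq> j"
      then have "{lo i..hi i} \<inter> {lo j..hi j} = {}"
        using disj by (auto simp: disjoint_family_on_def)
      then have "hi i < lo j \<or> hi j < lo i"
        using lohi[of i] lohi[of j] by (auto simp: disjoint_iff)
      then have "G (hi i) < G (lo j) \<or> G (hi j) < G (lo i)"
        using G(1) by (auto simp: strict_mono_less)
      then show "{G (lo i)..G (hi i)} \<inter> {G (lo j)..G (hi j)} = {}"
        by auto
    qed
    have WV: "emeasure lborel W \<le> ennreal p * emeasure lborel V"
    proof -
      have "emeasure lborel W = (\<integral>\<^sup>+i. emeasure lborel {G (lo i)..G (hi i)} \<partial>count_space C)"
        unfolding W_def using C(1) disjW by (intro emeasure_UN_countable) auto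
      also have "\<dots> \<le> (\<integral>\<^sup>+i. ennreal p * emeasure lborel {lo i..hi i} \<partial>count_space C)"
      proof (intro nn_integral_mono)
        fix i assume "i \<in> space (count_space C)"
        then have "i \<in> K"
          using C by auto
        then have "ennreal (G (hi i) - G (lo i)) \<le> ennreal (p * (hi i - lo i))"
          by (intro ennreal_leI) (auto simp: K_def)
        also have "\<dots> = ennreal p * ennreal (hi i - lo i)"
          using p lohi[of i] by (simp add: ennreal_mult)
        finally show "emeasure lborel {G (lo i)..G (hi i)} \<le> ennreal p * emeasure lborel {lo i..hi i}"
          using lohi[of i] G(1) by (simp add: strict_mono_less_eq)
      qed
      also have "\<dots> = ennreal p * (\<integral>\<^sup>+i. emeasure lborel {lo i..hi i} \<partial>count_space C)"
        by (rule nn_integral_cmult) auto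
      also have "(\<integral>\<^sup>+i. emeasure lborel {lo i..hi i} \<partial>count_space C) = emeasure lborel V"
        unfolding V_def using C(1) disj by (intro emeasure_UN_countable[symmetric]) auto
      finally show ?thesis .
    qed
    have VW: "V \<in> sets borel" "W \<in> sets borel"
      unfolding V_def W_def using C(1) by (auto intro!: sets.countable_UN')
    have "V \<subseteq> U"
      using C(2) by (auto simp: V_def K_def)
    then have "emeasure lborel V \<le> emeasure lborel U"
      using U by (intro emeasure_mono) auto
    also have "\<dots> = emeasure lborel (S \<union> (U - S))"
      using U by (simp add: Un_absorb1)
    also have "\<dots> \<le> emeasure lborel S + emeasure lborel (U - S)"
      using S(1) U by (intro emeasure_subadditive) auto
    also have "\<dots> \<le> emeasure lborel S + ennreal e"
      using U(3) by (intro add_left_mono) auto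
    finally have V: "emeasure lborel V \<le> emeasure lborel S + ennreal e" .
    have negl: "negligible (G ` (S - V))"
    proof (rule negligible_locally_Lipschitz_image)
      show "negligible (S - V)"
        using C(4) by (simp add: V_def ball)
      fix x assume "x \<in> S - V"
      show "\<exists>T B. open T \<and> x \<in> T \<and> (\<forall>y\<in>(S - V) \<inter> T. norm (G y - G x) \<le> B * norm (y - x))"
        using G(2) by (intro exI[of _ UNIV] exI[of _ L]) (auto simp: lipschitz_on_def dist_norm)
    qed auto
    have sub: "G ` S \<subseteq> G ` (S - V) \<union> W"
      using G(1) unfolding V_def W_def by (auto simp: strict_mono_less_eq)
    have "emeasure lebesgue (G ` S) \<le> emeasure lebesgue (G ` (S - V) \<union> W)"
      using sub negl VW by (intro emeasure_mono) (auto simp: negligible_iff_null_sets)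
    also have "\<dots> \<le> emeasure lebesgue (G ` (S - V)) + emeasure lebesgue W"
      using negl VW by (intro emeasure_subadditive) (auto simp: negligible_iff_null_sets)
    also have "emeasure lebesgue (G ` (S - V)) = 0"
      using negl by (auto simp: negligible_iff_null_sets)
    finally have "emeasure lborel (G ` S) \<le> emeasure lborel W"
      using VW S(3) by simp
    also have "\<dots> \<le> ennreal p * (emeasure lborel S + ennreal e)"
      using WV V by (meson mult_left_mono order_trans zero_le)
    also have "\<dots> = ennreal p * emeasure lborel S + ennreal (p * e)"
      using p e by (simp add: distrib_left ennreal_mult)
    finally show ?thesis .
  qed
  note * = this
  show ?thesis
  proof (rule ennreal_le_epsilon)
    fix e :: real assume e: "0 < e"
    have "p * (e / (p + 1)) \<le> e"
      using p e by (simp add: divide_simps mult.commute)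
    moreover have "e / (p + 1) > 0"
      using p e by simp
    ultimately show "emeasure lborel (G ` S) \<le> ennreal p * emeasure lborel S + ennreal e"
      using *[of "e / (p + 1)"] by (meson add_left_mono ennreal_leI order_trans)
  qed
qed

lemma strict_mono_real_slopeI:
  fixes G :: "real \<Rightarrow> real"
  assumes "\<And>x y. x \<le> y \<Longrightarrow> y - x \<le> G y - G x"
  shows "strict_mono G"
proof (rule strict_monoI)
  fix x y :: real assume "x < y"
  then show "G x < G y"
    using assms[of x y] by simp
qed

text \<open>Let S be a bounded piece of the set. Quotients below \<open>p\<close> give |G S| <= p
  |S|. Quotients of \<open>G\<close> above \<open>q\<close> are quotients of the inverse below
  \<open>1 / q\<close>, which gives |S| <= |G S| / q. So |S| <= (p / q) |S| with |S| finite.\<close>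

lemma negligible_oscillation_set_expanding:
  fixes G :: "real \<Rightarrow> real"
  assumes G: "L-lipschitz_on UNIV G" and slope1: "\<And>x y. x \<le> y \<Longrightarrow> y - x \<le> G y - G x"
    and p: "0 < p" "p < q"
  shows "negligible (oscillation_set G 1 p q)"
proof -
  have smono: "strict_mono G"
    by (rule strict_mono_real_slopeI[OF slope1])
  have contG: "continuous_on UNIV G"
    using G by (rule lipschitz_on_continuous_on)
  have expand: "\<bar>y - x\<bar> \<le> \<bar>G y - G x\<bar>" for x y
    using slope1[of x y] slope1[of y x] by (cases "x \<le> y") auto
  have "surj G"
  proof (rule surjI)
    fix y
    have "\<exists>x. G x = y"
    proof (cases "G 0 \<le> y")
      case True
      then show ?thesis
        using slope1[of 0 "y - G 0"] IVT'[of G 0 y "y - G 0"] continuous_on_subset[OF contG] by fastforce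
    next
      case False
      then show ?thesis
        using slope1[of "y - G 0" 0] IVT'[of G "y - G 0" y 0] continuous_on_subset[OF contG] by fastforce
    qed
    then show "G (SOME x. G x = y) = y"
      by (rule someI_ex)
  qed
  define F where "F = inv G"
  have GF: "G (F y) = y" for y
    using \<open>surj G\<close> by (simp add: F_def surj_f_inv_f)
  have FG: "F (G x) = x" for x
    using smono by (simp add: F_def strict_mono_imp_inj_on)
  have lipF: "1-lipschitz_on UNIV F"
    using expand[of "F x" "F y" for x y] by (auto simp: lipschitz_on_def dist_real_def GF abs_minus_commute)
  have smonoF: "strict_mono F"
    using smono GF by (metis strict_monoI strict_mono_less)
  have "negligible (oscillation_set G 1 p q \<inter> cbox (- c) c)" for c
  proof -
    define S where "S = oscillation_set G 1 p q \<inter> cbox (- c) c"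
    have S: "S \<in> sets borel"
      unfolding S_def using borel_oscillation_set[OF contG] by auto
    have "emeasure lborel S \<le> emeasure lborel (cbox (- c) c)"
      unfolding S_def by (intro emeasure_mono) auto
    also have "\<dots> < \<infinity>"
      by (rule emeasure_lborel_cbox_finite)
    finally have fin: "emeasure lborel S < \<infinity>" .
    have "G ` S = F -` S"
      using GF FG by (auto simp: image_iff) metis
    moreover have "F \<in> borel_measurable borel"
      using lipF by (intro borel_measurable_continuous_onI lipschitz_on_continuous_on)
    ultimately have GS: "G ` S \<in> sets borel"
      using S by (auto simp: measurable_def)
    have le1: "emeasure lborel (G ` S) \<le> ennreal p * emeasure lborel S"
      using p S GS fin
      by (intro emeasure_image_le_slope[OF smono G]) (auto simp: S_def oscillation_set_def)
    have FGS: "F ` G ` S = S"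
      by (auto simp: image_iff FG)
    have "emeasure lborel (F ` G ` S) \<le> ennreal (1 / q) * emeasure lborel (G ` S)"
    proof (rule emeasure_image_le_slope[OF smonoF lipF _ GS])
      show "emeasure lborel (G ` S) < \<infinity>"
        using le1 fin by (auto simp: ennreal_mult_less_top intro!: le_less_trans[OF le1])
      fix y e :: real assume "y \<in> G ` S" "e > 0"
      then obtain x where x: "y = G x" "x \<in> S"
        by auto
      have L: "L \<ge> 0"
        using G by (rule lipschitz_on_nonneg)
      \<comment> \<open>A step \<open>h\<close> of this size in the domain moves the image by less
        than \<open>e\<close>, as required of the step \<open>k\<close> of the inverse.\<close>
      have "e / (L + 1) > 0"
        using \<open>e > 0\<close> L by simp
      then obtain h where h: "h \<noteq> 0" "\<bar>h\<bar> < e / (L + 1)" "(G (x + h) - G x) / h > q"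
        using x unfolding S_def oscillation_set_def by (auto simp: max_def)
      define k where "k = G (x + h) - G x"
      have "\<bar>k\<bar> \<le> L * \<bar>h\<bar>"
        using lipschitz_onD[OF G, of "x + h" x] by (simp add: k_def dist_real_def)
      also have "\<dots> \<le> (L + 1) * \<bar>h\<bar>"
        by (simp add: mult_right_mono)
      also have "\<dots> < e"
        using h(2) L by (simp add: field_simps)
      finally have "\<bar>k\<bar> < e" .
      moreover have "k \<noteq> 0"
        using h smono by (auto simp: k_def strict_mono_eq)
      moreover have "(F (y + k) - F y) / k < 1 / q"
      proof -
        have "inverse (k / h) < inverse q"
          using h(3) p by (intro less_imp_inverse_less) (auto simp: k_def)
        then show ?thesis
          by (simp add: x k_def FG inverse_eq_divide)
      qed
      ultimately show "\<exists>k. k \<noteq> 0 \<and> \<bar>k\<bar> < e \<and> (F (y + k) - F y) / k < 1 / q"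
        by blast
    qed (use p S FGS in auto)
    then have "emeasure lborel S \<le> ennreal (1 / q) * (ennreal p * emeasure lborel S)"
      unfolding FGS using le1 by (meson mult_left_mono order_trans zero_le)
    moreover obtain m where m: "emeasure lborel S = ennreal m" "m \<ge> 0"
      using fin by (cases "emeasure lborel S") auto
    ultimately have "ennreal m \<le> ennreal (1 / q * (p * m))"
      using p by (simp only: ennreal_mult' ennreal_mult'' mult_nonneg_nonneg divide_nonneg_pos zero_le_one m less_imp_le)
    then have "m \<le> 1 / q * (p * m)"
      using p m by (subst (asm) ennreal_le_iff) auto
    then have "(q - p) * m \<le> 0"
      using p by (simp add: field_simps)
    then have "m = 0"
      using p m by (simp add: mult_le_0_iff)
    then show ?thesis
      using m S unfolding S_def by (simp add: negligible_iff_null_sets null_sets_def)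
  qed
  note * = this
  have "negligible (\<Union>n::nat. oscillation_set G 1 p q \<inter> cbox (- real n) (real n))"
    using * by (intro negligible_countable_Union) auto
  moreover have "oscillation_set G 1 p q = (\<Union>n::nat. oscillation_set G 1 p q \<inter> cbox (- real n) (real n))"
  proof -
    have "\<exists>n::nat. - real n \<le> x \<and> x \<le> real n" for x :: real
      using real_arch_simple[of "\<bar>x\<bar>"] by (auto simp: abs_le_iff minus_le_iff)
    then show ?thesis
      by auto
  qed
  ultimately show ?thesis
    by simp
qed

lemma negligible_oscillation_set_real:
  fixes g :: "real \<Rightarrow> real"
  assumes g: "L-lipschitz_on UNIV g" and pq: "p < q"
  shows "negligible (oscillation_set g 1 p q)"
proof -
  have L: "L \<ge> 0"
    using g by (rule lipschitz_on_nonneg)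
  \<comment> \<open>The part \<open>L + 1\<close> makes \<open>G\<close> expanding, the part
    \<open>\<bar>p\<bar>\<close> makes the shifted threshold positive.\<close>
  define c where "c = L + 1 + \<bar>p\<bar>"
  define G where "G x = g x + c * x" for x
  have lip: "\<bar>g y - g x\<bar> \<le> L * \<bar>y - x\<bar>" for x y
    using lipschitz_onD[OF g, of y x] by (simp add: dist_real_def)
  have "(L + c)-lipschitz_on UNIV G"
  proof (rule lipschitz_onI)
    fix x y
    have "\<bar>G x - G y\<bar> \<le> \<bar>g x - g y\<bar> + \<bar>c * (x - y)\<bar>"
      unfolding G_def by (simp add: algebra_simps)
    also have "\<dots> \<le> L * \<bar>x - y\<bar> + c * \<bar>x - y\<bar>"
      using lip[of x y] L by (simp add: abs_mult c_def)
    finally show "dist (G x) (G y) \<le> (L + c) * dist x y"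
      by (simp add: dist_real_def algebra_simps)
  qed (use L in \<open>simp add: c_def\<close>)
  moreover have "y - x \<le> G y - G x" if "x \<le> y" for x y
  proof -
    have "(L + 1) * (y - x) \<le> c * (y - x)"
      using that by (intro mult_right_mono) (auto simp: c_def)
    then show ?thesis
      using lip[of y x] that by (simp add: G_def algebra_simps)
  qed
  moreover have "p + c > 0"
    using L by (simp add: c_def abs_if)
  ultimately have "negligible (oscillation_set G 1 (p + c) (q + c))"
    using pq by (intro negligible_oscillation_set_expanding) auto
  moreover have "(G (x + h) - G x) / h = (g (x + h) - g x) / h + c" if "h \<noteq> 0" for x h
    using that by (simp add: G_def field_simps)
  then have "oscillation_set G 1 (p + c) (q + c) = oscillation_set g 1 p q"
    unfolding oscillation_set_def by (auto simp: cong: conj_cong)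
  ultimately show ?thesis
    by simp
qed

lemma negligible_oscillation_set:
  fixes f :: "'a::euclidean_space \<Rightarrow> real"
  assumes f: "L-lipschitz_on UNIV f" and pq: "p < q"
  shows "negligible (oscillation_set f v p q)"
proof (rule negligible_if_null_on_lines)
  show "oscillation_set f v p q \<in> sets borel"
    using f by (intro borel_oscillation_set lipschitz_on_continuous_on)
  fix x
  have L: "L \<ge> 0"
    using f by (rule lipschitz_on_nonneg)
  have "(L * norm v)-lipschitz_on UNIV (\<lambda>t. f (x + t *\<^sub>R v))"
  proof (rule lipschitz_onI)
    fix s t
    have "(x + s *\<^sub>R v) - (x + t *\<^sub>R v) = (s - t) *\<^sub>R v"
      by (simp add: scaleR_left_diff_distrib)
    then have "dist (x + s *\<^sub>R v) (x + t *\<^sub>R v) = norm v * dist s t"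
      unfolding dist_norm by simp
    then show "dist (f (x + s *\<^sub>R v)) (f (x + t *\<^sub>R v)) \<le> L * norm v * dist s t"
      using lipschitz_onD[OF f UNIV_I UNIV_I, of "x + s *\<^sub>R v" "x + t *\<^sub>R v"]
      by (metis mult.assoc)
  qed (use L in simp)
  from negligible_oscillation_set_real[OF this pq]
  show "negligible {t. x + t *\<^sub>R v \<in> oscillation_set f v p q}"
    by (simp add: oscillation_set_def scaleR_add_left add.assoc)
qed

section \<open>Directional slopes and their additivity\<close>

definition has_slope :: "('a::real_normed_vector \<Rightarrow> real) \<Rightarrow> 'a \<Rightarrow> 'a \<Rightarrow> real \<Rightarrow> bool" where
  "has_slope f x v l \<longleftrightarrow> ((\<lambda>h. (f (x + h *\<^sub>R v) - f x) / h) \<longlongrightarrow> l) (at 0)"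

lemma has_slope_unique: "has_slope f x v l \<Longrightarrow> has_slope f x v l' \<Longrightarrow> l = l'"
  unfolding has_slope_def by (rule tendsto_unique[OF at_neq_bot])

lemma has_slope_scaleR:
  assumes "has_slope f x v l"
  shows "has_slope f x (c *\<^sub>R v) (c * l)"
proof (cases "c = 0")
  case True
  then show ?thesis by (simp add: has_slope_def)
next
  case False
  have "filterlim (\<lambda>h. h * c) (at 0) (at (0::real))"
    unfolding filterlim_at using False
    by (auto simp: eventually_at_filter intro!: tendsto_mult_left_zero tendsto_ident_at)
  from filterlim_compose[OF assms[unfolded has_slope_def] this]
  have "((\<lambda>h. (f (x + (h * c) *\<^sub>R v) - f x) / (h * c)) \<longlongrightarrow> l) (at 0)" .
  from tendsto_mult_left[OF this, of c] show ?thesis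
    using False by (simp add: has_slope_def)
qed

lemma has_slopeD:
  assumes "has_slope f x v l" "e > 0"
  obtains d where "d > 0" "\<And>t. \<bar>t\<bar> < d \<Longrightarrow> \<bar>f (x + t *\<^sub>R v) - f x - t * l\<bar> \<le> e * \<bar>t\<bar>"
proof -
  obtain d where d: "d > 0" "\<And>t. t \<noteq> 0 \<Longrightarrow> \<bar>t\<bar> < d \<Longrightarrow> \<bar>(f (x + t *\<^sub>R v) - f x) / t - l\<bar> < e"
    using tendstoD[OF assms(1)[unfolded has_slope_def] assms(2)]
    by (auto simp: eventually_at dist_real_def)
  have "\<bar>f (x + t *\<^sub>R v) - f x - t * l\<bar> \<le> e * \<bar>t\<bar>" if "\<bar>t\<bar> < d" for t
  proof (cases "t = 0")
    case False
    then have "f (x + t *\<^sub>R v) - f x - t * l = ((f (x + t *\<^sub>R v) - f x) / t - l) * t"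
      by (simp add: field_simps)
    then show ?thesis
      using d(2)[OF False that] by (simp add: abs_mult mult_right_mono)
  qed simp
  from that[OF d(1) this] show ?thesis .
qed

text \<open>The candidate is the lower limit of the quotients, finite by the Lipschitz bound. If the
  quotients kept exceeding some number above it, two rationals in between would put \<open>x\<close>
  into an oscillation set.\<close>

lemma has_slope_if_no_oscillation:
  fixes f :: "'a::euclidean_space \<Rightarrow> real"
  assumes f: "L-lipschitz_on UNIV f"
    and osc: "\<And>p q. p \<in> \<rat> \<Longrightarrow> q \<in> \<rat> \<Longrightarrow> p < q \<Longrightarrow> x \<notin> oscillation_set f v p q"
  shows "\<exists>l. has_slope f x v l"
proof -
  define r where "r h = (f (x + h *\<^sub>R v) - f x) / h" for h
  define B where "B = L * norm v"
  define Q where "Q = {c. \<forall>e>0. \<exists>h. h \<noteq> 0 \<and> \<bar>h\<bar> < e \<and> r h < c}"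
  have rB: "\<bar>r h\<bar> \<le> B" for h
  proof (cases "h = 0")
    case True
    then show ?thesis
      using lipschitz_on_nonneg[OF f] by (simp add: r_def B_def)
  next
    case False
    then show ?thesis
      using lipschitz_onD[OF f, of "x + h *\<^sub>R v" x]
      by (simp add: r_def B_def dist_norm field_simps)
  qed
  have "B + 1 \<in> Q"
    unfolding Q_def
  proof (intro CollectI allI impI)
    fix e :: real assume "e > 0"
    then show "\<exists>h. h \<noteq> 0 \<and> \<bar>h\<bar> < e \<and> r h < B + 1"
      using rB[of "e / 2"] by (intro exI[of _ "e / 2"]) auto
  qed
  moreover have Qlow: "c \<ge> - B" if "c \<in> Q" for c
  proof -
    obtain h where "r h < c"
      using \<open>c \<in> Q\<close> unfolding Q_def by (auto dest: spec[of _ 1])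
    then show ?thesis
      using rB[of h] by linarith
  qed
  ultimately have Q: "Q \<noteq> {}" "bdd_below Q"
    by (auto intro!: bdd_belowI)
  define l where "l = Inf Q"
  have "(r \<longlongrightarrow> l) (at 0)"
  proof (rule order_tendstoI)
    fix a assume "a < l"
    then obtain c where c: "a < c" "c < l"
      using dense by blast
    then have "c \<notin> Q"
      using cInf_lower[OF _ Q(2)] unfolding l_def by fastforce
    then obtain e where "e > 0" "\<And>h. h \<noteq> 0 \<Longrightarrow> \<bar>h\<bar> < e \<Longrightarrow> c \<le> r h"
      unfolding Q_def by (force simp: not_less)
    then show "\<forall>\<^sub>F h in at 0. a < r h"
      using c unfolding eventually_at by (auto intro!: exI[of _ e] intro: less_le_trans)
  next
    fix a assume "l < a"
    then obtain q where q: "q \<in> \<rat>" "l < q" "q < a"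
      using Rats_dense_in_real by blast
    then obtain p where p: "p \<in> \<rat>" "l < p" "p < q"
      using Rats_dense_in_real by blast
    obtain c where c: "c \<in> Q" "c < p"
      using p(2) Q unfolding l_def by (auto simp: cInf_less_iff)
    have "\<forall>e>0. \<exists>h. h \<noteq> 0 \<and> \<bar>h\<bar> < e \<and> r h < p"
    proof (intro allI impI)
      fix e :: real assume "e > 0"
      then obtain h where "h \<noteq> 0" "\<bar>h\<bar> < e" "r h < c"
        using c(1) unfolding Q_def by blast
      then show "\<exists>h. h \<noteq> 0 \<and> \<bar>h\<bar> < e \<and> r h < p"
        using c(2) by (auto intro: less_trans)
    qed
    then have "\<not> (\<forall>e>0. \<exists>h. h \<noteq> 0 \<and> \<bar>h\<bar> < e \<and> r h > q)"
      using osc[OF p(1) q(1) p(3)] unfolding oscillation_set_def r_def by auto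
    then obtain e where "e > 0" "\<And>h. h \<noteq> 0 \<Longrightarrow> \<bar>h\<bar> < e \<Longrightarrow> r h \<le> q"
      by (force simp: not_less)
    then show "\<forall>\<^sub>F h in at 0. r h < a"
      using q unfolding eventually_at by (auto intro!: exI[of _ e] intro: le_less_trans)
  qed
  then show ?thesis
    unfolding has_slope_def r_def by blast
qed

text \<open>
  If the slopes at \<open>x\<close> in the directions \<open>v\<close>, \<open>w\<close>, \<open>v + w\<close> violate additivity in a quantified way,
  then no nearby point \<open>x + t v\<close> can have the same slopes as \<open>x\<close>: the set of all such points meets
  every line parallel to \<open>v\<close> in a countable set.
\<close>

lemma negligible_nonadditive_slopes_quantified:
  fixes f :: "'a::euclidean_space \<Rightarrow> real" and m :: nat
  assumes f: "continuous_on UNIV f" and abc: "\<bar>c - a - b\<bar> > 3 * e" and m: "m > 0"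
  shows "negligible {x. \<forall>t. \<bar>t\<bar> \<le> 1 / m \<longrightarrow> \<bar>f (x + t *\<^sub>R v) - f x - t * a\<bar> \<le> e * \<bar>t\<bar> \<and>
      \<bar>f (x + t *\<^sub>R w) - f x - t * b\<bar> \<le> e * \<bar>t\<bar> \<and> \<bar>f (x + t *\<^sub>R (v + w)) - f x - t * c\<bar> \<le> e * \<bar>t\<bar>}"
    (is "negligible ?S")
proof (rule negligible_if_null_on_lines)
  have "closed {x. \<bar>f (x + t *\<^sub>R u) - f x - t * d\<bar> \<le> e * \<bar>t\<bar>}" for t u d
    by (intro closed_Collect_le continuous_intros continuous_on_compose2[OF f]) auto
  then have "closed {x. \<bar>t\<bar> \<le> 1 / m \<longrightarrow> \<bar>f (x + t *\<^sub>R v) - f x - t * a\<bar> \<le> e * \<bar>t\<bar> \<and>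
      \<bar>f (x + t *\<^sub>R w) - f x - t * b\<bar> \<le> e * \<bar>t\<bar> \<and> \<bar>f (x + t *\<^sub>R (v + w)) - f x - t * c\<bar> \<le> e * \<bar>t\<bar>}" for t
    by (intro closed_Collect_imp closed_Collect_conj open_Collect_const)
  then have "closed ?S"
    by (rule closed_Collect_all)
  then show "?S \<in> sets borel"
    by simp
  fix x
  let ?T = "{t. x + t *\<^sub>R v \<in> ?S}"
  \<comment> \<open>For two points within 1 / m, the increment of \<open>f\<close> from
    \<open>y\<close> to \<open>y + h (v + w)\<close> is computed directly with slope
    \<open>c\<close> and by way of \<open>y + h v\<close> with slopes \<open>a\<close> and
    \<open>b\<close>; errors of total size 3 e h cannot make up for h |c - a - b|.\<close>
  have sep: "t > s + 1 / m" if st: "s \<in> ?T" "t \<in> ?T" "s < t" for s t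
  proof (rule ccontr)
    assume "\<not> t > s + 1 / m"
    define y h where "y = x + s *\<^sub>R v" and "h = t - s"
    have h: "0 < h" "h \<le> 1 / m"
      using st \<open>\<not> t > s + 1 / m\<close> by (auto simp: h_def)
    have eq: "x + t *\<^sub>R v = y + h *\<^sub>R v"
      by (simp add: y_def h_def algebra_simps)
    have "\<bar>f (y + h *\<^sub>R v) - f y - h * a\<bar> \<le> e * h" "\<bar>f (y + h *\<^sub>R (v + w)) - f y - h * c\<bar> \<le> e * h"
      using spec[OF CollectD[OF CollectD[OF st(1)]], of h] h unfolding y_def by auto
    moreover have eq': "y + h *\<^sub>R v + h *\<^sub>R w = y + h *\<^sub>R (v + w)"
      by (simp add: algebra_simps)
    have "\<bar>f (y + h *\<^sub>R (v + w)) - f (y + h *\<^sub>R v) - h * b\<bar> \<le> e * h"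
      using spec[OF CollectD[OF CollectD[OF st(2)]], of h] h unfolding eq eq' by auto
    ultimately have "\<bar>h * c - h * a - h * b\<bar> \<le> 3 * (e * h)"
      by linarith
    also have "h * c - h * a - h * b = h * (c - a - b)"
      by (simp add: algebra_simps)
    finally have "h * \<bar>c - a - b\<bar> \<le> h * (3 * e)"
      using h by (simp only: abs_mult) (simp add: mult.left_commute)
    then show False
      using abc h by simp
  qed
  have "inj_on (\<lambda>t. \<lfloor>t * m\<rfloor>) ?T"
  proof (rule inj_onI, rule ccontr)
    fix s t assume st: "s \<in> ?T" "t \<in> ?T" "\<lfloor>s * m\<rfloor> = \<lfloor>t * m\<rfloor>" "s \<noteq> t"
    have *: "\<lfloor>s * m\<rfloor> < \<lfloor>t * m\<rfloor>" if "s + 1 / m < t" for s t :: real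
    proof -
      have "s * m + 1 \<le> t * m"
        using that m by (simp add: field_simps)
      then show ?thesis
        by linarith
    qed
    show False
      using sep[OF st(1,2)] sep[OF st(2,1)] st(3,4) *[of s t] *[of t s] by (cases "s < t") auto
  qed
  then have "countable ?T"
    by (rule countableI')
  then show "negligible ?T"
    unfolding negligible_iff_null_sets by (intro null_sets_completionI countable_imp_null_set_lborel)
qed

lemma negligible_nonadditive_slopes:
  fixes f :: "'a::euclidean_space \<Rightarrow> real"
  assumes f: "continuous_on UNIV f"
  shows "negligible {x. \<exists>l1 l2 l3. has_slope f x v l1 \<and> has_slope f x w l2 \<and> has_slope f x (v + w) l3 \<and>
      l3 \<noteq> l1 + l2}"
proof -
  define S where "S = (\<lambda>(a, b, c, e, m::nat). {x. \<forall>t. \<bar>t\<bar> \<le> 1 / m \<longrightarrow> \<bar>f (x + t *\<^sub>R v) - f x - t * a\<bar> \<le> e * \<bar>t\<bar> \<and>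
      \<bar>f (x + t *\<^sub>R w) - f x - t * b\<bar> \<le> e * \<bar>t\<bar> \<and> \<bar>f (x + t *\<^sub>R (v + w)) - f x - t * c\<bar> \<le> e * \<bar>t\<bar>})"
  define I where "I = {(a :: real, b, c, e, m::nat). a \<in> \<rat> \<and> b \<in> \<rat> \<and> c \<in> \<rat> \<and> e \<in> \<rat> \<and> \<bar>c - a - b\<bar> > 3 * e \<and> m > 0}"
  have "countable (\<rat> \<times> \<rat> \<times> \<rat> \<times> \<rat> \<times> (UNIV :: nat set) :: (real \<times> real \<times> real \<times> real \<times> nat) set)"
    by (intro countable_SIGMA countable_rat) auto
  moreover have "I \<subseteq> \<rat> \<times> \<rat> \<times> \<rat> \<times> \<rat> \<times> UNIV"
    by (auto simp: I_def)
  ultimately have "countable I"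
    by (rule countable_subset[rotated])
  moreover have "negligible (S i)" if "i \<in> I" for i
    using that negligible_nonadditive_slopes_quantified[OF f] by (auto simp: I_def S_def)
  ultimately have "(\<Union>i\<in>I. S i) \<in> null_sets lebesgue"
    by (intro null_sets_UN') (auto simp: negligible_iff_null_sets)
  then have negl: "negligible (\<Union>i\<in>I. S i)"
    by (simp add: negligible_iff_null_sets)
  show ?thesis
  proof (rule negligible_subset[OF negl], safe)
    fix x l1 l2 l3
    assume l: "has_slope f x v l1" "has_slope f x w l2" "has_slope f x (v + w) l3" "l3 \<noteq> l1 + l2"
    \<comment> \<open>The additivity defect exceeds 6 e; replacing the three slopes by rationals
      within e / 2 costs less than 3 e / 2, so more than 3 e remains.\<close>
    obtain e where e: "e \<in> \<rat>" "0 < e" "e < \<bar>l3 - l1 - l2\<bar> / 6"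
      using Rats_dense_in_real[of 0 "\<bar>l3 - l1 - l2\<bar> / 6"] l(4) by auto
    have approx: "\<exists>a\<in>\<rat>. \<bar>l - a\<bar> < e / 2" for l
    proof -
      obtain a where "a \<in> \<rat>" "l < a" "a < l + e / 2"
        using Rats_dense_in_real[of l "l + e / 2"] e(2) by auto
      then show ?thesis
        by (intro bexI[of _ a]) auto
    qed
    obtain a where a: "a \<in> \<rat>" "\<bar>l1 - a\<bar> < e / 2"
      using approx by blast
    obtain b where b: "b \<in> \<rat>" "\<bar>l2 - b\<bar> < e / 2"
      using approx by blast
    obtain c where c: "c \<in> \<rat>" "\<bar>l3 - c\<bar> < e / 2"
      using approx by blast
    note abc = a b c
    have slope: "\<exists>d>0. \<forall>t. \<bar>t\<bar> < d \<longrightarrow> \<bar>f (x + t *\<^sub>R u) - f x - t * a'\<bar> \<le> e * \<bar>t\<bar>"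
      if "has_slope f x u l" "\<bar>l - a'\<bar> < e / 2" for u l a'
    proof -
      obtain d where d: "d > 0" "\<And>t. \<bar>t\<bar> < d \<Longrightarrow> \<bar>f (x + t *\<^sub>R u) - f x - t * l\<bar> \<le> (e / 2) * \<bar>t\<bar>"
        using has_slopeD[OF \<open>has_slope f x u l\<close>, of "e / 2"] e(2) by auto
      have "\<bar>f (x + t *\<^sub>R u) - f x - t * a'\<bar> \<le> e * \<bar>t\<bar>" if "\<bar>t\<bar> < d" for t
      proof -
        have "\<bar>t * l - t * a'\<bar> \<le> (e / 2) * \<bar>t\<bar>"
        proof -
          have "\<bar>t\<bar> * \<bar>l - a'\<bar> \<le> \<bar>t\<bar> * (e / 2)"
            using \<open>\<bar>l - a'\<bar> < e / 2\<close> by (intro mult_left_mono) auto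
          then show ?thesis
            unfolding right_diff_distrib[symmetric] abs_mult by (simp add: mult.commute)
        qed
        then show ?thesis
          using d(2)[OF that] by linarith
      qed
      then show ?thesis
        using d(1) by blast
    qed
    obtain d1 d2 d3 where d: "d1 > 0" "d2 > 0" "d3 > 0"
      "\<And>t. \<bar>t\<bar> < d1 \<Longrightarrow> \<bar>f (x + t *\<^sub>R v) - f x - t * a\<bar> \<le> e * \<bar>t\<bar>"
      "\<And>t. \<bar>t\<bar> < d2 \<Longrightarrow> \<bar>f (x + t *\<^sub>R w) - f x - t * b\<bar> \<le> e * \<bar>t\<bar>"
      "\<And>t. \<bar>t\<bar> < d3 \<Longrightarrow> \<bar>f (x + t *\<^sub>R (v + w)) - f x - t * c\<bar> \<le> e * \<bar>t\<bar>"
      using slope[OF l(1) abc(2)] slope[OF l(2) abc(4)] slope[OF l(3) abc(6)] by metis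
    obtain n :: nat where n: "1 / Suc n < min d1 (min d2 d3)"
      using reals_Archimedean[of "min d1 (min d2 d3)"] d(1-3) by (auto simp: inverse_eq_divide)
    have "\<bar>c - a - b\<bar> > 3 * e"
    proof -
      have "\<bar>l3 - l1 - l2\<bar> \<le> \<bar>c - a - b\<bar> + \<bar>l1 - a\<bar> + \<bar>l2 - b\<bar> + \<bar>l3 - c\<bar>"
        by linarith
      then show ?thesis
        using a(2) b(2) c(2) e(2,3) by simp
    qed
    then have "(a, b, c, e, Suc n) \<in> I"
      using abc e by (auto simp: I_def)
    moreover have "x \<in> S (a, b, c, e, Suc n)"
      using d(4-6) n by (auto simp: S_def)
    ultimately show "x \<in> (\<Union>i\<in>I. S i)"
      by blast
  qed
qed

text \<open>Off a null set, all slopes in the countably many rational directions exist and add up,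
  hence come from one linear map. The Lipschitz bound and compactness of the unit sphere upgrade
  slopes in finitely many directions to total differentiability.\<close>

theorem rademacher_real:
  fixes f :: "'a::euclidean_space \<Rightarrow> real"
  assumes f: "L-lipschitz_on UNIV f"
  shows "negligible {x. \<not> f differentiable (at x)}"
proof -
  have contf: "continuous_on UNIV f"
    using f by (rule lipschitz_on_continuous_on)
  define D where "D = (\<Union>q\<in>Basis \<rightarrow> \<rat>. {\<Sum>i\<in>Basis. q i *\<^sub>R i :: 'a})"
  have "D \<subseteq> (\<lambda>q. \<Sum>i\<in>Basis. q i *\<^sub>R i) ` (Basis \<rightarrow>\<^sub>E \<rat>)"
  proof
    fix v assume "v \<in> D"
    then obtain q where "q \<in> Basis \<rightarrow> \<rat>" "v = (\<Sum>i\<in>Basis. q i *\<^sub>R i)"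
      unfolding D_def by auto
    then show "v \<in> (\<lambda>q. \<Sum>i\<in>Basis. q i *\<^sub>R i) ` (Basis \<rightarrow>\<^sub>E \<rat>)"
      by (intro image_eqI[of _ _ "restrict q Basis"]) auto
  qed
  then have "countable D"
    by (rule countable_subset) (intro countable_image countable_PiE finite_Basis countable_rat)
  have dense: "closure D = UNIV"
    unfolding D_def by (rule closure_rational_coordinates)
  have D: "(\<Sum>i\<in>Basis. q i *\<^sub>R i) \<in> D" if "\<And>i. i \<in> Basis \<Longrightarrow> q i \<in> \<rat>" for q
    unfolding D_def using that by (intro UN_I[of q]) auto
  define I where "I = D \<times> {(p, q). p \<in> \<rat> \<and> q \<in> \<rat> \<and> p < (q::real)}"
  have "countable (\<rat> \<times> \<rat> :: (real \<times> real) set)"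
    by (intro countable_SIGMA countable_rat)
  then have "countable I"
    unfolding I_def using \<open>countable D\<close>
    by (intro countable_SIGMA) (auto intro: countable_subset[rotated])
  define N1 where "N1 = (\<Union>(v, p, q)\<in>I. oscillation_set f v p q)"
  have N1: "negligible N1"
    unfolding N1_def negligible_iff_null_sets using \<open>countable I\<close> negligible_oscillation_set[OF f]
    by (intro null_sets_UN') (auto simp: I_def negligible_iff_null_sets)
  define N2 where "N2 = (\<Union>(v, w)\<in>D \<times> D. {x. \<exists>l1 l2 l3. has_slope f x v l1 \<and> has_slope f x w l2 \<and>
    has_slope f x (v + w) l3 \<and> l3 \<noteq> l1 + l2})"
  have N2: "negligible N2"
    unfolding N2_def negligible_iff_null_sets using \<open>countable D\<close> negligible_nonadditive_slopes[OF contf]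
    by (intro null_sets_UN' countable_SIGMA) (auto simp: negligible_iff_null_sets)
  show ?thesis
  proof (rule negligible_subset[OF negligible_Un[OF N1 N2]], rule subsetI, rule ccontr)
    fix x assume "x \<in> {x. \<not> f differentiable (at x)}" and x: "x \<notin> N1 \<union> N2"
    then have nd: "\<not> f differentiable (at x)"
      by simp
    have "\<exists>l. has_slope f x v l" if "v \<in> D" for v
      using x that by (intro has_slope_if_no_oscillation[OF f]) (auto simp: N1_def I_def)
    then obtain l where l: "\<And>v. v \<in> D \<Longrightarrow> has_slope f x v (l v)"
      by metis
    have add: "l (v + w) = l v + l w" if "v \<in> D" "w \<in> D" "v + w \<in> D" for v w
      using x l that unfolding N2_def by blast
    have BasisD: "b \<in> D" if "b \<in> Basis" for b
      using D[of "\<lambda>i. if i = b then 1 else 0"] that by (simp add: if_distrib[of "\<lambda>a. a *\<^sub>R _"] cong: if_cong)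
    define l' where "l' h = (\<Sum>b\<in>Basis. (h \<bullet> b) * l b)" for h
    \<comment> \<open>Additivity is known only for pairs in \<open>D\<close>, so a rational
      combination is assembled one basis vector at a time.\<close>
    have partial: "has_slope f x (\<Sum>b\<in>A. q b *\<^sub>R b) (\<Sum>b\<in>A. q b * l b)"
      if "finite A" "A \<subseteq> Basis" "\<And>b. q b \<in> \<rat>" for A and q :: "'a \<Rightarrow> real"
      using that
    proof (induction A rule: finite_induct)
      case empty
      then show ?case by (simp add: has_slope_def)
    next
      case (insert b A)
      have mem: "(\<Sum>b\<in>A'. q b *\<^sub>R b) \<in> D" if "A' \<subseteq> Basis" for A'
      proof -
        have "(\<Sum>b\<in>A'. q b *\<^sub>R b) = (\<Sum>b\<in>Basis. (if b \<in> A' then q b else 0) *\<^sub>R b)"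
          using that by (intro sum.mono_neutral_cong_left) auto
        then show ?thesis
          using D[of "\<lambda>b. if b \<in> A' then q b else 0"] insert.prems(2) by simp
      qed
      have IH: "has_slope f x (\<Sum>b\<in>A. q b *\<^sub>R b) (\<Sum>b\<in>A. q b * l b)"
        using insert by auto
      have b: "has_slope f x (q b *\<^sub>R b) (q b * l b)"
        using has_slope_scaleR[OF l[OF BasisD]] insert.prems by auto
      have bD: "q b *\<^sub>R b \<in> D" "(\<Sum>b\<in>A. q b *\<^sub>R b) \<in> D" "q b *\<^sub>R b + (\<Sum>b\<in>A. q b *\<^sub>R b) \<in> D"
        using mem[of "{b}"] mem[of A] mem[of "insert b A"] insert by auto
      have "l (q b *\<^sub>R b + (\<Sum>b\<in>A. q b *\<^sub>R b)) = q b * l b + (\<Sum>b\<in>A. q b * l b)"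
        using add[OF bD] has_slope_unique[OF l[OF bD(1)] b] has_slope_unique[OF l[OF bD(2)] IH] by simp
      then show ?case
        using l[OF bD(3)] insert.hyps by simp
    qed
    have slope: "has_slope f x v (l' v)" if "v \<in> D" for v
    proof -
      obtain q where q: "q \<in> Basis \<rightarrow> \<rat>" "v = (\<Sum>i\<in>Basis. q i *\<^sub>R i)"
        using \<open>v \<in> D\<close> unfolding D_def by auto
      have "has_slope f x (\<Sum>b\<in>Basis. (if b \<in> Basis then q b else 0) *\<^sub>R b)
          (\<Sum>b\<in>Basis. (if b \<in> Basis then q b else 0) * l b)"
        using q(1) by (intro partial) auto
      moreover have "v \<bullet> b = q b" if "b \<in> Basis" for b
        using that q(2) by simp
      ultimately show ?thesis
        unfolding l'_def q(2) by (simp add: q(2)[symmetric] cong: sum.cong)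
    qed
    have "linear l'"
      unfolding l'_def by (intro linearI) (simp_all add: inner_add_left distrib_right sum.distrib sum_distrib_left mult.assoc)
    then have bl: "bounded_linear l'"
      by (rule linear_conv_bounded_linear[THEN iffD1])
    then obtain K where K: "K > 0" "\<And>h. norm (l' h) \<le> norm h * K"
      using bounded_linear.pos_bounded by blast
    have L: "L \<ge> 0"
      using f by (rule lipschitz_on_nonneg)
    have "(f has_derivative l') (at x)"
      unfolding has_derivative_at_alt
    proof (intro conjI bl allI impI)
      fix e :: real assume "e > 0"
      \<comment> \<open>Three errors add up: the slope error in the nearby direction
        \<open>d\<close> (factor 1), and the changes of \<open>f\<close> (factor \<open>L\<close>)
        and of \<open>l'\<close> (factor \<open>K\<close>) when the direction is replaced by
        \<open>d\<close>.\<close>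
      define e' where "e' = e / (L + K + 1)"
      have e': "e' > 0" "e' * (L + K + 1) = e"
        using \<open>e > 0\<close> L K(1) by (auto simp: e'_def)
      have "sphere 0 1 \<subseteq> (\<Union>d\<in>D. ball d e')"
      proof
        fix w :: 'a
        have "w \<in> closure D"
          using dense by simp
        then show "w \<in> (\<Union>d\<in>D. ball d e')"
          using e'(1) by (auto simp: closure_approachable mem_ball)
      qed
      then obtain F where F: "F \<subseteq> D" "finite F" "sphere 0 1 \<subseteq> (\<Union>d\<in>F. ball d e')"
        using compactE_image[OF compact_sphere[of "0::'a" 1], of D "\<lambda>d. ball d e'"] open_ball by metis
      have "\<forall>d\<in>F. \<exists>r>0. \<forall>t. \<bar>t\<bar> < r \<longrightarrow> \<bar>f (x + t *\<^sub>R d) - f x - t * l' d\<bar> \<le> e' * \<bar>t\<bar>"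
        using has_slopeD[OF slope e'(1)] F(1) by (metis subsetD)
      then obtain r where r: "\<And>d. d \<in> F \<Longrightarrow> r d > 0"
        "\<And>d t. d \<in> F \<Longrightarrow> \<bar>t\<bar> < r d \<Longrightarrow> \<bar>f (x + t *\<^sub>R d) - f x - t * l' d\<bar> \<le> e' * \<bar>t\<bar>"
        by metis
      obtain R where R: "R > 0" "\<And>d. d \<in> F \<Longrightarrow> R \<le> r d"
      proof (cases "F = {}")
        case False
        then show ?thesis
          using that[of "Min (r ` F)"] F(2) r(1) by auto
      qed (use that[of 1] in auto)
      have "norm (f y - f x - l' (y - x)) \<le> e * norm (y - x)" if "norm (y - x) < R" for y
      proof (cases "y = x")
        case True
        then show ?thesis
          using \<open>linear l'\<close> by (simp add: linear_0)
      next
        case False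
        define t w where "t = norm (y - x)" and "w = (y - x) /\<^sub>R norm (y - x)"
        have t: "t > 0" "y = x + t *\<^sub>R w" "norm w = 1"
          using False by (auto simp: t_def w_def)
        then obtain d where d: "d \<in> F" "norm (w - d) < e'"
          using F(3) by (force simp: dist_norm norm_minus_commute)
        have "\<bar>f (x + t *\<^sub>R d) - f x - t * l' d\<bar> \<le> e' * t"
          using r(2)[OF d(1), of t] R(2)[OF d(1)] that t(1) by (simp add: t_def)
        moreover have "\<bar>f y - f (x + t *\<^sub>R d)\<bar> \<le> L * (t * e')"
        proof -
          have "\<bar>f y - f (x + t *\<^sub>R d)\<bar> \<le> L * norm (y - (x + t *\<^sub>R d))"
            using lipschitz_onD[OF f, of y "x + t *\<^sub>R d"] by (simp add: dist_norm)
          also have "y - (x + t *\<^sub>R d) = t *\<^sub>R (w - d)"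
            unfolding t(2) by (simp add: algebra_simps)
          also have "L * norm (t *\<^sub>R (w - d)) \<le> L * (t * e')"
            using d(2) t(1) L by (intro mult_left_mono) auto
          finally show ?thesis .
        qed
        moreover have "\<bar>t * l' d - l' (y - x)\<bar> \<le> t * e' * K"
        proof -
          have "t * l' d - l' (y - x) = l' (t *\<^sub>R (d - w))"
            using \<open>linear l'\<close> unfolding t(2) by (simp add: linear_diff linear_scale algebra_simps)
          then have "\<bar>t * l' d - l' (y - x)\<bar> \<le> norm (t *\<^sub>R (d - w)) * K"
            using K(2)[of "t *\<^sub>R (d - w)"] by simp
          also have "\<dots> \<le> t * e' * K"
            using d(2) t(1) K(1) by (intro mult_right_mono) (auto simp: norm_minus_commute)
          finally show ?thesis .
        qed
        ultimately have "\<bar>f y - f x - l' (y - x)\<bar> \<le> e' * t + L * (t * e') + t * e' * K"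
          by linarith
        also have "\<dots> = e' * (L + K + 1) * t"
          by (simp add: algebra_simps)
        finally show ?thesis
          unfolding e'(2) by (simp add: t_def)
      qed
      then show "\<exists>d>0. \<forall>y. norm (y - x) < d \<longrightarrow> norm (f y - f x - l' (y - x)) \<le> e * norm (y - x)"
        using R(1) by blast
    qed
    then show False
      using nd by (auto simp: differentiable_def)
  qed
qed

corollary rademacher:
  fixes f :: "'a::euclidean_space \<Rightarrow> 'b::euclidean_space"
  assumes f: "L-lipschitz_on UNIV f"
  shows "negligible {x. \<not> f differentiable (at x)}"
proof -
  have "L-lipschitz_on UNIV (\<lambda>x. f x \<bullet> b)" if "b \<in> Basis" for b
  proof (rule lipschitz_onI)
    fix x y
    have "dist (f x \<bullet> b) (f y \<bullet> b) \<le> dist (f x) (f y)"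
      using Basis_le_norm[OF that, of "f x - f y"] by (simp add: dist_norm inner_diff_left)
    also have "\<dots> \<le> L * dist x y"
      using f by (auto intro: lipschitz_onD)
    finally show "dist (f x \<bullet> b) (f y \<bullet> b) \<le> L * dist x y" .
  qed (rule lipschitz_on_nonneg[OF f])
  then have "negligible (\<Union>b\<in>Basis. {x. \<not> (\<lambda>x. f x \<bullet> b) differentiable (at x)})"
    by (intro negligible_Union) (auto intro: rademacher_real)
  then show ?thesis
    by (rule negligible_subset) (subst differentiable_componentwise_within, auto)
qed

section \<open>The theorem on sums\<close>

text \<open>The defect is |t p - s q|^2 / (s t (s + t)). This is the composition rule for quadratic
  kernels; it serves to split the parameter \<open>a\<close> into \<open>b\<close> and
  \<open>a - b\<close>.\<close>

lemma norm_add_sq_divide_le: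
  fixes p q :: "'a::real_inner"
  assumes "s > 0" "t > 0"
  shows "(norm (p + q))\<^sup>2 / (s + t) \<le> (norm p)\<^sup>2 / s + (norm q)\<^sup>2 / t"
proof -
  define a b c where "a = p \<bullet> p" and "b = p \<bullet> q" and "c = q \<bullet> q"
  have "0 \<le> (norm (t *\<^sub>R p - s *\<^sub>R q))\<^sup>2 / (s * t * (s + t))"
    using assms by simp
  also have "(norm (t *\<^sub>R p - s *\<^sub>R q))\<^sup>2 = t\<^sup>2 * a - 2 * s * t * b + s\<^sup>2 * c"
    unfolding power2_norm_eq_inner
    by (simp add: inner_simps a_def b_def c_def inner_commute power2_eq_square algebra_simps)
  also have "(t\<^sup>2 * a - 2 * s * t * b + s\<^sup>2 * c) / (s * t * (s + t)) = a / s + c / t - (a + 2 * b + c) / (s + t)"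
    using assms by (simp add: divide_simps) (simp add: algebra_simps power2_eq_square)
  also have "a + 2 * b + c = (norm (p + q))\<^sup>2"
    by (simp add: power2_norm_eq_inner inner_simps a_def b_def c_def inner_commute)
  finally show ?thesis
    by (simp add: power2_norm_eq_inner a_def c_def)
qed

lemma parallelogram_divide:
  fixes A B M N a :: real
  assumes "A + B = 2 * M + N / 2" "a > 0"
  shows "A / (2 * a) + B / (2 * a) = 2 * (M / (2 * a)) + N / (4 * a)"
proof -
  have "A / (2 * a) + B / (2 * a) = (2 * M + N / 2) / (2 * a)"
    unfolding assms(1)[symmetric] by (simp add: add_divide_distrib)
  then show ?thesis
    using assms(2) by (simp add: field_simps)
qed

lemma quadratic_eventually_gt:
  fixes k :: real
  assumes "k > 0"
  obtains R where "R \<ge> 0" "\<And>s. s \<ge> R \<Longrightarrow> k * s\<^sup>2 - l * s > c"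
proof -
  define R where "R = (\<bar>l\<bar> + \<bar>c\<bar> + 1) / k + 1"
  have R: "R \<ge> 1"
    using assms by (simp add: R_def)
  show ?thesis
  proof
    show "R \<ge> 0"
      using R by simp
    fix s assume s: "s \<ge> R"
    have "k * s \<ge> \<bar>l\<bar> + \<bar>c\<bar> + 1"
      using assms s by (simp add: R_def field_simps)
    then have "(k * s - l) \<ge> \<bar>c\<bar> + 1"
      by linarith
    then have "(\<bar>c\<bar> + 1) * 1 \<le> (k * s - l) * s"
      using R s by (intro mult_mono) auto
    then show "k * s\<^sup>2 - l * s > c"
      by (simp add: power2_eq_square algebra_simps)
  qed
qed

text \<open>The second-order superjet. \<open>X\<close> is a linear map without a symmetry
  condition: only its quadratic form enters, and the derivative of a gradient found by Rademacher's
  theorem is then admissible as it stands.\<close>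

definition upper_jet :: "('a::euclidean_space \<Rightarrow> real) \<Rightarrow> 'a \<Rightarrow> 'a \<Rightarrow> ('a \<Rightarrow> 'a) \<Rightarrow> bool" where
  "upper_jet u x P X \<longleftrightarrow> linear X \<and>
    (\<forall>e>0. \<forall>\<^sub>F h in nhds 0. u (x + h) \<le> u x + P \<bullet> h + (h \<bullet> X h) / 2 + e * (norm h)\<^sup>2)"

section \<open>Sup-convolutions and their paraboloid envelopes\<close>

definition sup_convolution :: "'a::euclidean_space set \<Rightarrow> ('a \<Rightarrow> real) \<Rightarrow> real \<Rightarrow> 'a \<Rightarrow> real" where
  "sup_convolution C u a y = (SUP x\<in>C. u x - (norm (y - x))\<^sup>2 / (2 * a))"

text \<open>The Lasry-Lions double regularisation, used with \<open>b < a\<close>. Equivalently, the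
  lower envelope of all paraboloids of opening 1 / b lying above the sup-convolution with parameter
  \<open>a - b\<close>.\<close>

definition paraboloid_envelope :: "'a::euclidean_space set \<Rightarrow> ('a \<Rightarrow> real) \<Rightarrow> real \<Rightarrow> real \<Rightarrow> 'a \<Rightarrow> real" where
  "paraboloid_envelope C u a b x = (INF y. sup_convolution C u a y + (norm (x - y))\<^sup>2 / (2 * b))"

lemma sup_convolution_attained:
  assumes "compact C" "C \<noteq> {}" "continuous_on C u"
  obtains x where "x \<in> C" "sup_convolution C u a y = u x - (norm (y - x))\<^sup>2 / (2 * a)"
    "\<And>x'. x' \<in> C \<Longrightarrow> u x' - (norm (y - x'))\<^sup>2 / (2 * a) \<le> sup_convolution C u a y"
proof -
  have "continuous_on C (\<lambda>x. u x - (norm (y - x))\<^sup>2 / (2 * a))"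
    unfolding divide_inverse by (intro continuous_intros assms)
  from continuous_attains_sup[OF assms(1,2) this] obtain x where x: "x \<in> C"
    "\<And>x'. x' \<in> C \<Longrightarrow> u x' - (norm (y - x'))\<^sup>2 / (2 * a) \<le> u x - (norm (y - x))\<^sup>2 / (2 * a)"
    by blast
  have eq: "sup_convolution C u a y = u x - (norm (y - x))\<^sup>2 / (2 * a)"
    unfolding sup_convolution_def using x by (intro cSup_eq_maximum) auto
  show ?thesis
    by (rule that[OF x(1) eq]) (simp only: eq x(2))
qed

text \<open>The maximiser for the midpoint is a competitor at both ends; the parallelogram identity
  supplies the constant.\<close>

lemma sup_convolution_semiconvex:
  assumes "compact C" "C \<noteq> {}" "continuous_on C u" and a: "a > 0"
  shows "2 * sup_convolution C u a ((y1 + y2) /\<^sub>R 2) \<le>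
    sup_convolution C u a y1 + sup_convolution C u a y2 + (norm (y1 - y2))\<^sup>2 / (4 * a)"
proof -
  define m where "m = (y1 + y2) /\<^sub>R 2"
  obtain x where x: "x \<in> C" "sup_convolution C u a m = u x - (norm (m - x))\<^sup>2 / (2 * a)"
    using sup_convolution_attained[OF assms(1-3)] by metis
  have le: "u x - (norm (y - x))\<^sup>2 / (2 * a) \<le> sup_convolution C u a y" for y
    using sup_convolution_attained[OF assms(1-3)] x(1) by metis
  have y: "y1 - x = (m - x) + (y1 - y2) /\<^sub>R 2" "y2 - x = (m - x) - (y1 - y2) /\<^sub>R 2"
    by (simp_all add: m_def algebra_simps flip: scaleR_2)
  have "(norm (y1 - x))\<^sup>2 + (norm (y2 - x))\<^sup>2 = 2 * (norm (m - x))\<^sup>2 + (norm (y1 - y2))\<^sup>2 / 2"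
    unfolding y by (simp add: power2_norm_eq_inner inner_simps inner_commute)
  then have "(norm (y1 - x))\<^sup>2 / (2 * a) + (norm (y2 - x))\<^sup>2 / (2 * a)
      = 2 * ((norm (m - x))\<^sup>2 / (2 * a)) + (norm (y1 - y2))\<^sup>2 / (4 * a)"
    using a by (intro parallelogram_divide)
  then show ?thesis
    using le[of y1] le[of y2] x(2) unfolding m_def by linarith
qed

text \<open>Adding |y|^2 / (2 a) turns the supremum into one of affine functions, hence into a
  finite convex function on the whole space, which is continuous.\<close>

lemma continuous_on_sup_convolution:
  assumes "compact C" "C \<noteq> {}" "continuous_on C u" and a: "a > 0"
  shows "continuous_on UNIV (sup_convolution C u a)"
proof -
  let ?f = "\<lambda>y. sup_convolution C u a y + (norm y)\<^sup>2 / (2 * a)"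
  have expand: "u x - (norm (y - x))\<^sup>2 / (2 * a) + (norm y)\<^sup>2 / (2 * a) = u x - (norm x)\<^sup>2 / (2 * a) + (y \<bullet> x) / a" for x y
    using a by (simp add: power2_norm_eq_inner inner_simps inner_commute field_simps)
  have "convex_on UNIV ?f"
  proof (rule convex_onI)
    fix t :: real and y1 y2 :: 'a
    assume t: "0 < t" "t < 1"
    define y where "y = (1 - t) *\<^sub>R y1 + t *\<^sub>R y2"
    obtain x where x: "x \<in> C" "sup_convolution C u a y = u x - (norm (y - x))\<^sup>2 / (2 * a)"
      using sup_convolution_attained[OF assms(1-3)] by metis
    have le: "u x - (norm x)\<^sup>2 / (2 * a) + (z \<bullet> x) / a \<le> ?f z" for z
      using sup_convolution_attained[OF assms(1-3)] x(1) expand[of x z] by (smt (verit))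
    have "?f y = u x - (norm x)\<^sup>2 / (2 * a) + (y \<bullet> x) / a"
      using x(2) expand[of x y] by simp
    also have "\<dots> = (1 - t) * (u x - (norm x)\<^sup>2 / (2 * a) + (y1 \<bullet> x) / a) + t * (u x - (norm x)\<^sup>2 / (2 * a) + (y2 \<bullet> x) / a)"
      unfolding y_def by (simp add: inner_simps algebra_simps add_divide_distrib diff_divide_distrib)
    also have "\<dots> \<le> (1 - t) * ?f y1 + t * ?f y2"
      using t by (intro add_mono mult_left_mono le) auto
    finally show "?f ((1 - t) *\<^sub>R y1 + t *\<^sub>R y2) \<le> (1 - t) * ?f y1 + t * ?f y2"
      unfolding y_def .
  qed auto
  then have "continuous_on UNIV ?f"
    by (intro convex_on_continuous) auto
  then have "continuous_on UNIV (\<lambda>y. ?f y - (norm y)\<^sup>2 / (2 * a))"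
    using a by (intro continuous_on_diff[of _ ?f]) (auto intro!: continuous_intros)
  then show ?thesis
    by simp
qed

lemma paraboloid_envelope_attained:
  assumes C: "compact C" "C \<noteq> {}" "continuous_on C u" and ab: "0 < b" "b < a"
  obtains y where "paraboloid_envelope C u a b x = sup_convolution C u a y + (norm (x - y))\<^sup>2 / (2 * b)"
    "\<And>y'. paraboloid_envelope C u a b x \<le> sup_convolution C u a y' + (norm (x - y'))\<^sup>2 / (2 * b)"
proof -
  let ?f = "\<lambda>y. sup_convolution C u a y + (norm (x - y))\<^sup>2 / (2 * b)"
  obtain x1 where x1: "x1 \<in> C"
    using C by auto
  have low: "u x1 - (norm (y - x1))\<^sup>2 / (2 * a) \<le> sup_convolution C u a y" for y
    using sup_convolution_attained[OF C] x1 by metis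
  \<comment> \<open>The sup-convolution decreases at most like a paraboloid of opening 1 / a; since
    \<open>b < a\<close>, the added paraboloid wins with the surplus \<open>k\<close>, and
    minimisation reduces to a ball.\<close>
  define k where "k = 1 / (2 * b) - 1 / (2 * a)"
  define D where "D = norm (x - x1)"
  have k: "k > 0"
    using ab by (simp add: k_def field_simps)
  obtain R where R: "R \<ge> 0" "\<And>s. s \<ge> R \<Longrightarrow> k * s\<^sup>2 - (D / a) * s > ?f x + D\<^sup>2 / (2 * a) - u x1"
    using quadratic_eventually_gt[OF k] by metis
  have far: "?f y > ?f x" if y: "norm (y - x) \<ge> R" for y
  proof -
    define s where "s = norm (y - x)"
    have "norm (y - x1) \<le> s + D"
      using norm_triangle_ineq[of "y - x" "x - x1"] by (simp add: s_def D_def)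
    then have "(norm (y - x1))\<^sup>2 / (2 * a) \<le> (s + D)\<^sup>2 / (2 * a)"
      using ab by (intro divide_right_mono power_mono) auto
    then have "?f y \<ge> u x1 - (s + D)\<^sup>2 / (2 * a) + s\<^sup>2 / (2 * b)"
      using low[of y] by (simp add: s_def norm_minus_commute)
    also have "u x1 - (s + D)\<^sup>2 / (2 * a) + s\<^sup>2 / (2 * b) = (k * s\<^sup>2 - (D / a) * s) - D\<^sup>2 / (2 * a) + u x1"
      using ab by (simp add: k_def power2_eq_square field_simps)
    finally show ?thesis
      using R(2)[of s] y by (simp add: s_def)
  qed
  have "continuous_on (cball x R) ?f"
    using continuous_on_subset[OF continuous_on_sup_convolution[OF C]] ab
    by (intro continuous_intros) auto
  then obtain y where y: "y \<in> cball x R" "\<And>y'. y' \<in> cball x R \<Longrightarrow> ?f y \<le> ?f y'"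
    using continuous_attains_inf[of "cball x R" ?f] R(1) by auto
  have min: "?f y \<le> ?f y'" for y'
  proof (cases "y' \<in> cball x R")
    case False
    then have "?f x < ?f y'"
      by (intro far) (simp add: dist_norm norm_minus_commute)
    moreover have "?f y \<le> ?f x"
      using R(1) by (intro y) auto
    ultimately show ?thesis
      by simp
  qed (rule y)
  have eq: "paraboloid_envelope C u a b x = ?f y"
    unfolding paraboloid_envelope_def using min by (intro cInf_eq_minimum) auto
  show ?thesis
    by (rule that[OF eq]) (simp only: eq min)
qed

text \<open>The quadratic composition rule for (a - b) + b = a: the second regularisation does not
  undo the first one below parameter \<open>a - b\<close>.\<close>

lemma paraboloid_envelope_ge:
  assumes C: "compact C" "C \<noteq> {}" "continuous_on C u" and ab: "0 < b" "b < a" and x': "x' \<in> C"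
  shows "u x' - (norm (x - x'))\<^sup>2 / (2 * (a - b)) \<le> paraboloid_envelope C u a b x"
proof -
  obtain y where y: "paraboloid_envelope C u a b x = sup_convolution C u a y + (norm (x - y))\<^sup>2 / (2 * b)"
    using paraboloid_envelope_attained[OF C ab] by metis
  have "u x' - (norm (y - x'))\<^sup>2 / (2 * a) \<le> sup_convolution C u a y"
    using sup_convolution_attained[OF C] x' by metis
  moreover have "(norm (y - x'))\<^sup>2 / (2 * a) \<le> (norm (x - x'))\<^sup>2 / (2 * (a - b)) + (norm (x - y))\<^sup>2 / (2 * b)"
    using norm_add_sq_divide_le[of "2 * (a - b)" "2 * b" "x - x'" "y - x"] ab
    by (simp add: norm_minus_commute algebra_simps)
  ultimately show ?thesis
    using y by linarith
qed

text \<open>The converse direction, which justifies the name: the envelope at \<open>z\<close> lies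
  below every paraboloid of opening 1 / b that dominates the sup-convolution with parameter
  \<open>a - b\<close>.\<close>

lemma paraboloid_envelope_le:
  assumes C: "compact C" "C \<noteq> {}" "continuous_on C u" and ab: "0 < b" "b < a"
    and le: "\<And>x x'. x' \<in> C \<Longrightarrow> u x' - (norm (x - x'))\<^sup>2 / (2 * (a - b)) \<le> c + p \<bullet> (x - z) + (norm (x - z))\<^sup>2 / (2 * b)"
  shows "paraboloid_envelope C u a b z \<le> c"
proof -
  \<comment> \<open>The vertex of the given paraboloid; completing the square there makes it a
    competitor in the infimum that defines the envelope.\<close>
  define y where "y = z - b *\<^sub>R p"
  have sq: "p \<bullet> (x - z) + (norm (x - z))\<^sup>2 / (2 * b) = (norm (x - y))\<^sup>2 / (2 * b) - b * (p \<bullet> p) / 2" for x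
    using ab unfolding y_def power2_norm_eq_inner by (simp add: inner_simps inner_commute field_simps)
  obtain x' where x': "x' \<in> C" "sup_convolution C u a y = u x' - (norm (y - x'))\<^sup>2 / (2 * a)"
    using sup_convolution_attained[OF C] by metis
  define d where "d = x' - y"
  \<comment> \<open>The point on the segment from \<open>y\<close> to \<open>x'\<close> at which the
    quadratic composition rule is an equality.\<close>
  define x where "x = y + (b / a) *\<^sub>R d"
  have xx': "x - x' = (- (1 - b / a)) *\<^sub>R d" "x - y = (b / a) *\<^sub>R d"
    by (simp_all add: x_def d_def algebra_simps)
  have "1 - b / a > 0"
    using ab by simp
  have "(norm (x - x'))\<^sup>2 / (2 * (a - b)) + (norm (x - y))\<^sup>2 / (2 * b) = ((1 - b / a)\<^sup>2 / (2 * (a - b)) + (b / a)\<^sup>2 / (2 * b)) * (norm d)\<^sup>2"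
    unfolding xx' norm_scaleR power_mult_distrib power2_abs power2_minus by (simp add: distrib_right)
  also have "(1 - b / a)\<^sup>2 / (2 * (a - b)) + (b / a)\<^sup>2 / (2 * b) = 1 / (2 * a)"
    using ab by (simp add: power2_eq_square divide_simps) (simp add: algebra_simps)
  finally have "(norm (x - x'))\<^sup>2 / (2 * (a - b)) + (norm (x - y))\<^sup>2 / (2 * b) = (norm d)\<^sup>2 / (2 * a)"
    by simp
  then have "u x' - (norm d)\<^sup>2 / (2 * a) \<le> c - b * (p \<bullet> p) / 2"
    using le[OF x'(1), of x] sq[of x] by linarith
  then have "sup_convolution C u a y \<le> c - b * (p \<bullet> p) / 2"
    using x'(2) by (simp add: d_def norm_minus_commute)
  moreover have "paraboloid_envelope C u a b z \<le> sup_convolution C u a y + (norm (z - y))\<^sup>2 / (2 * b)"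
    using paraboloid_envelope_attained[OF C ab] by metis
  ultimately show ?thesis
    using sq[of z] by simp
qed

text \<open>From above, the minimising paraboloid touches at \<open>x\<close> and gives the slope
  \<open>g\<close>. From below, the envelope inherits semiconvexity with constant 1 / (a - b);
  combined with the upper bound at \<open>- h\<close> this yields the sum of the two
  constants.\<close>

lemma paraboloid_envelope_C11:
  assumes C: "compact C" "C \<noteq> {}" "continuous_on C u" and ab: "0 < b" "b < a"
  shows "\<exists>g. \<forall>h. \<bar>paraboloid_envelope C u a b (x + h) - paraboloid_envelope C u a b x - g \<bullet> h\<bar>
    \<le> (1 / (2 * b) + 1 / (a - b)) * (norm h)\<^sup>2"
proof -
  let ?U = "paraboloid_envelope C u a b" and ?S = "sup_convolution C u a"
  have le: "?U x \<le> ?S y + (norm (x - y))\<^sup>2 / (2 * b)" for x y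
    using paraboloid_envelope_attained[OF C ab] by metis
  obtain y where y: "?U x = ?S y + (norm (x - y))\<^sup>2 / (2 * b)"
    using paraboloid_envelope_attained[OF C ab] by metis
  define g where "g = (x - y) /\<^sub>R b"
  have up: "?U (x + h) \<le> ?U x + g \<bullet> h + (norm h)\<^sup>2 / (2 * b)" for h
  proof -
    have "(norm (x + h - y))\<^sup>2 = (norm (x - y))\<^sup>2 + 2 * ((x - y) \<bullet> h) + (norm h)\<^sup>2"
      unfolding power2_norm_eq_inner by (simp add: inner_simps inner_commute)
    then have "(norm (x + h - y))\<^sup>2 / (2 * b) = (norm (x - y))\<^sup>2 / (2 * b) + g \<bullet> h + (norm h)\<^sup>2 / (2 * b)"
    proof -
      have "g \<bullet> h = ((x - y) \<bullet> h) / b"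
        by (simp add: g_def divide_inverse)
      moreover assume "(norm (x + h - y))\<^sup>2 = (norm (x - y))\<^sup>2 + 2 * ((x - y) \<bullet> h) + (norm h)\<^sup>2"
      ultimately show ?thesis
        using ab by (simp add: field_simps)
    qed
    then show ?thesis
      using le[of "x + h" y] y by simp
  qed
  have low: "2 * ?U x \<le> ?U (x + h) + ?U (x - h) + (norm h)\<^sup>2 / (a - b)" for h
  proof -
    obtain y1 where y1: "?U (x + h) = ?S y1 + (norm (x + h - y1))\<^sup>2 / (2 * b)"
      using paraboloid_envelope_attained[OF C ab] by metis
    obtain y2 where y2: "?U (x - h) = ?S y2 + (norm (x - h - y2))\<^sup>2 / (2 * b)"
      using paraboloid_envelope_attained[OF C ab] by metis
    define m d where "m = (y1 + y2) /\<^sub>R 2" and "d = y1 - y2"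
    define e where "e = 2 *\<^sub>R h - d"
    have xy: "x + h - y1 = (x - m) + e /\<^sub>R 2" "x - h - y2 = (x - m) - e /\<^sub>R 2"
      by (simp_all add: m_def e_def d_def algebra_simps flip: scaleR_2)
    have "(norm (x + h - y1))\<^sup>2 + (norm (x - h - y2))\<^sup>2 = 2 * (norm (x - m))\<^sup>2 + (norm e)\<^sup>2 / 2"
      unfolding xy by (simp add: power2_norm_eq_inner inner_simps inner_commute)
    then have "(norm (x + h - y1))\<^sup>2 / (2 * b) + (norm (x - h - y2))\<^sup>2 / (2 * b)
        = 2 * ((norm (x - m))\<^sup>2 / (2 * b)) + (norm e)\<^sup>2 / (4 * b)"
      using ab by (intro parallelogram_divide) auto
    moreover have "2 * ?S m \<le> ?S y1 + ?S y2 + (norm d)\<^sup>2 / (4 * a)"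
      unfolding m_def d_def using ab by (intro sup_convolution_semiconvex[OF C]) auto
    moreover have "(norm d)\<^sup>2 / (4 * a) \<le> (norm (2 *\<^sub>R h))\<^sup>2 / (4 * (a - b)) + (norm e)\<^sup>2 / (4 * b)"
      using norm_add_sq_divide_le[of "4 * (a - b)" "4 * b" "2 *\<^sub>R h" "- e"] ab
      by (simp add: e_def norm_minus_commute algebra_simps)
    moreover have "(norm (2 *\<^sub>R h))\<^sup>2 / (4 * (a - b)) = (norm h)\<^sup>2 / (a - b)"
      using ab by (simp add: power_mult_distrib field_simps)
    ultimately show ?thesis
      using le[of x m] y1 y2 by linarith
  qed
  have "\<bar>?U (x + h) - ?U x - g \<bullet> h\<bar> \<le> (1 / (2 * b) + 1 / (a - b)) * (norm h)\<^sup>2" for h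
  proof -
    have "?U (x + h) - ?U x - g \<bullet> h \<ge> - ((norm h)\<^sup>2 / (2 * b) + (norm h)\<^sup>2 / (a - b))"
      using up[of "- h"] low[of h] by simp
    moreover have "(norm h)\<^sup>2 / (a - b) \<ge> 0"
      using ab by simp
    ultimately show ?thesis
      using up[of h] by (simp add: abs_le_iff distrib_right)
  qed
  then show ?thesis
    by blast
qed

section \<open>Functions of class C^{1,1}\<close>

lemma C11_gradient_lipschitz:
  fixes U :: "'a::euclidean_space \<Rightarrow> real"
  assumes U: "\<And>x h. \<bar>U (x + h) - U x - g x \<bullet> h\<bar> \<le> l * (norm h)\<^sup>2" and l: "l \<ge> 0"
  shows "(6 * l)-lipschitz_on UNIV g"
proof (rule lipschitz_onI)
  fix x y
  show "dist (g x) (g y) \<le> 6 * l * dist x y"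
  proof (cases "g x = g y \<or> x = y")
    case False
    define t where "t = norm (x - y)"
    define D where "D = norm (g y - g x)"
    \<comment> \<open>A step of length |x - y| in the direction of the gradient difference. The
      three quadratic errors, with increments of length at most t, 2 t and t, add up to the factor 1
      + 4 + 1 = 6.\<close>
    define k where "k = (t / D) *\<^sub>R (g y - g x)"
    have t: "t > 0" "D > 0"
      using False by (auto simp: t_def D_def)
    have k: "norm k = t" "(g y - g x) \<bullet> k = t * D"
      using t by (auto simp: k_def D_def simp flip: power2_norm_eq_inner) (simp add: power2_eq_square)
    have "U (y + k) - U y \<ge> g y \<bullet> k - l * (norm k)\<^sup>2"
      using U[of y k] by linarith
    moreover have "U (y + k) - U x \<le> g x \<bullet> (y - x) + g x \<bullet> k + l * (norm (y - x + k))\<^sup>2"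
      using U[of x "y - x + k"] by (simp add: inner_simps)
    moreover have "U y - U x \<ge> g x \<bullet> (y - x) - l * (norm (y - x))\<^sup>2"
      using U[of x "y - x"] by simp
    ultimately have *: "(g y - g x) \<bullet> k \<le> l * (norm k)\<^sup>2 + l * (norm (y - x + k))\<^sup>2 + l * (norm (y - x))\<^sup>2"
      by (simp add: inner_simps)
    have "norm (y - x + k) \<le> 2 * t"
      using norm_triangle_ineq[of "y - x" k] k(1) by (simp add: t_def norm_minus_commute)
    then have "l * (norm (y - x + k))\<^sup>2 \<le> l * (2 * t)\<^sup>2"
      using l by (intro mult_left_mono power_mono) auto
    then have "t * D \<le> t * (6 * l * t)"
      using * k by (simp add: t_def norm_minus_commute power2_eq_square algebra_simps)
    then show ?thesis
      using t(1) by (simp add: dist_norm t_def D_def norm_minus_commute)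
  qed (use l in auto)
qed (use l in auto)

lemma C11_has_derivative:
  fixes U :: "'a::euclidean_space \<Rightarrow> real"
  assumes U: "\<And>x h. \<bar>U (x + h) - U x - g x \<bullet> h\<bar> \<le> l * (norm h)\<^sup>2" and l: "l \<ge> 0"
  shows "(U has_derivative (\<lambda>h. g x \<bullet> h)) (at x)"
  unfolding has_derivative_at_alt
proof (intro conjI allI impI bounded_linear_inner_right)
  fix e :: real assume "e > 0"
  have "norm (U y - U x - g x \<bullet> (y - x)) \<le> e * norm (y - x)" if y: "norm (y - x) < e / (l + 1)" for y
  proof -
    have "\<bar>U y - U x - g x \<bullet> (y - x)\<bar> \<le> (l * norm (y - x)) * norm (y - x)"
      using U[of x "y - x"] by (simp add: power2_eq_square)
    also have "l * norm (y - x) \<le> (l + 1) * norm (y - x)"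
      by (simp add: distrib_right)
    also have "\<dots> \<le> e"
      using y l by (simp add: field_simps)
    finally show ?thesis
      by (simp add: mult_right_mono)
  qed
  then show "\<exists>d>0. \<forall>y. norm (y - x) < d \<longrightarrow> norm (U y - U x - g x \<bullet> (y - x)) \<le> e * norm (y - x)"
    using \<open>e > 0\<close> l by (intro exI[of _ "e / (l + 1)"]) auto
qed

text \<open>Mean value theorem along the segment: the derivative of the second-order remainder is
  the first-order remainder of the gradient, paired with \<open>h\<close>.\<close>

lemma C11_taylor2:
  fixes U :: "'a::euclidean_space \<Rightarrow> real"
  assumes U: "\<And>x h. \<bar>U (x + h) - U x - g x \<bullet> h\<bar> \<le> l * (norm h)\<^sup>2" and l: "l \<ge> 0"
    and X: "(g has_derivative X) (at x)" and e: "e > 0"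
  shows "\<forall>\<^sub>F h in nhds 0. \<bar>U (x + h) - U x - g x \<bullet> h - (h \<bullet> X h) / 2\<bar> \<le> e * (norm h)\<^sup>2"
proof -
  have lin: "linear X"
    using X by (rule has_derivative_linear)
  obtain d where d: "d > 0" "\<And>y. norm (y - x) < d \<Longrightarrow> norm (g y - g x - X (y - x)) \<le> e * norm (y - x)"
    using X e unfolding has_derivative_at_alt by blast
  have "\<bar>U (x + h) - U x - g x \<bullet> h - (h \<bullet> X h) / 2\<bar> \<le> e * (norm h)\<^sup>2" if h: "norm h < d" for h
  proof -
    define f where "f t = U (x + t *\<^sub>R h) - t * (g x \<bullet> h) - t\<^sup>2 / 2 * (h \<bullet> X h)" for t
    define f' where "f' t = (g (x + t *\<^sub>R h) - g x - t *\<^sub>R X h) \<bullet> h" for t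
    have der: "(f has_derivative (\<lambda>s. s * f' t)) (at t)" for t
    proof -
      have "((\<lambda>t. U (x + t *\<^sub>R h)) has_derivative (\<lambda>s. g (x + t *\<^sub>R h) \<bullet> (s *\<^sub>R h))) (at t)"
        by (rule has_derivative_compose[OF _ C11_has_derivative[OF U l]]) (auto intro!: derivative_eq_intros)
      then show ?thesis
        unfolding f_def f'_def
        by (auto intro!: derivative_eq_intros simp: inner_simps inner_commute algebra_simps power2_eq_square)
    qed
    have "\<exists>t\<in>{0<..<1}. f 1 - f 0 = (1 - 0) * f' t"
      using der by (intro mvt_simple) (auto intro: has_derivative_at_withinI)
    then obtain t where t: "0 < t" "t < 1" "f 1 - f 0 = f' t"
      by auto
    have "norm (t *\<^sub>R h) \<le> norm h"
      using t by (simp add: mult_left_le_one_le)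
    then have "norm (g (x + t *\<^sub>R h) - g x - X (t *\<^sub>R h)) \<le> e * norm (t *\<^sub>R h)"
      using d(2)[of "x + t *\<^sub>R h"] h by simp
    also have "\<dots> \<le> e * norm h"
      using e \<open>norm (t *\<^sub>R h) \<le> norm h\<close> by (intro mult_left_mono) auto
    finally have "norm (g (x + t *\<^sub>R h) - g x - t *\<^sub>R X h) \<le> e * norm h"
      by (simp add: linear_scale[OF lin])
    then have "\<bar>f' t\<bar> \<le> e * norm h * norm h"
      unfolding f'_def by (intro order_trans[OF Cauchy_Schwarz_ineq2] mult_right_mono) auto
    then show ?thesis
      using t(3) by (simp add: f_def power2_eq_square algebra_simps)
  qed
  then show ?thesis
    unfolding eventually_nhds_metric using d(1) by (auto intro!: exI[of _ d])
qed

lemma negligible_vimage_fst_snd: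
  fixes A :: "'a::euclidean_space set" and B :: "'b::euclidean_space set"
  shows "negligible A \<Longrightarrow> negligible {z :: 'a \<times> 'b. fst z \<in> A}"
    and "negligible B \<Longrightarrow> negligible {z :: 'a \<times> 'b. snd z \<in> B}"
proof -
  assume "negligible A"
  then obtain N where "N \<in> null_sets lborel" "A \<subseteq> N"
    unfolding negligible_iff_null_sets null_sets_completion_iff2 by auto
  then have "N \<times> UNIV \<in> null_sets (lborel \<Otimes>\<^sub>M (lborel :: 'b measure))"
    by (auto simp: null_sets_def lborel.emeasure_pair_measure_Times)
  then show "negligible {z :: 'a \<times> 'b. fst z \<in> A}"
    using \<open>A \<subseteq> N\<close> unfolding negligible_iff_null_sets null_sets_completion_iff2 lborel_prod
    by (intro bexI[of _ "N \<times> UNIV"]) auto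
next
  assume "negligible B"
  then obtain N where "N \<in> null_sets lborel" "B \<subseteq> N"
    unfolding negligible_iff_null_sets null_sets_completion_iff2 by auto
  then have "UNIV \<times> N \<in> null_sets ((lborel :: 'a measure) \<Otimes>\<^sub>M lborel)"
    by (auto simp: null_sets_def lborel.emeasure_pair_measure_Times)
  then show "negligible {z :: 'a \<times> 'b. snd z \<in> B}"
    using \<open>B \<subseteq> N\<close> unfolding negligible_iff_null_sets null_sets_completion_iff2 lborel_prod
    by (intro bexI[of _ "UNIV \<times> N"]) auto
qed

text \<open>
  The regularised functions \<open>U\<close>, \<open>W\<close> are \<open>C\<^bsup>1,1\<^esup>\<close> and touch the doubled function at the maximum
  points \<open>z\<^sub>\<zeta>\<close> of its perturbations by small linear terms \<open>\<zeta>\<close>. The Lipschitz map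
  \<open>z \<mapsto> (DU, DW) - T z\<close> sends \<open>z\<^sub>\<zeta>\<close> to \<open>\<zeta>\<close>, so the points \<open>z\<^sub>\<zeta>\<close> do not form a null set, and
  Rademacher's theorem provides one at which \<open>U\<close> and \<open>W\<close> are twice differentiable.
\<close>

lemma theorem_on_sums_centered:
  fixes u :: "'a::euclidean_space \<Rightarrow> real" and w :: "'b::euclidean_space \<Rightarrow> real"
    and T :: "'a \<times> 'b \<Rightarrow> 'a \<times> 'b"
  assumes r: "r > 0" and contu: "continuous_on (cball 0 r) u" and contw: "continuous_on (cball 0 r) w"
    and T: "linear T" and sym: "\<And>z z'. T z \<bullet> z' = z \<bullet> T z'"
    and le: "\<And>h k. norm h \<le> r \<Longrightarrow> norm k \<le> r \<Longrightarrow> u h + w k \<le> u 0 + w 0 + ((h, k) \<bullet> T (h, k)) / 2"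
    and eta: "\<eta> > 0" "\<eta> \<le> 1"
  obtains x y P X Q Y where "norm x < \<eta>" "norm y < \<eta>" "norm P < \<eta>" "norm Q < \<eta>"
    "upper_jet u x P X" "upper_jet w y Q Y"
    "\<And>h k. h \<bullet> X h + k \<bullet> Y k \<le> (h, k) \<bullet> T (h, k) + \<eta> * ((norm h)\<^sup>2 + (norm k)\<^sup>2)"
proof -
  define e where "e = \<eta> / 2"
  have e: "e > 0" "e \<le> 1 / 2"
    using eta by (auto simp: e_def)
  \<comment> \<open>The extra \<eta> |z|^2 makes the maximum at 0 strict with margin e |z'|^2, where
    e = \<eta> / 2; in the end it is the \<eta>-term of the conclusion.\<close>
  define T' where "T' z = T z + \<eta> *\<^sub>R z" for z
  have T': "linear T'"
    unfolding T'_def using T by (intro linear_compose_add linear_compose_scale_right linear_id[unfolded id_def])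
  have sym': "T' z \<bullet> z' = z \<bullet> T' z'" for z z'
    by (simp add: T'_def inner_simps sym)
  obtain K0 where K0: "K0 > 0" "\<And>z. norm (T' z) \<le> K0 * norm z"
    using linear_bounded_pos[OF T'] by blast
  define K where "K = K0 + 1"
  have K: "K \<ge> 1" "\<And>z. norm (T' z) \<le> K * norm z"
  proof -
    show "K \<ge> 1"
      using K0(1) by (simp add: K_def)
    show "norm (T' z) \<le> K * norm z" for z
      unfolding K_def distrib_right using K0(2)[of z] norm_ge_zero[of z] by linarith
  qed
  \<comment> \<open>Paraboloids of opening 1 / b = K dominate the form \<open>T'\<close>, see
    \<open>quad\<close>. The penalty with \<open>\<kappa>\<close> absorbs, in \<open>Fle\<close>,
    both K |d|^2 / 2 and the cross term K |d| |z'| at the expense of (e / 2) |z'|^2, and still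
    leaves |d|^2.\<close>
  define b where "b = 1 / K"
  define \<kappa> where "\<kappa> = 1 / (K + K\<^sup>2 / e + 2)"
  have "K + K\<^sup>2 / e + 2 > 0"
    using K(1) e(1) by (intro add_pos_pos) auto
  then have \<kappa>: "\<kappa> > 0" "1 / \<kappa> = K + K\<^sup>2 / e + 2"
    by (auto simp: \<kappa>_def)
  have b: "b > 0" "1 / b = K"
    using K(1) by (auto simp: b_def)
  define a where "a = \<kappa> + b"
  have ab: "0 < b" "b < a" "a - b = \<kappa>"
    using b \<kappa> by (auto simp: a_def)
  define C1 C2 where "C1 = cball (0 :: 'a) r" and "C2 = cball (0 :: 'b) r"
  have C1: "compact C1" "C1 \<noteq> {}" "continuous_on C1 u"
    and C2: "compact C2" "C2 \<noteq> {}" "continuous_on C2 w"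
    using r contu contw by (auto simp: C1_def C2_def)
  define U where "U = paraboloid_envelope C1 u a b"
  define W where "W = paraboloid_envelope C2 w a b"
  define l where "l = 1 / (2 * b) + 1 / (a - b)"
  have l: "l \<ge> 0"
    using ab by (simp add: l_def)
  have "\<exists>g. \<forall>h. \<bar>U (x + h) - U x - g \<bullet> h\<bar> \<le> l * (norm h)\<^sup>2" for x
    unfolding U_def l_def by (rule paraboloid_envelope_C11[OF C1 ab(1,2)])
  then obtain gU where gU: "\<And>x h. \<bar>U (x + h) - U x - gU x \<bullet> h\<bar> \<le> l * (norm h)\<^sup>2"
    by metis
  have "\<exists>g. \<forall>h. \<bar>W (x + h) - W x - g \<bullet> h\<bar> \<le> l * (norm h)\<^sup>2" for x
    unfolding W_def l_def by (rule paraboloid_envelope_C11[OF C2 ab(1,2)])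
  then obtain gW where gW: "\<And>x h. \<bar>W (x + h) - W x - gW x \<bullet> h\<bar> \<le> l * (norm h)\<^sup>2"
    by metis
  \<comment> \<open>The functions are evaluated at \<open>z'\<close>, the quadratic form at
    \<open>z\<close>; maximising over \<open>z'\<close> for fixed \<open>z\<close> produces the
    sup-convolutions with parameter \<open>\<kappa> = a - b\<close>. The vector
    \<open>\<zeta>\<close> is the linear perturbation.\<close>
  define F where "F z' z \<zeta> = u (fst z') + w (snd z') - (norm (z - z'))\<^sup>2 / (2 * \<kappa>) - (z \<bullet> T' z) / 2 - \<zeta> \<bullet> z"
    for z' z \<zeta> :: "'a \<times> 'b"
  define f0 where "f0 = u 0 + w 0"
  have Fle: "F z' z \<zeta> \<le> f0 - (e / 2) * (norm z')\<^sup>2 - (norm (z - z'))\<^sup>2 + norm \<zeta> * (norm z' + norm (z - z'))"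
    if z': "z' \<in> C1 \<times> C2" for z' z \<zeta>
  proof -
    define d where "d = z - z'"
    have z: "z = z' + d"
      by (simp add: d_def)
    have "u (fst z') + w (snd z') \<le> f0 + (z' \<bullet> T z') / 2"
      using le[of "fst z'" "snd z'"] z' by (auto simp: C1_def C2_def f0_def)
    also have "z' \<bullet> T z' = z' \<bullet> T' z' - \<eta> * (norm z')\<^sup>2"
      by (simp add: T'_def inner_simps power2_norm_eq_inner)
    finally have 1: "u (fst z') + w (snd z') \<le> f0 + (z' \<bullet> T' z') / 2 - e * (norm z')\<^sup>2"
      by (simp add: e_def field_simps)
    have "z \<bullet> T' z = z' \<bullet> T' z' + 2 * (d \<bullet> T' z') + d \<bullet> T' d"
      unfolding z using sym'[of z' d] by (simp add: linear_add[OF T'] inner_simps inner_commute)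
    moreover have "d \<bullet> T' z' \<ge> - (K * norm d * norm z')"
      using Cauchy_Schwarz_ineq2[of d "T' z'"] mult_left_mono[OF K(2)[of z'], of "norm d"] by (simp add: mult_ac)
    moreover have "d \<bullet> T' d \<ge> - (K * (norm d)\<^sup>2)"
      using Cauchy_Schwarz_ineq2[of d "T' d"] mult_left_mono[OF K(2)[of d], of "norm d"]
      by (simp add: mult_ac power2_eq_square)
    ultimately have 2: "(z \<bullet> T' z) / 2 \<ge> (z' \<bullet> T' z') / 2 - K * norm d * norm z' - K * (norm d)\<^sup>2 / 2"
      by linarith
    have 3: "\<zeta> \<bullet> z \<ge> - (norm \<zeta> * (norm z' + norm d))"
    proof -
      have "\<bar>\<zeta> \<bullet> z\<bar> \<le> norm \<zeta> * norm z"
        by (rule Cauchy_Schwarz_ineq2)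
      also have "\<dots> \<le> norm \<zeta> * (norm z' + norm d)"
        unfolding z by (intro mult_left_mono norm_triangle_ineq) auto
      finally show ?thesis
        by linarith
    qed
    have "K * norm d * norm z' \<le> (e / 2) * (norm z')\<^sup>2 + (K\<^sup>2 / (2 * e)) * (norm d)\<^sup>2"
    proof -
      have "0 \<le> (e * norm z' - K * norm d)\<^sup>2 / (2 * e)"
        using e by simp
      also have "\<dots> = (e / 2) * (norm z')\<^sup>2 + (K\<^sup>2 / (2 * e)) * (norm d)\<^sup>2 - K * norm d * norm z'"
        using e by (simp add: power2_eq_square field_simps)
      finally show ?thesis
        by simp
    qed
    moreover have "(norm d)\<^sup>2 / (2 * \<kappa>) = (K / 2 + K\<^sup>2 / (2 * e) + 1) * (norm d)\<^sup>2"
    proof -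
      have "(norm d)\<^sup>2 / (2 * \<kappa>) = (1 / \<kappa>) * (norm d)\<^sup>2 / 2"
        by simp
      then show ?thesis
        unfolding \<kappa>(2) by (simp add: add_divide_distrib distrib_right)
    qed
    ultimately show ?thesis
      using 1 2 3 unfolding F_def d_def[symmetric] by (simp add: distrib_right algebra_simps)
  qed
  \<comment> \<open>Calibrated so that \<open>Z_small\<close> bounds |z'| + |z - z'| by
    \<open>min \<eta> r / (2 * (K + 1))\<close>; then \<open>z'\<close> is interior and the gradient
    \<open>T' z + \<zeta>\<close> is smaller than \<eta>.\<close>
  define \<rho> where "\<rho> = min \<eta> r * (e / 4) / (2 * (K + 1))"
  have \<rho>: "\<rho> > 0" "\<rho> \<le> 1"
  proof -
    show "\<rho> > 0"
      using eta r e K(1) by (simp add: \<rho>_def)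
    have "min \<eta> r * (e / 4) \<le> 1 * 1"
      using eta e r by (intro mult_mono) auto
    then show "\<rho> \<le> 1"
      using K(1) by (simp add: \<rho>_def field_simps)
  qed
  have zero_mem: "(0, 0) \<in> C1 \<times> C2" "(0 :: 'a \<times> 'b) \<in> C1 \<times> C2"
    using r by (auto simp: C1_def C2_def zero_prod_def)
  define Z where "Z \<zeta> z' z \<longleftrightarrow> z' \<in> C1 \<times> C2 \<and> (\<forall>y'\<in>C1 \<times> C2. \<forall>y. F y' y \<zeta> \<le> F z' z \<zeta>)" for \<zeta> z' z
  have Z_ex: "\<exists>z' z. Z \<zeta> z' z" if \<zeta>: "norm \<zeta> < \<rho>" for \<zeta>
  proof -
    \<comment> \<open>Outside the ball of radius 4 r + 2 the distance to \<open>y'\<close> is at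
      least 2 r + 2, and \<open>Fle\<close> gives a value not above
      \<open>F 0 0 \<zeta>\<close>.\<close>
    define S where "S = (C1 \<times> C2) \<times> cball (0 :: 'a \<times> 'b) (4 * r + 2)"
    have "continuous_on S (\<lambda>s. F (fst s) (snd s) \<zeta>)"
      unfolding F_def S_def
      by (intro continuous_intros continuous_on_compose2[OF C1(3)] continuous_on_compose2[OF C2(3)]
          linear_continuous_on_compose[OF _ T'] bounded_linear.continuous_on[OF T'[unfolded linear_conv_bounded_linear]])
        (use \<kappa> in auto)
    moreover have "compact S" "S \<noteq> {}"
      unfolding S_def using C1 C2 r by (auto intro!: compact_Times)
    ultimately obtain s where s: "s \<in> S" "\<And>s'. s' \<in> S \<Longrightarrow> F (fst s') (snd s') \<zeta> \<le> F (fst s) (snd s) \<zeta>"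
      using continuous_attains_sup[of S "\<lambda>s. F (fst s) (snd s) \<zeta>"] by blast
    have "F y' y \<zeta> \<le> F (fst s) (snd s) \<zeta>" if y': "y' \<in> C1 \<times> C2" for y' y
    proof (cases "y \<in> cball 0 (4 * r + 2)")
      case True
      then show ?thesis
        using s(2)[of "(y', y)"] y' by (auto simp: S_def)
    next
      case False
      have ny': "norm y' \<le> 2 * r"
        using y' norm_Pair_le[of "fst y'" "snd y'"] by (auto simp: C1_def C2_def)
      define d where "d = norm (y - y')"
      have d: "d \<ge> 2 * r + 2"
        using False ny' norm_triangle_ineq2[of y y'] by (simp add: d_def)
      have "d * d \<ge> (2 * r + 2) * d"
        using d r by (intro mult_right_mono) auto
      then have "d * d \<ge> 2 * r * d + 2 * d"
        by (simp only: distrib_right)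
      moreover have "2 * r * d \<ge> 2 * r * 1"
        using d r by (intro mult_left_mono) auto
      ultimately have "d\<^sup>2 \<ge> d + 2 * r"
        unfolding power2_eq_square using d r by linarith
      moreover have "norm \<zeta> * (norm y' + d) \<le> 1 * (2 * r + d)"
        using \<zeta> \<rho> ny' by (intro mult_mono) (auto simp: d_def)
      moreover have "(e / 2) * (norm y')\<^sup>2 \<ge> 0"
        using e by simp
      ultimately have "F y' y \<zeta> \<le> f0"
        using Fle[OF y', of y \<zeta>] by (simp add: d_def)
      also have "f0 = F 0 0 \<zeta>"
        by (simp add: F_def f0_def)
      also have "\<dots> \<le> F (fst s) (snd s) \<zeta>"
        using s(2)[of "(0, 0)"] r zero_mem by (simp add: S_def)
      finally show ?thesis .
    qed
    then show ?thesis
      using s(1) unfolding Z_def S_def by (intro exI[of _ "fst s"] exI[of _ "snd s"]) auto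
  qed
  have Z_small: "norm z' + norm (z - z') \<le> (4 / e) * norm \<zeta>" if Z: "Z \<zeta> z' z" for \<zeta> z' z
  proof -
    define p q where "p = norm z'" and "q = norm (z - z')"
    have "F 0 0 \<zeta> \<le> F z' z \<zeta>"
      using bspec[OF conjunct2[OF Z[unfolded Z_def]] zero_mem(2)] by (rule spec)
    then have "(e / 2) * p\<^sup>2 + q\<^sup>2 \<le> norm \<zeta> * (p + q)"
      using Fle[of z' z \<zeta>] Z by (simp add: Z_def F_def f0_def p_def q_def)
    moreover have "(e / 2) * q\<^sup>2 \<le> 1 * q\<^sup>2"
      using e by (intro mult_right_mono) auto
    moreover have "(e / 4) * (p + q)\<^sup>2 \<le> (e / 4) * (2 * (p\<^sup>2 + q\<^sup>2))"
      using e sum_squares_bound[of p q] by (intro mult_left_mono) (auto simp: power2_sum)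
    ultimately have "(e / 4) * (p + q) * (p + q) \<le> norm \<zeta> * (p + q)"
      by (simp add: power2_eq_square algebra_simps)
    moreover have "p + q \<ge> 0"
      by (simp add: p_def q_def)
    ultimately have "(e / 4) * (p + q) \<le> norm \<zeta>"
      by (cases "p + q = 0") auto
    then show ?thesis
      using e by (simp add: p_def q_def field_simps)
  qed
  define M where "M \<zeta> z' z = F z' z \<zeta>" for \<zeta> z' z
  have quad: "(((x, y) + d) \<bullet> T' ((x, y) + d)) / 2 \<le> ((x, y) \<bullet> T' (x, y)) / 2 + T' (x, y) \<bullet> d + (norm d)\<^sup>2 / (2 * b)" for x y d
  proof -
    have "d \<bullet> T' d \<le> K * (norm d)\<^sup>2"
      using Cauchy_Schwarz_ineq2[of d "T' d"] mult_left_mono[OF K(2)[of d], of "norm d"]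
      by (simp add: mult_ac power2_eq_square)
    moreover have "(norm d)\<^sup>2 / (2 * b) = K * (norm d)\<^sup>2 / 2"
      by (simp add: b_def)
    ultimately show ?thesis
      using sym'[of "(x, y)" d] by (simp add: linear_add[OF T'] inner_simps inner_commute)
  qed
  have UW: "U x + W y \<le> F z' z \<zeta> + ((x, y) \<bullet> T' (x, y)) / 2 + \<zeta> \<bullet> (x, y)" if Z: "Z \<zeta> z' z" for \<zeta> z' z x y
  proof -
    \<comment> \<open>\<open>paraboloid_envelope_le\<close> acts on one variable at a time: with the
      second variable frozen the bound for \<open>u\<close> becomes one for \<open>U\<close>, then
      with \<open>U x\<close> frozen the bound for \<open>w\<close> becomes one for
      \<open>W\<close>.\<close>
    define m where "m x y = F z' z \<zeta> + ((x, y) \<bullet> T' (x, y)) / 2 + \<zeta> \<bullet> (x, y)" for x y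
    have base: "u x' - (norm (x - x'))\<^sup>2 / (2 * (a - b)) + (w y' - (norm (y - y'))\<^sup>2 / (2 * (a - b))) \<le> m x y"
      if "x' \<in> C1" "y' \<in> C2" for x x' y y'
    proof -
      have "F (x', y') (x, y) \<zeta> \<le> F z' z \<zeta>"
        using Z that by (auto simp: Z_def)
      then show ?thesis
        unfolding m_def ab(3) by (simp add: F_def norm_Pair add_divide_distrib)
    qed
    have step1: "U x + (w y' - (norm (y - y'))\<^sup>2 / (2 * (a - b))) \<le> m x y" if y': "y' \<in> C2" for x y y'
    proof -
      define c where "c = m x y - (w y' - (norm (y - y'))\<^sup>2 / (2 * (a - b)))"
      have "U x \<le> c"
        unfolding U_def
      proof (rule paraboloid_envelope_le[OF C1 ab(1,2)])
        fix v x' assume "x' \<in> C1"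
        have "u x' - (norm (v - x'))\<^sup>2 / (2 * (a - b)) \<le> m v y - (w y' - (norm (y - y'))\<^sup>2 / (2 * (a - b)))"
          using base[OF \<open>x' \<in> C1\<close> y', of v y] by simp
        also have "m v y \<le> m x y + fst (T' (x, y) + \<zeta>) \<bullet> (v - x) + (norm (v - x))\<^sup>2 / (2 * b)"
          using quad[of x y "(v - x, 0)"]
          by (simp add: m_def inner_prod_def inner_simps)
        finally show "u x' - (norm (v - x'))\<^sup>2 / (2 * (a - b)) \<le> c + fst (T' (x, y) + \<zeta>) \<bullet> (v - x) + (norm (v - x))\<^sup>2 / (2 * b)"
          by (simp add: c_def)
      qed
      then show ?thesis
        by (simp add: c_def)
    qed
    have "W y \<le> m x y - U x"
      unfolding W_def
    proof (rule paraboloid_envelope_le[OF C2 ab(1,2)])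
      fix v y' assume "y' \<in> C2"
      have "w y' - (norm (v - y'))\<^sup>2 / (2 * (a - b)) \<le> m x v - U x"
        using step1[OF \<open>y' \<in> C2\<close>, of x v] by simp
      also have "m x v \<le> m x y + snd (T' (x, y) + \<zeta>) \<bullet> (v - y) + (norm (v - y))\<^sup>2 / (2 * b)"
        using quad[of x y "(0, v - y)"]
        by (simp add: m_def inner_prod_def inner_simps)
      finally show "w y' - (norm (v - y'))\<^sup>2 / (2 * (a - b)) \<le> m x y - U x + snd (T' (x, y) + \<zeta>) \<bullet> (v - y) + (norm (v - y))\<^sup>2 / (2 * b)"
        by simp
    qed
    then show ?thesis
      by (simp add: m_def)
  qed
  have Uge: "u x' - (norm (x - x'))\<^sup>2 / (2 * \<kappa>) \<le> U x" if "x' \<in> C1" for x x'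
    using paraboloid_envelope_ge[OF C1 ab(1,2) that] by (simp add: U_def ab(3))
  have Wge: "w y' - (norm (y - y'))\<^sup>2 / (2 * \<kappa>) \<le> W y" if "y' \<in> C2" for y y'
    using paraboloid_envelope_ge[OF C2 ab(1,2) that] by (simp add: W_def ab(3))
  \<comment> \<open>At \<open>z\<close> the upper bound \<open>UW\<close> for the sum meets the sum
    of the lower bounds \<open>Uge\<close> and \<open>Wge\<close>, so both of these are
    equalities.\<close>
  have touch: "U (fst z) = u (fst z') - (norm (fst z - fst z'))\<^sup>2 / (2 * \<kappa>)"
    "W (snd z) = w (snd z') - (norm (snd z - snd z'))\<^sup>2 / (2 * \<kappa>)"
    if Z: "Z \<zeta> z' z" for \<zeta> z' z
  proof -
    have "U (fst z) + W (snd z) \<le> u (fst z') + w (snd z') - (norm (z - z'))\<^sup>2 / (2 * \<kappa>)"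
      using UW[OF Z, of "fst z" "snd z"] by (simp add: F_def)
    also have "(norm (z - z'))\<^sup>2 / (2 * \<kappa>) = (norm (fst z - fst z'))\<^sup>2 / (2 * \<kappa>) + (norm (snd z - snd z'))\<^sup>2 / (2 * \<kappa>)"
      by (simp add: norm_prod_def add_divide_distrib)
    finally show "U (fst z) = u (fst z') - (norm (fst z - fst z'))\<^sup>2 / (2 * \<kappa>)"
      "W (snd z) = w (snd z') - (norm (snd z - snd z'))\<^sup>2 / (2 * \<kappa>)"
      using Uge[of "fst z'" "fst z"] Wge[of "snd z'" "snd z"] Z by (auto simp: Z_def)
  qed
  define G where "G z = (gU (fst z), gW (snd z)) - T' z" for z
  have critical: "G z = \<zeta>" if Z: "Z \<zeta> z' z" for \<zeta> z' z
  proof -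
    define f where "f s = U (fst s) + W (snd s) - (s \<bullet> T' s) / 2 - \<zeta> \<bullet> s" for s
    have "f s \<le> f z" for s
      using UW[OF Z, of "fst s" "snd s"] touch[OF Z]
      by (simp add: f_def F_def norm_prod_def add_divide_distrib)
    moreover have "(f has_derivative (\<lambda>h. gU (fst z) \<bullet> fst h + gW (snd z) \<bullet> snd h - T' z \<bullet> h - \<zeta> \<bullet> h)) (at z)"
    proof -
      have "((\<lambda>s. U (fst s)) has_derivative (\<lambda>h. gU (fst z) \<bullet> fst h)) (at z)"
        by (rule has_derivative_compose[OF has_derivative_fst[OF has_derivative_ident] C11_has_derivative[OF gU l]])
      moreover have "((\<lambda>s. W (snd s)) has_derivative (\<lambda>h. gW (snd z) \<bullet> snd h)) (at z)"
        by (rule has_derivative_compose[OF has_derivative_snd[OF has_derivative_ident] C11_has_derivative[OF gW l]])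
      moreover have "(T' has_derivative T') (at z)"
        using T' by (simp add: linear_imp_has_derivative)
      ultimately show ?thesis
        unfolding f_def
        by (auto intro!: derivative_eq_intros simp: sym' inner_commute)
    qed
    ultimately have zero: "(\<lambda>h. gU (fst z) \<bullet> fst h + gW (snd z) \<bullet> snd h - T' z \<bullet> h - \<zeta> \<bullet> h) = (\<lambda>h. 0)"
      by (intro has_derivative_local_max[of f _ z]) auto
    have "(G z - \<zeta>) \<bullet> h = 0" for h
      using fun_cong[OF zero, of h] by (simp add: G_def inner_diff_left inner_prod_def)
    then have "G z - \<zeta> = 0"
      by (metis inner_eq_zero_iff)
    then show ?thesis
      by simp
  qed
  have lipU: "(6 * l)-lipschitz_on UNIV gU" and lipW: "(6 * l)-lipschitz_on UNIV gW"
    using C11_gradient_lipschitz[OF gU l] C11_gradient_lipschitz[OF gW l] by auto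
  define N where "N = {z. fst z \<in> {x. \<not> gU differentiable (at x)}} \<union> {z. snd z \<in> {y. \<not> gW differentiable (at y)}}"
  have N: "negligible N"
    unfolding N_def
    by (intro negligible_Un negligible_vimage_fst_snd rademacher[OF lipU] rademacher[OF lipW])
  have norm_fst: "norm (fst s) \<le> norm s" and norm_snd: "norm (snd s) \<le> norm s" for s :: "'a \<times> 'b"
    by (metis norm_fst_le prod.collapse, metis norm_snd_le prod.collapse)
  have "\<exists>\<zeta> z' z. norm \<zeta> < \<rho> \<and> Z \<zeta> z' z \<and> z \<notin> N"
  proof (rule ccontr)
    assume "\<not> ?thesis"
    then have "ball 0 \<rho> \<subseteq> G ` N"
      using Z_ex critical by (force simp: image_iff)
    moreover have "negligible (G ` N)"
    proof (rule negligible_locally_Lipschitz_image[OF _ N])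
      fix z assume "z \<in> N"
      have "norm (G s - G z) \<le> (12 * l + K) * norm (s - z)" for s
      proof -
        have "norm (gU (fst s) - gU (fst z)) \<le> 6 * l * norm (fst s - fst z)"
          using lipschitz_onD[OF lipU, of "fst s" "fst z"] by (simp add: dist_norm)
        also have "\<dots> \<le> 6 * l * norm (s - z)"
          using l norm_fst[of "s - z"] by (intro mult_left_mono) auto
        finally have 1: "norm (gU (fst s) - gU (fst z)) \<le> 6 * l * norm (s - z)" .
        have "norm (gW (snd s) - gW (snd z)) \<le> 6 * l * norm (snd s - snd z)"
          using lipschitz_onD[OF lipW, of "snd s" "snd z"] by (simp add: dist_norm)
        also have "\<dots> \<le> 6 * l * norm (s - z)"
          using l norm_snd[of "s - z"] by (intro mult_left_mono) auto
        finally have 2: "norm (gW (snd s) - gW (snd z)) \<le> 6 * l * norm (s - z)" .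
        have "G s - G z = (gU (fst s) - gU (fst z), gW (snd s) - gW (snd z)) - T' (s - z)"
          by (simp add: G_def linear_diff[OF T'])
        also have "norm \<dots> \<le> norm (gU (fst s) - gU (fst z)) + norm (gW (snd s) - gW (snd z)) + norm (T' (s - z))"
          using norm_triangle_ineq4 norm_Pair_le by (smt (verit))
        finally show ?thesis
          using 1 2 K(2)[of "s - z"] by (simp add: algebra_simps)
      qed
      then show "\<exists>T B. open T \<and> z \<in> T \<and> (\<forall>y\<in>N \<inter> T. norm (G y - G z) \<le> B * norm (y - z))"
        by (intro exI[of _ UNIV] exI[of _ "12 * l + K"]) auto
    qed simp
    ultimately have "negligible (ball (0 :: 'a \<times> 'b) \<rho>)"
      using negligible_subset by blast
    then show False
      using \<rho>(1) by (simp add: open_not_negligible)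
  qed
  then obtain \<zeta> z' z where z: "norm \<zeta> < \<rho>" "Z \<zeta> z' z" "z \<notin> N"
    by blast
  obtain X where X: "(gU has_derivative X) (at (fst z))"
    using z(3) by (auto simp: N_def differentiable_def)
  obtain Y where Y: "(gW has_derivative Y) (at (snd z))"
    using z(3) by (auto simp: N_def differentiable_def)
  have small: "norm z' + norm (z - z') < min \<eta> r / (2 * (K + 1))"
  proof -
    have "norm z' + norm (z - z') \<le> (4 / e) * norm \<zeta>"
      by (rule Z_small[OF z(2)])
    also have "\<dots> < (4 / e) * \<rho>"
      using z(1) e by (intro mult_strict_left_mono) auto
    also have "\<dots> = min \<eta> r / (2 * (K + 1))"
    proof -
      have "(4 / e) * (e / 4) = 1"
        using e by simp
      then show ?thesis
        unfolding \<rho>_def by (metis (no_types, opaque_lifting) mult.commute mult.left_commute mult_1 times_divide_eq_left)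
    qed
    finally show ?thesis .
  qed
  have "min \<eta> r / (2 * (K + 1)) \<le> min \<eta> r / 1"
    using K(1) eta r by (intro divide_left_mono) auto
  then have "min \<eta> r / (2 * (K + 1)) \<le> min \<eta> r"
    by simp
  then have z'_small: "norm z' < \<eta>" "norm z' < r"
    using small norm_ge_zero[of "z - z'"] by linarith+
  \<comment> \<open>Jets of the envelope at \<open>z\<close> are jets of the original function at
    \<open>z'\<close>: shifting both points by \<open>h\<close> leaves the penalty unchanged. Stated
    once for both factors.\<close>
  have jet: "upper_jet f (fst' z') (g (fst' z)) Y'" if
      "linear Y'" "f = f" "norm (fst' z') < r"
      "\<And>x'. norm x' \<le> r \<Longrightarrow> \<forall>x. f x' - (norm (x - x'))\<^sup>2 / (2 * \<kappa>) \<le> V x"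
      "V (fst' z) = f (fst' z') - (norm (fst' z - fst' z'))\<^sup>2 / (2 * \<kappa>)"
      "\<And>e. e > 0 \<Longrightarrow> \<forall>\<^sub>F h in nhds 0. \<bar>V (fst' z + h) - V (fst' z) - g (fst' z) \<bullet> h - (h \<bullet> Y' h) / 2\<bar> \<le> e * (norm h)\<^sup>2"
    for f V :: "'c::euclidean_space \<Rightarrow> real" and fst' :: "'a \<times> 'b \<Rightarrow> 'c" and g :: "'c \<Rightarrow> 'c" and Y'
    unfolding upper_jet_def
  proof (intro conjI allI impI that(1))
    fix e :: real assume "e > 0"
    have "\<forall>\<^sub>F h in nhds 0. norm (h :: 'c) < r - norm (fst' z')"
      using that(3) by (intro eventually_nhds_metric[THEN iffD2] exI[of _ "r - norm (fst' z')"]) (auto simp: dist_norm)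
    with that(6)[OF \<open>e > 0\<close>]
    show "\<forall>\<^sub>F h in nhds 0. f (fst' z' + h) \<le> f (fst' z') + g (fst' z) \<bullet> h + (h \<bullet> Y' h) / 2 + e * (norm h)\<^sup>2"
    proof eventually_elim
      case (elim h)
      have "norm (fst' z' + h) \<le> r"
        using norm_triangle_ineq[of "fst' z'" h] elim(2) by simp
      then have "f (fst' z' + h) - (norm ((fst' z + h) - (fst' z' + h)))\<^sup>2 / (2 * \<kappa>) \<le> V (fst' z + h)"
        using that(4) by blast
      then have "f (fst' z' + h) - (norm (fst' z - fst' z'))\<^sup>2 / (2 * \<kappa>) \<le> V (fst' z + h)"
        by simp
      then show ?case
        using elim(1) that(5) by linarith
    qed
  qed
  show ?thesis
  proof (rule that)
    show "norm (fst z') < \<eta>" "norm (snd z') < \<eta>"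
      using z'_small norm_fst[of z'] norm_snd[of z'] by linarith+
    have "(gU (fst z), gW (snd z)) = T' z + \<zeta>"
      using critical[OF z(2)] by (simp add: G_def algebra_simps)
    moreover have "norm (T' z + \<zeta>) < \<eta>"
    proof -
      have nz: "norm z \<le> norm z' + norm (z - z')"
        using norm_triangle_ineq[of z' "z - z'"] by simp
      have "norm (T' z + \<zeta>) \<le> K * norm z + norm \<zeta>"
        using norm_triangle_ineq[of "T' z" \<zeta>] K(2)[of z] by linarith
      also have "K * norm z \<le> K * (min \<eta> r / (2 * (K + 1)))"
        using nz small K(1) by (intro mult_left_mono) auto
      also have "norm \<zeta> \<le> min \<eta> r / (2 * (K + 1))"
      proof -
        have "\<rho> = (e / 4) * (min \<eta> r / (2 * (K + 1)))"
          by (simp add: \<rho>_def)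
        also have "\<dots> \<le> 1 * (min \<eta> r / (2 * (K + 1)))"
          using e eta r K(1) by (intro mult_right_mono) auto
        finally show ?thesis
          using z(1) by simp
      qed
      also have "K * (min \<eta> r / (2 * (K + 1))) + min \<eta> r / (2 * (K + 1)) = min \<eta> r / 2"
        using K(1) by (simp add: divide_simps) (simp add: algebra_simps)
      also have "\<dots> < \<eta>"
        using eta by simp
      finally show ?thesis
        by simp
    qed
    ultimately have "norm (gU (fst z), gW (snd z)) < \<eta>"
      by simp
    then show "norm (gU (fst z)) < \<eta>" "norm (gW (snd z)) < \<eta>"
      using norm_fst[of "(gU (fst z), gW (snd z))"] norm_snd[of "(gU (fst z), gW (snd z))"] by auto
    show "upper_jet u (fst z') (gU (fst z)) X"
    proof (rule jet[OF _ refl, of X fst u U gU])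
      show "linear X"
        using X by (rule has_derivative_linear)
      show "norm (fst z') < r"
        using z'_small norm_fst[of z'] by linarith
    qed (use Uge touch[OF z(2)] C11_taylor2[OF gU l X] in \<open>auto simp: C1_def\<close>)
    show "upper_jet w (snd z') (gW (snd z)) Y"
    proof (rule jet[OF _ refl, of Y snd w W gW])
      show "linear Y"
        using Y by (rule has_derivative_linear)
      show "norm (snd z') < r"
        using z'_small norm_snd[of z'] by linarith
    qed (use Wge touch[OF z(2)] C11_taylor2[OF gW l Y] in \<open>auto simp: C2_def\<close>)
    fix h k
    have linX: "linear X" and linY: "linear Y"
      using X Y by (auto intro: has_derivative_linear)
    \<comment> \<open>The expansions of \<open>U\<close> and \<open>W\<close> along t (h, k) are
      inserted into \<open>UW\<close>, which is an equality at \<open>z\<close>. First-order terms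
      cancel because \<open>G z = \<zeta>\<close>, and division by t^2 leaves the quadratic
      forms.\<close>
    show "h \<bullet> X h + k \<bullet> Y k \<le> (h, k) \<bullet> T (h, k) + \<eta> * ((norm h)\<^sup>2 + (norm k)\<^sup>2)"
    proof (rule field_le_epsilon)
      fix c :: real assume "c > 0"
      define e' where "e' = c / (2 * ((norm h)\<^sup>2 + (norm k)\<^sup>2 + 1))"
      have den: "(norm h)\<^sup>2 + (norm k)\<^sup>2 + 1 > 0"
        by (intro add_nonneg_pos) auto
      then have e': "e' > 0" "2 * (e' * ((norm h)\<^sup>2 + (norm k)\<^sup>2)) \<le> c"
        using \<open>c > 0\<close> by (auto simp: e'_def field_simps)
      have tend: "((\<lambda>t. t *\<^sub>R v) \<longlongrightarrow> 0) (at_right (0::real))" for v :: "'c::real_normed_vector"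
        by (intro tendsto_eq_intros) auto
      have "\<forall>\<^sub>F t in at_right 0. \<bar>U (fst z + t *\<^sub>R h) - U (fst z) - gU (fst z) \<bullet> (t *\<^sub>R h) - ((t *\<^sub>R h) \<bullet> X (t *\<^sub>R h)) / 2\<bar> \<le> e' * (norm (t *\<^sub>R h))\<^sup>2"
        using filterlim_iff[THEN iffD1, OF tend, rule_format, OF C11_taylor2[OF gU l X e'(1)]] .
      moreover have "\<forall>\<^sub>F t in at_right 0. \<bar>W (snd z + t *\<^sub>R k) - W (snd z) - gW (snd z) \<bullet> (t *\<^sub>R k) - ((t *\<^sub>R k) \<bullet> Y (t *\<^sub>R k)) / 2\<bar> \<le> e' * (norm (t *\<^sub>R k))\<^sup>2"
        using filterlim_iff[THEN iffD1, OF tend, rule_format, OF C11_taylor2[OF gW l Y e'(1)]] .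
      moreover have "\<forall>\<^sub>F t in at_right (0::real). t > 0"
        by (rule eventually_at_right_less)
      ultimately have "\<forall>\<^sub>F t in at_right (0::real). h \<bullet> X h + k \<bullet> Y k \<le> (h, k) \<bullet> T' (h, k) + c"
      proof eventually_elim
        case (elim t)
        define s where "s = t *\<^sub>R (h, k)"
        have "U (fst z + t *\<^sub>R h) + W (snd z + t *\<^sub>R k) \<le> F z' z \<zeta> + ((z + s) \<bullet> T' (z + s)) / 2 + \<zeta> \<bullet> (z + s)"
          using UW[OF z(2), of "fst (z + s)" "snd (z + s)"] unfolding prod.collapse by (simp add: s_def)
        moreover have "U (fst z) + W (snd z) = F z' z \<zeta> + (z \<bullet> T' z) / 2 + \<zeta> \<bullet> z"
          using touch[OF z(2)] by (simp add: F_def norm_prod_def add_divide_distrib)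
        moreover have "(z + s) \<bullet> T' (z + s) = z \<bullet> T' z + 2 * (T' z \<bullet> s) + s \<bullet> T' s"
          using sym'[of z s] by (simp add: linear_add[OF T'] inner_simps inner_commute)
        moreover have "gU (fst z) \<bullet> (t *\<^sub>R h) + gW (snd z) \<bullet> (t *\<^sub>R k) = T' z \<bullet> s + \<zeta> \<bullet> s"
        proof -
          have "gU (fst z) \<bullet> (t *\<^sub>R h) + gW (snd z) \<bullet> (t *\<^sub>R k) = (G z + T' z) \<bullet> s"
            by (simp add: G_def s_def inner_prod_def)
          then show ?thesis
            by (simp add: critical[OF z(2)] inner_simps)
        qed
        moreover have "\<zeta> \<bullet> (z + s) = \<zeta> \<bullet> z + \<zeta> \<bullet> s"
          by (rule inner_add_right)
        ultimately have "((t *\<^sub>R h) \<bullet> X (t *\<^sub>R h)) / 2 + ((t *\<^sub>R k) \<bullet> Y (t *\<^sub>R k)) / 2 \<le> (s \<bullet> T' s) / 2 + e' * (norm (t *\<^sub>R h))\<^sup>2 + e' * (norm (t *\<^sub>R k))\<^sup>2"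
          using elim(1,2) by linarith
        moreover have "(t *\<^sub>R h) \<bullet> X (t *\<^sub>R h) = t\<^sup>2 * (h \<bullet> X h)" "(t *\<^sub>R k) \<bullet> Y (t *\<^sub>R k) = t\<^sup>2 * (k \<bullet> Y k)"
          "s \<bullet> T' s = t\<^sup>2 * ((h, k) \<bullet> T' (h, k))"
          unfolding s_def by (simp_all only: linear_scale[OF linX] linear_scale[OF linY] linear_scale[OF T'] inner_scaleR_left inner_scaleR_right power2_eq_square mult.assoc)
        moreover have "(norm (t *\<^sub>R h))\<^sup>2 = t\<^sup>2 * (norm h)\<^sup>2" "(norm (t *\<^sub>R k))\<^sup>2 = t\<^sup>2 * (norm k)\<^sup>2"
          by (simp_all add: power_mult_distrib)
        ultimately have "t\<^sup>2 * (h \<bullet> X h + k \<bullet> Y k) \<le> t\<^sup>2 * ((h, k) \<bullet> T' (h, k) + 2 * (e' * ((norm h)\<^sup>2 + (norm k)\<^sup>2)))"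
          by (simp add: algebra_simps)
        then have "h \<bullet> X h + k \<bullet> Y k \<le> (h, k) \<bullet> T' (h, k) + 2 * (e' * ((norm h)\<^sup>2 + (norm k)\<^sup>2))"
          using elim(3) by simp
        then show ?case
          using e'(2) by linarith
      qed
      then have "h \<bullet> X h + k \<bullet> Y k \<le> (h, k) \<bullet> T' (h, k) + c"
        by (simp add: eventually_const_iff trivial_limit_at_right_real)
      then show "h \<bullet> X h + k \<bullet> Y k \<le> (h, k) \<bullet> T (h, k) + \<eta> * ((norm h)\<^sup>2 + (norm k)\<^sup>2) + c"
        by (simp add: T'_def inner_add_right power2_norm_eq_inner distrib_left)
    qed
  qed
qed

lemma upper_jetI:
  assumes "linear X" "\<forall>\<^sub>F h in nhds 0. u (x + h) \<le> u x + P \<bullet> h + (h \<bullet> X h) / 2"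
  shows "upper_jet u x P X"
  unfolding upper_jet_def
proof (intro conjI allI impI)
  fix e :: real assume "e > 0"
  then have "0 \<le> e * (norm h)\<^sup>2" for h :: 'a
    by simp
  then have le: "a + e * (norm h)\<^sup>2 \<ge> a" for a and h :: 'a
    by simp
  show "\<forall>\<^sub>F h in nhds 0. u (x + h) \<le> u x + P \<bullet> h + (h \<bullet> X h) / 2 + e * (norm h)\<^sup>2"
    using assms(2) by (rule eventually_mono) (rule order_trans[OF _ le])
qed (rule assms)

text \<open>A weak form of the Crandall-Ishii lemma: jets at nearby points and with nearby slopes
  instead of limits of jets, and only the upper bound for the pair of forms. Translation and removal
  of the linear parts reduce it to the centered case.\<close>

theorem theorem_on_sums:
  fixes u :: "'a::euclidean_space \<Rightarrow> real" and w :: "'b::euclidean_space \<Rightarrow> real"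
    and T :: "'a \<times> 'b \<Rightarrow> 'a \<times> 'b"
  assumes r: "r > 0" and contu: "continuous_on (cball x0 r) u" and contw: "continuous_on (cball y0 r) w"
    and T: "linear T" "\<And>z z'. T z \<bullet> z' = z \<bullet> T z'"
    and le: "\<And>h k. norm h \<le> r \<Longrightarrow> norm k \<le> r \<Longrightarrow>
      u (x0 + h) + w (y0 + k) \<le> u x0 + w y0 + p \<bullet> h + q \<bullet> k + ((h, k) \<bullet> T (h, k)) / 2"
    and eta: "\<eta> > 0"
  obtains x y P X Q Y where "dist x x0 < \<eta>" "dist y y0 < \<eta>" "dist P p < \<eta>" "dist Q q < \<eta>"
    "upper_jet u x P X" "upper_jet w y Q Y"
    "\<And>h k. h \<bullet> X h + k \<bullet> Y k \<le> (h, k) \<bullet> T (h, k) + \<eta> * ((norm h)\<^sup>2 + (norm k)\<^sup>2)"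
proof -
  define \<eta>' where "\<eta>' = min \<eta> 1"
  have eta': "\<eta>' > 0" "\<eta>' \<le> 1" "\<eta>' \<le> \<eta>"
    using eta by (auto simp: \<eta>'_def)
  define u' where "u' h = u (x0 + h) - p \<bullet> h" for h
  define w' where "w' k = w (y0 + k) - q \<bullet> k" for k
  have cu: "continuous_on (cball 0 r) u'"
    unfolding u'_def by (intro continuous_intros continuous_on_compose2[OF contu]) (auto simp: dist_norm)
  have cw: "continuous_on (cball 0 r) w'"
    unfolding w'_def by (intro continuous_intros continuous_on_compose2[OF contw]) (auto simp: dist_norm)
  have le': "u' h + w' k \<le> u' 0 + w' 0 + ((h, k) \<bullet> T (h, k)) / 2" if "norm h \<le> r" "norm k \<le> r"
    for h :: 'a and k :: 'b
    using le[OF that] by (simp add: u'_def w'_def)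
  obtain x y P X Q Y where *: "norm x < \<eta>'" "norm y < \<eta>'" "norm P < \<eta>'" "norm Q < \<eta>'"
    "upper_jet u' x P X" "upper_jet w' y Q Y"
    "\<And>h k. h \<bullet> X h + k \<bullet> Y k \<le> (h, k) \<bullet> T (h, k) + \<eta>' * ((norm h)\<^sup>2 + (norm k)\<^sup>2)"
    by (rule theorem_on_sums_centered[OF r cu cw T le' eta'(1,2)]) blast+
  have shift: "upper_jet f (z + x) (P + p) X" if "upper_jet (\<lambda>h. f (z + h) - p \<bullet> h) x P X"
    for f :: "'c::euclidean_space \<Rightarrow> real" and z x p P :: 'c and X :: "'c \<Rightarrow> 'c"
    using that unfolding upper_jet_def by (simp add: inner_simps algebra_simps)
  show ?thesis
  proof (rule that)
    show "dist (x0 + x) x0 < \<eta>" "dist (y0 + y) y0 < \<eta>" "dist (P + p) p < \<eta>" "dist (Q + q) q < \<eta>"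
      using * eta' by (auto simp: dist_norm)
    show "upper_jet u (x0 + x) (P + p) X" "upper_jet w (y0 + y) (Q + q) Y"
      using *(5,6) unfolding u'_def w'_def by (auto intro: shift)
    fix h :: 'a and k :: 'b
    have "\<eta>' * ((norm h)\<^sup>2 + (norm k)\<^sup>2) \<le> \<eta> * ((norm h)\<^sup>2 + (norm k)\<^sup>2)"
      using eta' by (intro mult_right_mono) auto
    then show "h \<bullet> X h + k \<bullet> Y k \<le> (h, k) \<bullet> T (h, k) + \<eta> * ((norm h)\<^sup>2 + (norm k)\<^sup>2)"
      using *(7)[of h k] by linarith
  qed
qed

section \<open>Subsolutions in terms of jets\<close>

text \<open>
  The second-order part is \<open>- tr (\<Sigma> \<Sigma>\<^sup>t D\<^sup>2u)\<close>, where \<open>s j x\<close>, \<open>j < d\<close>, are the columns of \<open>\<Sigma>(x)\<close>.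
\<close>

definition jet_subsolution ::
    "'a::euclidean_space set \<Rightarrow> ('a \<Rightarrow> real) \<Rightarrow> ('a \<Rightarrow> 'a \<Rightarrow> real) \<Rightarrow> (nat \<Rightarrow> 'a \<Rightarrow> 'a) \<Rightarrow> nat \<Rightarrow> bool" where
  "jet_subsolution A u F s d \<longleftrightarrow>
    (\<forall>x\<in>A. \<forall>P X. upper_jet u x P X \<longrightarrow> F x P \<le> (\<Sum>j<d. s j x \<bullet> X (s j x)))"

text \<open>As \<eta> tends to 0 the matrices from \<open>theorem_on_sums\<close> need not converge.
  Testing the form inequality with the pairs of columns eliminates them first; what remains is
  continuous and passes to the limit.\<close>

lemma jet_subsolution_sum:
  fixes u :: "'a::euclidean_space \<Rightarrow> real" and w :: "'b::euclidean_space \<Rightarrow> real"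
    and T :: "'a \<times> 'b \<Rightarrow> 'a \<times> 'b"
  assumes u: "jet_subsolution A u F s d" "open A" "x0 \<in> A" "continuous_on A u"
    and w: "jet_subsolution B w G t d" "open B" "y0 \<in> B" "continuous_on B w"
    and T: "linear T" "\<And>z z'. T z \<bullet> z' = z \<bullet> T z'"
    and r: "r > 0"
    and le: "\<And>h k. norm h \<le> r \<Longrightarrow> norm k \<le> r \<Longrightarrow>
      u (x0 + h) + w (y0 + k) \<le> u x0 + w y0 + p \<bullet> h + q \<bullet> k + ((h, k) \<bullet> T (h, k)) / 2"
    and F: "isCont (\<lambda>(x, P). F x P) (x0, p)" and G: "isCont (\<lambda>(y, Q). G y Q) (y0, q)"
    and s: "\<And>j. j < d \<Longrightarrow> isCont (s j) x0" and t: "\<And>j. j < d \<Longrightarrow> isCont (t j) y0"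
  shows "F x0 p + G y0 q \<le> (\<Sum>j<d. (s j x0, t j y0) \<bullet> T (s j x0, t j y0))"
proof -
  obtain r1 where r1: "r1 > 0" "cball x0 r1 \<subseteq> A"
    using u(2,3) open_contains_cball by blast
  obtain r2 where r2: "r2 > 0" "cball y0 r2 \<subseteq> B"
    using w(2,3) open_contains_cball by blast
  define r' where "r' = min r (min r1 r2)"
  have r': "r' > 0" "r' \<le> r" "cball x0 r' \<subseteq> A" "cball y0 r' \<subseteq> B"
    using r r1 r2 by (auto simp: r'_def)
  define \<eta> where "\<eta> n = min r' (1 / real (Suc n))" for n
  have eta: "\<eta> n > 0" "\<eta> n \<le> r'" "\<eta> n \<le> 1 / real (Suc n)" for n
    using r' by (auto simp: \<eta>_def)
  define R where "R n z \<longleftrightarrow> dist (fst (fst z)) x0 < \<eta> n \<and> dist (snd (fst z)) y0 < \<eta> n \<and>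
      dist (fst (snd z)) p < \<eta> n \<and> dist (snd (snd z)) q < \<eta> n \<and>
      F (fst (fst z)) (fst (snd z)) + G (snd (fst z)) (snd (snd z)) \<le>
        (\<Sum>j<d. (s j (fst (fst z)), t j (snd (fst z))) \<bullet> T (s j (fst (fst z)), t j (snd (fst z)))
          + \<eta> n * ((norm (s j (fst (fst z))))\<^sup>2 + (norm (t j (snd (fst z))))\<^sup>2))" for n z
  have "\<exists>z. R n z" for n
  proof -
    obtain x y P X Q Y where *: "dist x x0 < \<eta> n" "dist y y0 < \<eta> n" "dist P p < \<eta> n" "dist Q q < \<eta> n"
      "upper_jet u x P X" "upper_jet w y Q Y"
      "\<And>h k. h \<bullet> X h + k \<bullet> Y k \<le> (h, k) \<bullet> T (h, k) + \<eta> n * ((norm h)\<^sup>2 + (norm k)\<^sup>2)"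
      by (rule theorem_on_sums[OF r'(1) continuous_on_subset[OF u(4) r'(3)] continuous_on_subset[OF w(4) r'(4)] T, of p q "\<eta> n"])
        (use le eta r' in auto)
    have "x \<in> A" "y \<in> B"
      using r'(3,4) eta(2)[of n] *(1,2) by (auto simp: subset_iff dist_commute)
    then have "F x P + G y Q \<le> (\<Sum>j<d. s j x \<bullet> X (s j x)) + (\<Sum>j<d. t j y \<bullet> Y (t j y))"
      using u(1) w(1) *(5,6) unfolding jet_subsolution_def by (intro add_mono) auto
    also have "\<dots> = (\<Sum>j<d. s j x \<bullet> X (s j x) + t j y \<bullet> Y (t j y))"
      by (simp add: sum.distrib)
    also have "\<dots> \<le> (\<Sum>j<d. (s j x, t j y) \<bullet> T (s j x, t j y) + \<eta> n * ((norm (s j x))\<^sup>2 + (norm (t j y))\<^sup>2))"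
      by (intro sum_mono *(7))
    finally have "R n ((x, y), (P, Q))"
      using *(1-4) by (simp add: R_def)
    then show ?thesis
      by blast
  qed
  then obtain z where z: "\<And>n. R n (z n)"
    by metis
  define x y P Q where "x n = fst (fst (z n))" and "y n = snd (fst (z n))"
    and "P n = fst (snd (z n))" and "Q n = snd (snd (z n))" for n
  have xy: "dist (x n) x0 < \<eta> n" "dist (y n) y0 < \<eta> n" "dist (P n) p < \<eta> n" "dist (Q n) q < \<eta> n"
      "F (x n) (P n) + G (y n) (Q n) \<le> (\<Sum>j<d. (s j (x n), t j (y n)) \<bullet> T (s j (x n), t j (y n))
        + \<eta> n * ((norm (s j (x n)))\<^sup>2 + (norm (t j (y n)))\<^sup>2))" for n
    using z[of n] by (simp_all add: R_def x_def y_def P_def Q_def)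
  have inv: "(\<lambda>n. 1 / real (Suc n)) \<longlonglongrightarrow> 0"
    using LIMSEQ_inverse_real_of_nat by (simp add: inverse_eq_divide)
  have eta0: "\<eta> \<longlonglongrightarrow> 0"
    by (rule tendsto_sandwich[OF always_eventually always_eventually tendsto_const inv]) (intro allI less_imp_le eta, intro allI eta)
  have lim: "z \<longlonglongrightarrow> c" if "\<And>n. dist (z n) c < \<eta> n" for z :: "nat \<Rightarrow> 'c::metric_space" and c
  proof (rule metric_tendsto_imp_tendsto[OF eta0], intro always_eventually allI)
    show "dist (z n) c \<le> dist (\<eta> n) 0" for n
      using that[of n] eta(1)[of n] by simp
  qed
  have lims: "x \<longlonglongrightarrow> x0" "y \<longlonglongrightarrow> y0" "P \<longlonglongrightarrow> p" "Q \<longlonglongrightarrow> q"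
    using xy by (auto intro: lim)
  have FL: "(\<lambda>n. F (x n) (P n)) \<longlonglongrightarrow> F x0 p"
    using isCont_tendsto_compose[OF F tendsto_Pair[OF lims(1,3)]] by simp
  have GL: "(\<lambda>n. G (y n) (Q n)) \<longlonglongrightarrow> G y0 q"
    using isCont_tendsto_compose[OF G tendsto_Pair[OF lims(2,4)]] by simp
  have sL: "(\<lambda>n. s j (x n)) \<longlonglongrightarrow> s j x0" and tL: "(\<lambda>n. t j (y n)) \<longlonglongrightarrow> t j y0" if "j < d" for j
    using isCont_tendsto_compose[OF s lims(1)] isCont_tendsto_compose[OF t lims(2)] that by auto
  have TL: "(\<lambda>n. T (s j (x n), t j (y n))) \<longlonglongrightarrow> T (s j x0, t j y0)" if "j < d" for j
    using that by (intro bounded_linear.tendsto[OF T(1)[unfolded linear_conv_bounded_linear]] tendsto_Pair sL tL)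
  have "(\<lambda>n. \<Sum>j<d. (s j (x n), t j (y n)) \<bullet> T (s j (x n), t j (y n)) + \<eta> n * ((norm (s j (x n)))\<^sup>2 + (norm (t j (y n)))\<^sup>2))
      \<longlonglongrightarrow> (\<Sum>j<d. (s j x0, t j y0) \<bullet> T (s j x0, t j y0) + 0 * ((norm (s j x0))\<^sup>2 + (norm (t j y0))\<^sup>2))"
    by (intro tendsto_intros sL tL TL eta0) auto
  from LIMSEQ_le[OF tendsto_add[OF FL GL] this] xy(5) show ?thesis
    by simp
qed

text \<open>Second derivative of the test function used for the jet \<open>(P, X)\<close>, strict by \<open>\<eta>\<close>.\<close>

definition jet_form :: "('a::euclidean_space \<Rightarrow> 'a) \<Rightarrow> real \<Rightarrow> 'a \<Rightarrow>\<^sub>L 'a \<Rightarrow>\<^sub>L real" where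
  "jet_form X \<eta> = Blinfun (\<lambda>h. blinfun_inner_right ((X h + adjoint X h) /\<^sub>R 2 + (2 * \<eta>) *\<^sub>R h))"

lemma jet_form_apply:
  assumes "linear X"
  shows "jet_form X \<eta> h k = ((X h + adjoint X h) /\<^sub>R 2 + (2 * \<eta>) *\<^sub>R h) \<bullet> k"
proof -
  have "linear (\<lambda>h. (X h + adjoint X h) /\<^sub>R 2 + (2 * \<eta>) *\<^sub>R h)"
    using assms adjoint_linear[OF assms]
    by (intro linear_compose_add linear_compose_scale_right linear_id[unfolded id_def])
  then have "bounded_linear (\<lambda>h. blinfun_inner_right ((X h + adjoint X h) /\<^sub>R 2 + (2 * \<eta>) *\<^sub>R h) :: 'a \<Rightarrow>\<^sub>L real)"
    by (intro bounded_linear_compose[OF bounded_linear_blinfun_inner_right]) (simp add: linear_conv_bounded_linear)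
  then show ?thesis
    unfolding jet_form_def by (simp add: bounded_linear_Blinfun_apply)
qed

lemma jet_form_diag:
  assumes "linear X"
  shows "jet_form X \<eta> h h = h \<bullet> X h + 2 * \<eta> * (norm h)\<^sup>2"
  unfolding jet_form_apply[OF assms]
  by (simp add: inner_add_left power2_norm_eq_inner adjoint_clauses(2)[OF assms] inner_commute[of "X h" h])

lemma jet_test_function:
  assumes X: "linear X" and "\<eta> > 0" and jet: "upper_jet w z P X"
  defines "\<phi> \<equiv> \<lambda>z'. w z + P \<bullet> (z' - z) + jet_form X \<eta> (z' - z) (z' - z) / 2"
  shows "C2_on S \<phi> (\<lambda>z'. blinfun_inner_right P + jet_form X \<eta> (z' - z)) (\<lambda>z'. jet_form X \<eta>)"
    and "\<phi> z = w z" and "\<forall>\<^sub>F z' in nhds z. w z' \<le> \<phi> z'"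
proof -
  have symm: "jet_form X \<eta> h k = jet_form X \<eta> k h" for h k
    by (simp add: jet_form_apply[OF X] inner_simps inner_commute adjoint_clauses[OF X])
  show "C2_on S \<phi> (\<lambda>z'. blinfun_inner_right P + jet_form X \<eta> (z' - z)) (\<lambda>z'. jet_form X \<eta>)"
    unfolding C2_on_def
  proof (intro conjI ballI)
    fix z'
    show "(\<phi> has_derivative blinfun_apply (blinfun_inner_right P + jet_form X \<eta> (z' - z))) (at z')"
      unfolding \<phi>_def
      by (auto intro!: derivative_eq_intros simp: fun_eq_iff blinfun.bilinear_simps symm)
    show "((\<lambda>z'. blinfun_inner_right P + jet_form X \<eta> (z' - z)) has_derivative blinfun_apply (jet_form X \<eta>)) (at z')"
      by (auto intro!: derivative_eq_intros simp: fun_eq_iff blinfun.bilinear_simps)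
  qed (intro continuous_intros)
  show "\<phi> z = w z"
    by (simp add: \<phi>_def)
  have "\<forall>\<^sub>F h in nhds 0. w (z + h) \<le> w z + P \<bullet> h + (h \<bullet> X h) / 2 + \<eta> * (norm h)\<^sup>2"
    using jet \<open>\<eta> > 0\<close> by (simp add: upper_jet_def)
  then have "\<forall>\<^sub>F h in nhds 0. w (z + h) \<le> \<phi> (z + h)"
    by eventually_elim (simp add: \<phi>_def jet_form_diag[OF X] add_divide_distrib)
  moreover have "filterlim (\<lambda>z'. z' - z) (nhds (z - z)) (nhds z)"
    by (intro tendsto_diff tendsto_const filterlim_ident)
  ultimately have "\<forall>\<^sub>F z' in nhds z. w (z + (z' - z)) \<le> \<phi> (z + (z' - z))"
    using eventually_compose_filterlim[of "\<lambda>h. w (z + h) \<le> \<phi> (z + h)" "nhds 0" "\<lambda>z'. z' - z" "nhds z"] by simp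
  then show "\<forall>\<^sub>F z' in nhds z. w z' \<le> \<phi> z'"
    by simp
qed

section \<open>From viscosity inequalities to jets\<close>

lemma visc_le_zero_jet:
  assumes "visc_le_zero S G w" "z \<in> S" "upper_jet w z P X" "\<eta> > 0"
  shows "G z (blinfun_inner_right P) (jet_form X \<eta>) \<le> 0"
proof -
  have X: "linear X"
    using assms(3) by (simp add: upper_jet_def)
  note \<phi> = jet_test_function[OF X assms(4,3)]
  show ?thesis
    using assms(1)[unfolded visc_le_zero_def touches_from_above_def, rule_format, OF assms(2) \<phi>(1) conjI[OF \<phi>(2,3)]]
    by (simp add: blinfun.bilinear_simps)
qed

lemma visc_ge_zero_jet:
  assumes "visc_ge_zero S G w" "z \<in> S" "upper_jet (\<lambda>z. - w z) z P X" "\<eta> > 0"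
  shows "G z (blinfun_inner_right (- P)) (- jet_form X \<eta>) \<ge> 0"
proof -
  have X: "linear X"
    using assms(3) by (simp add: upper_jet_def)
  note \<phi> = jet_test_function[OF X assms(4,3)]
  let ?\<phi> = "\<lambda>z'. - (- w z + P \<bullet> (z' - z) + jet_form X \<eta> (z' - z) (z' - z) / 2)"
  let ?\<phi>' = "\<lambda>z'. - (blinfun_inner_right P + jet_form X \<eta> (z' - z))"
  have "C2_on S ?\<phi> ?\<phi>' (\<lambda>z'. - jet_form X \<eta>)"
    unfolding C2_on_def
  proof (intro conjI ballI)
    fix z' assume "z' \<in> S"
    with \<phi>(1)[of S] show "(?\<phi> has_derivative blinfun_apply (?\<phi>' z')) (at z')"
      and "(?\<phi>' has_derivative blinfun_apply (- jet_form X \<eta>)) (at z')"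
      unfolding uminus_blinfun.rep_eq C2_on_def by (intro has_derivative_minus; blast)+
  qed (intro continuous_intros)
  moreover have "touches_from_below ?\<phi> w z"
    unfolding touches_from_below_def
  proof
    show "?\<phi> z = w z"
      using \<phi>(2) by simp
    show "\<forall>\<^sub>F z' in nhds z. ?\<phi> z' \<le> w z'"
      using \<phi>(3) by (rule eventually_mono) simp
  qed
  ultimately have "G z (?\<phi>' z) (- jet_form X \<eta>) \<ge> 0"
    using assms(1)[unfolded visc_ge_zero_def, rule_format, OF assms(2)] by blast
  moreover have "?\<phi>' z = blinfun_inner_right (- P)"
    by (rule blinfun_eqI) (simp add: blinfun.bilinear_simps)
  ultimately show ?thesis
    by simp
qed

lemma trace_outer_products:
  fixes \<sigma> :: "nat \<Rightarrow> real ^ 'n::finite" and b :: "real ^ 'n \<Rightarrow> real ^ 'n \<Rightarrow> real"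
  assumes b: "bilinear b"
  shows "trace ((\<chi> i j. \<Sum>l<d. \<sigma> l $ i * \<sigma> l $ j) ** (\<chi> i j. b (axis i 1) (axis j 1))) = (\<Sum>l<d. b (\<sigma> l) (\<sigma> l))"
proof -
  have "b v v = (\<Sum>i\<in>UNIV. \<Sum>j\<in>UNIV. v $ i * v $ j * b (axis j 1) (axis i 1))" for v
  proof -
    have v: "v = (\<Sum>i\<in>UNIV. v $ i *\<^sub>R axis i 1)"
      using basis_expansion[of v] by (simp add: scalar_mult_eq_scaleR)
    have "b v v = b (\<Sum>j\<in>UNIV. v $ j *\<^sub>R axis j 1) (\<Sum>i\<in>UNIV. v $ i *\<^sub>R axis i 1)"
      using v by simp
    also have "\<dots> = (\<Sum>j\<in>UNIV. \<Sum>i\<in>UNIV. v $ j * (v $ i * b (axis j 1) (axis i 1)))"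
      by (simp only: bilinear_sum[OF b] sum.cartesian_product[symmetric] bilinear_lmul[OF b] bilinear_rmul[OF b] real_scaleR_def mult_ac)
    finally show ?thesis
      by (subst sum.swap) (simp add: mult_ac)
  qed
  note expand = this
  let ?f = "\<lambda>i j l. \<sigma> l $ i * \<sigma> l $ j * b (axis j 1) (axis i 1)"
  have "trace ((\<chi> i j. \<Sum>l<d. \<sigma> l $ i * \<sigma> l $ j) ** (\<chi> i j. b (axis i 1) (axis j 1))) =
      (\<Sum>i\<in>UNIV. \<Sum>j\<in>UNIV. \<Sum>l<d. ?f i j l)"
    by (simp add: trace_def matrix_matrix_mult_def sum_distrib_right)
  also have "\<dots> = (\<Sum>i\<in>UNIV. \<Sum>l<d. \<Sum>j\<in>UNIV. ?f i j l)"
    by (intro sum.cong refl sum.swap)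
  also have "\<dots> = (\<Sum>l<d. \<Sum>i\<in>UNIV. \<Sum>j\<in>UNIV. ?f i j l)"
    by (rule sum.swap)
  finally show ?thesis
    by (simp only: expand)
qed

text \<open>For \<open>sg = - 1\<close> this is the supersolution half, read as a subsolution
  inequality for \<open>- w\<close>, so that both halves share all later arguments. The columns have
  time component 0, as there is no diffusion in time; the excess \<eta> of the test function
  disappears in the limit.\<close>

lemma visc_parabolic_jet_subsolution:
  fixes w :: "(real ^ 'n::finite) \<times> real \<Rightarrow> real" and \<sigma> :: "(real ^ 'n) \<times> real \<Rightarrow> nat \<Rightarrow> real ^ 'n"
  assumes visc: "visc_eq_zero S (\<lambda>z L B. time_deriv L - \<epsilon> * trace (Am z ** space_hessian B) + h z (space_grad L)) w"
    and Am: "\<And>z. Am z = (\<chi> a b. \<Sum>j<d. \<sigma> z j $ a * \<sigma> z j $ b)"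
    and \<epsilon>: "\<epsilon> \<ge> 0" and sg: "sg \<in> {1, - 1}"
  shows "jet_subsolution S (\<lambda>z. sg * w z) (\<lambda>z P. snd P + sg * h z (sg *\<^sub>R fst P))
    (\<lambda>j z. (sqrt \<epsilon> *\<^sub>R \<sigma> z j, 0)) d"
  unfolding jet_subsolution_def
proof (intro ballI allI impI)
  fix z P X assume z: "z \<in> S" and jet: "upper_jet (\<lambda>z. sg * w z) z P X"
  have X: "linear X"
    using jet by (simp add: upper_jet_def)
  define N where "N = (\<Sum>j<d. (norm (\<sigma> z j))\<^sup>2)"
  have tr: "\<epsilon> * trace (Am z ** space_hessian (jet_form X \<eta>)) =
      (\<Sum>j<d. (sqrt \<epsilon> *\<^sub>R \<sigma> z j, 0) \<bullet> X (sqrt \<epsilon> *\<^sub>R \<sigma> z j, 0)) + 2 * \<eta> * \<epsilon> * N" for \<eta>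
  proof -
    have "bilinear (\<lambda>v w. jet_form X \<eta> (v, 0) (w, 0))"
      unfolding bilinear_def
    proof (intro conjI allI linearI)
      fix v v' w :: "real ^ 'n" and c :: real
      have "(v + v', 0) = (v, 0) + (v', 0 :: real)" "(c *\<^sub>R v, 0) = c *\<^sub>R (v, 0 :: real)"
        by simp_all
      then show "jet_form X \<eta> (v + v', 0) (w, 0) = jet_form X \<eta> (v, 0) (w, 0) + jet_form X \<eta> (v', 0) (w, 0)"
        "jet_form X \<eta> (w, 0) (v + v', 0) = jet_form X \<eta> (w, 0) (v, 0) + jet_form X \<eta> (w, 0) (v', 0)"
        "jet_form X \<eta> (c *\<^sub>R v, 0) (w, 0) = c *\<^sub>R jet_form X \<eta> (v, 0) (w, 0)"
        "jet_form X \<eta> (w, 0) (c *\<^sub>R v, 0) = c *\<^sub>R jet_form X \<eta> (w, 0) (v, 0)"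
        by (simp_all only: blinfun.bilinear_simps)
    qed
    from trace_outer_products[OF this, where d = d and \<sigma> = "\<sigma> z"]
    have "trace (Am z ** space_hessian (jet_form X \<eta>)) = (\<Sum>j<d. jet_form X \<eta> (\<sigma> z j, 0) (\<sigma> z j, 0))"
      by (simp add: Am space_hessian_def)
    also have "\<dots> = (\<Sum>j<d. (\<sigma> z j, 0) \<bullet> X (\<sigma> z j, 0)) + 2 * \<eta> * N"
      by (simp add: jet_form_diag[OF X] sum.distrib sum_distrib_left N_def norm_Pair)
    finally have 1: "trace (Am z ** space_hessian (jet_form X \<eta>)) = (\<Sum>j<d. (\<sigma> z j, 0) \<bullet> X (\<sigma> z j, 0)) + 2 * \<eta> * N" .
    have "(sqrt \<epsilon> *\<^sub>R v, 0) \<bullet> X (sqrt \<epsilon> *\<^sub>R v, 0) = \<epsilon> * ((v, 0) \<bullet> X (v, 0))" for v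
    proof -
      have "(sqrt \<epsilon> *\<^sub>R v, 0 :: real) = sqrt \<epsilon> *\<^sub>R (v, 0)"
        by simp
      then show ?thesis
        using \<epsilon> by (simp only: linear_scale[OF X] inner_scaleR_left inner_scaleR_right) (simp flip: mult.assoc)
    qed
    then show ?thesis
      unfolding 1 by (simp add: sum_distrib_left distrib_left)
  qed
  have N: "N \<ge> 0"
    unfolding N_def by (intro sum_nonneg) auto
  have le: "snd P + sg * h z (sg *\<^sub>R fst P) \<le> (\<Sum>j<d. (sqrt \<epsilon> *\<^sub>R \<sigma> z j, 0) \<bullet> X (sqrt \<epsilon> *\<^sub>R \<sigma> z j, 0)) + 2 * \<eta> * \<epsilon> * N"
    if "\<eta> > 0" for \<eta>
  proof -
    have td: "time_deriv (blinfun_inner_right P) = snd P" "space_grad (blinfun_inner_right P) = fst P"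
      for P :: "(real ^ 'n) \<times> real"
      by (simp_all add: time_deriv_def space_grad_def inner_prod_def vec_eq_iff inner_axis)
    have neg: "trace (Am z ** space_hessian (- B)) = - trace (Am z ** space_hessian B)" for B
      by (simp add: space_hessian_def trace_def matrix_matrix_mult_def blinfun.bilinear_simps sum_negf)
    show ?thesis
      using sg
    proof (elim insertE)
      assume sg: "sg = 1"
      then have "upper_jet w z P X"
        using jet by simp
      with visc z that have "snd P - \<epsilon> * trace (Am z ** space_hessian (jet_form X \<eta>)) + h z (fst P) \<le> 0"
        unfolding visc_eq_zero_def by (auto dest!: visc_le_zero_jet simp: td)
      then show ?thesis
        using sg unfolding tr by simp
    next
      assume sg: "sg = - 1"
      then have "upper_jet (\<lambda>z. - w z) z P X"
        using jet by simp
      with visc z that have "- snd P + \<epsilon> * trace (Am z ** space_hessian (jet_form X \<eta>)) + h z (- fst P) \<ge> 0"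
        unfolding visc_eq_zero_def by (auto dest!: visc_ge_zero_jet simp: td neg)
      then show ?thesis
        using sg unfolding tr by simp
    qed simp
  qed
  show "snd P + sg * h z (sg *\<^sub>R fst P) \<le> (\<Sum>j<d. (sqrt \<epsilon> *\<^sub>R \<sigma> z j, 0) \<bullet> X (sqrt \<epsilon> *\<^sub>R \<sigma> z j, 0))"
  proof (rule field_le_epsilon)
    fix e :: real assume "e > 0"
    define \<eta> where "\<eta> = e / (2 * \<epsilon> * N + 1)"
    have pos: "2 * \<epsilon> * N + 1 > 0"
      using \<epsilon> N by (intro add_nonneg_pos) auto
    then have "\<eta> > 0" "2 * \<eta> * \<epsilon> * N \<le> e"
      using \<open>e > 0\<close> by (auto simp: \<eta>_def field_simps)
    then show "snd P + sg * h z (sg *\<^sub>R fst P) \<le> (\<Sum>j<d. (sqrt \<epsilon> *\<^sub>R \<sigma> z j, 0) \<bullet> X (sqrt \<epsilon> *\<^sub>R \<sigma> z j, 0)) + e"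
      using le[of \<eta>] by linarith
  qed
qed

lemma visc_first_order_jet:
  fixes w :: "(real ^ 'n::finite) \<times> real \<Rightarrow> real"
  assumes visc: "visc_eq_zero S (\<lambda>z L B. time_deriv L + h z (space_grad L)) w"
    and sg: "sg \<in> {1, - 1}" and z: "z \<in> S" and jet: "upper_jet (\<lambda>z. sg * w z) z P X"
  shows "snd P + sg * h z (sg *\<^sub>R fst P) \<le> 0"
proof -
  have "visc_eq_zero S (\<lambda>z L B. time_deriv L - 0 * trace ((\<chi> a b. \<Sum>j<0::nat. (0 :: real ^ 'n) $ a * (0 :: real ^ 'n) $ b) ** space_hessian B)
      + h z (space_grad L)) w"
    using visc by simp
  then have "jet_subsolution S (\<lambda>z. sg * w z) (\<lambda>z P. snd P + sg * h z (sg *\<^sub>R fst P))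
      (\<lambda>j z. (sqrt 0 *\<^sub>R 0, 0)) 0"
    by (rule visc_parabolic_jet_subsolution) (use sg in auto)
  then show ?thesis
    using z jet unfolding jet_subsolution_def by fastforce
qed

lemma visc_elliptic_jet_subsolution:
  fixes w :: "real ^ 'n::finite \<Rightarrow> real" and \<sigma> :: "real ^ 'n \<Rightarrow> nat \<Rightarrow> real ^ 'n"
  assumes visc: "visc_eq_zero S (\<lambda>y L B. c y - trace (Am y ** hessian B) + h y (grad L)) w"
    and Am: "\<And>y. Am y = (\<chi> a b. \<Sum>j<d. \<sigma> y j $ a * \<sigma> y j $ b)"
    and sg: "sg \<in> {1, - 1}"
  shows "jet_subsolution S (\<lambda>y. sg * w y) (\<lambda>y Q. sg * (c y + h y (sg *\<^sub>R Q))) (\<lambda>j y. \<sigma> y j) d"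
  unfolding jet_subsolution_def
proof (intro ballI allI impI)
  fix y Q X assume y: "y \<in> S" and jet: "upper_jet (\<lambda>y. sg * w y) y Q X"
  have X: "linear X"
    using jet by (simp add: upper_jet_def)
  define N where "N = (\<Sum>j<d. (norm (\<sigma> y j))\<^sup>2)"
  have tr: "trace (Am y ** hessian (jet_form X \<eta>)) = (\<Sum>j<d. \<sigma> y j \<bullet> X (\<sigma> y j)) + 2 * \<eta> * N" for \<eta>
  proof -
    have "bilinear (\<lambda>v w. jet_form X \<eta> v w)"
      unfolding bilinear_def by (intro conjI allI linearI) (simp_all add: blinfun.bilinear_simps)
    from trace_outer_products[OF this, where d = d and \<sigma> = "\<sigma> y"]
    have "trace (Am y ** hessian (jet_form X \<eta>)) = (\<Sum>j<d. jet_form X \<eta> (\<sigma> y j) (\<sigma> y j))"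
      by (simp add: Am hessian_def)
    then show ?thesis
      by (simp add: jet_form_diag[OF X] sum.distrib sum_distrib_left N_def)
  qed
  have N: "N \<ge> 0"
    unfolding N_def by (intro sum_nonneg) auto
  have le: "sg * (c y + h y (sg *\<^sub>R Q)) \<le> (\<Sum>j<d. \<sigma> y j \<bullet> X (\<sigma> y j)) + 2 * \<eta> * N" if "\<eta> > 0" for \<eta>
  proof -
    have gr: "grad (blinfun_inner_right P) = P" for P :: "real ^ 'n"
      by (simp add: grad_def vec_eq_iff inner_axis)
    have neg: "trace (Am y ** hessian (- B)) = - trace (Am y ** hessian B)" for B
      by (simp add: hessian_def trace_def matrix_matrix_mult_def blinfun.bilinear_simps sum_negf)
    show ?thesis
      using sg
    proof (elim insertE)
      assume sg: "sg = 1"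
      then have "upper_jet w y Q X"
        using jet by simp
      with visc y that have "c y - trace (Am y ** hessian (jet_form X \<eta>)) + h y Q \<le> 0"
        unfolding visc_eq_zero_def by (auto dest!: visc_le_zero_jet simp: gr)
      then show ?thesis
        using sg unfolding tr by simp
    next
      assume sg: "sg = - 1"
      then have "upper_jet (\<lambda>y. - w y) y Q X"
        using jet by simp
      with visc y that have "c y + trace (Am y ** hessian (jet_form X \<eta>)) + h y (- Q) \<ge> 0"
        unfolding visc_eq_zero_def by (auto dest!: visc_ge_zero_jet simp: gr neg)
      then show ?thesis
        using sg unfolding tr by simp
    qed simp
  qed
  show "sg * (c y + h y (sg *\<^sub>R Q)) \<le> (\<Sum>j<d. \<sigma> y j \<bullet> X (\<sigma> y j))"
  proof (rule field_le_epsilon)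
    fix e :: real assume "e > 0"
    define \<eta> where "\<eta> = e / (2 * N + 1)"
    have pos: "2 * N + 1 > 0"
      using N by (intro add_nonneg_pos) auto
    then have "\<eta> > 0" "2 * \<eta> * N \<le> e"
      using \<open>e > 0\<close> by (auto simp: \<eta>_def field_simps)
    then show "sg * (c y + h y (sg *\<^sub>R Q)) \<le> (\<Sum>j<d. \<sigma> y j \<bullet> X (\<sigma> y j)) + e"
      using le[of \<eta>] by linarith
  qed
qed

text \<open>A jet with second-order part \<open>X\<close> of the rescaled function belongs to
  (\<epsilon> / c) X for \<open>w\<close>; multiplying the inequality by \<open>c\<close> leaves the
  factor \<epsilon>, which the columns carry as sqrt \<epsilon>.\<close>

lemma jet_subsolution_rescale:
  fixes w :: "'a::euclidean_space \<Rightarrow> real"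
  assumes w: "jet_subsolution UNIV w F s d" and c: "c > 0" and \<epsilon>: "\<epsilon> > 0"
  shows "jet_subsolution UNIV (\<lambda>x. c * \<epsilon> * w (x /\<^sub>R \<epsilon>)) (\<lambda>x Q. c * F (x /\<^sub>R \<epsilon>) (Q /\<^sub>R c))
    (\<lambda>j x. sqrt \<epsilon> *\<^sub>R s j (x /\<^sub>R \<epsilon>)) d"
  unfolding jet_subsolution_def
proof (intro ballI allI impI)
  fix x P X assume jet: "upper_jet (\<lambda>x. c * \<epsilon> * w (x /\<^sub>R \<epsilon>)) x P X"
  have X: "linear X"
    using jet by (simp add: upper_jet_def)
  have "upper_jet w (x /\<^sub>R \<epsilon>) (P /\<^sub>R c) (\<lambda>h. (\<epsilon> / c) *\<^sub>R X h)"
    unfolding upper_jet_def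
  proof (intro conjI allI impI)
    show "linear (\<lambda>h. (\<epsilon> / c) *\<^sub>R X h)"
      using X by (rule linear_compose_scale_right)
    fix e :: real assume "e > 0"
    then have "e * c / \<epsilon> > 0"
      using c \<epsilon> by simp
    then have "\<forall>\<^sub>F h in nhds 0. c * \<epsilon> * w ((x + h) /\<^sub>R \<epsilon>) \<le> c * \<epsilon> * w (x /\<^sub>R \<epsilon>) + P \<bullet> h + (h \<bullet> X h) / 2 + (e * c / \<epsilon>) * (norm h)\<^sup>2"
      using jet unfolding upper_jet_def by blast
    moreover have "((\<lambda>h. \<epsilon> *\<^sub>R h) \<longlongrightarrow> 0) (nhds (0 :: 'a))"
      using tendsto_scaleR[OF tendsto_const[of \<epsilon>] filterlim_ident[of "nhds (0 :: 'a)"]] by simp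
    ultimately have "\<forall>\<^sub>F h in nhds 0. c * \<epsilon> * w ((x + \<epsilon> *\<^sub>R h) /\<^sub>R \<epsilon>) \<le> c * \<epsilon> * w (x /\<^sub>R \<epsilon>) + P \<bullet> (\<epsilon> *\<^sub>R h)
        + ((\<epsilon> *\<^sub>R h) \<bullet> X (\<epsilon> *\<^sub>R h)) / 2 + (e * c / \<epsilon>) * (norm (\<epsilon> *\<^sub>R h))\<^sup>2"
      by (rule eventually_compose_filterlim)
    then show "\<forall>\<^sub>F h in nhds 0. w (x /\<^sub>R \<epsilon> + h) \<le> w (x /\<^sub>R \<epsilon>) + (P /\<^sub>R c) \<bullet> h + (h \<bullet> (\<epsilon> / c) *\<^sub>R X h) / 2 + e * (norm h)\<^sup>2"
    proof eventually_elim
      case (elim h)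
      have eq: "(x + \<epsilon> *\<^sub>R h) /\<^sub>R \<epsilon> = x /\<^sub>R \<epsilon> + h"
        using \<epsilon> by (simp add: scaleR_add_right)
      have "c * \<epsilon> * w (x /\<^sub>R \<epsilon>) + P \<bullet> (\<epsilon> *\<^sub>R h) + ((\<epsilon> *\<^sub>R h) \<bullet> X (\<epsilon> *\<^sub>R h)) / 2 + (e * c / \<epsilon>) * (norm (\<epsilon> *\<^sub>R h))\<^sup>2
          = c * \<epsilon> * (w (x /\<^sub>R \<epsilon>) + (P /\<^sub>R c) \<bullet> h + (h \<bullet> (\<epsilon> / c) *\<^sub>R X h) / 2 + e * (norm h)\<^sup>2)"
        using c \<epsilon> by (simp add: linear_scale[OF X] power_mult_distrib power2_eq_square field_simps)
      then have "c * \<epsilon> * w (x /\<^sub>R \<epsilon> + h) \<le> c * \<epsilon> * (w (x /\<^sub>R \<epsilon>) + (P /\<^sub>R c) \<bullet> h + (h \<bullet> (\<epsilon> / c) *\<^sub>R X h) / 2 + e * (norm h)\<^sup>2)"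
        using elim unfolding eq by simp
      then show ?case
        using c \<epsilon> by (simp only: mult_le_cancel_left_pos mult_pos_pos)
    qed
  qed
  then have "F (x /\<^sub>R \<epsilon>) (P /\<^sub>R c) \<le> (\<Sum>j<d. s j (x /\<^sub>R \<epsilon>) \<bullet> (\<epsilon> / c) *\<^sub>R X (s j (x /\<^sub>R \<epsilon>)))"
    using w unfolding jet_subsolution_def by blast
  then have "c * F (x /\<^sub>R \<epsilon>) (P /\<^sub>R c) \<le> c * (\<Sum>j<d. s j (x /\<^sub>R \<epsilon>) \<bullet> (\<epsilon> / c) *\<^sub>R X (s j (x /\<^sub>R \<epsilon>)))"
    using c by (intro mult_left_mono) auto
  also have "\<dots> = (\<Sum>j<d. (sqrt \<epsilon> *\<^sub>R s j (x /\<^sub>R \<epsilon>)) \<bullet> X (sqrt \<epsilon> *\<^sub>R s j (x /\<^sub>R \<epsilon>)))"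
    using c \<epsilon> unfolding sum_distrib_left
    by (intro sum.cong refl) (simp add: linear_scale[OF X] flip: mult.assoc)
  finally show "c * F (x /\<^sub>R \<epsilon>) (P /\<^sub>R c) \<le> (\<Sum>j<d. (sqrt \<epsilon> *\<^sub>R s j (x /\<^sub>R \<epsilon>)) \<bullet> X (sqrt \<epsilon> *\<^sub>R s j (x /\<^sub>R \<epsilon>)))" .
qed

section \<open>The coefficients for one environment\<close>

text \<open>The standing assumptions for one environment, with constants common to all
  \<open>k\<close>. Power growth is kept as growth faster than any linear function, and the
  Lipschitz bound compares equal gradients, so its constant does not grow with \<open>p\<close>.
  \<open>mono_diag\<close> is the monotonicity of the system for two constant vectors.\<close>

locale hj_coefficients =
  fixes \<sigma> :: "'m::finite \<Rightarrow> real ^ 'n::finite \<Rightarrow> nat \<Rightarrow> real ^ 'n" and d :: "'m \<Rightarrow> nat"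
    and H :: "'m \<Rightarrow> real ^ 'n \<Rightarrow> real ^ 'm \<Rightarrow> real ^ 'm \<Rightarrow> real ^ 'n \<Rightarrow> real" and CA :: real
  assumes CA: "CA \<ge> 0"
    and sigma_bound: "\<And>k y. (\<Sum>j<d k. (norm (\<sigma> k y j))\<^sup>2) \<le> CA"
    and sigma_lipschitz: "\<And>k y z. (\<Sum>j<d k. (norm (\<sigma> k y j - \<sigma> k z j))\<^sup>2) \<le> CA * (norm (y - z))\<^sup>2"
    and convex_p: "\<And>k r s y. s \<in> others k \<Longrightarrow> convex_on UNIV (\<lambda>p. H k p r s y)"
    and superlinear: "\<And>R a. \<exists>C. \<forall>k p r s y. norm r \<le> R \<longrightarrow> s \<in> others k \<longrightarrow> a * norm p - C \<le> H k p r s y"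
    and coercive_s: "\<And>R. \<exists>c>0. \<exists>C. \<forall>k p r s y i. norm r \<le> R \<longrightarrow> s \<in> others k \<longrightarrow> c * s $ i - C \<le> H k p r s y"
    and H_bounded: "\<And>R. \<exists>C. \<forall>k p r s y. norm p \<le> R \<longrightarrow> norm r \<le> R \<longrightarrow> norm s \<le> R \<longrightarrow> s \<in> others k \<longrightarrow> \<bar>H k p r s y\<bar> \<le> C"
    and H_lipschitz: "\<And>R. \<exists>C\<ge>0. \<forall>k p r1 r2 s1 s2 y1 y2. norm r1 \<le> R \<longrightarrow> norm r2 \<le> R \<longrightarrow>
        norm s1 \<le> R \<longrightarrow> norm s2 \<le> R \<longrightarrow> s1 \<in> others k \<longrightarrow> s2 \<in> others k \<longrightarrow>
        \<bar>H k p r1 s1 y1 - H k p r2 s2 y2\<bar> \<le> C * (norm (r1 - r2) + norm (s1 - s2) + norm (y1 - y2))"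
    and mono_s: "\<And>k p r s s' y. s \<in> others k \<Longrightarrow> s' \<in> others k \<Longrightarrow> (\<And>i. s $ i \<le> s' $ i) \<Longrightarrow> H k p r s y \<le> H k p r s' y"
    and mono_r: "\<And>k p r r' s y. s \<in> others k \<Longrightarrow> r $ k \<le> r' $ k \<Longrightarrow> (\<And>i. i \<noteq> k \<Longrightarrow> r' $ i \<le> r $ i) \<Longrightarrow>
        H k p r s y \<le> H k p r' s y"
    and mono_diag: "\<And>k p a b s y. s \<in> others k \<Longrightarrow> a \<le> b \<Longrightarrow> H k p (vec a) s y \<le> H k p (vec b) s y"

text \<open>Beyond \<open>x0\<close>, where C1 x^(g - 1) reaches |a|, the power dominates; below it,
  \<open>a * x\<close> is at most |a| x0.\<close>

lemma powr_superlinear: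
  fixes C1 g a :: real
  assumes "C1 > 0" "g > 1"
  shows "\<exists>C. \<forall>x\<ge>0. a * x - C \<le> C1 * x powr g"
proof -
  define x0 where "x0 = (\<bar>a\<bar> / C1) powr (1 / (g - 1))"
  have "a * x - \<bar>a\<bar> * x0 \<le> C1 * x powr g" if x: "x \<ge> 0" for x
  proof (cases "x \<le> x0")
    case True
    have "a * x \<le> \<bar>a\<bar> * x0"
      using x True by (intro mult_mono) auto
    moreover have "C1 * x powr g \<ge> 0"
      using assms by simp
    ultimately show ?thesis
      by linarith
  next
    case False
    have x0: "x0 \<ge> 0"
      by (simp add: x0_def)
    have "\<bar>a\<bar> / C1 = x0 powr (g - 1)"
      using assms unfolding x0_def powr_powr by simp
    also have "\<dots> \<le> x powr (g - 1)"
      using False x0 assms by (intro powr_mono2) auto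
    finally have "\<bar>a\<bar> \<le> C1 * x powr (g - 1)"
      using assms by (simp add: field_simps)
    then have "\<bar>a\<bar> * x \<le> C1 * x powr (g - 1) * x"
      using x by (rule mult_right_mono)
    also have "C1 * x powr (g - 1) * x = C1 * x powr g"
      using False x0 by (simp add: powr_diff)
    finally have "\<bar>a\<bar> * x \<le> C1 * x powr g" .
    moreover have "a * x \<le> \<bar>a\<bar> * x"
      using x by (rule mult_right_mono[OF abs_ge_self])
    moreover have "0 \<le> \<bar>a\<bar> * x0"
      using x0 by simp
    ultimately show ?thesis
      by linarith
  qed
  then show ?thesis
    by blast
qed

lemma finite_uniform_bound:
  fixes P :: "'m::finite \<Rightarrow> real \<Rightarrow> bool"
  assumes "\<And>k. \<exists>C. P k C" and mono: "\<And>k C C'. P k C \<Longrightarrow> C \<le> C' \<Longrightarrow> P k C'"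
  shows "\<exists>C\<ge>0. \<forall>k. P k C"
proof -
  obtain C where C: "\<And>k. P k (C k)"
    using assms(1) by metis
  define C' where "C' = (\<Sum>k\<in>UNIV. \<bar>C k\<bar>)"
  have "C k \<le> C'" for k
  proof -
    have "C k \<le> \<bar>C k\<bar>"
      by simp
    also have "\<dots> \<le> C'"
      unfolding C'_def by (intro member_le_sum) auto
    finally show ?thesis .
  qed
  moreover have "C' \<ge> 0"
    unfolding C'_def by (intro sum_nonneg) auto
  ultimately show ?thesis
    using C mono by blast
qed

lemma (in hj_system) hj_coefficients_at:
  assumes \<omega>: "\<omega> \<in> space M"
  obtains \<sigma> d CA where "hj_coefficients \<sigma> d (\<lambda>k p r s y. H k p r s y \<omega>) CA"
    "\<And>k y. A k y \<omega> = (\<chi> a b. \<Sum>j<d k. \<sigma> k y j $ a * \<sigma> k y j $ b)"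
proof -
  obtain d \<Sigma> where A': "\<forall>k y. \<forall>\<omega>\<in>space M. A k y \<omega> = (\<chi> a b. \<Sum>j<(d k :: nat). \<Sigma> k y \<omega> j $ a * \<Sigma> k y \<omega> j $ b)"
    and \<Sigma>: "\<forall>k. \<exists>C. \<forall>\<omega>\<in>space M. (\<forall>y. L2_set (\<lambda>j. norm (\<Sigma> k y \<omega> j)) {..<d k} \<le> C) \<and>
           (\<forall>y z. L2_set (\<lambda>j. norm (\<Sigma> k y \<omega> j - \<Sigma> k z \<omega> j)) {..<d k} \<le> C * norm (y - z))"
    using A_factor by (elim exE conjE) (rule that)
  have A: "A k y \<omega> = (\<chi> a b. \<Sum>j<d k. \<Sigma> k y \<omega> j $ a * \<Sigma> k y \<omega> j $ b)" for k y
    using A' \<omega> by blast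
  define \<sigma> where "\<sigma> k y j = \<Sigma> k y \<omega> j" for k y j
  have "\<exists>C. (\<forall>y. L2_set (\<lambda>j. norm (\<sigma> k y j)) {..<d k} \<le> C) \<and>
           (\<forall>y z. L2_set (\<lambda>j. norm (\<sigma> k y j - \<sigma> k z j)) {..<d k} \<le> C * norm (y - z))" for k
    using \<Sigma> \<omega> unfolding \<sigma>_def by blast
  then have "\<exists>C\<ge>0. \<forall>k. (\<forall>y. L2_set (\<lambda>j. norm (\<sigma> k y j)) {..<d k} \<le> C) \<and>
           (\<forall>y z. L2_set (\<lambda>j. norm (\<sigma> k y j - \<sigma> k z j)) {..<d k} \<le> C * norm (y - z))"
  proof (rule finite_uniform_bound)
    fix k and C C' :: real
    assume *: "(\<forall>y. L2_set (\<lambda>j. norm (\<sigma> k y j)) {..<d k} \<le> C) \<and>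
           (\<forall>y z. L2_set (\<lambda>j. norm (\<sigma> k y j - \<sigma> k z j)) {..<d k} \<le> C * norm (y - z))" and "C \<le> C'"
    have "C * norm v \<le> C' * norm v" for v :: "real ^ 'n"
      using \<open>C \<le> C'\<close> by (intro mult_right_mono) auto
    then show "(\<forall>y. L2_set (\<lambda>j. norm (\<sigma> k y j)) {..<d k} \<le> C') \<and>
           (\<forall>y z. L2_set (\<lambda>j. norm (\<sigma> k y j - \<sigma> k z j)) {..<d k} \<le> C' * norm (y - z))"
      using * \<open>C \<le> C'\<close> by (meson order_trans)
  qed
  then obtain C where C: "C \<ge> 0" "\<And>k y. L2_set (\<lambda>j. norm (\<sigma> k y j)) {..<d k} \<le> C"
    "\<And>k y z. L2_set (\<lambda>j. norm (\<sigma> k y j - \<sigma> k z j)) {..<d k} \<le> C * norm (y - z)"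
    by blast
  have sq: "(\<Sum>j<n. (f j)\<^sup>2) \<le> c\<^sup>2" if "L2_set f {..<n} \<le> c" for f :: "nat \<Rightarrow> real" and n c
    using that unfolding L2_set_def by (simp add: sqrt_le_D)
  \<comment> \<open>The standing bounds concern open balls of positive radius, the locale uses
    \<open>norm r \<le> R\<close> with arbitrary \<open>R\<close>; the radius |R| + 1 serves
    both.\<close>
  have R1: "\<bar>R\<bar> + 1 > 0" for R :: real
    by simp
  have coer: "\<exists>C1>0. \<exists>C2>0. \<exists>C3>0. \<forall>p r s y. norm r \<le> R \<longrightarrow> s \<in> others k \<longrightarrow>
      C1 * norm p powr \<gamma> k + C2 * Max (insert 0 ((\<lambda>i. max (s $ i) 0) ` (- {k}))) - C3 \<le> H k p r s y \<omega>" for R k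
  proof -
    obtain C1 C2 C3 where C: "C1 > 0" "C2 > 0" "C3 > 0"
      and low: "\<forall>p. \<forall>r\<in>ball 0 (\<bar>R\<bar> + 1). \<forall>s\<in>others k. \<forall>y. \<forall>\<omega>\<in>space M.
          C1 * norm p powr \<gamma> k + C2 * Max (insert 0 ((\<lambda>i. max (s $ i) 0) ` (- {k}))) - C3 \<le> H k p r s y \<omega>"
      using H_coercive[OF R1, of R k] by (elim exE conjE) (rule that)
    have "C1 * norm p powr \<gamma> k + C2 * Max (insert 0 ((\<lambda>i. max (s $ i) 0) ` (- {k}))) - C3 \<le> H k p r s y \<omega>"
      if "norm r \<le> R" "s \<in> others k" for p r s y
      using that \<omega> by (intro low[rule_format]) auto
    then show ?thesis
      using C by blast
  qed
  have Max_nonneg: "Max (insert 0 ((\<lambda>i. max (s $ i) 0) ` (- {k}))) \<ge> 0" for s :: "real ^ 'm" and k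
    by (intro Max_ge) auto
  have Max_ge_i: "Max (insert 0 ((\<lambda>i. max (s $ i) 0) ` (- {k}))) \<ge> s $ i" if "s \<in> others k" for s :: "real ^ 'm" and k i
  proof (cases "i = k")
    case True
    then show ?thesis
      using that Max_nonneg by (simp add: others_def)
  next
    case False
    then have "max (s $ i) 0 \<le> Max (insert 0 ((\<lambda>i. max (s $ i) 0) ` (- {k})))"
      by (intro Max_ge) auto
    then show ?thesis
      by linarith
  qed
  show ?thesis
  proof (rule that)
    show "A k y \<omega> = (\<chi> a b. \<Sum>j<d k. \<sigma> k y j $ a * \<sigma> k y j $ b)" for k y
      by (simp add: A \<sigma>_def)
    show "hj_coefficients \<sigma> d (\<lambda>k p r s y. H k p r s y \<omega>) (C\<^sup>2)"
    proof unfold_locales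
      show "(\<Sum>j<d k. (norm (\<sigma> k y j))\<^sup>2) \<le> C\<^sup>2" for k y
        by (rule sq[OF C(2)])
      show "(\<Sum>j<d k. (norm (\<sigma> k y j - \<sigma> k z j))\<^sup>2) \<le> C\<^sup>2 * (norm (y - z))\<^sup>2" for k y z
        using sq[OF C(3)] by (simp add: power_mult_distrib)
      show "convex_on UNIV (\<lambda>p. H k p r s y \<omega>)" if "s \<in> others k" for k r s y
        using that \<omega> by (rule H_convex_p)
      show "\<exists>C. \<forall>k p r s y. norm r \<le> R \<longrightarrow> s \<in> others k \<longrightarrow> a * norm p - C \<le> H k p r s y \<omega>" for R a
      proof -
        have ex: "\<exists>C. \<forall>p r s y. norm r \<le> R \<longrightarrow> s \<in> others k \<longrightarrow> a * norm p - C \<le> H k p r s y \<omega>" for k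
        proof -
          obtain C1 C2 C3 where c: "C1 > 0" "C2 > 0" "C3 > 0" "\<And>p r s y. norm r \<le> R \<Longrightarrow> s \<in> others k \<Longrightarrow>
            C1 * norm p powr \<gamma> k + C2 * Max (insert 0 ((\<lambda>i. max (s $ i) 0) ` (- {k}))) - C3 \<le> H k p r s y \<omega>"
            using coer by blast
          obtain C where C: "\<And>x. x \<ge> 0 \<Longrightarrow> a * x - C \<le> C1 * x powr \<gamma> k"
            using powr_superlinear[OF c(1) gamma_gt_1] by blast
          have "a * norm p - (C + C3) \<le> H k p r s y \<omega>" if "norm r \<le> R" "s \<in> others k" for p r s y
          proof -
            have "C2 * Max (insert 0 ((\<lambda>i. max (s $ i) 0) ` (- {k}))) \<ge> 0"
              using c(2) Max_nonneg by (intro mult_nonneg_nonneg) auto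
            then show ?thesis
              using c(4)[OF that, of p y] C[of "norm p"] by simp
          qed
          then show ?thesis
            by blast
        qed
        have "\<exists>C\<ge>0. \<forall>k. \<forall>p r s y. norm r \<le> R \<longrightarrow> s \<in> others k \<longrightarrow> a * norm p - C \<le> H k p r s y \<omega>"
        proof (rule finite_uniform_bound[OF ex], intro allI impI)
          fix k :: 'm and p y :: "real ^ 'n" and r s :: "real ^ 'm" and C C' :: real
          assume "\<forall>p r s y. norm r \<le> R \<longrightarrow> s \<in> others k \<longrightarrow> a * norm p - C \<le> H k p r s y \<omega>" "C \<le> C'"
            "norm r \<le> R" "s \<in> others k"
          moreover from this have "a * norm p - C \<le> H k p r s y \<omega>"
            by blast
          ultimately show "a * norm p - C' \<le> H k p r s y \<omega>"
            by linarith
        qed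
        then show ?thesis
          by blast
      qed
      show "\<exists>c>0. \<exists>C. \<forall>k p r s y i. norm r \<le> R \<longrightarrow> s \<in> others k \<longrightarrow> c * s $ i - C \<le> H k p r s y \<omega>" for R
      proof -
        have "\<exists>C2 C3. C2 > 0 \<and> C3 > 0 \<and> (\<forall>p r s y. norm r \<le> R \<longrightarrow> s \<in> others k \<longrightarrow>
            C2 * Max (insert 0 ((\<lambda>i. max (s $ i) 0) ` (- {k}))) - C3 \<le> H k p r s y \<omega>)" for k
        proof -
          obtain C1 C2 C3 where c: "C1 > 0" "C2 > 0" "C3 > 0" "\<And>p r s y. norm r \<le> R \<Longrightarrow> s \<in> others k \<Longrightarrow>
            C1 * norm p powr \<gamma> k + C2 * Max (insert 0 ((\<lambda>i. max (s $ i) 0) ` (- {k}))) - C3 \<le> H k p r s y \<omega>"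
            using coer by blast
          have "C1 * norm p powr \<gamma> k \<ge> 0" for p :: "real ^ 'n"
            using c(1) by simp
          then have "C2 * Max (insert 0 ((\<lambda>i. max (s $ i) 0) ` (- {k}))) - C3 \<le> H k p r s y \<omega>"
            if "norm r \<le> R" "s \<in> others k" for p r s y
            using c(4)[OF that, of p y] by (smt (verit))
          then show ?thesis
            using c(2,3) by blast
        qed
        then obtain C2 C3 where c: "\<And>k. C2 k > 0" "\<And>k. C3 k > 0" "\<And>k p r s y. norm r \<le> R \<Longrightarrow> s \<in> others k \<Longrightarrow>
            C2 k * Max (insert 0 ((\<lambda>i. max (s $ i) 0) ` (- {k}))) - C3 k \<le> H k p r s y \<omega>"
          by metis
        define c' where "c' = Min (range C2)"
        define C' where "C' = Max (range C3)"
        have c': "c' > 0" "\<And>k. c' \<le> C2 k" "\<And>k. C3 k \<le> C'"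
          using c(1) by (auto simp: c'_def C'_def)
        have "c' * s $ i - C' \<le> H k p r s y \<omega>" if "norm r \<le> R" "s \<in> others k" for k p r s y i
        proof -
          define m where "m = Max (insert 0 ((\<lambda>i. max (s $ i) 0) ` (- {k})))"
          have "c' * s $ i \<le> c' * m"
            using c'(1) Max_ge_i[OF that(2)] by (simp add: m_def)
          also have "\<dots> \<le> C2 k * m"
            using c'(2) Max_nonneg unfolding m_def by (intro mult_right_mono) auto
          finally show ?thesis
            using c(3)[OF that, of p y] c'(3)[of k] by (simp add: m_def)
        qed
        then show ?thesis
          using c'(1) by blast
      qed
      show "\<exists>C. \<forall>k p r s y. norm p \<le> R \<longrightarrow> norm r \<le> R \<longrightarrow> norm s \<le> R \<longrightarrow> s \<in> others k \<longrightarrow> \<bar>H k p r s y \<omega>\<bar> \<le> C" for R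
      proof -
        have ex: "\<exists>C. \<forall>p r s y. norm p \<le> R \<longrightarrow> norm r \<le> R \<longrightarrow> norm s \<le> R \<longrightarrow> s \<in> others k \<longrightarrow> \<bar>H k p r s y \<omega>\<bar> \<le> C" for k
        proof -
          obtain C4 where "\<forall>p\<in>ball 0 (\<bar>R\<bar> + 1). \<forall>r\<in>ball 0 (\<bar>R\<bar> + 1). \<forall>s\<in>ball 0 (\<bar>R\<bar> + 1) \<inter> others k. \<forall>y. \<forall>\<omega>\<in>space M.
            \<bar>H k p r s y \<omega>\<bar> \<le> C4"
            using H_locally_bounded[OF R1, of R k] by (elim exE) (rule that)
          then show ?thesis
            using \<omega> by (intro exI[of _ C4]) auto
        qed
        have "\<exists>C\<ge>0. \<forall>k. \<forall>p r s y. norm p \<le> R \<longrightarrow> norm r \<le> R \<longrightarrow> norm s \<le> R \<longrightarrow> s \<in> others k \<longrightarrow> \<bar>H k p r s y \<omega>\<bar> \<le> C"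
          by (rule finite_uniform_bound[OF ex]) (meson order_trans)
        then show ?thesis
          by blast
      qed
      show "\<exists>C\<ge>0. \<forall>k p r1 r2 s1 s2 y1 y2. norm r1 \<le> R \<longrightarrow> norm r2 \<le> R \<longrightarrow>
        norm s1 \<le> R \<longrightarrow> norm s2 \<le> R \<longrightarrow> s1 \<in> others k \<longrightarrow> s2 \<in> others k \<longrightarrow>
        \<bar>H k p r1 s1 y1 \<omega> - H k p r2 s2 y2 \<omega>\<bar> \<le> C * (norm (r1 - r2) + norm (s1 - s2) + norm (y1 - y2))" for R
      proof (rule finite_uniform_bound)
        fix k
        obtain C5 where C5: "\<forall>p1 p2. \<forall>r1\<in>ball 0 (\<bar>R\<bar> + 1). \<forall>r2\<in>ball 0 (\<bar>R\<bar> + 1).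
          \<forall>s1\<in>ball 0 (\<bar>R\<bar> + 1) \<inter> others k. \<forall>s2\<in>ball 0 (\<bar>R\<bar> + 1) \<inter> others k. \<forall>y1 y2. \<forall>\<omega>\<in>space M.
            \<bar>H k p1 r1 s1 y1 \<omega> - H k p2 r2 s2 y2 \<omega>\<bar>
            \<le> C5 * ((1 + norm p1 + norm p2) powr (\<gamma> k - 1) * norm (p1 - p2)
                    + norm (r1 - r2) + norm (s1 - s2) + norm (y1 - y2))"
          using H_locally_Lipschitz[OF R1, of R k] by (elim exE) (rule that)
        have "\<bar>H k p r1 s1 y1 \<omega> - H k p r2 s2 y2 \<omega>\<bar> \<le> C5 * (norm (r1 - r2) + norm (s1 - s2) + norm (y1 - y2))"
          if "norm r1 \<le> R" "norm r2 \<le> R" "norm s1 \<le> R" "norm s2 \<le> R" "s1 \<in> others k" "s2 \<in> others k"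
          for p r1 r2 s1 s2 y1 y2
        proof -
          have m: "r1 \<in> ball 0 (\<bar>R\<bar> + 1)" "r2 \<in> ball 0 (\<bar>R\<bar> + 1)" "s1 \<in> ball 0 (\<bar>R\<bar> + 1) \<inter> others k" "s2 \<in> ball 0 (\<bar>R\<bar> + 1) \<inter> others k"
            using that by auto
          from C5[rule_format, OF m \<omega>, of p y1 p y2] show ?thesis
            by simp
        qed
        then show "\<exists>C. \<forall>p r1 r2 s1 s2 y1 y2. norm r1 \<le> R \<longrightarrow> norm r2 \<le> R \<longrightarrow>
          norm s1 \<le> R \<longrightarrow> norm s2 \<le> R \<longrightarrow> s1 \<in> others k \<longrightarrow> s2 \<in> others k \<longrightarrow>
          \<bar>H k p r1 s1 y1 \<omega> - H k p r2 s2 y2 \<omega>\<bar> \<le> C * (norm (r1 - r2) + norm (s1 - s2) + norm (y1 - y2))"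
          by blast
        fix C C' :: real
        assume *: "\<forall>p r1 r2 s1 s2 y1 y2. norm r1 \<le> R \<longrightarrow> norm r2 \<le> R \<longrightarrow>
          norm s1 \<le> R \<longrightarrow> norm s2 \<le> R \<longrightarrow> s1 \<in> others k \<longrightarrow> s2 \<in> others k \<longrightarrow>
          \<bar>H k p r1 s1 y1 \<omega> - H k p r2 s2 y2 \<omega>\<bar> \<le> C * (norm (r1 - r2) + norm (s1 - s2) + norm (y1 - y2))"
          and "C \<le> C'"
        have le: "C * (norm a + norm b + norm e) \<le> C' * (norm a + norm b + norm e)"
          for a b :: "real ^ 'm" and e :: "real ^ 'n"
          using \<open>C \<le> C'\<close> by (intro mult_right_mono) auto
        show "\<forall>p r1 r2 s1 s2 y1 y2. norm r1 \<le> R \<longrightarrow> norm r2 \<le> R \<longrightarrow>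
          norm s1 \<le> R \<longrightarrow> norm s2 \<le> R \<longrightarrow> s1 \<in> others k \<longrightarrow> s2 \<in> others k \<longrightarrow>
          \<bar>H k p r1 s1 y1 \<omega> - H k p r2 s2 y2 \<omega>\<bar> \<le> C' * (norm (r1 - r2) + norm (s1 - s2) + norm (y1 - y2))"
          by (intro allI impI order_trans[OF *[rule_format] le])
      qed
      show "H k p r s y \<omega> \<le> H k p r s' y \<omega>"
        if s: "s \<in> others k" "s' \<in> others k" "\<And>i. s $ i \<le> s' $ i" for k p r s s' y
      proof -
        \<comment> \<open>Monotonicity is assumed one coordinate at a time; \<open>mix I\<close> has
          been switched to \<open>s'\<close> on \<open>I\<close>. Coordinate \<open>k\<close> is
          harmless, since both vectors vanish there.\<close>
        define mix where "mix I = (\<chi> i. if i \<in> I then s' $ i else s $ i)" for I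
        have mix: "mix I \<in> others k" for I
          using s by (simp add: mix_def others_def)
        have "H k p r s y \<omega> \<le> H k p r (mix I) y \<omega>" if "finite I" for I
          using that
        proof (induction I rule: finite_induct)
          case empty
          then show ?case by (simp add: mix_def)
        next
          case (insert i I)
          show ?case
          proof (cases "i = k")
            case True
            then have "mix (insert i I) = mix I"
              using s(1,2) by (auto simp: mix_def others_def vec_eq_iff)
            then show ?thesis
              using insert by simp
          next
            case False
            have "mono (\<lambda>a. H k p r (vec_upd (mix I) i a) y \<omega>)"
              using False mix \<omega> by (rule H_mono_s)
            then have "H k p r (vec_upd (mix I) i (s $ i)) y \<omega> \<le> H k p r (vec_upd (mix I) i (s' $ i)) y \<omega>"
              using s(3) by (rule monoD)
            moreover have "vec_upd (mix I) i (s $ i) = mix I" "vec_upd (mix I) i (s' $ i) = mix (insert i I)"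
              using insert.hyps by (auto simp: vec_upd_def mix_def vec_eq_iff)
            ultimately show ?thesis
              using insert.IH by simp
          qed
        qed
        from this[of UNIV] show ?thesis
          by (simp add: mix_def vec_lambda_eta)
      qed
      show "H k p r s y \<omega> \<le> H k p r' s y \<omega>"
        if s: "s \<in> others k" and r: "r $ k \<le> r' $ k" "\<And>i. i \<noteq> k \<Longrightarrow> r' $ i \<le> r $ i" for k p r r' s y
      proof -
        define mix where "mix I = (\<chi> i. if i \<in> I then r' $ i else r $ i)" for I
        have "H k p r s y \<omega> \<le> H k p (mix I) s y \<omega>" if "finite I" for I
          using that
        proof (induction I rule: finite_induct)
          case empty
          then show ?case by (simp add: mix_def)
        next
          case (insert i I)
          have eq: "vec_upd (mix I) i (r $ i) = mix I" "vec_upd (mix I) i (r' $ i) = mix (insert i I)"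
            using insert.hyps by (auto simp: vec_upd_def mix_def vec_eq_iff)
          have "H k p (vec_upd (mix I) i (r $ i)) s y \<omega> \<le> H k p (vec_upd (mix I) i (r' $ i)) s y \<omega>"
          proof (cases "i = k")
            case True
            then show ?thesis
              using monoD[OF H_mono_r_diag[OF s \<omega>, of p "mix I" y] r(1)] by simp
          next
            case False
            then show ?thesis
              using antimonoD[OF H_antimono_r_off_diag[OF False s \<omega>, of p "mix I" y] r(2)[OF False]] by simp
          qed
          then show ?case
            using insert.IH unfolding eq by simp
        qed
        from this[of UNIV] show ?thesis
          by (simp add: mix_def vec_lambda_eta)
      qed
      show "H k p (vec a) s y \<omega> \<le> H k p (vec b) s y \<omega>" if "s \<in> others k" "a \<le> b" for k p a b s y
      proof -
        have "(vec b :: real ^ 'm) $ k - vec a $ k = Max (range (\<lambda>i. \<bar>(vec b :: real ^ 'm) $ i - vec a $ i\<bar>))"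
          using that(2) by simp
        from H_monotone_system[OF that(1) \<omega> this] show ?thesis
          by simp
      qed
    qed simp
  qed
qed

section \<open>Attained maxima and touching functions\<close>

lemma norm_vec_le:
  "norm (vec r :: real ^ 'm::finite) \<le> real CARD('m) * \<bar>r\<bar>"
  using norm_le_l1_cart[of "vec r :: real ^ 'm"] by simp

lemma norm_le_card_component:
  fixes w :: "real ^ 'm::finite"
  assumes "\<And>i. \<bar>w $ i\<bar> \<le> b"
  shows "norm w \<le> real CARD('m) * b"
proof -
  have "norm w \<le> (\<Sum>i\<in>UNIV. \<bar>w $ i\<bar>)"
    by (rule norm_le_l1_cart)
  also have "\<dots> \<le> (\<Sum>i\<in>(UNIV :: 'm set). b)"
    using assms by (intro sum_mono) auto
  finally show ?thesis
    by simp
qed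

text \<open>Boundedness of the superlevel sets above one known value reduces everything to a compact
  set. The index is maximised too, because comparing the maximal component with the others at the
  same points gives the sign of the coupling terms.\<close>

lemma finite_family_attains_sup:
  fixes f :: "'i::finite \<Rightarrow> 'a::euclidean_space \<Rightarrow> real"
  assumes S: "closed S" "\<And>k. continuous_on S (f k)" "z0 \<in> S"
    and bdd: "\<And>k z. z \<in> S \<Longrightarrow> f k0 z0 \<le> f k z \<Longrightarrow> norm z \<le> B"
  obtains k z where "z \<in> S" "\<And>j z'. z' \<in> S \<Longrightarrow> f j z' \<le> f k z"
proof -
  define K where "K = S \<inter> cball 0 B"
  have K: "compact K" "z0 \<in> K"
    unfolding K_def using S(1,3) bdd[of z0 k0] by (auto intro: closed_Int_compact)
  have "\<exists>z\<in>K. \<forall>z'\<in>K. f k z' \<le> f k z" for k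
    using K by (intro continuous_attains_sup continuous_on_subset[OF S(2)]) (auto simp: K_def)
  then obtain z where z: "\<And>k. z k \<in> K" "\<And>k z'. z' \<in> K \<Longrightarrow> f k z' \<le> f k (z k)"
    by metis
  define m where "m = Max (range (\<lambda>k. f k (z k)))"
  have "m \<in> range (\<lambda>k. f k (z k))"
    unfolding m_def by (intro Max_in) auto
  then obtain k where k: "m = f k (z k)"
    by (rule rangeE)
  have max: "f j (z j) \<le> f k (z k)" for j
    using Max_ge[of "range (\<lambda>k. f k (z k))" "f j (z j)"] by (simp add: k[symmetric] m_def)
  show ?thesis
  proof (rule that)
    show "z k \<in> S"
      using z(1)[of k] by (simp add: K_def)
    fix j z' assume z': "z' \<in> S"
    show "f j z' \<le> f k (z k)"
    proof (cases "z' \<in> K")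
      case True
      then show ?thesis
        using z(2) max by (meson order_trans)
    next
      case False
      then have "\<not> f k0 z0 \<le> f j z'"
        using bdd[OF z', of j] z' by (auto simp: K_def)
      then have "f j z' < f k0 z0"
        by simp
      also have "\<dots> \<le> f k0 (z k0)"
        using z(2) K(2) by blast
      finally show ?thesis
        using max[of k0] by simp
    qed
  qed
qed

lemma upper_jet_quadraticI:
  assumes "\<And>h. f (x + h) \<le> f x + P \<bullet> h + c * (norm h)\<^sup>2"
  shows "upper_jet f x P (\<lambda>h. (2 * c) *\<^sub>R h)"
proof (rule upper_jetI)
  show "linear (\<lambda>h. (2 * c) *\<^sub>R h)"
    by (intro linear_compose_scale_right linear_id[unfolded id_def])
  show "\<forall>\<^sub>F h in nhds 0. f (x + h) \<le> f x + P \<bullet> h + h \<bullet> (2 * c) *\<^sub>R h / 2"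
    using assms by (intro always_eventually allI) (simp add: power2_norm_eq_inner)
qed

text \<open>From 2 s t <= s^2 + t^2 for the two values of the regularised norm. An upper bound
  suffices, since this cone is always used as a function touching from above.\<close>

lemma sqrt_norm_sq_le_quadratic:
  fixes x h :: "'a::real_inner"
  assumes \<tau>: "\<tau> > 0"
  shows "sqrt (\<tau>\<^sup>2 + (norm (x + h))\<^sup>2) \<le> sqrt (\<tau>\<^sup>2 + (norm x)\<^sup>2) + (x \<bullet> h) / sqrt (\<tau>\<^sup>2 + (norm x)\<^sup>2)
    + (norm h)\<^sup>2 / (2 * sqrt (\<tau>\<^sup>2 + (norm x)\<^sup>2))"
proof -
  define s where "s = sqrt (\<tau>\<^sup>2 + (norm x)\<^sup>2)"
  define t where "t = sqrt (\<tau>\<^sup>2 + (norm (x + h))\<^sup>2)"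
  have pos: "\<tau>\<^sup>2 + (norm y)\<^sup>2 > 0" for y :: 'a
    using \<tau> by (intro add_pos_nonneg) auto
  have s: "s > 0" "s\<^sup>2 = \<tau>\<^sup>2 + (norm x)\<^sup>2" and t: "t\<^sup>2 = \<tau>\<^sup>2 + (norm (x + h))\<^sup>2"
    using pos[of x] pos[of "x + h"] by (auto simp: s_def t_def intro: less_imp_le)
  have "t\<^sup>2 = s\<^sup>2 + 2 * (x \<bullet> h) + (norm h)\<^sup>2"
    unfolding s t by (simp add: power2_norm_eq_inner inner_simps inner_commute)
  moreover have "2 * s * t \<le> s\<^sup>2 + t\<^sup>2"
    by (rule sum_squares_bound)
  ultimately have "2 * s * t \<le> 2 * s\<^sup>2 + 2 * (x \<bullet> h) + (norm h)\<^sup>2"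
    by simp
  then have "t \<le> (2 * s\<^sup>2 + 2 * (x \<bullet> h) + (norm h)\<^sup>2) / (2 * s)"
    using s(1) by (simp add: field_simps)
  also have "\<dots> = s + (x \<bullet> h) / s + (norm h)\<^sup>2 / (2 * s)"
    using s(1) by (simp add: field_simps power2_eq_square)
  finally show ?thesis
    by (simp add: s_def t_def)
qed

definition gap :: "'m \<Rightarrow> real ^ 'm::finite \<Rightarrow> real ^ 'm" where
  "gap k v = (\<chi> j. v $ k - v $ j)"

lemma gap_nth [simp]: "gap k v $ j = v $ k - v $ j"
  by (simp add: gap_def)

lemma others_gap [simp]: "gap k v \<in> others k" "c *\<^sub>R gap k v \<in> others k" "0 \<in> others k"
  by (simp_all add: others_def)

lemma tendsto_gap [tendsto_intros]:
  "(f \<longlongrightarrow> l) F \<Longrightarrow> ((\<lambda>x. gap k (f x)) \<longlongrightarrow> gap k l) F"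
  unfolding gap_def by (intro tendsto_intros)

lemma jet_subsolution_scale:
  fixes w :: "'a::euclidean_space \<Rightarrow> real"
  assumes "jet_subsolution UNIV w F s d" "c > 0"
  shows "jet_subsolution UNIV (\<lambda>x. c * w x) (\<lambda>x Q. c * F x (Q /\<^sub>R c)) s d"
  using jet_subsolution_rescale[OF assms, of 1] by simp

section \<open>First bounds for the approximate correctors\<close>

context hj_coefficients
begin

lemma isCont_sigma:
  assumes "j < d k"
  shows "isCont (\<lambda>y. \<sigma> k y j) y"
proof -
  have bound: "norm (\<sigma> k z j - \<sigma> k y j) \<le> sqrt CA * norm (z - y)" for z
  proof -
    have "(norm (\<sigma> k z j - \<sigma> k y j))\<^sup>2 \<le> (\<Sum>j<d k. (norm (\<sigma> k z j - \<sigma> k y j))\<^sup>2)"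
      using assms by (intro member_le_sum) auto
    also have "\<dots> \<le> (sqrt CA * norm (z - y))\<^sup>2"
      using sigma_lipschitz[of k z y] CA by (simp add: power_mult_distrib)
    finally show ?thesis
      by (rule power2_le_imp_le) (use CA in simp)
  qed
  have "((\<lambda>z. sqrt CA * norm (z - y)) \<longlongrightarrow> sqrt CA * norm (y - y)) (at y)"
    by (intro tendsto_intros)
  then have lim0: "((\<lambda>z. sqrt CA * norm (z - y)) \<longlongrightarrow> 0) (at y)"
    by simp
  have "((\<lambda>z. \<sigma> k z j - \<sigma> k y j) \<longlongrightarrow> 0) (at y)"
    by (rule Lim_null_comparison[OF _ lim0]) (intro always_eventually allI bound)
  then show ?thesis
    by (simp add: isCont_def LIM_zero_iff)
qed

text \<open>The Lipschitz bound in the other variables is uniform in \<open>p\<close>, and finite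
  convex functions are continuous; together they give joint continuity.\<close>

lemma tendsto_H:
  assumes lim: "(P \<longlongrightarrow> p) F" "(r \<longlongrightarrow> r0) F" "(s \<longlongrightarrow> s0) F" "(y \<longlongrightarrow> y0) F"
    and s: "\<And>x. s x \<in> others k" "s0 \<in> others k"
  shows "((\<lambda>x. H k (P x) (r x) (s x) (y x)) \<longlongrightarrow> H k p r0 s0 y0) F"
proof -
  define R where "R = norm r0 + norm s0 + 1"
  have R: "norm r0 \<le> R" "norm s0 \<le> R" "norm r0 < R" "norm s0 < R"
    by (auto simp: R_def intro: add_nonneg_pos add_pos_nonneg add_increasing)
  obtain C where C: "C \<ge> 0" "\<And>p r1 r2 s1 s2 y1 y2. norm r1 \<le> R \<Longrightarrow> norm r2 \<le> R \<Longrightarrow>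
        norm s1 \<le> R \<Longrightarrow> norm s2 \<le> R \<Longrightarrow> s1 \<in> others k \<Longrightarrow> s2 \<in> others k \<Longrightarrow>
        \<bar>H k p r1 s1 y1 - H k p r2 s2 y2\<bar> \<le> C * (norm (r1 - r2) + norm (s1 - s2) + norm (y1 - y2))"
    using H_lipschitz[of R] by blast
  have "((\<lambda>x. H k (P x) (r x) (s x) (y x) - H k (P x) r0 s0 y0) \<longlongrightarrow> 0) F"
  proof (rule Lim_null_comparison)
    have "\<forall>\<^sub>F x in F. norm (r x) < R" "\<forall>\<^sub>F x in F. norm (s x) < R"
      using order_tendstoD(2)[OF tendsto_norm[OF lim(2)] R(3)] order_tendstoD(2)[OF tendsto_norm[OF lim(3)] R(4)] .
    then show "\<forall>\<^sub>F x in F. norm (H k (P x) (r x) (s x) (y x) - H k (P x) r0 s0 y0)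
        \<le> C * (norm (r x - r0) + norm (s x - s0) + norm (y x - y0))"
      by eventually_elim (use C(2) R s in auto)
    have "((\<lambda>x. C * (norm (r x - r0) + norm (s x - s0) + norm (y x - y0))) \<longlongrightarrow>
        C * (norm (r0 - r0) + norm (s0 - s0) + norm (y0 - y0))) F"
      by (intro tendsto_intros lim)
    then show "((\<lambda>x. C * (norm (r x - r0) + norm (s x - s0) + norm (y x - y0))) \<longlongrightarrow> 0) F"
      by simp
  qed
  moreover have "((\<lambda>x. H k (P x) r0 s0 y0) \<longlongrightarrow> H k p r0 s0 y0) F"
  proof (rule isCont_tendsto_compose[OF _ lim(1)])
    have "continuous_on UNIV (\<lambda>p. H k p r0 s0 y0)"
      using convex_p[OF s(2)] by (intro convex_on_continuous) auto
    then show "isCont (\<lambda>p. H k p r0 s0 y0) p"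
      by (simp add: continuous_on_eq_continuous_at)
  qed
  ultimately have "((\<lambda>x. (H k (P x) (r x) (s x) (y x) - H k (P x) r0 s0 y0) + H k (P x) r0 s0 y0) \<longlongrightarrow> 0 + H k p r0 s0 y0) F"
    by (rule tendsto_add)
  then show ?thesis
    by simp
qed

definition corrector :: "real ^ 'n \<Rightarrow> real \<Rightarrow> real \<Rightarrow> (real ^ 'n \<Rightarrow> real ^ 'm) \<Rightarrow> bool" where
  "corrector p r \<delta> v \<longleftrightarrow> bounded (range v) \<and> (\<exists>L. L-lipschitz_on UNIV v) \<and>
    (\<forall>sg\<in>{1, - 1}. \<forall>k. jet_subsolution UNIV (\<lambda>y. sg * v y $ k)
      (\<lambda>y Q. sg * (\<delta> * v y $ k + H k (p + sg *\<^sub>R Q) (vec r) (gap k (v y)) y)) (\<lambda>j y. \<sigma> k y j) (d k))"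

lemma corrector_jetD:
  assumes "corrector p r \<delta> v" "sg \<in> {1, - 1}" "upper_jet (\<lambda>y. sg * v y $ k) y Q (\<lambda>h. c *\<^sub>R h)" "c \<ge> 0"
  shows "sg * (\<delta> * v y $ k + H k (p + sg *\<^sub>R Q) (vec r) (gap k (v y)) y) \<le> c * CA"
proof -
  have "sg * (\<delta> * v y $ k + H k (p + sg *\<^sub>R Q) (vec r) (gap k (v y)) y) \<le> (\<Sum>j<d k. \<sigma> k y j \<bullet> c *\<^sub>R \<sigma> k y j)"
    using assms(1-3) unfolding corrector_def jet_subsolution_def by blast
  also have "\<dots> = c * (\<Sum>j<d k. (norm (\<sigma> k y j))\<^sup>2)"
    by (simp add: sum_distrib_left power2_norm_eq_inner)
  also have "\<dots> \<le> c * CA"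
    using sigma_bound assms(4) by (rule mult_left_mono)
  finally show ?thesis .
qed

lemma corrector_components:
  assumes "corrector p r \<delta> v"
  obtains L B where "L > 0" "B > 0" "\<And>x y k. \<bar>v x $ k - v y $ k\<bar> \<le> L * norm (x - y)" "\<And>x k. \<bar>v x $ k\<bar> \<le> B"
    "\<And>k. continuous_on UNIV (\<lambda>x. v x $ k)"
proof -
  obtain L where L: "L-lipschitz_on UNIV v"
    using assms by (auto simp: corrector_def)
  obtain B where B: "B > 0" "\<And>x. norm (v x) \<le> B"
    using assms by (auto simp: corrector_def bounded_pos)
  have lip: "\<bar>v x $ k - v y $ k\<bar> \<le> (L + 1) * norm (x - y)" for x y k
  proof -
    have "\<bar>v x $ k - v y $ k\<bar> \<le> norm (v x - v y)"
      using component_le_norm_cart[of "v x - v y" k] by simp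
    also have "\<dots> \<le> L * norm (x - y)"
      using lipschitz_onD[OF L, of x y] by (simp add: dist_norm)
    also have "\<dots> \<le> (L + 1) * norm (x - y)"
      by (simp add: distrib_right)
    finally show ?thesis .
  qed
  show ?thesis
  proof (rule that[of "L + 1" B])
    show "L + 1 > 0"
      using lipschitz_on_nonneg[OF L] by simp
    show "\<bar>v x $ k\<bar> \<le> B" for x k
      using component_le_norm_cart[of "v x" k] B(2)[of x] by simp
    show "continuous_on UNIV (\<lambda>x. v x $ k)" for k
      by (intro continuous_intros lipschitz_on_continuous_on[OF L])
  qed (use B lip in auto)
qed

text \<open>Touch the largest component of \<open>sg * v\<close> by a flat paraboloid, so that the
  gradient is at most 1. For \<open>sg = 1\<close> a lower bound of \<open>H\<close> suffices. For
  \<open>sg = - 1\<close> the touched component is the lowest one there, all gaps are nonpositive,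
  and \<open>H\<close> is at most its value at gap 0.\<close>

lemma corrector_times_delta_bounded:
  "\<exists>C. \<forall>p r \<delta> v y k. norm p \<le> R \<longrightarrow> \<bar>r\<bar> \<le> R \<longrightarrow> 0 < \<delta> \<longrightarrow> \<delta> \<le> 1 \<longrightarrow> corrector p r \<delta> v \<longrightarrow> \<bar>\<delta> * v y $ k\<bar> \<le> C"
proof -
  define R' where "R' = max (\<bar>R\<bar> + 1) (real CARD('m) * \<bar>R\<bar>)"
  have R'_nonneg: "R' \<ge> 0"
    by (simp add: R'_def)
  obtain C1 where C1: "\<And>k p r s y. norm r \<le> R' \<Longrightarrow> s \<in> others k \<Longrightarrow> 0 * norm p - C1 \<le> H k p r s y"
    using superlinear[of R' 0] by blast
  obtain C2 where C2: "\<And>k p r s y. norm p \<le> R' \<Longrightarrow> norm r \<le> R' \<Longrightarrow> norm s \<le> R' \<Longrightarrow> s \<in> others k \<Longrightarrow> \<bar>H k p r s y\<bar> \<le> C2"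
    using H_bounded[of R'] by blast
  define C where "C = max C1 C2 + 2 * CA"
  have "sg * (\<delta> * v y0 $ k0) \<le> C"
    if pr: "norm p \<le> R" "\<bar>r\<bar> \<le> R" and \<delta>: "0 < \<delta>" "\<delta> \<le> 1" and v: "corrector p r \<delta> v" and sg: "sg \<in> {1, - 1}"
    for p r \<delta> v y0 k0 and sg :: real
  proof -
    obtain L B where B: "B > 0" "\<And>x k. \<bar>v x $ k\<bar> \<le> B" "\<And>k. continuous_on UNIV (\<lambda>x. v x $ k)"
      using corrector_components[OF v] by metis
    have sgB: "\<bar>sg * v x $ k\<bar> \<le> B" for x k
      using B(2)[of x k] sg by auto
    \<comment> \<open>\<open>B\<close> belongs to this \<open>v\<close> and may depend on \<delta>;
      it only makes the paraboloid flat enough for \<open>norm Q \<le> 1\<close> and does not enter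
      \<open>C\<close>.\<close>
    define \<beta> where "\<beta> = min 1 (1 / (8 * B))"
    have \<beta>: "\<beta> > 0" "\<beta> \<le> 1" "8 * B * \<beta> \<le> 1"
      using B(1) by (auto simp: \<beta>_def min_def field_simps)
    define f where "f k y = sg * v y $ k - \<beta> * (norm (y - y0))\<^sup>2" for k y
    have near: "\<beta> * (norm (y - y0))\<^sup>2 \<le> 2 * B" if "f k0 y0 \<le> f k y" for k y
      using that sgB[of y k] sgB[of y0 k0] by (simp add: f_def abs_le_iff)
    obtain k y where max: "\<And>j z. f j z \<le> f k y"
    proof (rule finite_family_attains_sup[of UNIV f y0 k0 "norm y0 + sqrt (2 * B / \<beta>)"])
      show "continuous_on UNIV (f k)" for k
        unfolding f_def by (intro continuous_intros B(3))
      fix k z assume "f k0 y0 \<le> f k z"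
      then have "(norm (z - y0))\<^sup>2 \<le> 2 * B / \<beta>"
        using near[of k z] \<beta>(1) by (simp add: field_simps)
      then have "norm (z - y0) \<le> sqrt (2 * B / \<beta>)"
        by (rule real_le_rsqrt)
      then show "norm z \<le> norm y0 + sqrt (2 * B / \<beta>)"
        using norm_triangle_sub[of z y0] by simp
    qed auto
    define Q where "Q = (2 * \<beta>) *\<^sub>R (y - y0)"
    have "upper_jet (\<lambda>y. sg * v y $ k) y Q (\<lambda>h. (2 * \<beta>) *\<^sub>R h)"
    proof (rule upper_jet_quadraticI)
      fix h
      have "(norm (y + h - y0))\<^sup>2 = (norm (y - y0))\<^sup>2 + 2 * ((y - y0) \<bullet> h) + (norm h)\<^sup>2"
        by (simp add: power2_norm_eq_inner inner_simps inner_commute)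
      from max[of k "y + h", unfolded f_def this]
      show "sg * v (y + h) $ k \<le> sg * v y $ k + Q \<bullet> h + \<beta> * (norm h)\<^sup>2"
        by (simp add: Q_def distrib_left)
    qed
    from corrector_jetD[OF v sg this]
    have jet: "sg * (\<delta> * v y $ k + H k (p + sg *\<^sub>R Q) (vec r) (gap k (v y)) y) \<le> 2 * CA"
      using \<beta> CA mult_right_mono[of "2 * \<beta>" 2 CA] by simp
    have nr: "norm (vec r :: real ^ 'm) \<le> R'"
    proof -
      have "real CARD('m) * \<bar>r\<bar> \<le> real CARD('m) * \<bar>R\<bar>"
        using pr(2) by (intro mult_left_mono) auto
      also have "\<dots> \<le> R'"
        unfolding R'_def by (rule max.cobounded2)
      finally show ?thesis
        by (rule order_trans[OF norm_vec_le])
    qed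
    have nQ: "norm Q \<le> 1"
    proof -
      have "(norm Q)\<^sup>2 = 4 * \<beta> * (\<beta> * (norm (y - y0))\<^sup>2)"
        unfolding Q_def norm_scaleR power_mult_distrib by (simp add: power2_eq_square)
      also have "\<dots> \<le> 4 * \<beta> * (2 * B)"
        using near[OF max] \<beta>(1) by (intro mult_left_mono) auto
      also have "\<dots> \<le> 1"
        using \<beta>(3) by (simp add: mult_ac)
      finally show ?thesis
        by (simp add: abs_square_le_1)
    qed
    have ham: "sg * H k (p + sg *\<^sub>R Q) (vec r) (gap k (v y)) y \<ge> - max C1 C2"
      using sg
    proof (elim insertE)
      assume "sg = 1"
      then show ?thesis
        using C1[OF nr others_gap(1), of "p + sg *\<^sub>R Q" k "v y" y] by simp
    next
      assume sg: "sg = - 1"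
      have gap: "gap k (v y) $ j \<le> 0 $ j" for j
        using max[of j y] sg by (simp add: f_def)
      have "H k (p + sg *\<^sub>R Q) (vec r) (gap k (v y)) y \<le> H k (p + sg *\<^sub>R Q) (vec r) 0 y"
        using gap by (intro mono_s) auto
      also have "norm (p + sg *\<^sub>R Q) \<le> R'"
        using norm_triangle_ineq[of p "sg *\<^sub>R Q"] nQ pr(1) sg by (simp add: R'_def)
      then have "H k (p + sg *\<^sub>R Q) (vec r) 0 y \<le> C2"
        using C2[of "p + sg *\<^sub>R Q" "vec r" 0 k y] nr R'_nonneg by simp
      finally show ?thesis
        using sg by simp
    qed simp
    have "sg * v y0 $ k0 \<le> sg * v y $ k"
    proof -
      have "0 \<le> \<beta> * (norm (y - y0))\<^sup>2"
        using \<beta>(1) by simp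
      then show ?thesis
        using max[of k0 y0] unfolding f_def by simp
    qed
    then have "\<delta> * (sg * v y0 $ k0) \<le> \<delta> * (sg * v y $ k)"
      using less_imp_le[OF \<delta>(1)] by (rule mult_left_mono)
    then show ?thesis
      using jet ham by (simp add: C_def algebra_simps)
  qed
  then have "\<bar>\<delta> * v y $ k\<bar> \<le> C"
    if "norm p \<le> R" "\<bar>r\<bar> \<le> R" "0 < \<delta>" "\<delta> \<le> 1" "corrector p r \<delta> v" for p r \<delta> v y k
    using that by (force simp: abs_le_iff)
  then show ?thesis
    by blast
qed

end

section \<open>Oscillation of the approximate correctors\<close>

context hj_coefficients
begin

definition admissible :: "real \<Rightarrow> real ^ 'n \<Rightarrow> real \<Rightarrow> real \<Rightarrow> (real ^ 'n \<Rightarrow> real ^ 'm) \<Rightarrow> bool" where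
  "admissible R p r \<delta> v \<longleftrightarrow> norm p \<le> R \<and> \<bar>r\<bar> \<le> R \<and> 0 < \<delta> \<and> \<delta> \<le> 1 \<and> corrector p r \<delta> v"

text \<open>The reference level for the depth of a component. The unit ball gives room: a steep cone
  around its centre can touch \<open>v\<close> from above only inside it, see
  \<open>corrector_growth\<close>.\<close>

definition local_max :: "(real ^ 'n \<Rightarrow> real ^ 'm) \<Rightarrow> real ^ 'n \<Rightarrow> real" where
  "local_max v x = (SUP s\<in>UNIV \<times> cball x 1. v (snd s) $ fst s)"

lemma local_max:
  assumes "corrector p r \<delta> v"
  shows "norm (z - x) \<le> 1 \<Longrightarrow> v z $ k \<le> local_max v x"
    and "\<exists>k z. norm (z - x) \<le> 1 \<and> v z $ k = local_max v x"
proof -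
  obtain B where cont: "\<And>k. continuous_on UNIV (\<lambda>x. v x $ k)" and B: "\<And>x k. \<bar>v x $ k\<bar> \<le> B"
    using corrector_components[OF assms] by metis
  obtain k0 z0 where max: "z0 \<in> cball x 1" "\<And>j z. z \<in> cball x 1 \<Longrightarrow> v z $ j \<le> v z0 $ k0"
  proof (rule finite_family_attains_sup[of "cball x 1" "\<lambda>k z. v z $ k" x undefined "norm x + 1"])
    show "continuous_on (cball x 1) (\<lambda>z. v z $ k)" for k
      using cont by (rule continuous_on_subset) simp
    show "norm z \<le> norm x + 1" if "z \<in> cball x 1" for z
      using norm_triangle_sub[of z x] that by (simp add: dist_norm norm_minus_commute)
  qed auto
  have eq: "local_max v x = v z0 $ k0"
    unfolding local_max_def using max
    by (intro cSup_eq_maximum) (auto intro!: image_eqI[of _ _ "(k0, z0)"])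
  show "norm (z - x) \<le> 1 \<Longrightarrow> v z $ k \<le> local_max v x"
    unfolding eq by (intro max) (simp add: dist_norm norm_minus_commute)
  show "\<exists>k z. norm (z - x) \<le> 1 \<and> v z $ k = local_max v x"
    unfolding eq using max(1) by (intro exI[of _ k0] exI[of _ z0]) (simp add: dist_norm norm_minus_commute)
qed

lemma admissible_delta_bound:
  obtains C where "C \<ge> 0" "\<And>p r \<delta> v y k. admissible R p r \<delta> v \<Longrightarrow> \<bar>\<delta> * v y $ k\<bar> \<le> C"
proof -
  obtain C where C: "\<And>p r \<delta> v y k. admissible R p r \<delta> v \<Longrightarrow> \<bar>\<delta> * v y $ k\<bar> \<le> C"
    using corrector_times_delta_bounded[of R] unfolding admissible_def by blast
  have "\<bar>\<delta> * v y $ k\<bar> \<le> \<bar>C\<bar>" if "admissible R p r \<delta> v" for p r \<delta> v y k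
    using C[OF that, of y k] by linarith
  then show ?thesis
    using that[of "\<bar>C\<bar>"] by simp
qed

lemma admissible_norm_vec:
  "admissible R p r \<delta> v \<Longrightarrow> norm (vec r :: real ^ 'm) \<le> real CARD('m) * R"
  unfolding admissible_def
  by (rule order_trans[OF norm_vec_le]) (auto intro: mult_left_mono)

text \<open>If the cone of slope \<open>K\<close> touched outside the unit ball, the gradient there
  would be at least K / 2, and the superlinear Hamiltonian would outweigh the second-order term of
  size \<open>K * CA\<close>. Hence the contact lies where \<open>local_max\<close> bounds
  \<open>v\<close>.\<close>

lemma corrector_growth:
  obtains K where "K \<ge> 1"
    "\<And>p r \<delta> v x x0 k. admissible R p r \<delta> v \<Longrightarrow> v x $ k \<le> local_max v x0 + K * norm (x - x0)"
proof -
  obtain C0 where C0: "C0 \<ge> 0" "\<And>p r \<delta> v y k. admissible R p r \<delta> v \<Longrightarrow> \<bar>\<delta> * v y $ k\<bar> \<le> C0"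
    using admissible_delta_bound[of R] by metis
  \<comment> \<open>At gradient K / 2 the rate \<open>a\<close> yields (CA + 1) K, which exceeds the
    second-order term CA K by \<open>K\<close>; this surplus dominates the remaining
    constants.\<close>
  define a where "a = 2 * (CA + 1)"
  obtain C1 where C1: "\<And>k p r s y. norm r \<le> real CARD('m) * R \<Longrightarrow> s \<in> others k \<Longrightarrow> a * norm p - C1 \<le> H k p r s y"
    using superlinear by blast
  define K where "K = a * \<bar>R\<bar> + \<bar>C1\<bar> + C0 + 1"
  have a: "a \<ge> 2"
    using CA by (simp add: a_def)
  have K: "K \<ge> 1"
    using a C0 by (simp add: K_def)
  have "v x $ k \<le> local_max v x0 + K * norm (x - x0)" if adm: "admissible R p r \<delta> v" for p r \<delta> v x x0 k
  proof -
    have v: "corrector p r \<delta> v" and R: "norm p \<le> R" and \<delta>: "0 < \<delta>"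
      using adm by (auto simp: admissible_def)
    obtain B where B: "\<And>x k. \<bar>v x $ k\<bar> \<le> B" "\<And>k. continuous_on UNIV (\<lambda>x. v x $ k)"
      using corrector_components[OF v] by metis
    define S where "S y = sqrt (1\<^sup>2 + (norm (y - x0))\<^sup>2)" for y
    have S: "S y \<ge> 1" "S y \<ge> norm (y - x0)" "S y \<le> 1 + norm (y - x0)" for y
      using sqrt_sum_squares_le_sum[of 1 "norm (y - x0)"] by (auto simp: S_def real_le_rsqrt)
    define f where "f k y = v y $ k - K * S y" for k y
    obtain j y where max: "\<And>i z. f i z \<le> f j y"
    proof (rule finite_family_attains_sup[of UNIV f x0 k "norm x0 + 2 * B + K * S x0"])
      show "continuous_on UNIV (f i)" for i
        unfolding f_def S_def by (intro continuous_intros B(2))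
      fix i z assume "f k x0 \<le> f i z"
      then have "K * S z \<le> 2 * B + K * S x0"
        using B(1)[of z i] B(1)[of x0 k] by (simp add: f_def abs_le_iff)
      moreover have "1 * norm (z - x0) \<le> K * S z"
        using K S[of z] by (intro mult_mono) auto
      ultimately show "norm z \<le> norm x0 + 2 * B + K * S x0"
        using norm_triangle_sub[of z x0] by simp
    qed auto
    define P where "P = (K / S y) *\<^sub>R (y - x0)"
    have "upper_jet (\<lambda>y. 1 * v y $ j) y P (\<lambda>h. (2 * (K / (2 * S y))) *\<^sub>R h)"
    proof (rule upper_jet_quadraticI)
      fix h
      have "S (y + h) \<le> S y + ((y - x0) \<bullet> h) / S y + (norm h)\<^sup>2 / (2 * S y)"
        using sqrt_norm_sq_le_quadratic[of 1 "y - x0" h] by (simp add: S_def add_diff_eq diff_add_eq)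
      then have "K * S (y + h) \<le> K * (S y + ((y - x0) \<bullet> h) / S y + (norm h)\<^sup>2 / (2 * S y))"
        using K by (intro mult_left_mono) auto
      also have "\<dots> = K * S y + P \<bullet> h + K / (2 * S y) * (norm h)\<^sup>2"
        by (simp add: P_def distrib_left)
      finally show "1 * v (y + h) $ j \<le> 1 * v y $ j + P \<bullet> h + K / (2 * S y) * (norm h)\<^sup>2"
        using max[of j "y + h"] by (simp add: f_def)
    qed
    from corrector_jetD[OF v _ this]
    have "\<delta> * v y $ j + H j (p + P) (vec r) (gap j (v y)) y \<le> 2 * (K / (2 * S y)) * CA"
      using K S(1)[of y] by simp
    also have "2 * (K / (2 * S y)) = K / S y"
      by simp
    also have "K / S y * CA \<le> K / 1 * CA"
      using K S(1)[of y] CA by (intro mult_right_mono divide_left_mono) auto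
    finally have le: "H j (p + P) (vec r) (gap j (v y)) y \<le> K * CA + C0"
      using C0(2)[OF adm, of y j] by (simp add: abs_le_iff)
    have "norm (y - x0) \<le> 1"
    proof (rule ccontr)
      assume "\<not> norm (y - x0) \<le> 1"
      then have "S y \<le> 2 * norm (y - x0)"
        using S(3)[of y] by simp
      then have "K / 2 \<le> norm P"
        using K S(1)[of y] unfolding P_def norm_scaleR by (simp add: field_simps)
      moreover have "norm P - norm p \<le> norm (p + P)"
        using norm_triangle_ineq2[of P "- p"] by (simp add: add.commute)
      ultimately have "norm (p + P) \<ge> K / 2 - \<bar>R\<bar>"
        using R by linarith
      then have "a * (K / 2 - \<bar>R\<bar>) \<le> a * norm (p + P)"
        using a by (intro mult_left_mono) auto
      also have "\<dots> \<le> K * CA + C0 + C1"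
        using C1[OF admissible_norm_vec[OF adm] others_gap(1), of "p + P" j "v y" y] le by linarith
      finally have "(CA + 1) * K - a * \<bar>R\<bar> \<le> K * CA + C0 + C1"
        by (simp add: a_def algebra_simps)
      then show False
        by (simp add: K_def algebra_simps)
    qed
    then have "v y $ j \<le> local_max v x0"
      by (rule local_max(1)[OF v])
    moreover have "K * S x \<le> K * (1 + norm (x - x0))" "K * 1 \<le> K * S y"
      using K S(3)[of x] S(1)[of y] by (auto intro: mult_left_mono)
    ultimately show ?thesis
      using max[of k x] by (simp add: f_def distrib_left)
  qed
  then show ?thesis
    using K that by blast
qed

text \<open>Touch a component that attains the local maximum by a paraboloid. The equation bounds
  \<open>H\<close> from above at the contact point, and coercivity in \<open>s\<close> turns this
  into a bound for the gap to component \<open>k\<close>, at this one point only.\<close>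

lemma corrector_comparable:
  obtains C where "C \<ge> 0"
    "\<And>p r \<delta> v x0 k. admissible R p r \<delta> v \<Longrightarrow> \<exists>x. norm (x - x0) \<le> 2 \<and> v x $ k \<ge> local_max v x0 - C"
proof -
  obtain C0 where C0: "C0 \<ge> 0" "\<And>p r \<delta> v y k. admissible R p r \<delta> v \<Longrightarrow> \<bar>\<delta> * v y $ k\<bar> \<le> C0"
    using admissible_delta_bound[of R] by metis
  obtain K where K: "K \<ge> 1"
    "\<And>p r \<delta> v x x0 k. admissible R p r \<delta> v \<Longrightarrow> v x $ k \<le> local_max v x0 + K * norm (x - x0)"
    using corrector_growth[of R] by metis
  obtain c C1 where c: "c > 0" and C1: "\<And>k p r s y i. norm r \<le> real CARD('m) * R \<Longrightarrow> s \<in> others k \<Longrightarrow> c * s $ i - C1 \<le> H k p r s y"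
    using coercive_s by blast
  define C where "C = (4 * K * CA + C0 + \<bar>C1\<bar>) / c"
  have C: "C \<ge> 0"
    using K(1) CA C0(1) c by (simp add: C_def)
  have "\<exists>x. norm (x - x0) \<le> 2 \<and> v x $ k \<ge> local_max v x0 - C" if adm: "admissible R p r \<delta> v" for p r \<delta> v x0 k
  proof -
    have v: "corrector p r \<delta> v" and \<delta>: "0 < \<delta>"
      using adm by (auto simp: admissible_def)
    obtain B where B: "\<And>x k. \<bar>v x $ k\<bar> \<le> B" "\<And>k. continuous_on UNIV (\<lambda>x. v x $ k)"
      using corrector_components[OF v] by metis
    obtain j x' where x': "norm (x' - x0) \<le> 1" "v x' $ j = local_max v x0"
      using local_max(2)[OF v] by metis
    \<comment> \<open>Opening against the growth rate \<open>K\<close>: at the maximum 2 t^2 <= t +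
      1, so the contact point is within distance 1 of \<open>x'\<close> and 2 of
      \<open>x0\<close>.\<close>
    define f where "f y = v y $ j - 2 * K * (norm (y - x'))\<^sup>2" for y
    obtain i y where max: "\<And>z. f z \<le> f y"
    proof (rule finite_family_attains_sup[of UNIV "\<lambda>i :: unit. f" x' "()" "norm x' + sqrt (2 * B)"])
      show "continuous_on UNIV f"
        unfolding f_def by (intro continuous_intros B(2))
      fix i :: unit and z assume "f x' \<le> f z"
      then have "2 * K * (norm (z - x'))\<^sup>2 \<le> 2 * B"
        using B(1)[of z j] B(1)[of x' j] by (simp add: f_def abs_le_iff)
      moreover have "1 * (norm (z - x'))\<^sup>2 \<le> 2 * K * (norm (z - x'))\<^sup>2"
        using K(1) by (intro mult_right_mono) auto
      ultimately have "norm (z - x') \<le> sqrt (2 * B)"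
        by (intro real_le_rsqrt) simp
      then show "norm z \<le> norm x' + sqrt (2 * B)"
        using norm_triangle_sub[of z x'] by simp
    qed auto
    define t where "t = norm (y - x')"
    define P where "P = (4 * K) *\<^sub>R (y - x')"
    have low: "v y $ j \<ge> local_max v x0 + 2 * K * t\<^sup>2"
      using max[of x'] x'(2) by (simp add: f_def t_def)
    have "norm (y - x0) \<le> t + 1"
      using norm_triangle_ineq[of "y - x'" "x' - x0"] x'(1) by (simp add: t_def)
    then have "K * norm (y - x0) \<le> K * (t + 1)"
      using K(1) by (intro mult_left_mono) auto
    then have "K * (2 * t\<^sup>2) \<le> K * (t + 1)"
      using K(2)[OF adm, of y j x0] low by simp
    then have "2 * t\<^sup>2 \<le> t + 1"
      using K(1) by simp
    have "t \<le> 1"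
    proof (rule ccontr)
      assume "\<not> t \<le> 1"
      then have "t < t\<^sup>2"
        by (simp add: power2_eq_square)
      then show False
        using \<open>2 * t\<^sup>2 \<le> t + 1\<close> \<open>\<not> t \<le> 1\<close> by linarith
    qed
    then have near: "norm (y - x0) \<le> 2"
      using \<open>norm (y - x0) \<le> t + 1\<close> by simp
    have "upper_jet (\<lambda>y. 1 * v y $ j) y P (\<lambda>h. (2 * (2 * K)) *\<^sub>R h)"
    proof (rule upper_jet_quadraticI)
      fix h
      have "(norm (y + h - x'))\<^sup>2 = (norm (y - x'))\<^sup>2 + 2 * ((y - x') \<bullet> h) + (norm h)\<^sup>2"
        by (simp add: power2_norm_eq_inner inner_simps inner_commute)
      from max[of "y + h", unfolded f_def this]
      show "1 * v (y + h) $ j \<le> 1 * v y $ j + P \<bullet> h + 2 * K * (norm h)\<^sup>2"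
        by (simp add: P_def distrib_left)
    qed
    from corrector_jetD[OF v _ this]
    have "\<delta> * v y $ j + H j (p + P) (vec r) (gap j (v y)) y \<le> 4 * K * CA"
      using K(1) by simp
    moreover have "c * gap j (v y) $ k - C1 \<le> H j (p + P) (vec r) (gap j (v y)) y"
      by (rule C1[OF admissible_norm_vec[OF adm] others_gap(1)])
    ultimately have "c * (v y $ j - v y $ k) \<le> 4 * K * CA + C0 + \<bar>C1\<bar>"
      using C0(2)[OF adm, of y j] abs_ge_self[of C1] unfolding gap_nth abs_le_iff by linarith
    then have "v y $ j - v y $ k \<le> C"
      using c by (simp add: C_def field_simps)
    moreover have "2 * K * t\<^sup>2 \<ge> 0"
      using K(1) by simp
    ultimately show ?thesis
      using near low by (intro exI[of _ y]) auto
  qed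
  then show ?thesis
    using C that by blast
qed

text \<open>
  Near a point where \<open>v\<close> lies deepest below its local maximum, compare \<open>v\<close> with the large multiple
  \<open>N v\<close>. At the maximum of the doubled function the k-th component is nearly the lowest one, so the
  coupling term on the \<open>N v\<close> side is bounded; as the gradients are of size \<open>N\<close> and \<open>1\<close>, the
  superlinear growth of the Hamiltonian gives a contradiction.
\<close>

lemma corrector_depth:
  obtains D where "\<And>p r \<delta> v x k. admissible R p r \<delta> v \<Longrightarrow> local_max v x - v x $ k \<le> D"
proof -
  obtain C0 where C0: "C0 \<ge> 0" "\<And>p r \<delta> v y k. admissible R p r \<delta> v \<Longrightarrow> \<bar>\<delta> * v y $ k\<bar> \<le> C0"
    using admissible_delta_bound[of R] by metis
  obtain K where K: "K \<ge> 1"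
    "\<And>p r \<delta> v x x0 k. admissible R p r \<delta> v \<Longrightarrow> v x $ k \<le> local_max v x0 + K * norm (x - x0)"
    using corrector_growth[of R] by metis
  obtain C2 where C2: "C2 \<ge> 0"
    "\<And>p r \<delta> v x0 k. admissible R p r \<delta> v \<Longrightarrow> \<exists>x. norm (x - x0) \<le> 2 \<and> v x $ k \<ge> local_max v x0 - C2"
    using corrector_comparable[of R] by metis
  \<comment> \<open>At the maximum, t = |y - x0| and s = S (x - y) will satisfy s / 2 + t^2 <= 5 + K
    + (1 + K) t, whence the bounds \<open>T\<close> and \<open>\<Sigma>\<close>; \<open>G\<close>
    bounds the excess of component \<open>k\<close> over the others at \<open>y\<close>. None
    depends on the depth or on \<open>v\<close>.\<close>
  define T where "T = 6 + 2 * K"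
  define \<Sigma> where "\<Sigma> = 2 * (5 + K + (1 + K) * T)"
  define G where "G = 6 + K * (1 + T)"
  define R' where "R' = max (\<bar>R\<bar> + 1 + 2 * T) (max (real CARD('m) * \<bar>R\<bar>) (real CARD('m) * G))"
  obtain C4 where C4: "\<And>k p r s y. norm p \<le> R' \<Longrightarrow> norm r \<le> R' \<Longrightarrow> norm s \<le> R' \<Longrightarrow> s \<in> others k \<Longrightarrow> \<bar>H k p r s y\<bar> \<le> C4"
    using H_bounded[of R'] by blast
  \<comment> \<open>\<open>b * N\<close> will bound what opposes the Hamiltonian at
    \<open>x\<close>; at gradient N / 2 the rate \<open>a\<close> produces (b + 1) N.\<close>
  define b where "b = C0 + \<bar>C4\<bar> + CA * (\<Sigma> + 2)"
  define a where "a = 2 * (b + 1)"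
  obtain C1 where C1: "\<And>k p r s y. norm r \<le> real CARD('m) * R \<Longrightarrow> s \<in> others k \<Longrightarrow> a * norm p - C1 \<le> H k p r s y"
    using superlinear by blast
  have T: "T \<ge> 8" and \<Sigma>: "\<Sigma> \<ge> 0" and G: "G \<ge> 0"
    using K(1) by (auto simp: T_def \<Sigma>_def G_def intro!: add_nonneg_nonneg mult_nonneg_nonneg)
  have b: "b \<ge> 0"
    using C0 CA \<Sigma> by (simp add: b_def)
  then have a: "a \<ge> 2"
    by (simp add: a_def)
  \<comment> \<open>The sum of everything that \<open>N\<close> has to exceed. It is fixed before
    \<open>v\<close>, so that \<open>D0\<close> is uniform in \<delta>.\<close>
  define N where "N = 1 + 2 * K + C2 + K * (\<Sigma> + T) + a * \<bar>R\<bar> + \<bar>C1\<bar> + C0"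
  have N: "N \<ge> 1" "N \<ge> 2 * K" "N \<ge> C2" "N \<ge> K * (\<Sigma> + T)" "N \<ge> a * \<bar>R\<bar> + \<bar>C1\<bar> + C0 + 1"
    using K(1) C2(1) C0(1) \<Sigma> T a by (auto simp: N_def intro!: add_nonneg_nonneg mult_nonneg_nonneg add_increasing add_increasing2)
  define D0 where "D0 = 1 + 5 * N + N * (K * (1 + T))"
  have "local_max v x - v x $ k \<le> D0" if adm: "admissible R p r \<delta> v" for p r \<delta> v x k
  proof -
    have v: "corrector p r \<delta> v" and \<delta>: "0 < \<delta>" and p: "norm p \<le> R" and r: "\<bar>r\<bar> \<le> R"
      using adm by (auto simp: admissible_def)
    obtain L B where L: "L > 0" "\<And>x y k. \<bar>v x $ k - v y $ k\<bar> \<le> L * norm (x - y)"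
      and B: "\<And>x k. \<bar>v x $ k\<bar> \<le> B" and cont: "\<And>k. continuous_on UNIV (\<lambda>x. v x $ k)"
      using corrector_components[OF v] by metis
    \<comment> \<open>Finite for each \<open>v\<close>, by a bound depending on \<open>v\<close>;
      the claim is that it never exceeds \<open>D0\<close>. The supremum need not be attained,
      whence the base point of depth more than \<open>D - 1\<close>.\<close>
    define D where "D = (SUP s. local_max v (snd s) - v (snd s) $ fst s)"
    have bdd: "bdd_above (range (\<lambda>s. local_max v (snd s) - v (snd s) $ fst s))"
    proof (rule bdd_aboveI2)
      fix s :: "'m \<times> (real ^ 'n)"
      obtain j z where "v z $ j = local_max v (snd s)"
        using local_max(2)[OF v] by metis
      then show "local_max v (snd s) - v (snd s) $ fst s \<le> 2 * B"
        using B[of z j] B[of "snd s" "fst s"] by (simp add: abs_le_iff)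
    qed
    have D: "local_max v x - v x $ k \<le> D" for x k
      unfolding D_def using cSUP_upper[OF UNIV_I bdd, of "(k, x)"] by simp
    have "\<exists>s. D - 1 < local_max v (snd s) - v (snd s) $ fst s"
    proof (rule ccontr)
      assume "\<not> ?thesis"
      then have "D \<le> D - 1"
        unfolding D_def by (intro cSUP_least) (auto simp: not_less)
      then show False
        by simp
    qed
    then obtain k0 x0 where deep: "D - 1 < local_max v x0 - v x0 $ k0"
      by auto
    define c where "c = local_max v x0"
    define f where "f k x = v x $ k - c" for k x
    have f_up: "f k x \<le> K * norm (x - x0)" for k x
      using K(2)[OF adm, of x k x0] by (simp add: f_def c_def)
    have f_low: "f k x \<ge> - D - K * (1 + norm (x - x0))" for k x
    proof -
      obtain j z where z: "norm (z - x0) \<le> 1" "v z $ j = c"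
        using local_max(2)[OF v, of x0] unfolding c_def by metis
      have "norm (z - x) \<le> 1 + norm (x - x0)"
        using norm_triangle_ineq4[of "z - x0" "x - x0"] z(1) by simp
      then have "K * norm (z - x) \<le> K * (1 + norm (x - x0))"
        using K(1) by (intro mult_left_mono) auto
      then show ?thesis
        using K(2)[OF adm, of z j x] z(2) D[of x k] by (simp add: f_def)
    qed
    have f0: "f k0 x0 < 1 - D"
      using deep by (simp add: f_def c_def)
    obtain x1 where x1: "norm (x1 - x0) \<le> 2" "f k0 x1 \<ge> - C2"
      using C2(2)[OF adm, of x0 k0] by (auto simp: f_def c_def)
    \<comment> \<open>\<open>L\<close> is the uncontrolled Lipschitz constant of \<open>v\<close>.
      \<open>\<tau>\<close> separates the two cases below; the bounds on \<open>S\<close> use only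
      \<open>\<tau> \<le> 1\<close>, so that \<open>L\<close> enters none of the constants
      above.\<close>
    define \<tau> where "\<tau> = min 1 (1 / (L + 1))"
    have \<tau>: "\<tau> > 0" "\<tau> \<le> 1" "L * \<tau> \<le> 1"
      using L(1) by (auto simp: \<tau>_def min_def field_simps)
    define S where "S z = sqrt (\<tau>\<^sup>2 + (norm z)\<^sup>2)" for z :: "real ^ 'n"
    have S: "S z \<ge> norm z" "S z \<le> 1 + norm z" "S z > 0" for z
    proof -
      show "S z \<ge> norm z"
        by (simp add: S_def real_le_rsqrt)
      show "S z \<le> 1 + norm z"
        using sqrt_sum_squares_le_sum[of \<tau> "norm z"] \<tau> by (simp add: S_def)
      have "\<tau>\<^sup>2 + (norm z)\<^sup>2 > 0"
        using \<tau> by (intro add_pos_nonneg) auto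
      then show "S z > 0"
        by (simp add: S_def)
    qed
    define \<Theta> where "\<Theta> k s = f k (fst s) - N * f k (snd s) - N * S (fst s - snd s) - N * (norm (snd s - x0))\<^sup>2" for k s
    have base: "\<Theta> k0 (x1, x0) \<ge> N * D - 5 * N"
    proof -
      have "N * f k0 x0 \<le> N - N * D"
        using f0 N(1) mult_left_mono[of "f k0 x0" "1 - D" N] by (simp add: right_diff_distrib)
      moreover have "N * S (x1 - x0) \<le> N * 3"
        using N(1) S(2)[of "x1 - x0"] x1(1) by (intro mult_left_mono) auto
      moreover have "\<Theta> k0 (x1, x0) = f k0 x1 - N * f k0 x0 - N * S (x1 - x0)"
        by (simp add: \<Theta>_def)
      ultimately show ?thesis
        using x1(2) N(1,3) by linarith
    qed
    have bounds: "S (x - y) \<le> \<Sigma> \<and> norm (y - x0) \<le> T" if "\<Theta> k0 (x1, x0) \<le> \<Theta> k (x, y)" for k x y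
    proof -
      define t where "t = norm (y - x0)"
      define s where "s = S (x - y)"
      have t: "t \<ge> 0"
        by (simp add: t_def)
      have "norm (x - x0) \<le> s + t"
        using norm_triangle_ineq[of "x - y" "y - x0"] S(1)[of "x - y"] by (simp add: s_def t_def)
      then have "f k x \<le> K * (s + t)"
        using f_up[of k x] K(1) by (meson mult_left_mono order_trans zero_le_one)
      moreover have "K * s \<le> (N / 2) * s" "K * t \<le> N * t"
        using N S(3)[of "x - y"] t by (auto simp: s_def intro!: mult_right_mono)
      moreover have "- (N * f k y) \<le> N * (D + K * (1 + t))"
      proof -
        have "- f k y \<le> D + K * (1 + t)"
          using f_low[of y k] by (simp add: t_def)
        then have "N * - f k y \<le> N * (D + K * (1 + t))"
          using N(1) by (intro mult_left_mono) auto
        then show ?thesis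
          by simp
      qed
      ultimately have "\<Theta> k (x, y) \<le> N * (D + K * (1 + t) + t - s / 2 - t\<^sup>2)"
        by (simp add: \<Theta>_def s_def[symmetric] t_def[symmetric] algebra_simps)
      then have "N * (D - 5) \<le> N * (D + K * (1 + t) + t - s / 2 - t\<^sup>2)"
        using base that by (simp add: algebra_simps)
      then have key: "s / 2 + t\<^sup>2 \<le> 5 + K + (1 + K) * t"
      proof -
        have "D - 5 \<le> D + K * (1 + t) + t - s / 2 - t\<^sup>2"
          using \<open>N * (D - 5) \<le> _\<close> N(1) by (intro mult_left_le_imp_le[of N "D - 5"]) auto
        then show ?thesis
          by (simp add: algebra_simps)
      qed
      have tT: "t \<le> T"
      proof (rule ccontr)
        assume "\<not> t \<le> T"
        then have "T * t \<le> t\<^sup>2"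
          using t unfolding power2_eq_square by (intro mult_right_mono) auto
        moreover have "(5 + K) * 1 \<le> (5 + K) * t"
          using K(1) T \<open>\<not> t \<le> T\<close> by (intro mult_left_mono) auto
        ultimately have "s / 2 \<le> 0"
          using key by (simp add: T_def algebra_simps)
        then show False
          using S(3)[of "x - y"] by (simp add: s_def)
      qed
      then have "(1 + K) * t \<le> (1 + K) * T"
        using K(1) by (intro mult_left_mono) auto
      show ?thesis
      proof -
        have "s / 2 + t\<^sup>2 \<le> 5 + K + (1 + K) * T"
          using order_trans[OF key add_left_mono[OF \<open>(1 + K) * t \<le> (1 + K) * T\<close>]] .
        moreover have "t\<^sup>2 \<ge> 0"
          by simp
        ultimately have "s \<le> \<Sigma>"
          unfolding \<Sigma>_def by argo
        then show ?thesis
          using tT by (simp add: s_def t_def)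
      qed
    qed
    obtain k s where max0: "\<And>j s'. \<Theta> j s' \<le> \<Theta> k s"
    proof (rule finite_family_attains_sup[of UNIV \<Theta> "(x1, x0)" k0 "\<Sigma> + 2 * (T + norm x0)"])
      show "continuous_on UNIV (\<Theta> k)" for k
        unfolding \<Theta>_def f_def S_def
        by (intro continuous_intros continuous_on_compose2[OF cont]) auto
      fix j s assume "\<Theta> k0 (x1, x0) \<le> \<Theta> j s"
      then have b: "S (fst s - snd s) \<le> \<Sigma>" "norm (snd s - x0) \<le> T"
        using bounds[of j "fst s" "snd s"] by auto
      have "norm (fst s) \<le> \<Sigma> + norm (snd s)"
        using norm_triangle_sub[of "fst s" "snd s"] S(1)[of "fst s - snd s"] b by simp
      moreover have "norm (snd s) \<le> T + norm x0"
        using norm_triangle_sub[of "snd s" x0] b by simp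
      ultimately show "norm s \<le> \<Sigma> + 2 * (T + norm x0)"
        using norm_Pair_le[of "fst s" "snd s"] by simp
    qed auto
    define x y where "x = fst s" and "y = snd s"
    have max: "\<Theta> j (x', y') \<le> \<Theta> k (x, y)" for j x' y'
      using max0 by (simp add: x_def y_def)
    define \<rho> where "\<rho> = S (x - y)"
    have \<rho>: "0 < \<rho>" "\<rho> \<le> \<Sigma>" and yT: "norm (y - x0) \<le> T"
      using bounds[OF max] S(3) by (auto simp: \<rho>_def)
    have \<Theta>_ge: "\<Theta> k (x, y) \<ge> N * D - 5 * N"
      using base max by (meson order_trans)
    \<comment> \<open>Near the diagonal \<open>v\<close> differs by at most 1 between the two
      points, so \<Theta> is at most about (N - 1) D, against a value of at least N D - 5 N: the
      depth is bounded outright. Away from it the penalization has slope at least N / 2, and the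
      equations are contradictory.\<close>
    show ?thesis
    proof (cases "norm (x - y) < \<tau>")
      case True
      have "f k x \<le> f k y + 1"
      proof -
        have "f k x - f k y \<le> L * norm (x - y)"
          using L(2)[of x k y] by (simp add: f_def abs_le_iff)
        also have "\<dots> \<le> L * \<tau>"
          using True L(1) by (intro mult_left_mono) auto
        finally show ?thesis
          using \<tau>(3) by simp
      qed
      moreover have "- ((N - 1) * f k y) \<le> (N - 1) * (D + K * (1 + T))"
      proof -
        have "K * (1 + norm (y - x0)) \<le> K * (1 + T)"
          using K(1) yT by (intro mult_left_mono) auto
        then have "- f k y \<le> D + K * (1 + T)"
          using f_low[of y k] by simp
        then show ?thesis
          using N(1) mult_left_mono[of "- f k y" "D + K * (1 + T)" "N - 1"] by simp
      qed
      moreover have "N * S (x - y) \<ge> 0" "N * (norm (y - x0))\<^sup>2 \<ge> 0" "K * (1 + T) \<ge> 0"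
        using N(1) S(3)[of "x - y"] K(1) T by auto
      ultimately have "D \<le> D0"
        using \<Theta>_ge by (simp add: \<Theta>_def D0_def algebra_simps)
      then show ?thesis
        using D by (meson order_trans)
    next
      case False
      define P where "P = (N / \<rho>) *\<^sub>R (x - y)"
      define Q where "Q = - P + (2 * N) *\<^sub>R (y - x0)"
      define Tq where "Tq z = ((N / \<rho>) *\<^sub>R (fst z - snd z), (N / \<rho>) *\<^sub>R (snd z - fst z) + (2 * N) *\<^sub>R snd z)"
        for z :: "(real ^ 'n) \<times> (real ^ 'n)"
      have Tq: "z \<bullet> Tq z = (N / \<rho>) * (norm (fst z - snd z))\<^sup>2 + 2 * N * (norm (snd z))\<^sup>2" for z
        by (simp add: Tq_def inner_prod_def power2_norm_eq_inner inner_simps inner_commute algebra_simps)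
      let ?F1 = "\<lambda>x Q. 1 * (\<delta> * v x $ k + H k (p + 1 *\<^sub>R Q) (vec r) (gap k (v x)) x)"
      let ?F2 = "\<lambda>x Q. N * (- 1 * (\<delta> * v x $ k + H k (p + (- 1) *\<^sub>R (Q /\<^sub>R N)) (vec r) (gap k (v x)) x))"
      have "?F1 x P + ?F2 y Q \<le> (\<Sum>j<d k. (\<sigma> k x j, \<sigma> k y j) \<bullet> Tq (\<sigma> k x j, \<sigma> k y j))"
      proof (rule jet_subsolution_sum[where A = UNIV and B = UNIV and r = 1
            and u = "\<lambda>x. 1 * v x $ k" and w = "\<lambda>y. N * (- 1 * v y $ k)"
            and F = ?F1 and G = ?F2 and s = "\<lambda>j x. \<sigma> k x j" and t = "\<lambda>j x. \<sigma> k x j"])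
        show "jet_subsolution UNIV (\<lambda>x. 1 * v x $ k) ?F1 (\<lambda>j x. \<sigma> k x j) (d k)"
          using v unfolding corrector_def by blast
        show "jet_subsolution UNIV (\<lambda>y. N * (- 1 * v y $ k)) ?F2 (\<lambda>j y. \<sigma> k y j) (d k)"
          using v N(1) unfolding corrector_def by (intro jet_subsolution_scale) auto
        show "continuous_on UNIV (\<lambda>x. 1 * v x $ k)" "continuous_on UNIV (\<lambda>y. N * (- 1 * v y $ k))"
          by (intro continuous_intros cont)+
        show "linear Tq"
          unfolding Tq_def by (rule linearI) (simp_all add: algebra_simps)
        show "Tq z \<bullet> z' = z \<bullet> Tq z'" for z z'
          by (simp add: Tq_def inner_prod_def inner_simps inner_commute algebra_simps)
        have vc: "isCont v z" for z
        proof -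
          obtain L' where "L'-lipschitz_on UNIV v"
            using v by (auto simp: corrector_def)
          then show ?thesis
            using lipschitz_on_continuous_on continuous_on_eq_continuous_at by blast
        qed
        have lim: "((\<lambda>z. v (fst z)) \<longlongrightarrow> v x) (at (x, P))" for x P :: "real ^ 'n"
          using isCont_tendsto_compose[OF vc[of x], of fst "at (x, P)"] tendsto_fst[OF tendsto_ident_at, of "(x, P)" UNIV] by simp
        have lim': "((\<lambda>z. fst z) \<longlongrightarrow> x) (at (x, P))" "((\<lambda>z. snd z) \<longlongrightarrow> P) (at (x, P))" for x P :: "real ^ 'n"
          using tendsto_fst[OF tendsto_ident_at, of "(x, P)" UNIV] tendsto_snd[OF tendsto_ident_at, of "(x, P)" UNIV] by auto
        show "isCont (\<lambda>(x, P). ?F1 x P) (x, P)" "isCont (\<lambda>(x, P). ?F2 x P) (y, Q)"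
          unfolding isCont_def case_prod_beta fst_conv snd_conv
          by (intro tendsto_intros tendsto_H lim lim' others_gap)+
        show "isCont (\<lambda>y. \<sigma> k y j) x" "isCont (\<lambda>y. \<sigma> k y j) y" if "j < d k" for j
          using isCont_sigma[OF that] by auto
        fix h h' :: "real ^ 'n"
        have "S (x + h - (y + h')) \<le> \<rho> + ((x - y) \<bullet> (h - h')) / \<rho> + (norm (h - h'))\<^sup>2 / (2 * \<rho>)"
          using sqrt_norm_sq_le_quadratic[OF \<tau>(1), of "x - y" "h - h'"]
          by (simp add: S_def \<rho>_def algebra_simps)
        then have "N * S (x + h - (y + h')) \<le> N * (\<rho> + ((x - y) \<bullet> (h - h')) / \<rho> + (norm (h - h'))\<^sup>2 / (2 * \<rho>))"
          using N(1) by (intro mult_left_mono) auto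
        also have "\<dots> = N * \<rho> + P \<bullet> h - P \<bullet> h' + (N / \<rho>) * (norm (h - h'))\<^sup>2 / 2"
          by (simp add: P_def inner_simps algebra_simps diff_divide_distrib add_divide_distrib)
        finally have 1: "N * S (x + h - (y + h')) \<le> N * \<rho> + P \<bullet> h - P \<bullet> h' + (N / \<rho>) * (norm (h - h'))\<^sup>2 / 2" .
        have "(norm (y + h' - x0))\<^sup>2 = (norm (y - x0))\<^sup>2 + 2 * ((y - x0) \<bullet> h') + (norm h')\<^sup>2"
          by (simp add: power2_norm_eq_inner inner_simps inner_commute)
        then have 2: "N * (norm (y + h' - x0))\<^sup>2 = N * (norm (y - x0))\<^sup>2 + (Q + P) \<bullet> h' + N * (norm h')\<^sup>2"
          by (simp add: Q_def distrib_left)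
        have "v (x + h) $ k - N * v (y + h') $ k - N * S (x + h - (y + h')) - N * (norm (y + h' - x0))\<^sup>2
            \<le> v x $ k - N * v y $ k - N * \<rho> - N * (norm (y - x0))\<^sup>2"
          using max[of k "x + h" "y + h'"] by (simp add: \<Theta>_def f_def \<rho>_def algebra_simps)
        then show "1 * v (x + h) $ k + N * (- 1 * v (y + h') $ k) \<le> 1 * v x $ k + N * (- 1 * v y $ k)
            + P \<bullet> h + Q \<bullet> h' + ((h, h') \<bullet> Tq (h, h')) / 2"
          using 1 unfolding 2 Tq by (simp add: inner_simps add_divide_distrib)
      qed auto
      also have "\<dots> \<le> N * CA * (\<Sigma> + 2)"
      proof -
        have "(\<Sum>j<d k. (\<sigma> k x j, \<sigma> k y j) \<bullet> Tq (\<sigma> k x j, \<sigma> k y j)) =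
            (N / \<rho>) * (\<Sum>j<d k. (norm (\<sigma> k x j - \<sigma> k y j))\<^sup>2) + 2 * N * (\<Sum>j<d k. (norm (\<sigma> k y j))\<^sup>2)"
          by (simp add: Tq sum.distrib sum_distrib_left)
        also have "\<dots> \<le> (N / \<rho>) * (CA * \<rho>\<^sup>2) + 2 * N * CA"
        proof (intro add_mono mult_left_mono sigma_bound)
          have "(norm (x - y))\<^sup>2 \<le> \<rho>\<^sup>2"
            using S(1) by (auto simp: \<rho>_def intro: power_mono)
          then show "(\<Sum>j<d k. (norm (\<sigma> k x j - \<sigma> k y j))\<^sup>2) \<le> CA * \<rho>\<^sup>2"
            using sigma_lipschitz[of k x y] CA by (meson mult_left_mono order_trans)
        qed (use N(1) \<rho> in auto)
        also have "\<dots> = N * CA * (\<rho> + 2)"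
          using \<rho>(1) by (simp add: power2_eq_square algebra_simps)
        also have "\<dots> \<le> N * CA * (\<Sigma> + 2)"
          using \<rho>(2) N(1) CA by (intro mult_left_mono) auto
        finally show ?thesis .
      qed
      finally have main: "?F1 x P + ?F2 y Q \<le> N * CA * (\<Sigma> + 2)" .
      \<comment> \<open>The maximum forces \<open>f k y \<le> 6 - D\<close>, while no component near
        \<open>x0\<close> lies much below \<open>- D\<close>: component \<open>k\<close> is the
        lowest at \<open>y\<close> up to \<open>G\<close>.\<close>
      have gapG: "gap k (v y) $ j \<le> (\<chi> j. if j = k then 0 else G) $ j" for j
      proof -
        have "K * norm (x - x0) \<le> K * (\<Sigma> + T)"
          using norm_triangle_ineq[of "x - y" "y - x0"] S(1)[of "x - y"] \<rho>(2) yT K(1)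
          by (intro mult_left_mono) (auto simp: \<rho>_def)
        then have "f k x \<le> N"
          using f_up[of k x] N(4) by linarith
        moreover have "N * S (x - y) \<ge> 0" "N * (norm (y - x0))\<^sup>2 \<ge> 0"
          using N(1) S(3)[of "x - y"] by auto
        ultimately have "N * (D - 5) \<le> N * (1 - f k y)"
          using \<Theta>_ge by (simp add: \<Theta>_def algebra_simps)
        then have "f k y \<le> 6 - D"
          using N(1) by simp
        moreover have "K * (1 + norm (y - x0)) \<le> K * (1 + T)"
          using K(1) yT by (intro mult_left_mono) auto
        ultimately have "v y $ k - v y $ j \<le> G"
          using f_low[of y j] by (simp add: f_def G_def)
        then show ?thesis
          by simp
      qed
      have nQ: "norm (p + (- 1) *\<^sub>R (Q /\<^sub>R N)) \<le> R'"
      proof -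
        have "(- 1) *\<^sub>R (Q /\<^sub>R N) = (1 / \<rho>) *\<^sub>R (x - y) - 2 *\<^sub>R (y - x0)"
        proof -
          have "inverse N * (N / \<rho>) = 1 / \<rho>" "inverse N * (2 * N) = 2"
            using N(1) by auto
          then have "Q /\<^sub>R N = - ((1 / \<rho>) *\<^sub>R (x - y)) + 2 *\<^sub>R (y - x0)"
            unfolding Q_def P_def by (simp only: scaleR_add_right scaleR_minus_right scaleR_scaleR)
          then show ?thesis
            by (simp only: scaleR_minus_left scaleR_one) simp
        qed
        moreover have "norm ((1 / \<rho>) *\<^sub>R (x - y)) \<le> 1"
          using \<rho>(1) S(1)[of "x - y"] by (simp add: \<rho>_def)
        moreover have "norm (2 *\<^sub>R (y - x0)) \<le> 2 * T"
          using yT by simp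
        ultimately have "norm (p + (- 1) *\<^sub>R (Q /\<^sub>R N)) \<le> R + (1 + 2 * T)"
          using p norm_triangle_ineq4[of "(1 / \<rho>) *\<^sub>R (x - y)" "2 *\<^sub>R (y - x0)"]
          by (intro norm_triangle_le) auto
        also have "\<dots> \<le> R'"
          by (simp add: R'_def)
        finally show ?thesis .
      qed
      have "H k (p + (- 1) *\<^sub>R (Q /\<^sub>R N)) (vec r) (gap k (v y)) y
          \<le> H k (p + (- 1) *\<^sub>R (Q /\<^sub>R N)) (vec r) (\<chi> j. if j = k then 0 else G) y"
        using gapG by (intro mono_s) (auto simp: others_def)
      also have "\<dots> \<le> \<bar>C4\<bar>"
      proof -
        have "norm (\<chi> j. if j = k then 0 else G :: real ^ 'm) \<le> real CARD('m) * G"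
          using G by (intro norm_le_card_component) simp
        also have "\<dots> \<le> R'"
          by (simp add: R'_def)
        finally have "norm (\<chi> j. if j = k then 0 else G :: real ^ 'm) \<le> R'" .
        moreover have "norm (vec r :: real ^ 'm) \<le> R'"
          using admissible_norm_vec[OF adm] r by (simp add: R'_def)
        ultimately have "\<bar>H k (p + (- 1) *\<^sub>R (Q /\<^sub>R N)) (vec r) (\<chi> j. if j = k then 0 else G) y\<bar> \<le> C4"
          using nQ by (intro C4) (auto simp: others_def)
        then show ?thesis
          by linarith
      qed
      finally have Hy: "H k (p + (- 1) *\<^sub>R (Q /\<^sub>R N)) (vec r) (gap k (v y)) y \<le> \<bar>C4\<bar>" .
      have "\<delta> * v y $ k \<le> C0" "\<delta> * v x $ k \<ge> - C0"
        using C0(2)[OF adm, of y k] C0(2)[OF adm, of x k] by (auto simp: abs_le_iff)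
      then have "\<delta> * v y $ k + H k (p + (- 1) *\<^sub>R (Q /\<^sub>R N)) (vec r) (gap k (v y)) y \<le> C0 + \<bar>C4\<bar>"
        using Hy by linarith
      then have "N * (\<delta> * v y $ k + H k (p + (- 1) *\<^sub>R (Q /\<^sub>R N)) (vec r) (gap k (v y)) y) \<le> N * (C0 + \<bar>C4\<bar>)"
        using N(1) by (intro mult_left_mono) auto
      moreover have "?F2 y Q = - (N * (\<delta> * v y $ k + H k (p + (- 1) *\<^sub>R (Q /\<^sub>R N)) (vec r) (gap k (v y)) y))"
        by (simp only: mult_minus_left mult_minus_right mult_1_left)
      ultimately have F2: "?F2 y Q \<ge> - (N * (C0 + \<bar>C4\<bar>))"
        by linarith
      have nP: "norm P \<ge> N / 2"
      proof -
        have "\<tau>\<^sup>2 \<le> (norm (x - y))\<^sup>2"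
          using False \<tau>(1) by (intro power_mono) auto
        then have "\<rho> \<le> sqrt ((2 * norm (x - y))\<^sup>2)"
        proof -
          have "(2 * norm (x - y))\<^sup>2 = 4 * (norm (x - y))\<^sup>2"
            by (simp add: power_mult_distrib)
          then have "\<tau>\<^sup>2 + (norm (x - y))\<^sup>2 \<le> (2 * norm (x - y))\<^sup>2"
            using \<open>\<tau>\<^sup>2 \<le> (norm (x - y))\<^sup>2\<close> zero_le_power2[of "norm (x - y)"] by linarith
          then show ?thesis
            unfolding \<rho>_def S_def by (rule real_sqrt_le_mono)
        qed
        then have "\<rho> \<le> 2 * norm (x - y)"
          unfolding real_sqrt_abs by simp
        then show ?thesis
          using N(1) \<rho>(1) unfolding P_def norm_scaleR by (simp add: field_simps)
      qed
      have "norm (p + P) \<ge> N / 2 - \<bar>R\<bar>"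
        using norm_triangle_ineq2[of P "- p"] nP p by (simp add: add.commute)
      then have "a * (N / 2 - \<bar>R\<bar>) \<le> a * norm (p + P)"
        using a by (intro mult_left_mono) auto
      also have "\<dots> \<le> H k (p + P) (vec r) (gap k (v x)) x + C1"
        using C1[OF admissible_norm_vec[OF adm] others_gap(1), of "p + P" k "v x" x] by simp
      finally have "a * (N / 2 - \<bar>R\<bar>) - C1 - C0 \<le> N * (C0 + \<bar>C4\<bar>) + N * CA * (\<Sigma> + 2)"
        using main F2 \<open>\<delta> * v x $ k \<ge> - C0\<close> by simp
      also have "\<dots> = b * N"
        by (simp add: b_def algebra_simps)
      finally have "N \<le> a * \<bar>R\<bar> + C1 + C0"
        by (simp add: a_def algebra_simps)
      then have False
        using N(5) by linarith
      then show ?thesis ..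
    qed
  qed
  then show ?thesis
    by (rule that)
qed

theorem corrector_oscillation:
  obtains C where "C \<ge> 0" "\<And>p r \<delta> v x j k. admissible R p r \<delta> v \<Longrightarrow> \<bar>v x $ k - v x $ j\<bar> \<le> C"
    "\<And>p r \<delta> v x k. admissible R p r \<delta> v \<Longrightarrow> \<bar>\<delta> * v x $ k\<bar> \<le> C"
proof -
  obtain C0 where C0: "C0 \<ge> 0" "\<And>p r \<delta> v y k. admissible R p r \<delta> v \<Longrightarrow> \<bar>\<delta> * v y $ k\<bar> \<le> C0"
    using admissible_delta_bound[of R] by metis
  obtain D where D: "\<And>p r \<delta> v x k. admissible R p r \<delta> v \<Longrightarrow> local_max v x - v x $ k \<le> D"
    using corrector_depth[of R] by metis
  have diff: "v x $ k - v x $ j \<le> D" if adm: "admissible R p r \<delta> v" for p r \<delta> v x j k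
  proof -
    have "v x $ k \<le> local_max v x"
      using adm by (intro local_max(1)) (auto simp: admissible_def)
    then show ?thesis
      using D[OF adm, of x j] by linarith
  qed
  show ?thesis
  proof (rule that[of "max C0 D"])
    show "\<bar>v x $ k - v x $ j\<bar> \<le> max C0 D" if "admissible R p r \<delta> v" for p r \<delta> v x j k
      using diff[OF that, of x k j] diff[OF that, of x j k] by (simp add: abs_le_iff le_max_iff_disj)
    show "\<bar>\<delta> * v x $ k\<bar> \<le> max C0 D" if "admissible R p r \<delta> v" for p r \<delta> v x k
      using C0(2)[OF that, of x k] by (simp add: le_max_iff_disj)
  qed (use C0 in \<open>simp add: le_max_iff_disj\<close>)
qed

end

section \<open>Perturbed test functions\<close>

context hj_coefficients
begin

text \<open>The comparison at a contact point, at a cost independent of the penalization gradient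
  \<open>\<xi>\<close>. Monotonicity first exchanges \<open>su\<close>, \<open>uv\<close> and
  \<open>r\<close>, the Lipschitz bound is applied at one common gradient, and convexity moves the
  gradient last.\<close>

lemma hamiltonian_comparison:
  "\<exists>C\<ge>0. \<forall>sg \<mu> \<nu> p r U0 e \<xi> k su sV uv x y. sg \<in> {1, - 1} \<longrightarrow> 0 < \<mu> \<longrightarrow> \<mu> \<le> 1 / 2 \<longrightarrow> 0 \<le> \<nu> \<longrightarrow> \<nu> \<le> 1 \<longrightarrow>
    norm p \<le> R \<longrightarrow> \<bar>r\<bar> \<le> R \<longrightarrow> \<bar>U0\<bar> \<le> R \<longrightarrow> norm sV \<le> R \<longrightarrow> sg * r \<le> U0 \<longrightarrow> norm e \<le> \<mu> \<longrightarrow>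
    su \<in> others k \<longrightarrow> sV \<in> others k \<longrightarrow> (\<forall>i. sg * (1 + sg * \<mu>) * sV $ i \<le> sg * su $ i) \<longrightarrow>
    (\<forall>j. sg * uv $ j \<le> U0 + \<nu>) \<longrightarrow> U0 - \<nu> \<le> sg * uv $ k \<longrightarrow>
    sg * (1 + sg * \<mu>) * H k (p + \<xi> /\<^sub>R (1 + sg * \<mu>)) (vec r) sV y - C * (\<mu> + \<nu> + norm (x - y))
      \<le> sg * H k (p + e + \<xi>) uv su x"
proof -
  define R' where "R' = max (\<bar>R\<bar> + 1) (max (real CARD('m) * (\<bar>R\<bar> + 1)) (2 * \<bar>R\<bar>))"
  have R': "\<bar>R\<bar> + 1 \<le> R'" "real CARD('m) * (\<bar>R\<bar> + 1) \<le> R'" "2 * \<bar>R\<bar> \<le> R'"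
    by (auto simp: R'_def)
  obtain C4 where C4: "\<And>k p r s y. norm p \<le> R' \<Longrightarrow> norm r \<le> R' \<Longrightarrow> norm s \<le> R' \<Longrightarrow> s \<in> others k \<Longrightarrow> \<bar>H k p r s y\<bar> \<le> C4"
    using H_bounded[of R'] by blast
  obtain C5 where C5: "C5 \<ge> 0" "\<And>k p r1 r2 s1 s2 y1 y2. norm r1 \<le> R' \<Longrightarrow> norm r2 \<le> R' \<Longrightarrow>
        norm s1 \<le> R' \<Longrightarrow> norm s2 \<le> R' \<Longrightarrow> s1 \<in> others k \<Longrightarrow> s2 \<in> others k \<Longrightarrow>
        \<bar>H k p r1 s1 y1 - H k p r2 s2 y2\<bar> \<le> C5 * (norm (r1 - r2) + norm (s1 - s2) + norm (y1 - y2))"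
    using H_lipschitz[of R'] by blast
  define C where "C = C5 * (real CARD('m) + \<bar>R\<bar> + 1) + \<bar>C4\<bar>"
  have C: "C \<ge> 0"
    using C5(1) by (simp add: C_def)
  have norm_R': "norm w \<le> R'" if "\<And>i. \<bar>w $ i\<bar> \<le> \<bar>R\<bar> + 1" for w :: "real ^ 'm"
    using norm_le_card_component[OF that] R'(2) by (rule order_trans)
  have "sg * (1 + sg * \<mu>) * H k (p + \<xi> /\<^sub>R (1 + sg * \<mu>)) (vec r) sV y - C * (\<mu> + \<nu> + norm (x - y))
      \<le> sg * H k (p + e + \<xi>) uv su x"
    if sg: "sg \<in> {1, - 1}" and \<mu>: "0 < \<mu>" "\<mu> \<le> 1 / 2" and \<nu>: "0 \<le> \<nu>" "\<nu> \<le> 1"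
      and p: "norm p \<le> R" and r: "\<bar>r\<bar> \<le> R" and U0: "\<bar>U0\<bar> \<le> R" and nsV: "norm sV \<le> R" and rU: "sg * r \<le> U0"
      and e: "norm e \<le> \<mu>" and su: "su \<in> others k" and sV: "sV \<in> others k"
      and gap: "\<And>i. sg * (1 + sg * \<mu>) * sV $ i \<le> sg * su $ i"
      and uv: "\<And>j. sg * uv $ j \<le> U0 + \<nu>" "U0 - \<nu> \<le> sg * uv $ k"
    for sg \<mu> \<nu> r U0 :: real and p e \<xi> :: "real ^ 'n" and k and su sV uv :: "real ^ 'm" and x y :: "real ^ 'n"
  proof -
    define P where "P = p + e + \<xi>"
    define c where "c = 1 + sg * \<mu>"
    have c: "1 / 2 \<le> c" "c \<le> 3 / 2"
      using sg \<mu> by (auto simp: c_def)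
    \<comment> \<open>The least favourable vector compatible with the bounds on \<open>uv\<close>:
      monotonicity lets it replace \<open>uv\<close>, and its components are within \<nu> of
      \<open>sg * U0\<close>.\<close>
    define r' where "r' = (\<chi> j. sg * (U0 + (if j = k then - \<nu> else \<nu>)))"
    have csV: "c *\<^sub>R sV \<in> others k"
      using sV by (simp add: others_def)
    have 1: "sg * H k P uv (c *\<^sub>R sV) x \<le> sg * H k P uv su x"
    proof -
      have "H k P uv (c *\<^sub>R sV) x \<le> H k P uv su x" if "sg = 1"
        using gap that by (intro mono_s su csV) (simp add: c_def)
      moreover have "H k P uv su x \<le> H k P uv (c *\<^sub>R sV) x" if "sg = - 1"
      proof (rule mono_s[OF su csV])
        show "su $ i \<le> (c *\<^sub>R sV) $ i" for i
          using gap[of i] that by (simp add: c_def algebra_simps)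
      qed
      ultimately show ?thesis
        using sg by auto
    qed
    have 2: "sg * H k P r' (c *\<^sub>R sV) x \<le> sg * H k P uv (c *\<^sub>R sV) x"
    proof -
      have "H k P r' (c *\<^sub>R sV) x \<le> H k P uv (c *\<^sub>R sV) x" if "sg = 1"
        using uv that by (intro mono_r csV) (auto simp: r'_def)
      moreover have "H k P uv (c *\<^sub>R sV) x \<le> H k P r' (c *\<^sub>R sV) x" if "sg = - 1"
      proof (rule mono_r[OF csV])
        show "uv $ k \<le> r' $ k"
          using uv(2) that by (simp add: r'_def)
        show "r' $ i \<le> uv $ i" if "i \<noteq> k" for i
          using uv(1)[of i] that \<open>sg = - 1\<close> by (simp add: r'_def)
      qed
      ultimately show ?thesis
        using sg by auto
    qed
    have 3: "sg * H k P (vec r) sV y \<le> sg * H k P (vec (sg * U0)) sV y"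
    proof -
      have "H k P (vec r) sV y \<le> H k P (vec (sg * U0)) sV y" if "sg = 1"
        using rU that by (intro mono_diag sV) simp
      moreover have "H k P (vec (sg * U0)) sV y \<le> H k P (vec r) sV y" if "sg = - 1"
        using rU that by (intro mono_diag sV) simp
      ultimately show ?thesis
        using sg by auto
    qed
    have 4: "\<bar>H k P r' (c *\<^sub>R sV) x - H k P (vec (sg * U0)) sV y\<bar> \<le> C5 * (real CARD('m) * \<nu> + \<mu> * \<bar>R\<bar> + norm (x - y))"
    proof -
      have "norm r' \<le> R'"
        using U0 \<nu> sg by (intro norm_R') (auto simp: r'_def abs_mult)
      moreover have "norm (vec (sg * U0) :: real ^ 'm) \<le> R'"
        using U0 sg by (intro norm_R') (auto simp: abs_mult)
      moreover have "norm (c *\<^sub>R sV) \<le> R'"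
      proof -
        have "norm (c *\<^sub>R sV) \<le> 2 * \<bar>R\<bar>"
          using c nsV unfolding norm_scaleR by (intro mult_mono) auto
        then show ?thesis
          using R'(3) by linarith
      qed
      moreover have "norm sV \<le> R'"
        using nsV R'(1) by linarith
      ultimately have "\<bar>H k P r' (c *\<^sub>R sV) x - H k P (vec (sg * U0)) sV y\<bar>
          \<le> C5 * (norm (r' - vec (sg * U0)) + norm (c *\<^sub>R sV - sV) + norm (x - y))"
        by (intro C5(2) csV sV)
      also have "\<dots> \<le> C5 * (real CARD('m) * \<nu> + \<mu> * \<bar>R\<bar> + norm (x - y))"
      proof (intro mult_left_mono add_mono order_refl C5(1))
        show "norm (r' - vec (sg * U0)) \<le> real CARD('m) * \<nu>"
          using sg \<nu>(1) by (intro norm_le_card_component) (auto simp: r'_def algebra_simps)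
        have "c *\<^sub>R sV - sV = (sg * \<mu>) *\<^sub>R sV"
          by (simp add: c_def scaleR_add_left)
        moreover have "\<bar>sg * \<mu>\<bar> = \<mu>"
          using sg \<mu>(1) by auto
        ultimately show "norm (c *\<^sub>R sV - sV) \<le> \<mu> * \<bar>R\<bar>"
          using nsV \<mu>(1) by (simp add: mult_left_mono)
      qed
      finally show ?thesis .
    qed
    have 5: "sg * c * H k (p + \<xi> /\<^sub>R c) (vec r) sV y - \<mu> * \<bar>C4\<bar> \<le> sg * H k P (vec r) sV y"
    proof -
      define f where "f q = H k q (vec r) sV y" for q
      have convex: "convex_on UNIV f"
        unfolding f_def by (rule convex_p[OF sV])
      have bound: "f (p + t *\<^sub>R (e /\<^sub>R \<mu>)) \<le> \<bar>C4\<bar>" if "\<bar>t\<bar> = 1" for t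
      proof -
        have "norm (t *\<^sub>R (e /\<^sub>R \<mu>)) \<le> 1"
          using e \<mu>(1) that by (simp add: field_simps)
        then have "norm (p + t *\<^sub>R (e /\<^sub>R \<mu>)) \<le> R'"
          using p R'(1) norm_triangle_ineq[of p "t *\<^sub>R (e /\<^sub>R \<mu>)"] by linarith
        moreover have "norm (vec r :: real ^ 'm) \<le> R'"
          using r by (intro norm_R') auto
        moreover have "norm sV \<le> R'"
          using nsV R'(1) by linarith
        ultimately have "\<bar>f (p + t *\<^sub>R (e /\<^sub>R \<mu>))\<bar> \<le> C4"
          unfolding f_def by (intro C4 sV)
        then show ?thesis
          by linarith
      qed
      consider "sg = 1" | "sg = - 1"
        using sg by auto
      then show ?thesis
      proof cases
        case 1
        have t: "1 - \<mu> / c = 1 / c" "0 \<le> \<mu> / c" "\<mu> / c \<le> 1"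
          using c \<mu> 1 by (auto simp: c_def field_simps)
        \<comment> \<open>The gradient on the corrector side, \<open>p + \<xi> /\<^sub>R c\<close>,
          is a convex combination of \<open>P\<close> and the bounded vector p - e / \<mu>, with
          weights 1 / c and \<mu> / c.\<close>
        have "(1 / c) *\<^sub>R P + (\<mu> / c) *\<^sub>R (p + (- 1) *\<^sub>R (e /\<^sub>R \<mu>)) = (1 / c) *\<^sub>R (P + \<mu> *\<^sub>R (p + (- 1) *\<^sub>R (e /\<^sub>R \<mu>)))"
          by (simp add: scaleR_add_right)
        also have "P + \<mu> *\<^sub>R (p + (- 1) *\<^sub>R (e /\<^sub>R \<mu>)) = c *\<^sub>R p + \<xi>"
          using \<mu>(1) 1 by (simp add: P_def c_def scaleR_add_right scaleR_add_left scaleR_diff_right)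
        also have "(1 / c) *\<^sub>R (c *\<^sub>R p + \<xi>) = p + \<xi> /\<^sub>R c"
          using c by (simp add: scaleR_add_right inverse_eq_divide)
        finally have "f (p + \<xi> /\<^sub>R c) \<le> (1 / c) * f P + (\<mu> / c) * f (p + (- 1) *\<^sub>R (e /\<^sub>R \<mu>))"
          using convex_onD[OF convex t(2,3), of P "p + (- 1) *\<^sub>R (e /\<^sub>R \<mu>)"] unfolding t(1) by simp
        also have "\<dots> = (f P + \<mu> * f (p + (- 1) *\<^sub>R (e /\<^sub>R \<mu>))) / c"
          by (simp add: add_divide_distrib)
        finally have "c * f (p + \<xi> /\<^sub>R c) \<le> f P + \<mu> * f (p + (- 1) *\<^sub>R (e /\<^sub>R \<mu>))"
          using c by (simp add: field_simps)
        moreover have "\<mu> * f (p + (- 1) *\<^sub>R (e /\<^sub>R \<mu>)) \<le> \<mu> * \<bar>C4\<bar>"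
          using bound[of "- 1"] \<mu>(1) by (intro mult_left_mono) auto
        ultimately show ?thesis
          using 1 by (simp add: f_def)
      next
        case 2
        have t: "1 - \<mu> = c" "0 \<le> \<mu>" "\<mu> \<le> 1"
          using \<mu> 2 by (auto simp: c_def)
        \<comment> \<open>Here the roles are exchanged: \<open>P\<close> is the convex combination,
          with weights c and \<mu>, of the gradient on the corrector side and p + e / \<mu>.\<close>
        have "c *\<^sub>R (p + \<xi> /\<^sub>R c) + \<mu> *\<^sub>R (p + 1 *\<^sub>R (e /\<^sub>R \<mu>)) = P"
        proof -
          have "c *\<^sub>R (\<xi> /\<^sub>R c) = \<xi>" "\<mu> *\<^sub>R (1 *\<^sub>R (e /\<^sub>R \<mu>)) = e" "c *\<^sub>R p + \<mu> *\<^sub>R p = p"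
            using c \<mu>(1) 2 by (simp_all add: c_def flip: scaleR_add_left)
          then show ?thesis
            unfolding P_def scaleR_add_right by (simp add: algebra_simps)
        qed
        then have "f P \<le> c * f (p + \<xi> /\<^sub>R c) + \<mu> * f (p + 1 *\<^sub>R (e /\<^sub>R \<mu>))"
          using convex_onD[OF convex t(2,3), of "p + \<xi> /\<^sub>R c" "p + 1 *\<^sub>R (e /\<^sub>R \<mu>)"] unfolding t(1) by simp
        moreover have "\<mu> * f (p + 1 *\<^sub>R (e /\<^sub>R \<mu>)) \<le> \<mu> * \<bar>C4\<bar>"
          using bound[of 1] \<mu>(1) by (intro mult_left_mono) auto
        ultimately show ?thesis
          using 2 by (simp add: f_def)
      qed
    qed
    have 6: "sg * H k P (vec (sg * U0)) sV y - C5 * (real CARD('m) * \<nu> + \<mu> * \<bar>R\<bar> + norm (x - y)) \<le> sg * H k P r' (c *\<^sub>R sV) x"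
      using 4 sg by auto
    have "C5 * (real CARD('m) * \<nu> + \<mu> * \<bar>R\<bar> + norm (x - y)) + \<mu> * \<bar>C4\<bar> \<le> C * (\<mu> + \<nu> + norm (x - y))"
    proof -
      define n where "n = norm (x - y)"
      define N where "N = real CARD('m)"
      have "N \<ge> 0" "n \<ge> 0"
        by (auto simp: n_def N_def)
      then have "0 \<le> N * \<mu> + N * n + \<bar>R\<bar> * \<nu> + \<bar>R\<bar> * n + \<mu> + \<nu>"
        using \<mu>(1) \<nu>(1) by (intro add_nonneg_nonneg mult_nonneg_nonneg) auto
      then have "C5 * (N * \<nu> + \<mu> * \<bar>R\<bar> + n) \<le> C5 * ((N + \<bar>R\<bar> + 1) * (\<mu> + \<nu> + n))"
        by (intro mult_left_mono C5(1)) (simp add: algebra_simps)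
      moreover have "\<bar>C4\<bar> * \<mu> \<le> \<bar>C4\<bar> * (\<mu> + \<nu> + n)"
        using \<nu>(1) \<open>n \<ge> 0\<close> by (intro mult_left_mono) auto
      ultimately show ?thesis
        unfolding n_def[symmetric] N_def[symmetric] C_def by (simp add: algebra_simps)
    qed
    then show ?thesis
      using 1 2 3 6 5 unfolding P_def[symmetric] c_def[symmetric] by linarith
  qed
  then show ?thesis
    using C by blast
qed

text \<open>The theorem on sums for \<open>u\<close> in space-time against \<open>c\<close> times
  the rescaled corrector in space. The coupling |x - y|^2 / (2 \<alpha>) gives both the gradient
  \<open>\<zeta>\<close>; its second-order cost is the squared increment of the rescaled columns, of
  order (|x - y| / \<epsilon>)^2, times \<epsilon> / \<alpha>.\<close>

lemma contact_with_corrector: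
  fixes U :: "(real ^ 'n) \<times> real \<Rightarrow> real ^ 'm" and z b :: "(real ^ 'n) \<times> real" and y :: "real ^ 'n" and \<alpha> :: real
  defines "\<zeta> \<equiv> (fst z - y) /\<^sub>R \<alpha>"
  assumes sg: "sg \<in> {1, - 1}" and \<epsilon>: "\<epsilon> > 0" and c: "c > 0" and \<alpha>: "\<alpha> > 0" and K: "K \<ge> 0" and \<rho>: "\<rho> > 0"
    and U: "jet_subsolution (UNIV \<times> {0<..}) (\<lambda>z. sg * U z $ k)
      (\<lambda>z P. snd P + sg * H k (sg *\<^sub>R fst P) (U z) (gap k (U z) /\<^sub>R \<epsilon>) (fst z /\<^sub>R \<epsilon>))
      (\<lambda>j z. (sqrt \<epsilon> *\<^sub>R \<sigma> k (fst z /\<^sub>R \<epsilon>) j, 0)) (d k)"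
    and contU: "continuous_on (UNIV \<times> {0<..}) U"
    and v: "corrector p r \<epsilon> v" and z: "snd z > 0"
    and max: "\<And>h \<eta>. norm h \<le> \<rho> \<Longrightarrow> norm \<eta> \<le> \<rho> \<Longrightarrow>
      sg * U (z + h) $ k - sg * (c * \<epsilon> * v ((y + \<eta>) /\<^sub>R \<epsilon>) $ k) \<le> sg * U z $ k - sg * (c * \<epsilon> * v (y /\<^sub>R \<epsilon>) $ k)
        + b \<bullet> h + K * (norm h)\<^sup>2 + ((norm (fst (z + h) - (y + \<eta>)))\<^sup>2 - (norm (fst z - y))\<^sup>2) / (2 * \<alpha>)"
  shows "snd b + sg * H k (sg *\<^sub>R (fst b + \<zeta>)) (U z) (gap k (U z) /\<^sub>R \<epsilon>) (fst z /\<^sub>R \<epsilon>)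
      - sg * c * (\<epsilon> * v (y /\<^sub>R \<epsilon>) $ k + H k (p + (sg *\<^sub>R \<zeta>) /\<^sub>R c) (vec r) (gap k (v (y /\<^sub>R \<epsilon>))) (y /\<^sub>R \<epsilon>))
    \<le> 2 * K * \<epsilon> * CA + CA * (norm (fst z - y))\<^sup>2 / (\<alpha> * \<epsilon>)"
proof -
  define T where "T w = ((2 * K) *\<^sub>R fst w + ((fst (fst w) - snd w) /\<^sub>R \<alpha>, 0), (snd w - fst (fst w)) /\<^sub>R \<alpha>)"
    for w :: "((real ^ 'n) \<times> real) \<times> (real ^ 'n)"
  have T: "w \<bullet> T w = 2 * K * (norm (fst w))\<^sup>2 + (norm (fst (fst w) - snd w))\<^sup>2 / \<alpha>" for w
    by (simp add: T_def inner_prod_def power2_norm_eq_inner inner_simps inner_commute divide_inverse algebra_simps)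
  let ?F = "\<lambda>z P. snd P + sg * H k (sg *\<^sub>R fst P) (U z) (gap k (U z) /\<^sub>R \<epsilon>) (fst z /\<^sub>R \<epsilon>)"
  let ?V = "\<lambda>y Q. - sg * (\<epsilon> * v y $ k + H k (p + (- sg) *\<^sub>R Q) (vec r) (gap k (v y)) y)"
  let ?G = "\<lambda>x Q. c * ?V (x /\<^sub>R \<epsilon>) (Q /\<^sub>R c)"
  have "?F z (b + (\<zeta>, 0)) + ?G y (- \<zeta>) \<le> (\<Sum>j<d k. ((sqrt \<epsilon> *\<^sub>R \<sigma> k (fst z /\<^sub>R \<epsilon>) j, 0), sqrt \<epsilon> *\<^sub>R \<sigma> k (y /\<^sub>R \<epsilon>) j)
      \<bullet> T ((sqrt \<epsilon> *\<^sub>R \<sigma> k (fst z /\<^sub>R \<epsilon>) j, 0), sqrt \<epsilon> *\<^sub>R \<sigma> k (y /\<^sub>R \<epsilon>) j))"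
  proof (rule jet_subsolution_sum[where A = "UNIV \<times> {0<..}" and B = UNIV and r = \<rho>
        and u = "\<lambda>z. sg * U z $ k" and w = "\<lambda>x. c * \<epsilon> * (- sg * v (x /\<^sub>R \<epsilon>) $ k)"
        and F = ?F and G = ?G and s = "\<lambda>j z. (sqrt \<epsilon> *\<^sub>R \<sigma> k (fst z /\<^sub>R \<epsilon>) j, 0)"
        and t = "\<lambda>j x. sqrt \<epsilon> *\<^sub>R \<sigma> k (x /\<^sub>R \<epsilon>) j"])
    show "jet_subsolution (UNIV \<times> {0<..}) (\<lambda>z. sg * U z $ k) ?F (\<lambda>j z. (sqrt \<epsilon> *\<^sub>R \<sigma> k (fst z /\<^sub>R \<epsilon>) j, 0)) (d k)"
      by (rule U)
    have "- sg \<in> {1, - 1}"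
      using sg by auto
    then have "jet_subsolution UNIV (\<lambda>y. - sg * v y $ k) ?V (\<lambda>j y. \<sigma> k y j) (d k)"
      using v unfolding corrector_def by blast
    then show "jet_subsolution UNIV (\<lambda>x. c * \<epsilon> * (- sg * v (x /\<^sub>R \<epsilon>) $ k)) ?G (\<lambda>j x. sqrt \<epsilon> *\<^sub>R \<sigma> k (x /\<^sub>R \<epsilon>) j) (d k)"
      using c \<epsilon> by (rule jet_subsolution_rescale)
    show op: "open (UNIV \<times> {0<..} :: ((real ^ 'n) \<times> real) set)"
      by (intro open_Times) auto
    show zin: "z \<in> UNIV \<times> {0<..}"
      using z by (simp add: mem_Times_iff)
    show "continuous_on (UNIV \<times> {0<..}) (\<lambda>z. sg * U z $ k)"
      by (intro continuous_intros contU)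
    have contv: "continuous_on UNIV v"
    proof -
      obtain L where "L-lipschitz_on UNIV v"
        using v by (auto simp: corrector_def)
      then show ?thesis
        by (rule lipschitz_on_continuous_on)
    qed
    show "continuous_on UNIV (\<lambda>x. c * \<epsilon> * (- sg * v (x /\<^sub>R \<epsilon>) $ k))"
      by (intro continuous_intros continuous_on_compose2[OF contv]) auto
    show "linear T"
      unfolding T_def by (rule linearI) (simp_all add: algebra_simps prod_eq_iff)
    show "T w \<bullet> w' = w \<bullet> T w'" for w w'
      by (simp add: T_def inner_prod_def inner_simps inner_commute algebra_simps)
    have vc: "isCont v x" for x
      using contv by (simp add: continuous_on_eq_continuous_at)
    have Uc: "isCont U z"
      using contU zin continuous_on_eq_continuous_at[OF op] by blast
    have lim: "((\<lambda>w. fst w) \<longlongrightarrow> z) (at (z, P))" "((\<lambda>w. snd w) \<longlongrightarrow> P) (at (z, P))" for P :: "(real ^ 'n) \<times> real"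
      using tendsto_fst[OF tendsto_ident_at, of "(z, P)" UNIV] tendsto_snd[OF tendsto_ident_at, of "(z, P)" UNIV] by simp_all
    have lim': "((\<lambda>w. fst w) \<longlongrightarrow> y) (at (y, P))" "((\<lambda>w. snd w) \<longlongrightarrow> P) (at (y, P))" for P :: "real ^ 'n"
      using tendsto_fst[OF tendsto_ident_at, of "(y, P)" UNIV] tendsto_snd[OF tendsto_ident_at, of "(y, P)" UNIV] by simp_all
    have limU: "((\<lambda>w. U (fst w)) \<longlongrightarrow> U z) (at (z, P))" for P :: "(real ^ 'n) \<times> real"
      by (rule isCont_tendsto_compose[OF Uc lim(1)])
    have limv: "((\<lambda>w. v (fst w /\<^sub>R \<epsilon>)) \<longlongrightarrow> v (y /\<^sub>R \<epsilon>)) (at (y, P))" for P :: "real ^ 'n"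
      by (rule isCont_tendsto_compose[OF vc]) (intro tendsto_intros lim')
    show "isCont (\<lambda>(z, P). ?F z P) (z, b + (\<zeta>, 0))" "isCont (\<lambda>(x, P). ?G x P) (y, - \<zeta>)"
      unfolding isCont_def case_prod_beta fst_conv snd_conv
      by (intro tendsto_intros tendsto_H lim lim' limU limv others_gap)+
    show "isCont (\<lambda>z. (sqrt \<epsilon> *\<^sub>R \<sigma> k (fst z /\<^sub>R \<epsilon>) j, 0)) z" "isCont (\<lambda>x. sqrt \<epsilon> *\<^sub>R \<sigma> k (x /\<^sub>R \<epsilon>) j) y" if "j < d k" for j
      by (intro continuous_intros isCont_o2[OF _ isCont_sigma[OF that]])+
    fix h :: "(real ^ 'n) \<times> real" and \<eta> :: "real ^ 'n" assume h: "norm h \<le> \<rho>" "norm \<eta> \<le> \<rho>"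
    have "fst (z + h) - (y + \<eta>) = (fst z - y) + (fst h - \<eta>)"
      by simp
    then have "(norm (fst (z + h) - (y + \<eta>)))\<^sup>2 - (norm (fst z - y))\<^sup>2 = 2 * ((fst z - y) \<bullet> (fst h - \<eta>)) + (norm (fst h - \<eta>))\<^sup>2"
      by (simp only: power2_norm_eq_inner inner_simps) (simp add: inner_commute)
    then have eq: "((norm (fst (z + h) - (y + \<eta>)))\<^sup>2 - (norm (fst z - y))\<^sup>2) / (2 * \<alpha>) = \<zeta> \<bullet> (fst h - \<eta>) + (norm (fst h - \<eta>))\<^sup>2 / (2 * \<alpha>)"
    proof -
      have "\<zeta> \<bullet> (fst h - \<eta>) = ((fst z - y) \<bullet> (fst h - \<eta>)) / \<alpha>"
        unfolding \<zeta>_def inner_scaleR_left by (simp add: divide_inverse mult.commute)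
      then show ?thesis
        unfolding \<open>(norm (fst (z + h) - (y + \<eta>)))\<^sup>2 - _ = _\<close> by (simp add: add_divide_distrib)
    qed
    then show "sg * U (z + h) $ k + c * \<epsilon> * (- sg * v ((y + \<eta>) /\<^sub>R \<epsilon>) $ k) \<le> sg * U z $ k + c * \<epsilon> * (- sg * v (y /\<^sub>R \<epsilon>) $ k)
        + (b + (\<zeta>, 0)) \<bullet> h + - \<zeta> \<bullet> \<eta> + ((h, \<eta>) \<bullet> T (h, \<eta>)) / 2"
    proof -
      have "(b + (\<zeta>, 0)) \<bullet> h + - \<zeta> \<bullet> \<eta> + ((h, \<eta>) \<bullet> T (h, \<eta>)) / 2
          = b \<bullet> h + K * (norm h)\<^sup>2 + (\<zeta> \<bullet> (fst h - \<eta>) + (norm (fst h - \<eta>))\<^sup>2 / (2 * \<alpha>))"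
        unfolding T by (simp add: inner_add_left inner_prod_def inner_diff_right add_divide_distrib)
      moreover have minus: "c * \<epsilon> * (- sg * w) = - (sg * (c * \<epsilon> * w))" for w
        by simp
      ultimately show ?thesis
        using max[OF h] unfolding eq minus by linarith
    qed
  qed (use \<rho> in auto)
  also have "\<dots> \<le> 2 * K * \<epsilon> * CA + CA * (norm (fst z - y))\<^sup>2 / (\<alpha> * \<epsilon>)"
  proof -
    have "((sqrt \<epsilon> *\<^sub>R a, 0), sqrt \<epsilon> *\<^sub>R a') \<bullet> T ((sqrt \<epsilon> *\<^sub>R a, 0), sqrt \<epsilon> *\<^sub>R a')
        = 2 * K * \<epsilon> * (norm a)\<^sup>2 + \<epsilon> / \<alpha> * (norm (a - a'))\<^sup>2" for a a' :: "real ^ 'n"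
    proof -
      have "(norm (sqrt \<epsilon> *\<^sub>R a))\<^sup>2 = \<epsilon> * (norm a)\<^sup>2" for a :: "real ^ 'n"
        using \<epsilon> by (simp add: power_mult_distrib)
      moreover have "norm (w, 0 :: real) = norm w" for w :: "real ^ 'n"
        by (simp add: norm_Pair)
      ultimately show ?thesis
        unfolding T fst_conv snd_conv scaleR_diff_right[symmetric] by (simp only: mult.assoc times_divide_eq_left)
    qed
    then have "(\<Sum>j<d k. ((sqrt \<epsilon> *\<^sub>R \<sigma> k (fst z /\<^sub>R \<epsilon>) j, 0), sqrt \<epsilon> *\<^sub>R \<sigma> k (y /\<^sub>R \<epsilon>) j)
      \<bullet> T ((sqrt \<epsilon> *\<^sub>R \<sigma> k (fst z /\<^sub>R \<epsilon>) j, 0), sqrt \<epsilon> *\<^sub>R \<sigma> k (y /\<^sub>R \<epsilon>) j))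
      = 2 * K * \<epsilon> * (\<Sum>j<d k. (norm (\<sigma> k (fst z /\<^sub>R \<epsilon>) j))\<^sup>2)
        + \<epsilon> / \<alpha> * (\<Sum>j<d k. (norm (\<sigma> k (fst z /\<^sub>R \<epsilon>) j - \<sigma> k (y /\<^sub>R \<epsilon>) j))\<^sup>2)"
      by (simp add: sum.distrib sum_distrib_left)
    also have "\<dots> \<le> 2 * K * \<epsilon> * CA + \<epsilon> / \<alpha> * (CA * (norm (fst z /\<^sub>R \<epsilon> - y /\<^sub>R \<epsilon>))\<^sup>2)"
      using K \<epsilon> \<alpha> by (intro add_mono mult_left_mono sigma_bound sigma_lipschitz) auto
    also have "norm (fst z /\<^sub>R \<epsilon> - y /\<^sub>R \<epsilon>) = norm (fst z - y) / \<epsilon>"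
      using \<epsilon> by (simp add: divide_inverse mult.commute flip: scaleR_diff_right)
    also have "\<epsilon> / \<alpha> * (CA * (norm (fst z - y) / \<epsilon>)\<^sup>2) = CA * (norm (fst z - y))\<^sup>2 / (\<alpha> * \<epsilon>)"
      using \<epsilon> \<alpha> by (simp add: power_divide power2_eq_square field_simps)
    finally show ?thesis .
  qed
  also have "?F z (b + (\<zeta>, 0)) + ?G y (- \<zeta>) = snd b + sg * H k (sg *\<^sub>R (fst b + \<zeta>)) (U z) (gap k (U z) /\<^sub>R \<epsilon>) (fst z /\<^sub>R \<epsilon>)
      - sg * c * (\<epsilon> * v (y /\<^sub>R \<epsilon>) $ k + H k (p + (sg *\<^sub>R \<zeta>) /\<^sub>R c) (vec r) (gap k (v (y /\<^sub>R \<epsilon>))) (y /\<^sub>R \<epsilon>))"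
    by (simp add: algebra_simps)
  finally show ?thesis .
qed

end

lemma le_if_le_add_small:
  fixes x y D :: real
  assumes "\<And>e. 0 < e \<Longrightarrow> e \<le> 1 \<Longrightarrow> x \<le> y + D * e"
  shows "x \<le> y"
proof (rule field_le_epsilon)
  fix e :: real assume e: "e > 0"
  define t where "t = min 1 (e / (\<bar>D\<bar> + 1))"
  have t: "0 < t" "t \<le> 1" "t \<le> e / (\<bar>D\<bar> + 1)"
    using e by (auto simp: t_def)
  have "D * t \<le> \<bar>D\<bar> * t"
    using t by (intro mult_right_mono) auto
  also have "\<dots> \<le> \<bar>D\<bar> * (e / (\<bar>D\<bar> + 1))"
    using t by (intro mult_left_mono) auto
  also have "\<dots> \<le> e"
    using e by (simp add: field_simps)
  finally show "x \<le> y + e"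
    using assms[OF t(1,2)] by linarith
qed

text \<open>\<open>Hbar\<close> is accessible only through \<open>v_limit\<close> and
  \<open>ubar_jet\<close>, each of which concerns one pair \<open>(p, r)\<close> at a time.\<close>

locale homogenization = hj_coefficients \<sigma> d H CA
  for \<sigma> :: "'m::finite \<Rightarrow> real ^ 'n::finite \<Rightarrow> nat \<Rightarrow> real ^ 'n" and d H CA +
  fixes u0 :: "real ^ 'n \<Rightarrow> real ^ 'm" and v :: "real ^ 'n \<Rightarrow> real \<Rightarrow> real \<Rightarrow> real ^ 'n \<Rightarrow> real ^ 'm"
    and i1 :: 'm and Hbar :: "real ^ 'n \<Rightarrow> real \<Rightarrow> real"
    and u :: "real \<Rightarrow> (real ^ 'n) \<times> real \<Rightarrow> real ^ 'm" and ubar :: "(real ^ 'n) \<times> real \<Rightarrow> real"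
  assumes u0: "BUC_on UNIV u0"
    and v: "\<And>p r \<delta>. \<delta> > 0 \<Longrightarrow> corrector p r \<delta> (v p r \<delta>)"
    and v_limit: "\<And>R p r. R > 0 \<Longrightarrow>
      ((\<lambda>\<delta>. SUP y\<in>ball 0 (R / \<delta>). \<bar>\<delta> * v p r \<delta> y $ i1 + Hbar p r\<bar>) \<longlongrightarrow> 0) (at_right 0)"
    and u_BUC: "\<And>\<epsilon> T. \<epsilon> > 0 \<Longrightarrow> T > 0 \<Longrightarrow> BUC_on (UNIV \<times> {0..<T}) (u \<epsilon>)"
    and u_initial: "\<And>\<epsilon> x. \<epsilon> > 0 \<Longrightarrow> u \<epsilon> (x, 0) = u0 x"
    and u_jet: "\<And>\<epsilon> sg k. \<epsilon> > 0 \<Longrightarrow> sg \<in> {1, - 1} \<Longrightarrow>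
      jet_subsolution (UNIV \<times> {0<..}) (\<lambda>z. sg * u \<epsilon> z $ k)
        (\<lambda>z P. snd P + sg * H k (sg *\<^sub>R fst P) (u \<epsilon> z) (gap k (u \<epsilon> z) /\<^sub>R \<epsilon>) (fst z /\<^sub>R \<epsilon>))
        (\<lambda>j z. (sqrt \<epsilon> *\<^sub>R \<sigma> k (fst z /\<^sub>R \<epsilon>) j, 0)) (d k)"
    and ubar_BUC: "\<And>T. T > 0 \<Longrightarrow> BUC_on (UNIV \<times> {0..<T}) ubar"
    and ubar_initial: "\<And>x. ubar (x, 0) = Min (range (\<lambda>k. u0 x $ k))"
    and ubar_jet: "\<And>sg z P X. sg \<in> {1, - 1} \<Longrightarrow> snd z > 0 \<Longrightarrow> upper_jet (\<lambda>z. sg * ubar z) z P X \<Longrightarrow>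
      snd P + sg * Hbar (sg *\<^sub>R fst P) (ubar z) \<le> 0"

lemma continuous_on_half_space:
  fixes f :: "'a::topological_space \<times> real \<Rightarrow> 'b::topological_space"
  assumes "\<And>T. T > 0 \<Longrightarrow> continuous_on (UNIV \<times> {0..<T}) f"
  shows "continuous_on (UNIV \<times> {0..}) f"
  unfolding continuous_on_def
proof
  fix z :: "'a \<times> real" assume z: "z \<in> UNIV \<times> {0..}"
  define T where "T = snd z + 1"
  have T: "T > 0" and zT: "z \<in> UNIV \<times> {0..<T}"
    using z by (auto simp: T_def mem_Times_iff)
  have eq: "at z within UNIV \<times> {0..} = at z within UNIV \<times> {0..<T}"
    by (rule at_within_nhd[of z "UNIV \<times> {..<T}"]) (use zT in \<open>auto simp: mem_Times_iff intro: open_Times\<close>)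
  then show "(f \<longlongrightarrow> f z) (at z within UNIV \<times> {0..})"
    using assms[OF T] zT unfolding continuous_on_def eq by blast
qed

context homogenization
begin

lemma u_cont: "\<epsilon> > 0 \<Longrightarrow> continuous_on (UNIV \<times> {0..}) (u \<epsilon>)"
  using u_BUC unfolding BUC_on_def by (intro continuous_on_half_space uniformly_continuous_imp_continuous) blast

lemma ubar_cont: "continuous_on (UNIV \<times> {0..}) ubar"
  using ubar_BUC unfolding BUC_on_def by (intro continuous_on_half_space uniformly_continuous_imp_continuous) blast

lemma corrector_convergence:
  assumes R: "R > 0" and \<nu>: "\<nu> > 0"
  obtains \<epsilon>1 where "\<epsilon>1 > 0"
    "\<And>\<epsilon> x k. 0 < \<epsilon> \<Longrightarrow> \<epsilon> < \<epsilon>1 \<Longrightarrow> norm x \<le> R \<Longrightarrow> \<bar>\<epsilon> * v p r \<epsilon> (x /\<^sub>R \<epsilon>) $ k + Hbar p r\<bar> \<le> \<nu>"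
proof -
  obtain C where C: "C \<ge> 0" "\<And>p' r' \<delta> v x j k. admissible (max (norm p) \<bar>r\<bar>) p' r' \<delta> v \<Longrightarrow> \<bar>v x $ k - v x $ j\<bar> \<le> C"
    "\<And>p' r' \<delta> v x k. admissible (max (norm p) \<bar>r\<bar>) p' r' \<delta> v \<Longrightarrow> \<bar>\<delta> * v x $ k\<bar> \<le> C"
    using corrector_oscillation[of "max (norm p) \<bar>r\<bar>"] by metis
  have "\<forall>\<^sub>F \<delta> in at_right 0. (SUP y\<in>ball 0 ((R + 1) / \<delta>). \<bar>\<delta> * v p r \<delta> y $ i1 + Hbar p r\<bar>) < \<nu> / 2"
    using v_limit[of "R + 1" p r] R \<nu> by (intro order_tendstoD) auto
  then obtain e where e: "e > 0" "\<And>\<delta>. 0 < \<delta> \<Longrightarrow> \<delta> < e \<Longrightarrow> (SUP y\<in>ball 0 ((R + 1) / \<delta>). \<bar>\<delta> * v p r \<delta> y $ i1 + Hbar p r\<bar>) < \<nu> / 2"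
    unfolding eventually_at_right_field by auto
  show ?thesis
  proof (rule that[of "min (min e 1) (\<nu> / (2 * (C + 1)))"])
    show "min (min e 1) (\<nu> / (2 * (C + 1))) > 0"
      using e(1) \<nu> C(1) by simp
    fix \<epsilon> k and x :: "real ^ 'n" assume \<epsilon>: "0 < \<epsilon>" "\<epsilon> < min (min e 1) (\<nu> / (2 * (C + 1)))" and x: "norm x \<le> R"
    have adm: "admissible (max (norm p) \<bar>r\<bar>) p r \<epsilon> (v p r \<epsilon>)"
      using \<epsilon> v by (auto simp: admissible_def)
    have "x /\<^sub>R \<epsilon> \<in> ball 0 ((R + 1) / \<epsilon>)"
      using x \<epsilon>(1) by (simp add: field_simps)
    moreover have "bdd_above ((\<lambda>y. \<bar>\<epsilon> * v p r \<epsilon> y $ i1 + Hbar p r\<bar>) ` ball 0 ((R + 1) / \<epsilon>))"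
    proof (rule bdd_aboveI2)
      show "\<bar>\<epsilon> * v p r \<epsilon> y $ i1 + Hbar p r\<bar> \<le> C + \<bar>Hbar p r\<bar>" for y
        using C(3)[OF adm, of y i1] by linarith
    qed
    ultimately have "\<bar>\<epsilon> * v p r \<epsilon> (x /\<^sub>R \<epsilon>) $ i1 + Hbar p r\<bar> \<le> (SUP y\<in>ball 0 ((R + 1) / \<epsilon>). \<bar>\<epsilon> * v p r \<epsilon> y $ i1 + Hbar p r\<bar>)"
      by (rule cSUP_upper)
    also have "\<dots> < \<nu> / 2"
      using \<epsilon> by (intro e(2)) auto
    finally have 1: "\<bar>\<epsilon> * v p r \<epsilon> (x /\<^sub>R \<epsilon>) $ i1 + Hbar p r\<bar> < \<nu> / 2" .
    have "\<epsilon> * \<bar>v p r \<epsilon> (x /\<^sub>R \<epsilon>) $ k - v p r \<epsilon> (x /\<^sub>R \<epsilon>) $ i1\<bar> \<le> \<epsilon> * C"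
      using C(2)[OF adm] \<epsilon>(1) by (intro mult_left_mono) auto
    moreover have "\<epsilon> * C \<le> \<nu> / 2"
    proof -
      have "\<epsilon> * (2 * (C + 1)) \<le> \<nu>"
        using \<epsilon> C(1) by (simp add: pos_less_divide_eq)
      then show ?thesis
        using \<epsilon>(1) by (simp add: algebra_simps)
    qed
    moreover have "\<epsilon> * \<bar>v p r \<epsilon> (x /\<^sub>R \<epsilon>) $ k - v p r \<epsilon> (x /\<^sub>R \<epsilon>) $ i1\<bar> = \<bar>\<epsilon> * v p r \<epsilon> (x /\<^sub>R \<epsilon>) $ k - \<epsilon> * v p r \<epsilon> (x /\<^sub>R \<epsilon>) $ i1\<bar>"
      using \<epsilon>(1) by (simp add: abs_mult flip: right_diff_distrib)
    ultimately show "\<bar>\<epsilon> * v p r \<epsilon> (x /\<^sub>R \<epsilon>) $ k + Hbar p r\<bar> \<le> \<nu>"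
      using 1 by linarith
  qed
qed

text \<open>
  Double the variables between \<open>u\<close> and the corrector, multiplied by \<open>1 \<plusminus> \<mu>\<close>: the penalization
  term then enters both gradients, and convexity of the Hamiltonian in \<open>p\<close> absorbs the gradient
  error at the cost \<open>C \<mu>\<close>, however large the penalization gradient is.
\<close>

lemma perturbed_test_function:
  "\<exists>C\<ge>0. \<forall>sg \<mu> p r U0 z0 a K \<rho>0. sg \<in> {1, - 1} \<longrightarrow> 0 < \<mu> \<longrightarrow> \<mu> \<le> 1 / 2 \<longrightarrow> norm p \<le> R \<longrightarrow> \<bar>r\<bar> \<le> R \<longrightarrow> \<bar>U0\<bar> \<le> R \<longrightarrow>
    sg * r \<le> U0 \<longrightarrow> 0 < snd z0 \<longrightarrow> norm (sg *\<^sub>R fst a - p) < \<mu> \<longrightarrow> 0 \<le> K \<longrightarrow> 0 < \<rho>0 \<longrightarrow>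
    (\<forall>\<eta>>0. \<exists>\<epsilon>1>0. \<forall>\<epsilon> z k. 0 < \<epsilon> \<longrightarrow> \<epsilon> < \<epsilon>1 \<longrightarrow> dist z z0 \<le> \<rho>0 \<longrightarrow>
      sg * u \<epsilon> z $ k \<le> U0 + a \<bullet> (z - z0) + K * (norm (z - z0))\<^sup>2 + \<eta>) \<longrightarrow>
    (\<forall>\<rho>>0. \<exists>\<epsilon> z k. 0 < \<epsilon> \<and> \<epsilon> < \<rho> \<and> dist z z0 < \<rho> \<and> U0 - \<rho> \<le> sg * u \<epsilon> z $ k) \<longrightarrow>
    snd a + sg * Hbar p r \<le> C * \<mu>"
proof -
  obtain C1 where C1: "C1 \<ge> 0" "\<And>p r \<delta> v x j k. admissible R p r \<delta> v \<Longrightarrow> \<bar>v x $ k - v x $ j\<bar> \<le> C1"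
    "\<And>p r \<delta> v x k. admissible R p r \<delta> v \<Longrightarrow> \<bar>\<delta> * v x $ k\<bar> \<le> C1"
    using corrector_oscillation[of R] by metis
  define R' where "R' = max R (real CARD('m) * C1)"
  obtain C2 where C2: "C2 \<ge> 0" "\<forall>sg \<mu> \<nu> p r U0 e \<xi> k su sV uv x y. sg \<in> {1, - 1} \<longrightarrow> 0 < \<mu> \<longrightarrow> \<mu> \<le> 1 / 2 \<longrightarrow> 0 \<le> \<nu> \<longrightarrow> \<nu> \<le> 1 \<longrightarrow>
    norm p \<le> R' \<longrightarrow> \<bar>r\<bar> \<le> R' \<longrightarrow> \<bar>U0\<bar> \<le> R' \<longrightarrow> norm sV \<le> R' \<longrightarrow> sg * r \<le> U0 \<longrightarrow> norm e \<le> \<mu> \<longrightarrow>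
    su \<in> others k \<longrightarrow> sV \<in> others k \<longrightarrow> (\<forall>i. sg * (1 + sg * \<mu>) * sV $ i \<le> sg * su $ i) \<longrightarrow>
    (\<forall>j. sg * uv $ j \<le> U0 + \<nu>) \<longrightarrow> U0 - \<nu> \<le> sg * uv $ k \<longrightarrow>
    sg * (1 + sg * \<mu>) * H k (p + \<xi> /\<^sub>R (1 + sg * \<mu>)) (vec r) sV y - C2 * (\<mu> + \<nu> + norm (x - y))
      \<le> sg * H k (p + e + \<xi>) uv su x"
    using hamiltonian_comparison[of R'] by blast
  have R': "R \<le> R'" "real CARD('m) * C1 \<le> R'"
    by (auto simp: R'_def)
  define C where "C = C1 + 1 + C2"
  have C: "C \<ge> 0"
    using C1(1) C2(1) by (simp add: C_def)
  have "snd a + sg * Hbar p r \<le> C * \<mu>"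
    if sg: "sg \<in> {1, - 1}" and \<mu>: "0 < \<mu>" "\<mu> \<le> 1 / 2" and p: "norm p \<le> R" and r: "\<bar>r\<bar> \<le> R" and U0: "\<bar>U0\<bar> \<le> R"
      and rU: "sg * r \<le> U0" and z0: "0 < snd z0" and ap: "norm (sg *\<^sub>R fst a - p) < \<mu>" and K: "0 \<le> K" and \<rho>0: "0 < \<rho>0"
      and up: "\<And>\<eta>. \<eta> > 0 \<Longrightarrow> \<exists>\<epsilon>1>0. \<forall>\<epsilon> z k. 0 < \<epsilon> \<longrightarrow> \<epsilon> < \<epsilon>1 \<longrightarrow> dist z z0 \<le> \<rho>0 \<longrightarrow>
        sg * u \<epsilon> z $ k \<le> U0 + a \<bullet> (z - z0) + K * (norm (z - z0))\<^sup>2 + \<eta>"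
      and low: "\<And>\<rho>. \<rho> > 0 \<Longrightarrow> \<exists>\<epsilon> z k. 0 < \<epsilon> \<and> \<epsilon> < \<rho> \<and> dist z z0 < \<rho> \<and> U0 - \<rho> \<le> sg * u \<epsilon> z $ k"
    for sg \<mu> p r U0 K \<rho>0 and z0 a :: "(real ^ 'n) \<times> real"
  proof -
    define c where "c = 1 + sg * \<mu>"
    have c: "1 / 2 \<le> c" "c \<le> 3 / 2"
      using sg \<mu> by (auto simp: c_def)
    \<comment> \<open>The additional |z - z0|^2 makes the contact at \<open>z0\<close> strict and
      keeps the maximum away from the boundary of the ball.\<close>
    define K1 where "K1 = K + 1"
    define D where "D = 2 * K1 + 2 + 2 * C2 + 2 * K1 * CA + CA"
    have K1: "K1 \<ge> 1"
      using K by (simp add: K1_def)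
    have abs_sg: "\<bar>sg * w\<bar> = \<bar>w\<bar>" for w
      using sg by (auto simp: abs_mult)
    \<comment> \<open>Allows \<open>c * Hbar p r\<close> to be replaced by \<open>Hbar p r\<close>
      at a cost proportional to \<mu>.\<close>
    have Hb: "\<bar>Hbar p r\<bar> \<le> C1 + 1"
    proof -
      obtain \<epsilon>1 where \<epsilon>1: "\<epsilon>1 > 0" "\<And>\<epsilon> x k. 0 < \<epsilon> \<Longrightarrow> \<epsilon> < \<epsilon>1 \<Longrightarrow> norm x \<le> 1 \<Longrightarrow> \<bar>\<epsilon> * v p r \<epsilon> (x /\<^sub>R \<epsilon>) $ k + Hbar p r\<bar> \<le> 1"
        using corrector_convergence[of 1 1 p r] by (metis zero_less_one)
      define \<epsilon> where "\<epsilon> = min 1 (\<epsilon>1 / 2)"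
      have \<epsilon>: "0 < \<epsilon>" "\<epsilon> < \<epsilon>1" "\<epsilon> \<le> 1"
        using \<epsilon>1(1) by (auto simp: \<epsilon>_def)
      have "admissible R p r \<epsilon> (v p r \<epsilon>)"
        using \<epsilon> p r v by (auto simp: admissible_def)
      from C1(3)[OF this, of "0 /\<^sub>R \<epsilon>" i1] \<epsilon>1(2)[OF \<epsilon>(1,2), of 0 i1] show ?thesis
        by (auto simp: abs_le_iff)
    qed
    have "snd a + sg * Hbar p r \<le> C * \<mu> + D * \<nu>" if \<nu>: "0 < \<nu>" "\<nu> \<le> 1" for \<nu>
    proof -
      define A where "A = norm a + K1"
      have A: "A \<ge> 1"
        using K1 by (simp add: A_def add_increasing)
      define \<rho> where "\<rho> = min (min \<rho>0 (snd z0 / 2)) (min ((\<mu> - norm (sg *\<^sub>R fst a - p)) / (2 * K1)) (\<nu> / (2 * A)))"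
      have \<rho>: "\<rho> > 0" "\<rho> \<le> \<rho>0" "\<rho> < snd z0" "2 * K1 * \<rho> \<le> \<mu> - norm (sg *\<^sub>R fst a - p)" "A * \<rho> \<le> \<nu> / 2" "\<rho> \<le> 1" "\<rho> \<le> \<nu>"
      proof -
        show "\<rho> > 0"
          using \<rho>0 z0 ap K1 A \<nu> by (simp add: \<rho>_def)
        have "\<rho> \<le> \<nu> / (2 * A)"
          by (simp add: \<rho>_def)
        then show "A * \<rho> \<le> \<nu> / 2"
          using A by (simp add: field_simps)
        moreover have "1 * \<rho> \<le> A * \<rho>"
          using \<open>\<rho> > 0\<close> A by (intro mult_right_mono) auto
        ultimately show "\<rho> \<le> \<nu>" "\<rho> \<le> 1"
          using \<nu> by auto
        have "\<rho> \<le> (\<mu> - norm (sg *\<^sub>R fst a - p)) / (2 * K1)"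
          by (simp add: \<rho>_def)
        then show "2 * K1 * \<rho> \<le> \<mu> - norm (sg *\<^sub>R fst a - p)"
          using K1 by (simp add: field_simps)
      qed (use \<rho>0 z0 ap K1 A \<nu> in \<open>auto simp: \<rho>_def\<close>)
      \<comment> \<open>The maximum will satisfy - 5 \<nu>1 <= sg u - Q <= \<nu>1 - |z - z0|^2, so 6
        \<nu>1 must stay below \<rho>^2; the bound \<nu> / 10 lets the accumulated errors fit into
        \<nu>.\<close>
      define \<nu>1 where "\<nu>1 = min (\<nu> / 10) (\<rho>\<^sup>2 / 7)"
      have \<nu>1: "\<nu>1 > 0" "10 * \<nu>1 \<le> \<nu>" "7 * \<nu>1 \<le> \<rho>\<^sup>2"
        using \<nu> \<rho>(1) by (auto simp: \<nu>1_def)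
      define Q where "Q z = U0 + a \<bullet> (z - z0) + K1 * (norm (z - z0))\<^sup>2" for z
      have Q_near: "\<bar>Q z - U0\<bar> \<le> A * t" if "dist z z0 \<le> t" "t \<le> 1" for z t
      proof -
        define n where "n = norm (z - z0)"
        have n: "0 \<le> n" "n \<le> t"
          using that by (auto simp: n_def dist_norm)
        have "\<bar>a \<bullet> (z - z0)\<bar> \<le> norm a * n"
          unfolding n_def by (rule Cauchy_Schwarz_ineq2)
        moreover have "n\<^sup>2 \<le> 1 * n"
          using n that(2) unfolding power2_eq_square by (intro mult_right_mono) auto
        then have "K1 * n\<^sup>2 \<le> K1 * n"
          using K1 by (intro mult_left_mono) auto
        moreover have "A * n \<le> A * t"
          using n A by (intro mult_left_mono) auto
        moreover have "0 \<le> K1 * n\<^sup>2"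
          using K1 by simp
        ultimately show ?thesis
          unfolding Q_def n_def[symmetric] A_def by (simp add: algebra_simps)
      qed
      define \<rho>1 where "\<rho>1 = min (\<rho> / 2) (\<nu>1 / A)"
      have \<rho>1: "\<rho>1 > 0" "\<rho>1 \<le> \<rho>" "\<rho>1 \<le> \<nu>1" "A * \<rho>1 \<le> \<nu>1" "\<rho>1 \<le> 1"
      proof -
        show 0: "\<rho>1 > 0"
          using \<rho> \<nu>1 A by (simp add: \<rho>1_def)
        have "\<rho>1 \<le> \<nu>1 / A"
          by (simp add: \<rho>1_def)
        then show "A * \<rho>1 \<le> \<nu>1"
          using A by (simp add: field_simps)
        moreover have "1 * \<rho>1 \<le> A * \<rho>1"
          using 0 A by (intro mult_right_mono) auto
        ultimately show "\<rho>1 \<le> \<nu>1"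
          by simp
      qed (use \<rho> in \<open>auto simp: \<rho>1_def\<close>)
      obtain e1 where e1: "e1 > 0" "\<And>\<epsilon> z k. 0 < \<epsilon> \<Longrightarrow> \<epsilon> < e1 \<Longrightarrow> dist z z0 \<le> \<rho>0 \<Longrightarrow>
          sg * u \<epsilon> z $ k \<le> U0 + a \<bullet> (z - z0) + K * (norm (z - z0))\<^sup>2 + \<nu>1"
        using up[OF \<nu>1(1)] by blast
      define R1 where "R1 = norm (fst z0) + 2"
      have "R1 > 0"
        by (simp add: R1_def add_nonneg_pos)
      then obtain e2 where e2: "e2 > 0" "\<And>\<epsilon> x k. 0 < \<epsilon> \<Longrightarrow> \<epsilon> < e2 \<Longrightarrow> norm x \<le> R1 \<Longrightarrow>
          \<bar>\<epsilon> * v p r \<epsilon> (x /\<^sub>R \<epsilon>) $ k + Hbar p r\<bar> \<le> \<nu>1"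
        using corrector_convergence[of R1 \<nu>1 p r] \<nu>1(1) by metis
      define \<epsilon>0 where "\<epsilon>0 = min (min e1 e2) (min \<rho>1 \<nu>)"
      have "\<epsilon>0 > 0"
        using e1 e2 \<rho>1 \<nu> by (simp add: \<epsilon>0_def)
      then obtain \<epsilon> z1 k1 where \<epsilon>: "0 < \<epsilon>" "\<epsilon> < \<epsilon>0" and z1: "dist z1 z0 < \<epsilon>0" "U0 - \<epsilon>0 \<le> sg * u \<epsilon> z1 $ k1"
        using low[of \<epsilon>0] by blast
      have \<epsilon>': "\<epsilon> < e1" "\<epsilon> < e2" "\<epsilon> \<le> \<nu>" "\<epsilon> \<le> 1"
        using \<epsilon> \<nu> by (auto simp: \<epsilon>0_def)
      have "\<epsilon>0 \<le> \<rho>1"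
        by (simp add: \<epsilon>0_def)
      then have z1': "dist z1 z0 \<le> \<rho>1" "U0 - \<nu>1 \<le> sg * u \<epsilon> z1 $ k1"
        using z1 \<rho>1 by auto
      define w where "w k y = \<epsilon> * v p r \<epsilon> (y /\<^sub>R \<epsilon>) $ k" for k y
      have cor: "corrector p r \<epsilon> (v p r \<epsilon>)"
        using \<epsilon>(1) by (rule v)
      have adm: "admissible R p r \<epsilon> (v p r \<epsilon>)"
        using \<epsilon>(1) \<epsilon>'(4) p r cor by (simp add: admissible_def)
      have w_bound: "\<bar>w k y\<bar> \<le> C1" for k y
        unfolding w_def by (rule C1(3)[OF adm])
      have w_near: "\<bar>w k y + Hbar p r\<bar> \<le> \<nu>1" if "norm y \<le> R1" for k y
        unfolding w_def by (rule e2(2)[OF \<epsilon>(1) \<epsilon>'(2) that])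
      obtain L where L: "L > 0" "\<And>x y k. \<bar>v p r \<epsilon> x $ k - v p r \<epsilon> y $ k\<bar> \<le> L * norm (x - y)"
        and contv: "\<And>k. continuous_on UNIV (\<lambda>x. v p r \<epsilon> x $ k)"
        using corrector_components[OF cor] by metis
      have w_lip: "\<bar>w k x - w k y\<bar> \<le> L * norm (x - y)" for k x y
      proof -
        have "\<bar>w k x - w k y\<bar> = \<epsilon> * \<bar>v p r \<epsilon> (x /\<^sub>R \<epsilon>) $ k - v p r \<epsilon> (y /\<^sub>R \<epsilon>) $ k\<bar>"
          using \<epsilon>(1) by (simp add: w_def abs_mult flip: right_diff_distrib)
        also have "\<dots> \<le> \<epsilon> * (L * norm (x /\<^sub>R \<epsilon> - y /\<^sub>R \<epsilon>))"
          using \<epsilon>(1) by (intro mult_left_mono L(2)) auto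
        also have "norm (x /\<^sub>R \<epsilon> - y /\<^sub>R \<epsilon>) = norm (x - y) / \<epsilon>"
          using \<epsilon>(1) by (simp add: divide_inverse mult.commute flip: scaleR_diff_right)
        finally show ?thesis
          using \<epsilon>(1) by simp
      qed
      \<comment> \<open>\<open>L\<close> depends on \<epsilon>, so \<alpha> is chosen after it.
        Maximality gives |x - y| <= 3 L \<alpha>; the two terms of the denominator then make |x - y|
        / \<epsilon> and |x - y|^2 / (\<alpha> \<epsilon>) at most \<nu>.\<close>
      define \<alpha> where "\<alpha> = \<nu> * \<epsilon> / (9 * L\<^sup>2 + 3 * L)"
      have den: "9 * L\<^sup>2 + 3 * L > 0"
        using L(1) by (intro add_nonneg_pos) auto
      then have \<alpha>: "\<alpha> > 0"
        using \<nu> \<epsilon>(1) by (simp add: \<alpha>_def)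
      have \<alpha>': "3 * L * \<alpha> \<le> \<nu> * \<epsilon>" "9 * L\<^sup>2 * \<alpha> \<le> \<nu> * \<epsilon>"
      proof -
        have "(9 * L\<^sup>2 + 3 * L) * \<alpha> = \<nu> * \<epsilon>"
          using den by (simp add: \<alpha>_def)
        moreover have "9 * L\<^sup>2 * \<alpha> \<ge> 0" "3 * L * \<alpha> \<ge> 0"
          using L(1) \<alpha> by auto
        ultimately show "3 * L * \<alpha> \<le> \<nu> * \<epsilon>" "9 * L\<^sup>2 * \<alpha> \<le> \<nu> * \<epsilon>"
          unfolding distrib_right by linarith+
      qed
      define \<Theta> where "\<Theta> k s = sg * u \<epsilon> (fst s) $ k - Q (fst s) - sg * (c * w k (snd s))
          - (norm (fst (fst s) - snd s))\<^sup>2 / (2 * \<alpha>)" for k s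
      have in_time: "snd z > 0" if "dist z z0 \<le> \<rho>" for z
        using that \<rho>(3) dist_snd_le[of z z0] by (simp add: dist_real_def)
      have u_up: "sg * u \<epsilon> z $ k - Q z \<le> \<nu>1 - (norm (z - z0))\<^sup>2" if "dist z z0 \<le> \<rho>" for z k
        using e1(2)[OF \<epsilon>(1) \<epsilon>'(1), of z k] that \<rho>(2) by (simp add: Q_def K1_def algebra_simps)
      have base: "- 2 * \<nu>1 - sg * (c * w k1 (fst z1)) \<le> \<Theta> k1 (z1, fst z1)"
        using z1'(2) Q_near[OF z1'(1) \<rho>1(5)] \<rho>1(4) by (simp add: \<Theta>_def)
      have cw: "\<bar>sg * (c * w k y)\<bar> \<le> 3 / 2 * C1" for k y
      proof -
        have "\<bar>sg * (c * w k y)\<bar> = c * \<bar>w k y\<bar>"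
          unfolding abs_sg using c by (simp add: abs_mult)
        also have "\<dots> \<le> 3 / 2 * C1"
          using c w_bound[of k y] C1(1) by (intro mult_mono) auto
        finally show ?thesis .
      qed
      define M where "M = sqrt (2 * \<alpha> * (3 * \<nu>1 + 3 * C1))"
      have contw: "continuous_on UNIV (w k)" for k
      proof -
        have "continuous_on UNIV (\<lambda>y. v p r \<epsilon> (y /\<^sub>R \<epsilon>) $ k)"
          by (rule continuous_on_compose2[OF contv]) (auto intro!: continuous_intros)
        then show ?thesis
          unfolding w_def by (rule continuous_on_mult_left)
      qed
      obtain k s where s: "s \<in> cball z0 \<rho> \<times> UNIV" and max0: "\<And>j s'. s' \<in> cball z0 \<rho> \<times> UNIV \<Longrightarrow> \<Theta> j s' \<le> \<Theta> k s"
      proof (rule finite_family_attains_sup[of "cball z0 \<rho> \<times> UNIV" \<Theta> "(z1, fst z1)" k1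
            "2 * (norm z0 + \<rho>) + M"])
        show "continuous_on (cball z0 \<rho> \<times> UNIV) (\<Theta> k)" for k
        proof -
          have "continuous_on (cball z0 \<rho>) (u \<epsilon>)"
          proof (rule continuous_on_subset[OF u_cont[OF \<epsilon>(1)]], rule subsetI)
            show "z \<in> UNIV \<times> {0..}" if "z \<in> cball z0 \<rho>" for z
              using in_time[of z] that by (simp add: mem_Times_iff dist_commute)
          qed
          then show ?thesis
            unfolding \<Theta>_def Q_def using \<alpha>
            by (intro continuous_intros continuous_on_compose2[OF \<open>continuous_on (cball z0 \<rho>) (u \<epsilon>)\<close>]
                continuous_on_compose2[OF contw]) auto
        qed
        show "closed (cball z0 \<rho> \<times> (UNIV :: (real ^ 'n) set))"
          by (intro closed_Times) auto
        show "(z1, fst z1) \<in> cball z0 \<rho> \<times> UNIV"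
          using z1' \<rho>1 by (simp add: dist_commute)
        fix k s assume s: "s \<in> cball z0 \<rho> \<times> UNIV" and le: "\<Theta> k1 (z1, fst z1) \<le> \<Theta> k s"
        have z: "dist (fst s) z0 \<le> \<rho>"
          using s by (auto simp: dist_commute)
        have "(norm (fst (fst s) - snd s))\<^sup>2 / (2 * \<alpha>) \<le> 3 * \<nu>1 + 3 * C1"
          using le base u_up[OF z, of k] cw[of k1 "fst z1"] cw[of k "snd s"] zero_le_power2[of "norm (fst s - z0)"]
          unfolding \<Theta>_def abs_le_iff by linarith
        then have "(norm (fst (fst s) - snd s))\<^sup>2 \<le> 2 * \<alpha> * (3 * \<nu>1 + 3 * C1)"
          using \<alpha> by (simp add: field_simps)
        then have "norm (fst (fst s) - snd s) \<le> M"
          unfolding M_def by (rule real_le_rsqrt)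
        moreover have "norm (fst s) \<le> norm z0 + \<rho>"
          using z norm_triangle_sub[of "fst s" z0] by (simp add: dist_norm)
        moreover have "norm (fst (fst s)) \<le> norm (fst s)"
          using norm_fst_le[of "fst (fst s)" "snd (fst s)"] by simp
        moreover have "norm (snd s) \<le> norm (fst (fst s)) + norm (fst (fst s) - snd s)"
          using norm_triangle_sub[of "snd s" "fst (fst s)"] by (simp add: norm_minus_commute)
        moreover have "norm s \<le> norm (fst s) + norm (snd s)"
          using norm_Pair_le[of "fst s" "snd s"] by simp
        ultimately show "norm s \<le> 2 * (norm z0 + \<rho>) + M"
          by argo
      next
        fix k s assume "s \<in> cball z0 \<rho> \<times> UNIV" "\<And>j s'. s' \<in> cball z0 \<rho> \<times> UNIV \<Longrightarrow> \<Theta> j s' \<le> \<Theta> k s"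
        then show thesis
          by (rule that)
      qed
      define z y where "z = fst s" and "y = snd s"
      have z: "dist z z0 \<le> \<rho>"
        using s by (auto simp: z_def dist_commute)
      have max: "\<Theta> j (z', y') \<le> \<Theta> k (z, y)" if "dist z' z0 \<le> \<rho>" for j z' y'
        using max0[of "(z', y')" j] that by (simp add: z_def y_def dist_commute)
      define n where "n = norm (fst z - y)"
      \<comment> \<open>Compared with the competitor in which \<open>y\<close> is moved to
        \<open>fst z\<close>; the factor 3 comes from c <= 3 / 2.\<close>
      have n: "n \<le> 3 * L * \<alpha>"
      proof -
        have "\<bar>c * (w k (fst z) - w k y)\<bar> \<le> 3 / 2 * (L * n)"
          using c w_lip[of k "fst z" y] unfolding abs_mult n_def by (intro mult_mono) auto
        then have "\<bar>sg * (c * (w k (fst z) - w k y))\<bar> \<le> 3 / 2 * (L * n)"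
          by (simp only: abs_sg)
        moreover have "n\<^sup>2 / (2 * \<alpha>) \<le> sg * (c * w k (fst z)) - sg * (c * w k y)"
          using max[OF z, of k "fst z"] by (simp add: \<Theta>_def n_def)
        ultimately have "n\<^sup>2 / (2 * \<alpha>) \<le> 3 / 2 * (L * n)"
          unfolding right_diff_distrib by linarith
        then have "n * n \<le> n * (3 * L * \<alpha>)"
          using \<alpha> by (simp add: field_simps power2_eq_square)
        moreover have "n \<ge> 0"
          by (simp add: n_def)
        moreover have "0 \<le> 3 * L * \<alpha>"
          using L(1) \<alpha> by simp
        ultimately show ?thesis
          by (cases "n = 0") (auto simp: mult_le_cancel_left)
      qed
      have n1: "n \<le> \<nu> * \<epsilon>" "n \<le> 1"
      proof -
        show "n \<le> \<nu> * \<epsilon>"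
          using n \<alpha>'(1) by linarith
        also have "\<dots> \<le> 1 * 1"
          using \<nu> \<epsilon>(1) \<epsilon>'(4) by (intro mult_mono) auto
        finally show "n \<le> 1"
          by simp
      qed
      have yR: "norm y \<le> R1" and z1R: "norm (fst z1) \<le> R1"
      proof -
        have "dist (fst z) (fst z0) \<le> 1" "dist (fst z1) (fst z0) \<le> 1"
          using dist_fst_le[of z z0] dist_fst_le[of z1 z0] z z1'(1) \<rho>(6) \<rho>1(5) by linarith+
        then show "norm y \<le> R1" "norm (fst z1) \<le> R1"
          using norm_triangle_sub[of y "fst z"] norm_triangle_sub[of "fst z" "fst z0"] norm_triangle_sub[of "fst z1" "fst z0"] n1(2)
          by (auto simp: R1_def n_def dist_norm norm_minus_commute)
      qed
      have cw_near: "\<bar>sg * (c * w k y) + sg * (c * Hbar p r)\<bar> \<le> 3 / 2 * \<nu>1" if "norm y \<le> R1" for k y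
      proof -
        have "\<bar>sg * (c * w k y) + sg * (c * Hbar p r)\<bar> = c * \<bar>w k y + Hbar p r\<bar>"
          unfolding distrib_left[symmetric] abs_sg using c by (simp add: abs_mult)
        also have "\<dots> \<le> 3 / 2 * \<nu>1"
          using c w_near[OF that, of k] \<nu>1(1) by (intro mult_mono) auto
        finally show ?thesis .
      qed
      have max1: "- 5 * \<nu>1 + n\<^sup>2 / (2 * \<alpha>) \<le> sg * u \<epsilon> z $ k - Q z"
      proof -
        have "- 2 * \<nu>1 - sg * (c * w k1 (fst z1)) \<le> \<Theta> k (z, y)"
          using base max[of z1 k1 "fst z1"] z1'(1) \<rho>1(2) by linarith
        then show ?thesis
          using cw_near[OF z1R, of k1] cw_near[OF yR, of k] unfolding \<Theta>_def fst_conv snd_conv n_def[symmetric] abs_le_iff by linarith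
      qed
      have \<alpha>n: "0 \<le> n\<^sup>2 / (2 * \<alpha>)"
        using \<alpha> by simp
      have inner: "dist z z0 < \<rho>"
      proof -
        have "(dist z z0)\<^sup>2 \<le> 6 * \<nu>1"
          using max1 \<alpha>n u_up[OF z, of k] by (simp add: dist_norm)
        also have "\<dots> < \<rho>\<^sup>2"
          using \<nu>1 by linarith
        finally show ?thesis
          using \<rho>(1) by (intro power_less_imp_less_base[of "dist z z0" 2 \<rho>]) auto
      qed
      have Qz: "\<bar>Q z - U0\<bar> \<le> \<nu> / 2"
        using Q_near[OF z \<rho>(6)] \<rho>(5) by linarith
      have uv: "sg * u \<epsilon> z $ j \<le> U0 + \<nu>" "U0 - \<nu> \<le> sg * u \<epsilon> z $ k" for j
        using u_up[OF z, of j] zero_le_power2[of "norm (z - z0)"] max1 \<alpha>n Qz \<nu>1 by linarith+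
      define b where "b = a + (2 * K1) *\<^sub>R (z - z0)"
      define \<zeta> where "\<zeta> = (fst z - y) /\<^sub>R \<alpha>"
      have contact: "snd b + sg * H k (sg *\<^sub>R (fst b + \<zeta>)) (u \<epsilon> z) (gap k (u \<epsilon> z) /\<^sub>R \<epsilon>) (fst z /\<^sub>R \<epsilon>)
          - sg * c * (w k y + H k (p + (sg *\<^sub>R \<zeta>) /\<^sub>R c) (vec r) (gap k (v p r \<epsilon> (y /\<^sub>R \<epsilon>))) (y /\<^sub>R \<epsilon>))
        \<le> 2 * K1 * \<epsilon> * CA + CA * n\<^sup>2 / (\<alpha> * \<epsilon>)"
        unfolding \<zeta>_def w_def n_def
      proof (rule contact_with_corrector[OF sg \<epsilon>(1) _ \<alpha> _ _ u_jet[OF \<epsilon>(1) sg] _ cor, where \<rho> = "\<rho> - dist z z0"])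
        show "continuous_on (UNIV \<times> {0<..}) (u \<epsilon>)"
          by (rule continuous_on_subset[OF u_cont[OF \<epsilon>(1)]]) auto
        show "snd z > 0"
          by (rule in_time[OF z])
        show "0 < \<rho> - dist z z0" "K1 \<ge> 0" "c > 0"
          using inner K1 c by auto
        fix h :: "(real ^ 'n) \<times> real" and \<eta> :: "real ^ 'n" assume "norm h \<le> \<rho> - dist z z0"
        then have "dist (z + h) z0 \<le> \<rho>"
          using norm_triangle_ineq[of "z - z0" h] by (simp add: dist_norm algebra_simps)
        from max[OF this, of k "y + \<eta>"]
        have "sg * u \<epsilon> (z + h) $ k - sg * (c * w k (y + \<eta>)) \<le> sg * u \<epsilon> z $ k - sg * (c * w k y) + (Q (z + h) - Q z)
            + ((norm (fst (z + h) - (y + \<eta>)))\<^sup>2 / (2 * \<alpha>) - (norm (fst z - y))\<^sup>2 / (2 * \<alpha>))"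
          unfolding \<Theta>_def fst_conv snd_conv by linarith
        moreover have "Q (z + h) - Q z = b \<bullet> h + K1 * (norm h)\<^sup>2"
        proof -
          have "(norm (z + h - z0))\<^sup>2 = (norm (z - z0))\<^sup>2 + 2 * ((z - z0) \<bullet> h) + (norm h)\<^sup>2"
            by (simp add: power2_norm_eq_inner inner_diff_left inner_diff_right inner_add_left inner_add_right inner_commute)
          then show ?thesis
            unfolding Q_def b_def by (simp add: inner_add_left inner_add_right inner_diff_right distrib_left)
        qed
        ultimately show "sg * u \<epsilon> (z + h) $ k - sg * (c * \<epsilon> * v p r \<epsilon> ((y + \<eta>) /\<^sub>R \<epsilon>) $ k)
            \<le> sg * u \<epsilon> z $ k - sg * (c * \<epsilon> * v p r \<epsilon> (y /\<^sub>R \<epsilon>) $ k) + b \<bullet> h + K1 * (norm h)\<^sup>2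
            + ((norm (fst (z + h) - (y + \<eta>)))\<^sup>2 - (norm (fst z - y))\<^sup>2) / (2 * \<alpha>)"
          unfolding w_def by (simp add: diff_divide_distrib mult.assoc)
      qed
      define e where "e = sg *\<^sub>R fst b - p"
      have e: "norm e \<le> \<mu>"
      proof -
        have "norm ((2 * K1) *\<^sub>R (fst z - fst z0)) \<le> 2 * K1 * \<rho>"
          using K1 z dist_fst_le[of z z0] by (simp add: dist_norm mult_left_mono)
        moreover have "e = (sg *\<^sub>R fst a - p) + sg *\<^sub>R ((2 * K1) *\<^sub>R (fst z - fst z0))"
          by (simp add: e_def b_def scaleR_add_right)
        moreover have "norm (sg *\<^sub>R x) = norm x" for x :: "real ^ 'n"
          using sg by auto
        ultimately have "norm e \<le> norm (sg *\<^sub>R fst a - p) + 2 * K1 * \<rho>"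
          using norm_triangle_ineq[of "sg *\<^sub>R fst a - p" "sg *\<^sub>R ((2 * K1) *\<^sub>R (fst z - fst z0))"]
          by (metis add_left_mono order_trans)
        then show ?thesis
          using \<rho>(4) by linarith
      qed
      have ham: "sg * c * H k (p + (sg *\<^sub>R \<zeta>) /\<^sub>R c) (vec r) (gap k (v p r \<epsilon> (y /\<^sub>R \<epsilon>))) (y /\<^sub>R \<epsilon>)
          - C2 * (\<mu> + \<nu> + norm (fst z /\<^sub>R \<epsilon> - y /\<^sub>R \<epsilon>))
        \<le> sg * H k (p + e + sg *\<^sub>R \<zeta>) (u \<epsilon> z) (gap k (u \<epsilon> z) /\<^sub>R \<epsilon>) (fst z /\<^sub>R \<epsilon>)"
        unfolding c_def
      proof (rule C2(2)[rule_format])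
        show "norm (gap k (v p r \<epsilon> (y /\<^sub>R \<epsilon>))) \<le> R'"
          using norm_le_card_component[of "gap k (v p r \<epsilon> (y /\<^sub>R \<epsilon>))" C1] C1(2)[OF adm] R'(2) by simp
        fix i
        \<comment> \<open>Maximality over the component at the same two points orders the gaps of
          \<open>u\<close>, divided by \<epsilon>, and those of the corrector, multiplied by
          \<open>c\<close>.\<close>
        have "sg * (c * w k y) - sg * (c * w i y) \<le> sg * u \<epsilon> z $ k - sg * u \<epsilon> z $ i"
          using max[OF z, of i y] by (simp add: \<Theta>_def)
        moreover have "\<epsilon> * (sg * (gap k (u \<epsilon> z) /\<^sub>R \<epsilon>) $ i) = sg * u \<epsilon> z $ k - sg * u \<epsilon> z $ i"
        proof -
          have "\<epsilon> * (gap k (u \<epsilon> z) /\<^sub>R \<epsilon>) $ i = u \<epsilon> z $ k - u \<epsilon> z $ i"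
            using \<epsilon>(1) by simp
          then have "sg * (\<epsilon> * (gap k (u \<epsilon> z) /\<^sub>R \<epsilon>) $ i) = sg * (u \<epsilon> z $ k - u \<epsilon> z $ i)"
            by (rule arg_cong)
          then show ?thesis
            unfolding right_diff_distrib by (simp only: mult.left_commute)
        qed
        moreover have "\<epsilon> * (sg * c * gap k (v p r \<epsilon> (y /\<^sub>R \<epsilon>)) $ i) = sg * (c * w k y) - sg * (c * w i y)"
          by (simp add: w_def algebra_simps)
        ultimately have "\<epsilon> * (sg * c * gap k (v p r \<epsilon> (y /\<^sub>R \<epsilon>)) $ i) \<le> \<epsilon> * (sg * (gap k (u \<epsilon> z) /\<^sub>R \<epsilon>) $ i)"
          by linarith
        then show "sg * (1 + sg * \<mu>) * gap k (v p r \<epsilon> (y /\<^sub>R \<epsilon>)) $ i \<le> sg * (gap k (u \<epsilon> z) /\<^sub>R \<epsilon>) $ i"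
          using \<epsilon>(1) unfolding c_def by (simp only: mult_le_cancel_left_pos)
      qed (use sg \<mu> \<nu> p r U0 rU e uv R'(1) in auto)
      have e_eq: "sg *\<^sub>R (fst b + \<zeta>) = p + e + sg *\<^sub>R \<zeta>"
        by (simp add: e_def scaleR_add_right)
      have n_eps: "norm (fst z /\<^sub>R \<epsilon> - y /\<^sub>R \<epsilon>) \<le> \<nu>"
      proof -
        have "norm (fst z /\<^sub>R \<epsilon> - y /\<^sub>R \<epsilon>) = n / \<epsilon>"
          using \<epsilon>(1) by (simp add: n_def divide_inverse mult.commute flip: scaleR_diff_right)
        also have "\<dots> \<le> \<nu>"
          using n1(1) \<epsilon>(1) by (simp add: pos_divide_le_eq)
        finally show ?thesis .
      qed
      have n_sq: "CA * n\<^sup>2 / (\<alpha> * \<epsilon>) \<le> CA * \<nu>"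
      proof -
        have "n\<^sup>2 \<le> (3 * L * \<alpha>)\<^sup>2"
          using n by (intro power_mono) (auto simp: n_def)
        also have "\<dots> = (9 * L\<^sup>2 * \<alpha>) * \<alpha>"
          by (simp add: power2_eq_square)
        also have "\<dots> \<le> (\<nu> * \<epsilon>) * \<alpha>"
          using \<alpha>' \<alpha> by (intro mult_right_mono) auto
        finally have "n\<^sup>2 / (\<alpha> * \<epsilon>) \<le> \<nu>"
          using \<alpha> \<epsilon>(1) by (simp add: field_simps)
        then show ?thesis
          using CA mult_left_mono[of "n\<^sup>2 / (\<alpha> * \<epsilon>)" \<nu> CA] by simp
      qed
      have "2 * K1 * \<epsilon> * CA \<le> 2 * K1 * CA * \<nu>"
        using \<epsilon>'(3) K1 CA mult_left_mono[of \<epsilon> \<nu> "2 * K1 * CA"] by (simp add: mult_ac)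
      moreover have "C2 * (\<mu> + \<nu> + norm (fst z /\<^sub>R \<epsilon> - y /\<^sub>R \<epsilon>)) \<le> C2 * (\<mu> + \<nu> + \<nu>)"
        using n_eps C2(1) by (intro mult_left_mono) auto
      moreover have "sg * c * (w k y + h) = sg * (c * w k y) + sg * c * h" for h
        by (simp add: algebra_simps)
      moreover have "sg * (c * Hbar p r) \<ge> sg * Hbar p r - \<mu> * (C1 + 1)"
      proof -
        have "sg * (c * Hbar p r) = sg * Hbar p r + (sg * sg) * (\<mu> * Hbar p r)"
          by (simp add: c_def algebra_simps)
        moreover have "sg * sg = 1"
          using sg by auto
        moreover have "\<mu> * - (C1 + 1) \<le> \<mu> * Hbar p r"
          using Hb \<mu>(1) by (intro mult_left_mono) (auto simp: abs_le_iff)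
        ultimately show ?thesis
          unfolding mult_minus_right by simp
      qed
      moreover have "snd b \<ge> snd a - 2 * K1 * \<nu>"
      proof -
        have "\<bar>snd z - snd z0\<bar> \<le> \<nu>"
          using z dist_snd_le[of z z0] \<rho>(7) by (simp add: dist_real_def)
        then have "2 * K1 * - \<nu> \<le> 2 * K1 * (snd z - snd z0)"
          using K1 by (intro mult_left_mono) (auto simp: abs_le_iff)
        then show ?thesis
          by (simp add: b_def)
      qed
      moreover note contact[unfolded e_eq] ham cw_near[OF yR, of k, unfolded abs_le_iff] n_sq \<nu>1(2)
      ultimately have "snd a + sg * Hbar p r \<le> 2 * K1 * \<nu> + \<mu> * (C1 + 1) + 2 * \<nu> + C2 * (\<mu> + \<nu> + \<nu>) + 2 * K1 * CA * \<nu> + CA * \<nu>"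
        using \<nu> by argo
      also have "\<dots> = C * \<mu> + D * \<nu>"
        by (simp add: C_def D_def algebra_simps)
      finally show ?thesis .
    qed
    then show ?thesis
      by (rule le_if_le_add_small)
  qed
  then show ?thesis
    using C by blast
qed

end

section \<open>Barriers\<close>

lemma upper_jet_localI:
  assumes "linear X" "r > 0" "\<And>h. norm h \<le> r \<Longrightarrow> f (x + h) \<le> f x + P \<bullet> h + (h \<bullet> X h) / 2"
  shows "upper_jet f x P X"
proof (rule upper_jetI[OF assms(1)])
  have "\<forall>\<^sub>F h in nhds 0. h \<in> ball (0 :: 'a) r"
    using assms(2) by (intro eventually_nhds_in_open) auto
  then show "\<forall>\<^sub>F h in nhds 0. f (x + h) \<le> f x + P \<bullet> h + (h \<bullet> X h) / 2"
    by eventually_elim (rule assms(3), simp)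
qed

lemma pos_part_square_le:
  fixes t h :: real
  shows "(max 0 (t + h))\<^sup>2 \<le> (max 0 t)\<^sup>2 + 2 * max 0 t * h + h\<^sup>2"
proof (cases "t \<ge> 0")
  case True
  have "(max 0 (t + h))\<^sup>2 \<le> (t + h)\<^sup>2"
    by (simp add: max_def)
  then show ?thesis
    using True by (simp add: power2_sum algebra_simps)
next
  case False
  then have "(max 0 (t + h))\<^sup>2 \<le> \<bar>h\<bar>\<^sup>2"
    by (intro power_mono) auto
  then show ?thesis
    using False by (simp add: max_def)
qed

context hj_coefficients
begin

text \<open>Where component \<open>k\<close> of \<open>sg * w\<close> is the largest, the coupling
  and the other components act in the favourable direction, and the equation can be treated as a
  scalar one with constant vector \<open>w $ k\<close> and gap 0.\<close>

lemma H_at_maximal_component: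
  assumes sg: "sg \<in> {1, - 1}" and max: "\<And>j. sg * w $ j \<le> sg * w $ k" and c: "c \<ge> 0"
  shows "sg * H k P (vec (w $ k)) 0 y \<le> sg * H k P w (c *\<^sub>R gap k w) y"
  using sg
proof (elim insertE emptyE)
  assume sg: "sg = 1"
  have "H k P (vec (w $ k)) 0 y \<le> H k P w 0 y"
    using max sg by (intro mono_r) auto
  also have "\<dots> \<le> H k P w (c *\<^sub>R gap k w) y"
    using max sg c by (intro mono_s) auto
  finally show ?thesis
    using sg by simp
next
  assume sg: "sg = - 1"
  have "c * (w $ k - w $ j) \<le> 0" for j
    using max[of j] sg c by (simp add: mult_nonneg_nonpos)
  then have "H k P w (c *\<^sub>R gap k w) y \<le> H k P w 0 y"
    by (intro mono_s) auto
  also have "\<dots> \<le> H k P (vec (w $ k)) 0 y"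
    using max sg by (intro mono_r) auto
  finally show ?thesis
    using sg by simp
qed

end

context homogenization
begin

lemma u_bounded:
  assumes "\<epsilon> > 0" "T > 0"
  obtains B where "B > 0" "\<And>z k. 0 \<le> snd z \<Longrightarrow> snd z < T \<Longrightarrow> \<bar>u \<epsilon> z $ k\<bar> \<le> B"
proof -
  have "bounded (u \<epsilon> ` (UNIV \<times> {0..<T}))"
    using u_BUC[OF assms] by (simp add: BUC_on_def)
  then obtain B where B: "B > 0" "\<And>z. z \<in> UNIV \<times> {0..<T} \<Longrightarrow> norm (u \<epsilon> z) \<le> B"
    unfolding bounded_pos by blast
  have "\<bar>u \<epsilon> z $ k\<bar> \<le> B" if "0 \<le> snd z" "snd z < T" for z k
    using B(2)[of z] that component_le_norm_cart[of "u \<epsilon> z" k] by (simp add: mem_Times_iff)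
  then show ?thesis
    using B(1) by (rule that[rotated])
qed

text \<open>If \<open>sg * u\<close> exceeded its barrier, a maximum over all components and points
  would exist by the quadratic growth of the barrier. The initial condition excludes time 0, and at
  a positive time the equation of the touched component holds with the slope \<open>b\<close> of the
  barrier.\<close>

lemma barrier_contact:
  fixes \<psi> :: "'m \<Rightarrow> (real ^ 'n) \<times> real \<Rightarrow> real" and b :: "'m \<Rightarrow> (real ^ 'n) \<times> real \<Rightarrow> (real ^ 'n) \<times> real"
    and z1 :: "(real ^ 'n) \<times> real"
  assumes sg: "sg \<in> {1, - 1}" and \<epsilon>: "\<epsilon> > 0" and T: "T \<ge> 0" and K: "K \<ge> 0" and \<beta>: "\<beta> > 0"
    and cont: "\<And>k. continuous_on (UNIV \<times> {0..}) (\<psi> k)"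
    and growth: "\<And>k x t. 0 \<le> t \<Longrightarrow> \<beta> * (norm (x - x0))\<^sup>2 - B' \<le> \<psi> k (x, t)"
    and init: "\<And>k x. sg * u0 x $ k \<le> \<psi> k (x, 0)"
    and quad: "\<And>k z. 0 < snd z \<Longrightarrow> \<exists>r>0. \<forall>h. norm h \<le> r \<longrightarrow>
        \<psi> k (z + h) \<le> \<psi> k z + b k z \<bullet> h + K * (norm (fst h))\<^sup>2 + K' * (snd h)\<^sup>2"
    and above: "0 \<le> snd z1" "snd z1 \<le> T" "\<psi> k1 z1 < sg * u \<epsilon> z1 $ k1"
  obtains k z where "0 < snd z" "snd z < T + 1" "\<psi> k z < sg * u \<epsilon> z $ k"
    "\<And>j. sg * u \<epsilon> z $ j - \<psi> j z \<le> sg * u \<epsilon> z $ k - \<psi> k z"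
    "snd (b k z) + sg * H k (sg *\<^sub>R fst (b k z)) (u \<epsilon> z) (gap k (u \<epsilon> z) /\<^sub>R \<epsilon>) (fst z /\<^sub>R \<epsilon>) \<le> 2 * K * \<epsilon> * CA"
proof -
  obtain B where B: "B > 0" "\<And>z k. 0 \<le> snd z \<Longrightarrow> snd z < T + 2 \<Longrightarrow> \<bar>u \<epsilon> z $ k\<bar> \<le> B"
    using u_bounded[OF \<epsilon>, of "T + 2"] T by auto
  define G where "G = B + \<bar>B'\<bar>"
  have G: "G > 0"
    using B(1) by (simp add: G_def)
  define f where "f k z = sg * u \<epsilon> z $ k - \<psi> k z - G * (max 0 (snd z - T))\<^sup>2" for k z
  have sgB: "sg * u \<epsilon> z $ k \<le> B" if "0 \<le> snd z" "snd z < T + 2" for z k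
    using B(2)[OF that, of k] sg by (auto simp: abs_le_iff)
  have f1: "f k1 z1 > 0"
    using above by (simp add: f_def)
  have near: "\<beta> * (norm (fst z - x0))\<^sup>2 \<le> B + \<bar>B'\<bar> - G * (max 0 (snd z - T))\<^sup>2" if "0 < f k z" "0 \<le> snd z" "snd z \<le> T + 1" for k z
    using that(1) sgB[of z k] that(2,3) growth[of "snd z" "fst z" k] by (simp add: f_def)
  obtain k z where z: "z \<in> UNIV \<times> {0..T + 1}" and max: "\<And>j z'. z' \<in> UNIV \<times> {0..T + 1} \<Longrightarrow> f j z' \<le> f k z"
  proof (rule finite_family_attains_sup[of "UNIV \<times> {0..T + 1}" f z1 k1 "norm x0 + sqrt ((B + \<bar>B'\<bar>) / \<beta>) + (T + 1)"])
    show "closed (UNIV \<times> {0..T + 1} :: ((real ^ 'n) \<times> real) set)"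
      by (intro closed_Times) auto
    show "continuous_on (UNIV \<times> {0..T + 1}) (f k)" for k
    proof -
      have "continuous_on (UNIV \<times> {0..T + 1}) (u \<epsilon>)" "continuous_on (UNIV \<times> {0..T + 1}) (\<psi> k)"
        by (rule continuous_on_subset[OF u_cont[OF \<epsilon>]] continuous_on_subset[OF cont], force)+
      then show ?thesis
        unfolding f_def by (intro continuous_intros)
    qed
    show "z1 \<in> UNIV \<times> {0..T + 1}"
      using above by (simp add: mem_Times_iff)
    fix k z assume z: "z \<in> UNIV \<times> {0..T + 1}" and le: "f k1 z1 \<le> f k z"
    then have t: "0 \<le> snd z" "snd z \<le> T + 1"
      by (auto simp: mem_Times_iff)
    have "0 \<le> G * (max 0 (snd z - T))\<^sup>2"
      using G by simp
    then have "\<beta> * (norm (fst z - x0))\<^sup>2 \<le> B + \<bar>B'\<bar>"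
      using near[OF _ t, of k] f1 le by linarith
    then have "(norm (fst z - x0))\<^sup>2 \<le> (B + \<bar>B'\<bar>) / \<beta>"
      using \<beta> by (simp add: field_simps)
    then have "norm (fst z - x0) \<le> sqrt ((B + \<bar>B'\<bar>) / \<beta>)"
      by (rule real_le_rsqrt)
    moreover have "norm z \<le> norm (fst z) + \<bar>snd z\<bar>"
      using norm_Pair_le[of "fst z" "snd z"] by simp
    ultimately show "norm z \<le> norm x0 + sqrt ((B + \<bar>B'\<bar>) / \<beta>) + (T + 1)"
      using norm_triangle_sub[of "fst z" x0] t by linarith
  next
    fix k z assume "z \<in> UNIV \<times> {0..T + 1}" "\<And>j z'. z' \<in> UNIV \<times> {0..T + 1} \<Longrightarrow> f j z' \<le> f k z"
    then show thesis
      by (rule that)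
  qed
  have t: "0 \<le> snd z" "snd z \<le> T + 1"
    using z by (auto simp: mem_Times_iff)
  have fpos: "0 < f k z"
    using f1 max[of z1 k1] above by (auto simp: mem_Times_iff)
  have pen: "0 \<le> G * (max 0 (snd z - T))\<^sup>2"
    using G by simp
  have t1: "snd z < T + 1"
  proof (rule ccontr)
    assume "\<not> ?thesis"
    then have "max 0 (snd z - T) = 1"
      using t by simp
    then have "\<beta> * (norm (fst z - x0))\<^sup>2 + G \<le> B + \<bar>B'\<bar>"
      using near[OF fpos t] by simp
    moreover have "f k z \<le> B + \<bar>B'\<bar> - \<beta> * (norm (fst z - x0))\<^sup>2 - G"
      using sgB[of z k] t growth[of "snd z" "fst z" k] \<open>max 0 (snd z - T) = 1\<close> by (simp add: f_def)
    moreover have "0 \<le> \<beta> * (norm (fst z - x0))\<^sup>2"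
      using \<beta> by simp
    ultimately show False
      using fpos by (simp add: G_def)
  qed
  have t0: "0 < snd z"
  proof (rule ccontr)
    assume "\<not> ?thesis"
    then have "z = (fst z, 0)"
      using t by (simp add: prod_eq_iff)
    then have "sg * u \<epsilon> z $ k \<le> \<psi> k z"
      using init[of "fst z" k] u_initial[OF \<epsilon>, of "fst z"] by metis
    then show False
      using fpos pen by (simp add: f_def)
  qed
  have zin: "z \<in> UNIV \<times> {0<..}"
    using t0 by (simp add: mem_Times_iff)
  obtain r where r: "r > 0" "\<And>h. norm h \<le> r \<Longrightarrow> \<psi> k (z + h) \<le> \<psi> k z + b k z \<bullet> h + K * (norm (fst h))\<^sup>2 + K' * (snd h)\<^sup>2"
    using quad[OF t0, of k] by blast
  define X where "X h = ((2 * K) *\<^sub>R fst h, (2 * (K' + G)) *\<^sub>R snd h)" for h :: "(real ^ 'n) \<times> real"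
  define P where "P = b k z + (0, 2 * G * max 0 (snd z - T))"
  have "upper_jet (\<lambda>z. sg * u \<epsilon> z $ k) z P X"
  proof (rule upper_jet_localI)
    show "linear X"
      unfolding X_def by (rule linearI) (simp_all add: algebra_simps)
    define r' where "r' = min r (min (snd z) (T + 1 - snd z))"
    show "r' > 0"
      using r(1) t0 t1 by (simp add: r'_def)
    fix h :: "(real ^ 'n) \<times> real" assume h: "norm h \<le> r'"
    have "\<bar>snd h\<bar> \<le> r'"
      using h norm_snd_le[of "snd h" "fst h"] by simp
    then have "z + h \<in> UNIV \<times> {0..T + 1}"
      by (auto simp: r'_def mem_Times_iff)
    from max[OF this, of k]
    have 1: "sg * u \<epsilon> (z + h) $ k \<le> sg * u \<epsilon> z $ k + (\<psi> k (z + h) - \<psi> k z) + (G * (max 0 (snd (z + h) - T))\<^sup>2 - G * (max 0 (snd z - T))\<^sup>2)"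
      by (simp add: f_def)
    have "(max 0 ((snd z - T) + snd h))\<^sup>2 \<le> (max 0 (snd z - T))\<^sup>2 + 2 * max 0 (snd z - T) * snd h + (snd h)\<^sup>2"
      by (rule pos_part_square_le)
    then have "G * (max 0 ((snd z - T) + snd h))\<^sup>2 \<le> G * ((max 0 (snd z - T))\<^sup>2 + 2 * max 0 (snd z - T) * snd h + (snd h)\<^sup>2)"
      using G by (intro mult_left_mono) auto
    then have 2: "G * (max 0 (snd (z + h) - T))\<^sup>2 - G * (max 0 (snd z - T))\<^sup>2 \<le> 2 * G * max 0 (snd z - T) * snd h + G * (snd h)\<^sup>2"
      by (simp add: algebra_simps)
    have 3: "\<psi> k (z + h) - \<psi> k z \<le> b k z \<bullet> h + K * (norm (fst h))\<^sup>2 + K' * (snd h)\<^sup>2"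
      using r(2)[of h] h by (simp add: r'_def)
    have "P \<bullet> h + (h \<bullet> X h) / 2 = b k z \<bullet> h + 2 * G * max 0 (snd z - T) * snd h + K * (norm (fst h))\<^sup>2 + (K' + G) * (snd h)\<^sup>2"
      by (simp add: P_def X_def inner_add_left inner_prod_def power2_norm_eq_inner) (simp add: power2_eq_square algebra_simps)
    then show "sg * u \<epsilon> (z + h) $ k \<le> sg * u \<epsilon> z $ k + P \<bullet> h + (h \<bullet> X h) / 2"
      using 1 2 3 by (simp add: distrib_right)
  qed
  then have "snd P + sg * H k (sg *\<^sub>R fst P) (u \<epsilon> z) (gap k (u \<epsilon> z) /\<^sub>R \<epsilon>) (fst z /\<^sub>R \<epsilon>)
      \<le> (\<Sum>j<d k. (sqrt \<epsilon> *\<^sub>R \<sigma> k (fst z /\<^sub>R \<epsilon>) j, 0) \<bullet> X (sqrt \<epsilon> *\<^sub>R \<sigma> k (fst z /\<^sub>R \<epsilon>) j, 0))"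
    using u_jet[OF \<epsilon> sg, of k] zin unfolding jet_subsolution_def by blast
  also have "\<dots> = 2 * K * \<epsilon> * (\<Sum>j<d k. (norm (\<sigma> k (fst z /\<^sub>R \<epsilon>) j))\<^sup>2)"
  proof -
    have "(sqrt \<epsilon> *\<^sub>R a, 0) \<bullet> X (sqrt \<epsilon> *\<^sub>R a, 0) = 2 * K * (sqrt \<epsilon> * sqrt \<epsilon>) * (norm a)\<^sup>2" for a :: "real ^ 'n"
      unfolding X_def fst_conv snd_conv inner_prod_def power2_norm_eq_inner inner_scaleR_left inner_scaleR_right
      by (simp add: mult_ac)
    moreover have "sqrt \<epsilon> * sqrt \<epsilon> = \<epsilon>"
      using \<epsilon> by simp
    ultimately show ?thesis
      by (simp add: sum_distrib_left)
  qed
  also have "\<dots> \<le> 2 * K * \<epsilon> * CA"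
    using K \<epsilon> by (intro mult_left_mono sigma_bound) auto
  finally have 4: "snd P + sg * H k (sg *\<^sub>R fst P) (u \<epsilon> z) (gap k (u \<epsilon> z) /\<^sub>R \<epsilon>) (fst z /\<^sub>R \<epsilon>) \<le> 2 * K * \<epsilon> * CA" .
  have P: "fst P = fst (b k z)" "snd (b k z) \<le> snd P"
    using G by (auto simp: P_def)
  show ?thesis
  proof (rule that[OF t0 t1])
    show "\<psi> k z < sg * u \<epsilon> z $ k"
      using fpos pen by (simp add: f_def)
    show "sg * u \<epsilon> z $ j - \<psi> j z \<le> sg * u \<epsilon> z $ k - \<psi> k z" for j
      using max[OF z, of j] by (simp add: f_def)
    show "snd (b k z) + sg * H k (sg *\<^sub>R fst (b k z)) (u \<epsilon> z) (gap k (u \<epsilon> z) /\<^sub>R \<epsilon>) (fst z /\<^sub>R \<epsilon>) \<le> 2 * K * \<epsilon> * CA"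
      using 4 P by simp
  qed
qed

lemma u0_bounded:
  obtains B where "B > 0" "\<And>x k. \<bar>u0 x $ k\<bar> \<le> B"
proof -
  obtain B where "B > 0" "\<And>x. norm (u0 x) \<le> B"
    using u0 unfolding BUC_on_def bounded_pos by blast
  then show ?thesis
    using component_le_norm_cart by (intro that[of B]) (auto intro: order_trans)
qed

lemma quadratic_increment:
  fixes x x0 h :: "real ^ 'n"
  shows "(norm (x + h - x0))\<^sup>2 = (norm (x - x0))\<^sup>2 + 2 * ((x - x0) \<bullet> h) + (norm h)\<^sup>2"
  by (simp add: power2_norm_eq_inner inner_diff_left inner_diff_right inner_add_left inner_add_right inner_commute)

text \<open>The barrier B0 + C t + \<beta> |x - x0|^2 is the same for all components, so the touched
  one is the largest. There \<open>sg * u\<close> is positive and \<open>mono_diag\<close> lowers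
  the constant vector to 0, which keeps the size of \<open>u\<close> out of the bound on
  \<open>H\<close>.\<close>

lemma u_uniformly_bounded:
  obtains B C where "B > 0" "C > 0" "\<And>(\<epsilon> :: real) z k. 0 < \<epsilon> \<Longrightarrow> \<epsilon> \<le> 1 \<Longrightarrow> 0 \<le> snd z \<Longrightarrow> \<bar>u \<epsilon> z $ k\<bar> \<le> B + C * snd z"
proof -
  obtain B0 where B0: "B0 > 0" "\<And>x k. \<bar>u0 x $ k\<bar> \<le> B0"
    using u0_bounded by metis
  obtain C4 where C4: "\<And>k p r s y. norm p \<le> 1 \<Longrightarrow> norm r \<le> 1 \<Longrightarrow> norm s \<le> 1 \<Longrightarrow> s \<in> others k \<Longrightarrow> \<bar>H k p r s y\<bar> \<le> C4"
    using H_bounded[of 1] by blast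
  define C where "C = \<bar>C4\<bar> + 2 * CA + 1"
  have C: "C > 0"
    using CA by (simp add: C_def)
  have main: "sg * u \<epsilon> (x0, t0) $ k0 \<le> B0 + C * t0" if sg: "sg \<in> {1, - 1}" and \<epsilon>: "0 < \<epsilon>" "\<epsilon> \<le> 1" and t0: "0 \<le> t0"
    for sg \<epsilon> t0 :: real and k0 x0
  proof (rule ccontr)
    assume above: "\<not> ?thesis"
    obtain B where B: "B > 0" "\<And>z k. 0 \<le> snd z \<Longrightarrow> snd z < t0 + 1 \<Longrightarrow> \<bar>u \<epsilon> z $ k\<bar> \<le> B"
      using u_bounded[OF \<epsilon>(1), of "t0 + 1"] t0 by auto
    define \<beta> where "\<beta> = min 1 (1 / (4 * B))"
    have \<beta>: "\<beta> > 0" "\<beta> \<le> 1" "4 * \<beta> * B \<le> 1"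
      using B(1) by (auto simp: \<beta>_def min_def field_simps)
    define \<psi> where "\<psi> z = B0 + C * snd z + \<beta> * (norm (fst z - x0))\<^sup>2" for z
    define b where "b z = ((2 * \<beta>) *\<^sub>R (fst z - x0), C)" for z :: "(real ^ 'n) \<times> real"
    obtain k z where z: "0 < snd z" "snd z < t0 + 1" "\<psi> z < sg * u \<epsilon> z $ k"
      "\<And>j. sg * u \<epsilon> z $ j - \<psi> z \<le> sg * u \<epsilon> z $ k - \<psi> z"
      "snd (b z) + sg * H k (sg *\<^sub>R fst (b z)) (u \<epsilon> z) (gap k (u \<epsilon> z) /\<^sub>R \<epsilon>) (fst z /\<^sub>R \<epsilon>) \<le> 2 * \<beta> * \<epsilon> * CA"
    proof (rule barrier_contact[OF sg \<epsilon>(1) t0 less_imp_le[OF \<beta>(1)] \<beta>(1), of "\<lambda>_. \<psi>" x0 0 "\<lambda>_. b" 0 "(x0, t0)" k0])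
      show "continuous_on (UNIV \<times> {0..}) \<psi>"
        unfolding \<psi>_def by (intro continuous_intros)
      show "\<beta> * (norm (x - x0))\<^sup>2 - 0 \<le> \<psi> (x, t)" if "0 \<le> t" for x t
        using that B0(1) C by (simp add: \<psi>_def)
      show "sg * u0 x $ k \<le> \<psi> (x, 0)" for k x
      proof -
        have "sg * u0 x $ k \<le> B0"
          using B0(2)[of x k] sg by (auto simp: abs_le_iff)
        then show ?thesis
          using \<beta>(1) by (simp add: \<psi>_def add_increasing2)
      qed
      show "\<exists>r>0. \<forall>h. norm h \<le> r \<longrightarrow> \<psi> (z + h) \<le> \<psi> z + b z \<bullet> h + \<beta> * (norm (fst h))\<^sup>2 + 0 * (snd h)\<^sup>2" for z
        unfolding \<psi>_def b_def fst_add snd_add quadratic_increment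
        by (intro exI[of _ 1]) (simp add: inner_prod_def distrib_left)
      show "\<psi> (x0, t0) < sg * u \<epsilon> (x0, t0) $ k0"
        using above by (simp add: \<psi>_def)
    qed (use t0 in auto)
    have \<psi>_pos: "0 \<le> \<psi> z" "\<beta> * (norm (fst z - x0))\<^sup>2 \<le> \<psi> z"
      using z(1) B0(1) C \<beta>(1) by (auto simp: \<psi>_def)
    have uB: "sg * u \<epsilon> z $ k \<le> B"
      using B(2)[of z k] z(1,2) sg by (auto simp: abs_le_iff)
    have "(norm (fst (b z)))\<^sup>2 = 4 * \<beta> * (\<beta> * (norm (fst z - x0))\<^sup>2)"
      by (simp add: b_def power_mult_distrib power2_eq_square)
    also have "\<dots> \<le> 4 * \<beta> * B"
      using z(3) \<psi>_pos uB \<beta>(1) by (intro mult_left_mono) auto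
    also have "\<dots> \<le> 1"
      by (rule \<beta>(3))
    finally have nb: "norm (sg *\<^sub>R fst (b z)) \<le> 1"
      using sg by (auto simp: abs_square_le_1)
    have "- \<bar>C4\<bar> \<le> sg * H k (sg *\<^sub>R fst (b z)) (vec 0) 0 (fst z /\<^sub>R \<epsilon>)"
      using C4[OF nb, of "vec 0" 0 k "fst z /\<^sub>R \<epsilon>"] sg by (auto simp: abs_le_iff)
    also have "\<dots> \<le> sg * H k (sg *\<^sub>R fst (b z)) (vec (u \<epsilon> z $ k)) 0 (fst z /\<^sub>R \<epsilon>)"
    proof -
      have "H k P (vec 0) 0 y \<le> H k P (vec (u \<epsilon> z $ k)) 0 y" if "sg = 1" for P y
        using that z(3) \<psi>_pos(1) by (intro mono_diag) auto
      moreover have "H k P (vec (u \<epsilon> z $ k)) 0 y \<le> H k P (vec 0) 0 y" if "sg = - 1" for P y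
        using that z(3) \<psi>_pos(1) by (intro mono_diag) auto
      ultimately show ?thesis
        using sg by (elim insertE emptyE) (simp_all only: mult_1_left mult_minus_left neg_le_iff_le)
    qed
    also have "\<dots> \<le> sg * H k (sg *\<^sub>R fst (b z)) (u \<epsilon> z) (gap k (u \<epsilon> z) /\<^sub>R \<epsilon>) (fst z /\<^sub>R \<epsilon>)"
      using z(4) \<epsilon>(1) by (intro H_at_maximal_component sg) auto
    finally have "C - \<bar>C4\<bar> \<le> 2 * \<beta> * \<epsilon> * CA"
      using z(5) by (simp add: b_def)
    also have "\<dots> \<le> 2 * CA"
    proof -
      have "\<beta> * \<epsilon> \<le> 1"
        using \<beta> \<epsilon> by (intro mult_le_one) auto
      then show ?thesis
        using CA mult_right_mono[of "\<beta> * \<epsilon>" 1 "2 * CA"] by (simp add: mult_ac)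
    qed
    finally show False
      by (simp add: C_def)
  qed
  show ?thesis
  proof (rule that[OF B0(1) C])
    fix \<epsilon> :: real and z :: "(real ^ 'n) \<times> real" and k assume *: "0 < \<epsilon>" "\<epsilon> \<le> 1" "0 \<le> snd z"
    show "\<bar>u \<epsilon> z $ k\<bar> \<le> B0 + C * snd z"
      using main[of 1 \<epsilon> "snd z" "fst z" k] main[of "- 1" \<epsilon> "snd z" "fst z" k] * by (simp add: abs_le_iff)
  qed
qed

end

section \<open>Initial data and the initial layer\<close>

lemma inverse_affine_le_quadratic:
  fixes s g :: real
  assumes "s \<ge> 1" "\<bar>g\<bar> \<le> 1 / 2"
  shows "1 / (s + g) \<le> 1 / s - g / s\<^sup>2 + 2 * g\<^sup>2"
proof -
  have pos: "s + g \<ge> 1 / 2" "s > 0"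
    using assms by linarith+
  have "1 / (s + g) = 1 / s - g / s\<^sup>2 + g\<^sup>2 / (s\<^sup>2 * (s + g))"
  proof -
    define t where "t = s + g"
    have g: "g = t - s" and "t \<noteq> 0" "s \<noteq> 0"
      using pos by (auto simp: t_def)
    then show ?thesis
      unfolding t_def[symmetric] g by (simp add: divide_simps power2_eq_square) (simp add: algebra_simps)
  qed
  moreover have "g\<^sup>2 / (s\<^sup>2 * (s + g)) \<le> g\<^sup>2 / (1 / 2)"
  proof (rule divide_left_mono)
    have "1 * (1 / 2) \<le> s\<^sup>2 * (s + g)"
      using assms(1) pos by (intro mult_mono) (auto intro: one_le_power)
    then show "1 / 2 \<le> s\<^sup>2 * (s + g)" "0 < (s\<^sup>2 * (s + g)) * (1 / 2)"
      by auto
  qed simp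
  ultimately show ?thesis
    by simp
qed

context homogenization
begin

definition u0_min :: "real ^ 'n \<Rightarrow> real" where
  "u0_min x = Min (range (\<lambda>k. u0 x $ k))"

lemma u0_min_le: "u0_min x \<le> u0 x $ k"
  by (simp add: u0_min_def)

lemma u0_min_attained: "\<exists>k. u0_min x = u0 x $ k"
proof -
  have "u0_min x \<in> range (\<lambda>k. u0 x $ k)"
    unfolding u0_min_def by (intro Min_in) auto
  then show ?thesis
    by auto
qed

text \<open>Beyond the distance \<open>e\<close> of uniform continuity the quadratic term alone
  exceeds the largest possible difference \<open>2 * B\<close>. Paraboloids can thus serve as
  barriers for merely uniformly continuous data.\<close>

lemma u0_quadratic_modulus:
  assumes \<eta>: "\<eta> > 0"
  obtains K where "K > 0" "\<And>x y k. \<bar>u0 x $ k - u0 y $ k\<bar> \<le> \<eta> + K * (norm (x - y))\<^sup>2"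
proof -
  obtain B where B: "B > 0" "\<And>x k. \<bar>u0 x $ k\<bar> \<le> B"
    using u0_bounded by metis
  obtain e where e: "e > 0" "\<And>x y. dist x y < e \<Longrightarrow> dist (u0 x) (u0 y) < \<eta>"
    using u0 \<eta> unfolding BUC_on_def uniformly_continuous_on_def by blast
  have "\<bar>u0 x $ k - u0 y $ k\<bar> \<le> \<eta> + (2 * B / e\<^sup>2) * (norm (x - y))\<^sup>2" for x y k
  proof (cases "dist x y < e")
    case True
    have "\<bar>u0 x $ k - u0 y $ k\<bar> \<le> norm (u0 x - u0 y)"
      using component_le_norm_cart[of "u0 x - u0 y" k] by simp
    also have "\<dots> \<le> \<eta>"
      using e(2)[OF True] by (simp add: dist_norm)
    finally show ?thesis
      using B(1) by (simp add: add_increasing2)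
  next
    case False
    then have "e\<^sup>2 \<le> (norm (x - y))\<^sup>2"
      using e(1) by (intro power_mono) (auto simp: dist_norm)
    then have "(2 * B / e\<^sup>2) * e\<^sup>2 \<le> (2 * B / e\<^sup>2) * (norm (x - y))\<^sup>2"
      using B(1) by (intro mult_left_mono) auto
    moreover have "(2 * B / e\<^sup>2) * e\<^sup>2 = 2 * B"
      using e(1) by simp
    ultimately show ?thesis
      using B(2)[of x k] B(2)[of y k] \<eta> by linarith
  qed
  moreover have "2 * B / e\<^sup>2 > 0"
    using B(1) e(1) by simp
  ultimately show ?thesis
    by (rule that[rotated])
qed

lemma u0_min_quadratic_modulus:
  assumes "\<And>x y k. \<bar>u0 x $ k - u0 y $ k\<bar> \<le> \<eta> + K * (norm (x - y))\<^sup>2"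
  shows "\<bar>u0_min x - u0_min y\<bar> \<le> \<eta> + K * (norm (x - y))\<^sup>2"
proof -
  obtain k j where "u0_min x = u0 x $ k" "u0_min y = u0 y $ j"
    using u0_min_attained by metis
  then show ?thesis
    using u0_min_le[of x j] u0_min_le[of y k] assms[of x j y] assms[of x k y] by linarith
qed

text \<open>
  For \<open>sg = 1\<close>, the components other than the smallest one decay to it in time \<open>O(\<epsilon>)\<close>, because the
  coupling term grows linearly in \<open>(u\<^sub>k - u\<^sub>j) / \<epsilon>\<close>; the barrier models this decay.
\<close>

lemma initial_layer:
  assumes \<eta>: "\<eta> > 0"
  obtains C c E where "C \<ge> 0" "c > 0" "E \<ge> 0" "\<And>sg \<epsilon> x t k. sg \<in> {1, - 1} \<Longrightarrow> 0 < \<epsilon> \<Longrightarrow> \<epsilon> \<le> 1 \<Longrightarrow> 0 \<le> t \<Longrightarrow> t \<le> 1 \<Longrightarrow>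
    sg * u \<epsilon> (x, t) $ k \<le> sg * u0_min x + \<eta> + C * t + E / (1 + c * t / \<epsilon>)"
proof -
  obtain B0 where B0: "B0 > 0" "\<And>x k. \<bar>u0 x $ k\<bar> \<le> B0"
    using u0_bounded by metis
  obtain B' C' where B': "B' > 0" "C' > 0" "\<And>\<epsilon> z k. 0 < \<epsilon> \<Longrightarrow> \<epsilon> \<le> 1 \<Longrightarrow> 0 \<le> snd z \<Longrightarrow> \<bar>u \<epsilon> z $ k\<bar> \<le> B' + C' * snd z"
    using u_uniformly_bounded by metis
  define M where "M = B' + 2 * C'"
  have M: "\<bar>u \<epsilon> z $ k\<bar> \<le> M" if "0 < \<epsilon>" "\<epsilon> \<le> 1" "0 \<le> snd z" "snd z \<le> 2" for \<epsilon> z k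
    using B'(3)[OF that(1-3), of k] mult_left_mono[OF that(4), of C'] B'(2) unfolding M_def by linarith
  have M0: "M \<ge> 0"
    using B' by (simp add: M_def)
  obtain K where K: "K > 0" "\<And>x y k. \<bar>u0 x $ k - u0 y $ k\<bar> \<le> \<eta> + K * (norm (x - y))\<^sup>2"
    using u0_quadratic_modulus[OF \<eta>] by metis
  define R where "R = max (1 + 4 * K * (M + B0)) (real CARD('m) * M)"
  obtain c C3 where c: "c > 0" and C3: "\<And>k p r s y i. norm r \<le> R \<Longrightarrow> s \<in> others k \<Longrightarrow> c * s $ i - C3 \<le> H k p r s y"
    using coercive_s[of R] by blast
  obtain C4 where C4: "\<And>k p r s y. norm p \<le> R \<Longrightarrow> norm r \<le> R \<Longrightarrow> norm s \<le> R \<Longrightarrow> s \<in> others k \<Longrightarrow> \<bar>H k p r s y\<bar> \<le> C4"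
    using H_bounded[of R] by blast
  define C where "C = \<bar>C3\<bar> + \<bar>C4\<bar> + 2 * K * CA + 1"
  have C: "C \<ge> 0"
    using CA K(1) by (simp add: C_def)
  define E where "E = 2 * B0"
  have normR: "norm w \<le> R" if "\<And>i. \<bar>w $ i\<bar> \<le> M" for w :: "real ^ 'm"
    using norm_le_card_component[OF that] by (simp add: R_def le_max_iff_disj)
  have "sg * u \<epsilon> (x0, t0) $ k0 \<le> sg * u0_min x0 + \<eta> + C * t0 + E / (1 + c * t0 / \<epsilon>)"
    if sg: "sg \<in> {1, - 1}" and \<epsilon>: "0 < \<epsilon>" "\<epsilon> \<le> 1" and t0: "0 \<le> t0" "t0 \<le> 1" for sg \<epsilon> t0 :: real and x0 k0
  proof (rule ccontr)
    assume above: "\<not> ?thesis"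
    obtain j0 where j0: "u0_min x0 = u0 x0 $ j0"
      using u0_min_attained by metis
    \<comment> \<open>Only the upper bound has a layer, and only for the components other than
      \<open>j0\<close>, which attains the minimum at \<open>x0\<close>; \<open>E = 2 * B0\<close>
      covers their initial excess.\<close>
    define E' where "E' k = (if sg = 1 \<and> k \<noteq> j0 then E else 0)" for k
    have E': "0 \<le> E' k" "E' k \<le> E" for k
      using B0(1) by (auto simp: E'_def E_def)
    define a where "a = c / \<epsilon>"
    have a: "a > 0"
      using c \<epsilon>(1) by (simp add: a_def)
    \<comment> \<open>The profile solves \<theta>' = - a \<theta>^2 with values in [0, 1]: the decay
      a E' \<theta>^2 of the barrier is at most \<open>a\<close> times the excess E' \<theta>, and
      this is what coercivity in \<open>s\<close> supplies for
      \<open>a = c / \<epsilon>\<close>.\<close>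
    define \<theta> where "\<theta> t = 1 / (1 + a * t)" for t
    define \<psi> where "\<psi> k z = sg * u0_min x0 + \<eta> + C * snd z + K * (norm (fst z - x0))\<^sup>2 + E' k * \<theta> (snd z)" for k z
    define b where "b k z = ((2 * K) *\<^sub>R (fst z - x0), C - E' k * a * (\<theta> (snd z))\<^sup>2)" for k and z :: "(real ^ 'n) \<times> real"
    have \<theta>_nonneg: "0 \<le> \<theta> t" "\<theta> t \<le> 1" if "0 \<le> t" for t
    proof -
      have "0 \<le> a * t"
        using that a by simp
      then show "0 \<le> \<theta> t" "\<theta> t \<le> 1"
        by (auto simp: \<theta>_def)
    qed
    have minB: "\<bar>sg * u0_min x0\<bar> \<le> B0"
      using B0(2)[of x0 j0] sg by (auto simp: j0)
    obtain k z where z: "0 < snd z" "snd z < 1 + 1" "\<psi> k z < sg * u \<epsilon> z $ k"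
      "\<And>j. sg * u \<epsilon> z $ j - \<psi> j z \<le> sg * u \<epsilon> z $ k - \<psi> k z"
      "snd (b k z) + sg * H k (sg *\<^sub>R fst (b k z)) (u \<epsilon> z) (gap k (u \<epsilon> z) /\<^sub>R \<epsilon>) (fst z /\<^sub>R \<epsilon>) \<le> 2 * K * \<epsilon> * CA"
    proof (rule barrier_contact[OF sg \<epsilon>(1) zero_le_one less_imp_le[OF K(1)] K(1), of \<psi> x0 B0 b "2 * E * a\<^sup>2" "(x0, t0)" k0])
      show "continuous_on (UNIV \<times> {0..}) (\<psi> k)" for k
      proof -
        have "1 + a * snd z \<noteq> 0" if "z \<in> UNIV \<times> {0..}" for z :: "(real ^ 'n) \<times> real"
        proof -
          have "0 \<le> a * snd z"
            using that a by (auto simp: mem_Times_iff)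
          then show ?thesis
            by linarith
        qed
        then show ?thesis
          unfolding \<psi>_def \<theta>_def by (intro continuous_intros) auto
      qed
      show "K * (norm (x - x0))\<^sup>2 - B0 \<le> \<psi> k (x, t)" if "0 \<le> t" for k x t
      proof -
        have "0 \<le> C * t" "0 \<le> E' k * \<theta> t"
          using that C E' \<theta>_nonneg by auto
        then show ?thesis
          using minB \<eta> by (simp add: \<psi>_def)
      qed
      show "sg * u0 x $ k \<le> \<psi> k (x, 0)" for k x
      proof -
        consider "sg = 1" "k = j0" | "sg = 1" "k \<noteq> j0" | "sg = - 1"
          using sg by auto
        then show ?thesis
        proof cases
          case 1
          then show ?thesis
            using K(2)[of x j0 x0] by (simp add: \<psi>_def E'_def j0 abs_le_iff)
        next
          case 2
          have "0 \<le> K * (norm (x - x0))\<^sup>2"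
            using K(1) by simp
          then show ?thesis
            using 2 B0(2)[of x k] minB \<eta> by (simp add: \<psi>_def E'_def E_def \<theta>_def abs_le_iff)
        next
          case 3
          then show ?thesis
            using K(2)[of x k x0] u0_min_le[of x0 k] by (simp add: \<psi>_def E'_def abs_le_iff)
        qed
      qed
      fix k and z :: "(real ^ 'n) \<times> real" assume z: "0 < snd z"
      have "\<psi> k (z + h) \<le> \<psi> k z + b k z \<bullet> h + K * (norm (fst h))\<^sup>2 + 2 * E * a\<^sup>2 * (snd h)\<^sup>2" if h: "norm h \<le> 1 / (2 * a)" for h
      proof -
        have "\<bar>snd h\<bar> \<le> 1 / (2 * a)"
          using h norm_snd_le[of "snd h" "fst h"] by simp
        then have ah: "\<bar>a * snd h\<bar> \<le> 1 / 2"
          using a by (simp add: abs_mult field_simps)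
        have s: "1 \<le> 1 + a * snd z"
          using a z by simp
        have "\<theta> (snd z + snd h) \<le> \<theta> (snd z) - a * snd h * (\<theta> (snd z))\<^sup>2 + 2 * (a * snd h)\<^sup>2"
          using inverse_affine_le_quadratic[OF s ah] by (simp add: \<theta>_def distrib_left power_one_over add.assoc)
        then have "E' k * \<theta> (snd z + snd h) \<le> E' k * (\<theta> (snd z) - a * snd h * (\<theta> (snd z))\<^sup>2 + 2 * (a * snd h)\<^sup>2)"
          using E' by (intro mult_left_mono) auto
        also have "\<dots> = E' k * \<theta> (snd z) - E' k * a * (\<theta> (snd z))\<^sup>2 * snd h + E' k * (2 * (a * snd h)\<^sup>2)"
          by (simp add: algebra_simps)
        also have "E' k * (2 * (a * snd h)\<^sup>2) \<le> E * (2 * (a * snd h)\<^sup>2)"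
          using E' by (intro mult_right_mono) auto
        finally have "E' k * \<theta> (snd z + snd h) \<le> E' k * \<theta> (snd z) - E' k * a * (\<theta> (snd z))\<^sup>2 * snd h + 2 * E * a\<^sup>2 * (snd h)\<^sup>2"
          by (simp add: power_mult_distrib mult_ac)
        then show ?thesis
          unfolding \<psi>_def b_def fst_add snd_add quadratic_increment
          by (simp add: inner_prod_def algebra_simps)
      qed
      then show "\<exists>r>0. \<forall>h. norm h \<le> r \<longrightarrow> \<psi> k (z + h) \<le> \<psi> k z + b k z \<bullet> h + K * (norm (fst h))\<^sup>2 + 2 * E * a\<^sup>2 * (snd h)\<^sup>2"
        using a by (intro exI[of _ "1 / (2 * a)"]) auto
    next
      have "\<psi> k0 (x0, t0) \<le> sg * u0_min x0 + \<eta> + C * t0 + E / (1 + c * t0 / \<epsilon>)"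
      proof -
        have "E' k0 * \<theta> t0 \<le> E * \<theta> t0"
          using E' \<theta>_nonneg[OF t0(1)] by (intro mult_right_mono) auto
        then show ?thesis
          by (simp add: \<psi>_def \<theta>_def a_def)
      qed
      then show "\<psi> k0 (x0, t0) < sg * u \<epsilon> (x0, t0) $ k0"
        using above by simp
    qed (use t0 in auto)
    have uM: "\<bar>u \<epsilon> z $ j\<bar> \<le> M" for j
      using z(1,2) \<epsilon> by (intro M) auto
    have \<theta>z: "0 \<le> \<theta> (snd z)" "\<theta> (snd z) \<le> 1"
      using z(1) \<theta>_nonneg by auto
    have trace: "2 * K * \<epsilon> * CA \<le> 2 * K * CA"
      using \<epsilon> K(1) CA mult_left_mono[of \<epsilon> 1 "2 * K * CA"] by (simp add: mult_ac)
    show False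
    proof (cases "sg = 1")
      case True
      \<comment> \<open>At the contact the gap to \<open>j0\<close> is at least the difference E'
        \<theta> of the two barriers, because \<open>E' j0 = 0\<close>.\<close>
      have bound: "E' k * a * (\<theta> (snd z))\<^sup>2 - C3 \<le> H k (fst (b k z)) (u \<epsilon> z) (gap k (u \<epsilon> z) /\<^sub>R \<epsilon>) (fst z /\<^sub>R \<epsilon>)"
      proof -
        have "E' k * \<theta> (snd z) \<le> gap k (u \<epsilon> z) $ j0"
          using z(4)[of j0] True by (simp add: \<psi>_def E'_def split: if_splits)
        moreover have "E' k * (\<theta> (snd z))\<^sup>2 \<le> E' k * \<theta> (snd z)"
          using \<theta>z E' mult_left_mono[of "\<theta> (snd z)" 1 "\<theta> (snd z)"] by (intro mult_left_mono) (auto simp: power2_eq_square)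
        ultimately have "a * (E' k * (\<theta> (snd z))\<^sup>2) \<le> a * gap k (u \<epsilon> z) $ j0"
          using a by (intro mult_left_mono) auto
        moreover have "a * gap k (u \<epsilon> z) $ j0 = c * (gap k (u \<epsilon> z) /\<^sub>R \<epsilon>) $ j0"
          by (simp add: a_def divide_inverse)
        moreover have "c * (gap k (u \<epsilon> z) /\<^sub>R \<epsilon>) $ j0 - C3 \<le> H k (fst (b k z)) (u \<epsilon> z) (gap k (u \<epsilon> z) /\<^sub>R \<epsilon>) (fst z /\<^sub>R \<epsilon>)"
          by (intro C3 normR uM) simp
        moreover have "E' k * a * (\<theta> (snd z))\<^sup>2 = a * (E' k * (\<theta> (snd z))\<^sup>2)"
          by simp
        ultimately show ?thesis
          by linarith
      qed
      then show False
        using z(5) trace True by (simp add: b_def C_def)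
    next
      case False
      then have sg1: "sg = - 1"
        using sg by auto
      have E0: "E' j = 0" for j
        using False by (simp add: E'_def)
      have "K * (norm (fst z - x0))\<^sup>2 \<le> M + B0"
      proof -
        have "0 \<le> C * snd z"
          using C z(1) by simp
        then show ?thesis
          using z(3) uM[of k] minB \<eta> sg1 by (simp add: \<psi>_def E0 abs_le_iff)
      qed
      have nb: "norm (sg *\<^sub>R fst (b k z)) \<le> R"
      proof -
        have "norm (sg *\<^sub>R fst (b k z)) = 2 * K * norm (fst z - x0)"
          using K(1) sg1 by (simp add: b_def)
        also have "\<dots> \<le> 1 + (2 * K * norm (fst z - x0))\<^sup>2"
        proof -
          have "t \<le> 1 + t\<^sup>2" if "0 \<le> t" for t :: real
            using sum_squares_bound[of 1 t] that by simp
          then show ?thesis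
            using K(1) by simp
        qed
        also have "(2 * K * norm (fst z - x0))\<^sup>2 = 4 * K * (K * (norm (fst z - x0))\<^sup>2)"
          by (simp add: power_mult_distrib power2_eq_square)
        also have "\<dots> \<le> 4 * K * (M + B0)"
          using K(1) \<open>K * _ \<le> _\<close> by (intro mult_left_mono) auto
        finally show ?thesis
          by (simp add: R_def le_max_iff_disj)
      qed
      have "norm (vec (u \<epsilon> z $ k) :: real ^ 'm) \<le> R"
        using uM by (intro normR) simp
      then have "\<bar>H k (sg *\<^sub>R fst (b k z)) (vec (u \<epsilon> z $ k)) 0 (fst z /\<^sub>R \<epsilon>)\<bar> \<le> C4"
        using nb K(1) M0 B0(1) by (intro C4) (auto simp: R_def le_max_iff_disj)
      then have "- \<bar>C4\<bar> \<le> sg * H k (sg *\<^sub>R fst (b k z)) (vec (u \<epsilon> z $ k)) 0 (fst z /\<^sub>R \<epsilon>)"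
        using sg1 by (simp add: abs_le_iff)
      also have "\<dots> \<le> sg * H k (sg *\<^sub>R fst (b k z)) (u \<epsilon> z) (gap k (u \<epsilon> z) /\<^sub>R \<epsilon>) (fst z /\<^sub>R \<epsilon>)"
        using z(4) \<epsilon>(1) by (intro H_at_maximal_component sg) (auto simp: \<psi>_def E0)
      finally show False
        using z(5) trace by (simp add: b_def C_def E0)
    qed
  qed
  moreover have "E \<ge> 0"
    using B0(1) by (simp add: E_def)
  ultimately show ?thesis
    using C c by (intro that[of C c E]) auto
qed

end

section \<open>The relaxed half-limits\<close>

text \<open>If every point were beaten by some \<open>g x\<close>, semicontinuity and compactness
  would leave finitely many values \<open>f (g x)\<close> that beat all points, among them the point
  with the largest of these values.\<close>

lemma upper_semicontinuous_attains_sup: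
  fixes f :: "'a::topological_space \<Rightarrow> real"
  assumes K: "compact K" "K \<noteq> {}"
    and usc: "\<And>x a. x \<in> K \<Longrightarrow> f x < a \<Longrightarrow> \<exists>U. open U \<and> x \<in> U \<and> (\<forall>y\<in>K \<inter> U. f y < a)"
  shows "\<exists>x\<in>K. \<forall>y\<in>K. f y \<le> f x"
proof (rule ccontr)
  assume "\<not> ?thesis"
  then have "\<forall>x\<in>K. \<exists>y\<in>K. f x < f y"
    by (auto simp: not_le)
  then obtain g where g: "\<And>x. x \<in> K \<Longrightarrow> g x \<in> K \<and> f x < f (g x)"
    by metis
  have "\<forall>x\<in>K. \<exists>U. open U \<and> x \<in> U \<and> (\<forall>y\<in>K \<inter> U. f y < f (g x))"
    using usc g by blast
  then obtain U where U: "\<And>x. x \<in> K \<Longrightarrow> open (U x) \<and> x \<in> U x \<and> (\<forall>y\<in>K \<inter> U x. f y < f (g x))"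
    by metis
  obtain D where D: "D \<subseteq> K" "finite D" "K \<subseteq> (\<Union>x\<in>D. U x)"
  proof (rule compactE_image[OF K(1), of K U])
    show "open (U x)" if "x \<in> K" for x
      using U[OF that] by blast
    show "K \<subseteq> (\<Union>x\<in>K. U x)"
      using U by blast
  qed (rule that)
  have "D \<noteq> {}"
    using D K(2) by auto
  then have "Max ((\<lambda>x. f (g x)) ` D) \<in> (\<lambda>x. f (g x)) ` D"
    using D(2) by (intro Max_in) auto
  then obtain x where x: "x \<in> D" "Max ((\<lambda>x. f (g x)) ` D) = f (g x)"
    by auto
  then obtain y where y: "y \<in> D" "g x \<in> U y"
    using D g by blast
  then have "f (g x) < f (g y)"
    using U[of y] g[of x] x D by auto
  moreover have "f (g y) \<le> f (g x)"
    unfolding x(2)[symmetric] using y D(2) by (intro Max_ge) auto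
  ultimately show False
    by simp
qed

context homogenization
begin

text \<open>The condition \<open>0 < snd z'\<close> lets \<open>z\<close> lie on the initial plane
  although \<open>u\<close> is meaningless at negative times.\<close>

definition bounds_near :: "real \<Rightarrow> (real ^ 'n) \<times> real \<Rightarrow> real \<Rightarrow> bool" where
  "bounds_near sg z a \<longleftrightarrow> (\<exists>\<rho>>0. \<forall>\<epsilon> z' k. 0 < \<epsilon> \<longrightarrow> \<epsilon> < \<rho> \<longrightarrow> dist z' z < \<rho> \<longrightarrow> 0 < snd z' \<longrightarrow> sg * u \<epsilon> z' $ k \<le> a)"

text \<open>The relaxed upper half-limit of \<open>sg * u\<close>: the upper limit as \<epsilon>
  tends to 0 and the points tend to \<open>z\<close>, over all components at once. For
  \<open>sg = - 1\<close> it is the negative of the relaxed lower half-limit.\<close>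

definition half_limit :: "real \<Rightarrow> (real ^ 'n) \<times> real \<Rightarrow> real" where
  "half_limit sg z = Inf {a. bounds_near sg z a}"

lemma bounds_near_bounded:
  obtains B C where "B > 0" "C > 0"
    "\<And>(sg :: real) z. sg \<in> {1, - 1} \<Longrightarrow> 0 \<le> snd z \<Longrightarrow> bounds_near sg z (B + C * (snd z + 1))"
    "\<And>(sg :: real) z a. sg \<in> {1, - 1} \<Longrightarrow> 0 \<le> snd z \<Longrightarrow> bounds_near sg z a \<Longrightarrow> - (B + C * (snd z + 1)) \<le> a"
proof -
  obtain B C where B: "B > 0" "C > 0" "\<And>\<epsilon> z k. 0 < \<epsilon> \<Longrightarrow> \<epsilon> \<le> 1 \<Longrightarrow> 0 \<le> snd z \<Longrightarrow> \<bar>u \<epsilon> z $ k\<bar> \<le> B + C * snd z"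
    using u_uniformly_bounded by metis
  have sgB: "\<bar>sg * u \<epsilon> z $ k\<bar> \<le> B + C * (t + 1)"
    if "sg \<in> {1, - 1}" "0 < \<epsilon>" "\<epsilon> \<le> 1" "0 \<le> snd z" "snd z \<le> t + 1" for sg \<epsilon> z k t
  proof -
    have "\<bar>sg * u \<epsilon> z $ k\<bar> \<le> B + C * snd z"
      using B(3)[OF that(2-4), of k] that(1) by auto
    also have "\<dots> \<le> B + C * (t + 1)"
      using B(2) that(5) by simp
    finally show ?thesis .
  qed
  show ?thesis
  proof (rule that[OF B(1,2)])
    fix sg :: real and z :: "(real ^ 'n) \<times> real" assume *: "sg \<in> {1, - 1}" "0 \<le> snd z"
    show "bounds_near sg z (B + C * (snd z + 1))"
      unfolding bounds_near_def
    proof (intro exI[of _ 1] conjI allI impI)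
      fix \<epsilon> :: real and z' :: "(real ^ 'n) \<times> real" and k assume "0 < \<epsilon>" "\<epsilon> < 1" "dist z' z < 1" "0 < snd z'"
      then have "snd z' \<le> snd z + 1"
        using dist_snd_le[of z' z] unfolding dist_real_def by linarith
      then have "\<bar>sg * u \<epsilon> z' $ k\<bar> \<le> B + C * (snd z + 1)"
        using * \<open>0 < \<epsilon>\<close> \<open>\<epsilon> < 1\<close> \<open>0 < snd z'\<close> by (intro sgB) auto
      then show "sg * u \<epsilon> z' $ k \<le> B + C * (snd z + 1)"
        by linarith
    qed simp
    fix a assume "bounds_near sg z a"
    then obtain \<rho> where \<rho>: "\<rho> > 0" "\<And>\<epsilon> z' k. 0 < \<epsilon> \<Longrightarrow> \<epsilon> < \<rho> \<Longrightarrow> dist z' z < \<rho> \<Longrightarrow> 0 < snd z' \<Longrightarrow> sg * u \<epsilon> z' $ k \<le> a"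
      unfolding bounds_near_def by blast
    define t where "t = min 1 (\<rho> / 2)"
    have t: "0 < t" "t \<le> 1" "t < \<rho>"
      using \<rho>(1) by (auto simp: t_def)
    define z' where "z' = z + (0, t)"
    have "dist z' z < \<rho>"
      using t by (simp add: z'_def dist_norm norm_Pair)
    then have "sg * u t z' $ i1 \<le> a"
      using t *(2) by (intro \<rho>(2)) (auto simp: z'_def)
    moreover have "\<bar>sg * u t z' $ i1\<bar> \<le> B + C * (snd z + 1)"
      using t * by (intro sgB) (auto simp: z'_def)
    ultimately show "- (B + C * (snd z + 1)) \<le> a"
      by linarith
  qed
qed

lemma half_limit_le: 
  assumes "sg \<in> {1, - 1}" "0 \<le> snd z" "bounds_near sg z a"
  shows "half_limit sg z \<le> a"
proof -
  obtain B C where "\<And>a. bounds_near sg z a \<Longrightarrow> - (B + C * (snd z + 1)) \<le> a"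
    using bounds_near_bounded assms by metis
  then have "bdd_below {a. bounds_near sg z a}"
    by (intro bdd_belowI) auto
  then show ?thesis
    unfolding half_limit_def using assms(3) by (intro cInf_lower) auto
qed

lemma half_limit_bounded:
  obtains B C where "B > 0" "C > 0" "\<And>(sg :: real) z. sg \<in> {1, - 1} \<Longrightarrow> 0 \<le> snd z \<Longrightarrow> \<bar>half_limit sg z\<bar> \<le> B + C * (snd z + 1)"
proof -
  obtain B C where B: "B > 0" "C > 0"
    "\<And>(sg :: real) z. sg \<in> {1, - 1} \<Longrightarrow> 0 \<le> snd z \<Longrightarrow> bounds_near sg z (B + C * (snd z + 1))"
    "\<And>(sg :: real) z a. sg \<in> {1, - 1} \<Longrightarrow> 0 \<le> snd z \<Longrightarrow> bounds_near sg z a \<Longrightarrow> - (B + C * (snd z + 1)) \<le> a"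
    using bounds_near_bounded by metis
  show ?thesis
  proof (rule that[OF B(1,2)])
    fix sg :: real and z :: "(real ^ 'n) \<times> real" assume *: "sg \<in> {1, - 1}" "0 \<le> snd z"
    have "half_limit sg z \<le> B + C * (snd z + 1)"
      using * by (intro half_limit_le B(3))
    moreover have "- (B + C * (snd z + 1)) \<le> half_limit sg z"
      unfolding half_limit_def using B(3,4)[OF *] by (intro cInf_greatest) auto
    ultimately show "\<bar>half_limit sg z\<bar> \<le> B + C * (snd z + 1)"
      by linarith
  qed
qed

lemma half_limit_lessD:
  assumes "sg \<in> {1, - 1}" "0 \<le> snd z" "half_limit sg z < a"
  obtains \<rho> where "\<rho> > 0" "\<And>\<epsilon> z' k. 0 < \<epsilon> \<Longrightarrow> \<epsilon> < \<rho> \<Longrightarrow> dist z' z < \<rho> \<Longrightarrow> 0 < snd z' \<Longrightarrow> sg * u \<epsilon> z' $ k < a"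
proof -
  obtain B C where "bounds_near sg z (B + C * (snd z + 1))"
    using bounds_near_bounded assms by metis
  then have "{a. bounds_near sg z a} \<noteq> {}"
    by auto
  then obtain a' where "bounds_near sg z a'" "a' < a"
    using assms(3) cInf_lessD[of "{a. bounds_near sg z a}" a] unfolding half_limit_def by auto
  then obtain \<rho> where "\<rho> > 0" "\<And>\<epsilon> z' k. 0 < \<epsilon> \<Longrightarrow> \<epsilon> < \<rho> \<Longrightarrow> dist z' z < \<rho> \<Longrightarrow> 0 < snd z' \<Longrightarrow> sg * u \<epsilon> z' $ k \<le> a'"
    unfolding bounds_near_def by blast
  then have "sg * u \<epsilon> z' $ k < a" if "0 < \<epsilon>" "\<epsilon> < \<rho>" "dist z' z < \<rho>" "0 < snd z'" for \<epsilon> z' k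
    using that \<open>a' < a\<close> by (meson le_less_trans)
  then show ?thesis
    using \<open>\<rho> > 0\<close> by (rule that[rotated])
qed

lemma half_limit_greaterD:
  assumes "sg \<in> {1, - 1}" "0 \<le> snd z" "a < half_limit sg z" "\<rho> > 0"
  shows "\<exists>\<epsilon> z' k. 0 < \<epsilon> \<and> \<epsilon> < \<rho> \<and> dist z' z < \<rho> \<and> a < sg * u \<epsilon> z' $ k"
proof (rule ccontr)
  assume "\<not> ?thesis"
  then have "\<forall>\<epsilon> z' k. 0 < \<epsilon> \<longrightarrow> \<epsilon> < \<rho> \<longrightarrow> dist z' z < \<rho> \<longrightarrow> 0 < snd z' \<longrightarrow> sg * u \<epsilon> z' $ k \<le> a"
    by (meson not_less)
  then have "bounds_near sg z a"
    unfolding bounds_near_def using assms(4) by blast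
  then have "half_limit sg z \<le> a"
    by (rule half_limit_le[OF assms(1,2)])
  then show False
    using assms(3) by simp
qed

lemma half_limit_usc:
  assumes "sg \<in> {1, - 1}" "0 \<le> snd z" "half_limit sg z < a"
  obtains \<rho> where "\<rho> > 0" "\<And>z'. dist z' z < \<rho> \<Longrightarrow> 0 \<le> snd z' \<Longrightarrow> half_limit sg z' < a"
proof -
  obtain a' where a': "half_limit sg z < a'" "a' < a"
    using dense[OF assms(3)] by blast
  obtain \<rho> where \<rho>: "\<rho> > 0" "\<And>\<epsilon> z' k. 0 < \<epsilon> \<Longrightarrow> \<epsilon> < \<rho> \<Longrightarrow> dist z' z < \<rho> \<Longrightarrow> 0 < snd z' \<Longrightarrow> sg * u \<epsilon> z' $ k < a'"
    using half_limit_lessD[OF assms(1,2) a'(1)] by metis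
  show ?thesis
  proof (rule that[of "\<rho> / 2"])
    fix z' :: "(real ^ 'n) \<times> real" assume z': "dist z' z < \<rho> / 2" "0 \<le> snd z'"
    have "bounds_near sg z' a'"
      unfolding bounds_near_def
    proof (intro exI[of _ "\<rho> / 2"] conjI allI impI)
      fix \<epsilon> :: real and w :: "(real ^ 'n) \<times> real" and k assume *: "0 < \<epsilon>" "\<epsilon> < \<rho> / 2" "dist w z' < \<rho> / 2" "0 < snd w"
      then have "dist w z < \<rho>"
        using dist_triangle[of w z z'] z' by linarith
      then show "sg * u \<epsilon> w $ k \<le> a'"
        using * \<rho> by (intro less_imp_le \<rho>(2)) auto
    qed (use \<rho> in auto)
    then show "half_limit sg z' < a"
      using half_limit_le[OF assms(1) z'(2)] a'(2) by fastforce
  qed (use \<rho> in auto)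
qed

text \<open>A finite subcover makes the strict inequality uniform in \<epsilon>. This is the way
  back from the half-limits to \<open>u\<close> itself.\<close>

lemma half_limit_uniform:
  assumes sg: "sg \<in> {1, - 1}" and K: "compact K" "\<And>z. z \<in> K \<Longrightarrow> 0 < snd z"
    and f: "continuous_on K f" "\<And>z. z \<in> K \<Longrightarrow> half_limit sg z < f z"
  obtains \<rho> where "\<rho> > 0" "\<And>\<epsilon> z k. 0 < \<epsilon> \<Longrightarrow> \<epsilon> < \<rho> \<Longrightarrow> z \<in> K \<Longrightarrow> sg * u \<epsilon> z $ k < f z"
proof -
  have "\<forall>z\<in>K. \<exists>\<rho>>0. \<forall>\<epsilon> z' k. 0 < \<epsilon> \<longrightarrow> \<epsilon> < \<rho> \<longrightarrow> z' \<in> K \<longrightarrow> dist z' z < \<rho> \<longrightarrow> sg * u \<epsilon> z' $ k < f z'"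
  proof
    fix z assume z: "z \<in> K"
    obtain a where a: "half_limit sg z < a" "a < f z"
      using dense[OF f(2)[OF z]] by blast
    obtain \<rho> where \<rho>: "\<rho> > 0" "\<And>\<epsilon> z' k. 0 < \<epsilon> \<Longrightarrow> \<epsilon> < \<rho> \<Longrightarrow> dist z' z < \<rho> \<Longrightarrow> 0 < snd z' \<Longrightarrow> sg * u \<epsilon> z' $ k < a"
      using half_limit_lessD[OF sg less_imp_le[OF K(2)[OF z]] a(1)] by metis
    obtain r where r: "r > 0" "\<And>z'. z' \<in> K \<Longrightarrow> dist z' z < r \<Longrightarrow> dist (f z') (f z) < f z - a"
      using f(1) z a(2) unfolding continuous_on_iff by (meson diff_gt_0_iff_gt)
    show "\<exists>\<rho>>0. \<forall>\<epsilon> z' k. 0 < \<epsilon> \<longrightarrow> \<epsilon> < \<rho> \<longrightarrow> z' \<in> K \<longrightarrow> dist z' z < \<rho> \<longrightarrow> sg * u \<epsilon> z' $ k < f z'"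
    proof (intro exI[of _ "min \<rho> r"] conjI allI impI)
      fix \<epsilon> z' k assume *: "0 < \<epsilon>" "\<epsilon> < min \<rho> r" "z' \<in> K" "dist z' z < min \<rho> r"
      then have "sg * u \<epsilon> z' $ k < a"
        using K(2) by (intro \<rho>(2)) auto
      moreover have "a < f z'"
        using r(2)[of z'] * by (simp add: dist_real_def abs_less_iff)
      ultimately show "sg * u \<epsilon> z' $ k < f z'"
        by simp
    qed (use \<rho> r in auto)
  qed
  then obtain \<rho> where \<rho>: "\<And>z. z \<in> K \<Longrightarrow> \<rho> z > 0"
    "\<And>z \<epsilon> z' k. z \<in> K \<Longrightarrow> 0 < \<epsilon> \<Longrightarrow> \<epsilon> < \<rho> z \<Longrightarrow> z' \<in> K \<Longrightarrow> dist z' z < \<rho> z \<Longrightarrow> sg * u \<epsilon> z' $ k < f z'"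
    by metis
  obtain D where D: "D \<subseteq> K" "finite D" "K \<subseteq> (\<Union>z\<in>D. ball z (\<rho> z))"
  proof (rule compactE_image[OF K(1), of K "\<lambda>z. ball z (\<rho> z)"])
    show "K \<subseteq> (\<Union>z\<in>K. ball z (\<rho> z))"
    proof
      fix z assume "z \<in> K"
      then show "z \<in> (\<Union>z\<in>K. ball z (\<rho> z))"
        using \<rho>(1)[of z] by (intro UN_I[of z]) auto
    qed
  qed (auto intro: that)
  define r where "r = Min (insert 1 (\<rho> ` D))"
  have r: "r > 0" "\<And>z. z \<in> D \<Longrightarrow> r \<le> \<rho> z"
    using D \<rho>(1) by (auto simp: r_def)
  show ?thesis
  proof (rule that[OF r(1)])
    fix \<epsilon> z k assume *: "0 < \<epsilon>" "\<epsilon> < r" "z \<in> K"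
    then obtain z0 where z0: "z0 \<in> D" "dist z z0 < \<rho> z0"
      using D(3) by (auto simp: dist_commute)
    then show "sg * u \<epsilon> z $ k < f z"
      using * r(2)[OF z0(1)] D(1) by (intro \<rho>(2)[of z0]) auto
  qed
qed

text \<open>At a fixed positive time the layer term E / (1 + c t / \<epsilon>) vanishes with
  \<epsilon>; the constant doubles because nearby times may reach \<open>2 * t\<close>.\<close>

lemma half_limit_initial:
  assumes \<eta>: "\<eta> > 0"
  obtains C where "C \<ge> 0" "\<And>sg x t. sg \<in> {1, - 1} \<Longrightarrow> 0 < t \<Longrightarrow> t < 1 \<Longrightarrow> half_limit sg (x, t) \<le> sg * u0_min x + \<eta> + C * t"
proof -
  have \<eta>4: "\<eta> / 4 > 0"
    using \<eta> by simp
  obtain C c E where C: "C \<ge> 0" "c > 0" "E \<ge> 0" "\<And>sg \<epsilon> x t k. sg \<in> {1, - 1} \<Longrightarrow> 0 < \<epsilon> \<Longrightarrow> \<epsilon> \<le> 1 \<Longrightarrow> 0 \<le> t \<Longrightarrow> t \<le> 1 \<Longrightarrow>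
    sg * u \<epsilon> (x, t) $ k \<le> sg * u0_min x + \<eta> / 4 + C * t + E / (1 + c * t / \<epsilon>)"
    using initial_layer[OF \<eta>4] by metis
  obtain K where K: "K > 0" "\<And>x y. \<bar>u0_min x - u0_min y\<bar> \<le> \<eta> / 4 + K * (norm (x - y))\<^sup>2"
    using u0_quadratic_modulus[OF \<eta>4] u0_min_quadratic_modulus by metis
  have "half_limit sg (x, t) \<le> sg * u0_min x + \<eta> + (2 * C) * t" if sg: "sg \<in> {1, - 1}" and t: "0 < t" "t < 1" for sg x t
  proof (rule half_limit_le[OF sg])
    define \<rho> where "\<rho> = min (min (t / 2) (1 - t)) (min (sqrt (\<eta> / (4 * K))) (\<eta> * c * t / (8 * (E + 1))))"
    have \<rho>: "\<rho> > 0" "\<rho> \<le> t / 2" "\<rho> \<le> 1 - t" "\<rho> \<le> sqrt (\<eta> / (4 * K))" "\<rho> \<le> \<eta> * c * t / (8 * (E + 1))"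
    proof -
      have "0 < \<eta> * c * t / (8 * (E + 1))"
        using t \<eta> C by (intro divide_pos_pos mult_pos_pos) auto
      then show "\<rho> > 0"
        using t \<eta> K(1) by (simp add: \<rho>_def)
      have "\<rho> \<le> min (t / 2) (1 - t)" "\<rho> \<le> min (sqrt (\<eta> / (4 * K))) (\<eta> * c * t / (8 * (E + 1)))"
        unfolding \<rho>_def by (rule min.cobounded1, rule min.cobounded2)
      then show "\<rho> \<le> t / 2" "\<rho> \<le> 1 - t" "\<rho> \<le> sqrt (\<eta> / (4 * K))" "\<rho> \<le> \<eta> * c * t / (8 * (E + 1))"
        unfolding min.bounded_iff by blast+
    qed
    show "bounds_near sg (x, t) (sg * u0_min x + \<eta> + (2 * C) * t)"
      unfolding bounds_near_def
    proof (intro exI[of _ \<rho>] conjI allI impI)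
      fix \<epsilon> :: real and z' :: "(real ^ 'n) \<times> real" and k assume *: "0 < \<epsilon>" "\<epsilon> < \<rho>" "dist z' (x, t) < \<rho>" "0 < snd z'"
      define x' t' where "x' = fst z'" and "t' = snd z'"
      have d: "norm (x' - x) < \<rho>" "\<bar>t' - t\<bar> < \<rho>"
        using *(3) dist_fst_le[of z' "(x, t)"] dist_snd_le[of z' "(x, t)"] by (auto simp: x'_def t'_def dist_norm)
      have t': "t / 2 \<le> t'" "t' \<le> 1" "t' \<le> 2 * t"
        using d(2) \<rho> t by linarith+
      have "(norm (x' - x))\<^sup>2 \<le> (sqrt (\<eta> / (4 * K)))\<^sup>2"
        using d(1) \<rho>(4) by (intro power_mono) auto
      then have "(norm (x' - x))\<^sup>2 \<le> \<eta> / (4 * K)"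
        using \<eta> K(1) by simp
      then have "K * (norm (x' - x))\<^sup>2 \<le> \<eta> / 4"
        using K(1) by (simp add: field_simps)
      then have "\<bar>u0_min x' - u0_min x\<bar> \<le> \<eta> / 2"
        using K(2)[of x' x] by linarith
      then have 1: "sg * u0_min x' \<le> sg * u0_min x + \<eta> / 2"
        using sg by (elim insertE emptyE) (simp_all only: mult_1_left mult_minus_left abs_le_iff, linarith+)
      have 2: "E / (1 + c * t' / \<epsilon>) \<le> \<eta> / 4"
      proof -
        have "\<epsilon> * (8 * (E + 1)) \<le> \<eta> * c * t"
        proof -
          have "\<epsilon> \<le> \<eta> * c * t / (8 * (E + 1))"
            using *(2) \<rho>(5) by linarith
          then show ?thesis
            using C(3) by (simp add: field_simps)
        qed
        also have "\<dots> \<le> \<eta> * c * (2 * t')"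
          using \<eta> C(2) t' by (intro mult_left_mono) auto
        finally have "4 * E * \<epsilon> \<le> \<eta> * (c * t')"
          using *(1) by (simp add: algebra_simps)
        then have "4 * E \<le> \<eta> * (c * t' / \<epsilon>)"
          using *(1) by (simp add: field_simps)
        also have "\<dots> \<le> \<eta> * (1 + c * t' / \<epsilon>)"
          using \<eta> by (intro mult_left_mono) auto
        finally have "4 * E \<le> \<eta> * (1 + c * t' / \<epsilon>)" .
        moreover have "1 + c * t' / \<epsilon> > 0"
          using C(2) t' t *(1) by (intro add_pos_nonneg) auto
        ultimately show ?thesis
          by (simp add: pos_divide_le_eq)
      qed
      have "C * t' \<le> C * (2 * t)"
        using C(1) t'(3) by (rule mult_left_mono[rotated])
      moreover have "sg * u \<epsilon> (x', t') $ k \<le> sg * u0_min x' + \<eta> / 4 + C * t' + E / (1 + c * t' / \<epsilon>)"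
        using * \<rho>(3) t t' by (intro C(4) sg) auto
      ultimately show "sg * u \<epsilon> z' $ k \<le> sg * u0_min x + \<eta> + (2 * C) * t"
        using 1 2 unfolding x'_def t'_def prod.collapse by linarith
    qed (rule \<rho>(1))
    show "0 \<le> snd (x, t)"
      using t by simp
  qed
  then show ?thesis
    using C(1) by (intro that[of "2 * C"]) auto
qed

end

section \<open>Comparison with the effective solution\<close>

context homogenization
begin

text \<open>At time 0 the value is prescribed by the data, so that the doubling can take place on a
  closed time interval; the estimate \<open>half_limit_initial\<close> keeps the extension upper
  semicontinuous.\<close>

definition extended_half_limit :: "real \<Rightarrow> (real ^ 'n) \<times> real \<Rightarrow> real" where
  "extended_half_limit sg z = (if 0 < snd z then half_limit sg z else sg * u0_min (fst z))"

lemma extended_half_limit_initial: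
  assumes "\<eta> > 0"
  obtains C where "C \<ge> 0" "\<And>sg z. sg \<in> {1, - 1} \<Longrightarrow> 0 \<le> snd z \<Longrightarrow> snd z < 1 \<Longrightarrow> extended_half_limit sg z \<le> sg * u0_min (fst z) + \<eta> + C * snd z"
proof -
  obtain C where C: "C \<ge> 0" "\<And>sg x t. sg \<in> {1, - 1} \<Longrightarrow> 0 < t \<Longrightarrow> t < 1 \<Longrightarrow> half_limit sg (x, t) \<le> sg * u0_min x + \<eta> + C * t"
    using half_limit_initial[OF assms] by metis
  have "extended_half_limit sg z \<le> sg * u0_min (fst z) + \<eta> + C * snd z" if "sg \<in> {1, - 1}" "0 \<le> snd z" "snd z < 1" for sg z
    using C(2)[OF that(1), of "snd z" "fst z"] that assms by (auto simp: extended_half_limit_def)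
  then show ?thesis
    using C(1) by (rule that[rotated])
qed

lemma extended_half_limit_usc:
  assumes sg: "sg \<in> {1, - 1}" and z: "0 \<le> snd z" and less: "extended_half_limit sg z < a"
  obtains \<rho> where "\<rho> > 0" "\<And>z'. dist z' z < \<rho> \<Longrightarrow> 0 \<le> snd z' \<Longrightarrow> extended_half_limit sg z' < a"
proof (cases "0 < snd z")
  case True
  then have "half_limit sg z < a"
    using less by (simp add: extended_half_limit_def)
  then obtain \<rho> where \<rho>: "\<rho> > 0" "\<And>z'. dist z' z < \<rho> \<Longrightarrow> 0 \<le> snd z' \<Longrightarrow> half_limit sg z' < a"
    using half_limit_usc[OF sg z] by metis
  show ?thesis
  proof (rule that[of "min \<rho> (snd z)"])
    fix z' :: "(real ^ 'n) \<times> real" assume *: "dist z' z < min \<rho> (snd z)" "0 \<le> snd z'"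
    then have "0 < snd z'"
      using dist_snd_le[of z' z] unfolding dist_real_def by linarith
    then show "extended_half_limit sg z' < a"
      using \<rho>(2)[of z'] * by (simp add: extended_half_limit_def)
  qed (use \<rho> True in auto)
next
  case False
  define \<eta> where "\<eta> = (a - extended_half_limit sg z) / 4"
  have \<eta>: "\<eta> > 0"
    using less by (simp add: \<eta>_def)
  have Wz: "extended_half_limit sg z = sg * u0_min (fst z)" "snd z = 0"
    using False z by (auto simp: extended_half_limit_def)
  obtain C where C: "C \<ge> 0" "\<And>sg z. sg \<in> {1, - 1} \<Longrightarrow> 0 \<le> snd z \<Longrightarrow> snd z < 1 \<Longrightarrow> extended_half_limit sg z \<le> sg * u0_min (fst z) + \<eta> + C * snd z"
    using extended_half_limit_initial[OF \<eta>] by metis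
  obtain K where K: "K > 0" "\<And>x y. \<bar>u0_min x - u0_min y\<bar> \<le> \<eta> + K * (norm (x - y))\<^sup>2"
    using u0_quadratic_modulus[OF \<eta>] u0_min_quadratic_modulus by metis
  define \<rho> where "\<rho> = min (1 / 2) (min (\<eta> / (C + 1)) (sqrt (\<eta> / K)))"
  have "\<rho> \<le> 1 / 2" "\<rho> \<le> min (\<eta> / (C + 1)) (sqrt (\<eta> / K))"
    unfolding \<rho>_def by (rule min.cobounded1, rule min.cobounded2)
  then have \<rho>: "\<rho> \<le> 1 / 2" "\<rho> \<le> \<eta> / (C + 1)" "\<rho> \<le> sqrt (\<eta> / K)"
    unfolding min.bounded_iff by blast+
  show ?thesis
  proof (rule that[of \<rho>])
    show "\<rho> > 0"
      using \<eta> C(1) K(1) by (simp add: \<rho>_def)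
    fix z' :: "(real ^ 'n) \<times> real" assume *: "dist z' z < \<rho>" "0 \<le> snd z'"
    have d: "norm (fst z' - fst z) < \<rho>" "snd z' < \<rho>"
      using *(1) dist_fst_le[of z' z] dist_snd_le[of z' z] Wz(2) by (auto simp: dist_norm)
    have "(norm (fst z' - fst z))\<^sup>2 \<le> (sqrt (\<eta> / K))\<^sup>2"
      using d(1) \<rho>(3) by (intro power_mono) auto
    then have "K * (norm (fst z' - fst z))\<^sup>2 \<le> \<eta>"
      using \<eta> K(1) by (simp add: field_simps)
    then have "\<bar>u0_min (fst z') - u0_min (fst z)\<bar> \<le> 2 * \<eta>"
      using K(2)[of "fst z'" "fst z"] by linarith
    then have "sg * u0_min (fst z') \<le> sg * u0_min (fst z) + 2 * \<eta>"
      using sg by (elim insertE emptyE) (simp_all only: mult_1_left mult_minus_left abs_le_iff, linarith+)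
    moreover have "C * snd z' < \<eta>"
    proof -
      have "C * snd z' \<le> C * (\<eta> / (C + 1))"
        using C(1) d(2) \<rho>(2) by (intro mult_left_mono) auto
      also have "\<dots> < \<eta>"
        using C(1) \<eta> by (simp add: field_simps)
      finally show ?thesis .
    qed
    moreover have "extended_half_limit sg z' \<le> sg * u0_min (fst z') + \<eta> + C * snd z'"
      using d(2) \<rho>(1) *(2) by (intro C(2) sg) auto
    moreover have "a = extended_half_limit sg z + 4 * \<eta>"
      by (simp add: \<eta>_def field_simps)
    ultimately show "extended_half_limit sg z' < a"
      unfolding Wz(1) by linarith
  qed
qed

lemma extended_half_limit_bounded:
  obtains M where "M > 0" "\<And>sg z. sg \<in> {1, - 1} \<Longrightarrow> 0 \<le> snd z \<Longrightarrow> snd z \<le> T \<Longrightarrow> \<bar>extended_half_limit sg z\<bar> \<le> M"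
proof -
  obtain B C where B: "B > 0" "C > 0" "\<And>(sg :: real) z. sg \<in> {1, - 1} \<Longrightarrow> 0 \<le> snd z \<Longrightarrow> \<bar>half_limit sg z\<bar> \<le> B + C * (snd z + 1)"
    using half_limit_bounded by metis
  obtain B0 where B0: "B0 > 0" "\<And>x k. \<bar>u0 x $ k\<bar> \<le> B0"
    using u0_bounded by metis
  define M where "M = B0 + B + C * (\<bar>T\<bar> + 1)"
  have pos: "0 < C * (\<bar>T\<bar> + 1)"
    using B(2) by simp
  have "\<bar>extended_half_limit sg z\<bar> \<le> M" if sg: "sg \<in> {1, - 1}" and z: "0 \<le> snd z" "snd z \<le> T" for sg z
  proof (cases "0 < snd z")
    case True
    have "C * (snd z + 1) \<le> C * (\<bar>T\<bar> + 1)"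
      using z B(2) by (intro mult_left_mono) auto
    then show ?thesis
      using B(3)[OF sg z(1)] True B0(1) by (simp add: extended_half_limit_def M_def)
  next
    case False
    obtain k where "u0_min (fst z) = u0 (fst z) $ k"
      using u0_min_attained by metis
    then have "\<bar>sg * u0_min (fst z)\<bar> \<le> B0"
      using B0(2)[of "fst z" k] sg by auto
    then show ?thesis
      using False pos B(1) by (simp add: extended_half_limit_def M_def)
  qed
  moreover have "M > 0"
    using B(1) B0(1) pos by (simp add: M_def)
  ultimately show ?thesis
    by (rule that[rotated])
qed

text \<open>Doubling between the half-limit at \<open>z\<close> and \<open>ubar\<close> at
  \<open>\<zeta>\<close>. The two inequalities contain \<open>Hbar p (ubar \<zeta>)\<close> with
  opposite signs; after cancellation the strict term \<kappa> t contradicts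
  \<open>CR * \<mu> < \<kappa>\<close>.\<close>

theorem half_limit_le_ubar:
  assumes sg: "sg \<in> {1, - 1}" and z1: "0 < snd z1"
  shows "half_limit sg z1 \<le> sg * ubar z1"
proof (rule ccontr)
  assume "\<not> ?thesis"
  then have gt: "sg * ubar z1 < half_limit sg z1"
    by simp
  define B where "B z = sg * ubar z" for z
  define w where "w = extended_half_limit sg"
  define T where "T = snd z1"
  \<comment> \<open>The gap at \<open>z1\<close> is \<open>3 * \<delta>\<close>; the term \<kappa> t
    uses up \<delta> at time \<open>T\<close>, so the doubled function has the value
    \<open>2 * \<delta>\<close> at \<open>(z1, z1)\<close>.\<close>
  define \<delta> where "\<delta> = (w z1 - B z1) / 3"
  have \<delta>: "\<delta> > 0"
    using gt z1 by (simp add: \<delta>_def w_def B_def extended_half_limit_def)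
  define \<kappa> where "\<kappa> = \<delta> / T"
  have T: "T > 0" and \<kappa>: "\<kappa> > 0" "\<kappa> * T = \<delta>"
    using z1 \<delta> by (auto simp: T_def \<kappa>_def)
  obtain M1 where M1: "M1 > 0" "\<And>sg z. sg \<in> {1, - 1} \<Longrightarrow> 0 \<le> snd z \<Longrightarrow> snd z \<le> T + 1 \<Longrightarrow> \<bar>extended_half_limit sg z\<bar> \<le> M1"
    using extended_half_limit_bounded[of "T + 1"] by metis
  have BUC: "BUC_on (UNIV \<times> {0..<T + 3}) ubar"
    using T by (intro ubar_BUC) auto
  then have "bounded (ubar ` (UNIV \<times> {0..<T + 3}))"
    by (simp add: BUC_on_def)
  then obtain M2 where M2: "M2 > 0" "\<And>z. z \<in> UNIV \<times> {0..<T + 3} \<Longrightarrow> norm (ubar z) \<le> M2"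
    unfolding bounded_pos by blast
  define M where "M = max M1 M2"
  have M: "M > 0"
    using M1(1) by (simp add: M_def)
  have wM: "\<bar>w z\<bar> \<le> M" if "0 \<le> snd z" "snd z \<le> T + 1" for z
    using M1(2)[OF sg that] by (simp add: w_def M_def)
  have ubarM: "\<bar>ubar z\<bar> \<le> M" if "0 \<le> snd z" "snd z \<le> T + 2" for z
    using M2(2)[of z] that by (simp add: mem_Times_iff M_def)
  have BM: "\<bar>B z\<bar> \<le> M" if "0 \<le> snd z" "snd z \<le> T + 2" for z
    using ubarM[OF that] sg by (auto simp: B_def)
  have "\<delta> / 4 > 0"
    using \<delta> by simp
  then obtain C where C: "C \<ge> 0" "\<And>sg z. sg \<in> {1, - 1} \<Longrightarrow> 0 \<le> snd z \<Longrightarrow> snd z < 1 \<Longrightarrow> extended_half_limit sg z \<le> sg * u0_min (fst z) + \<delta> / 4 + C * snd z"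
    using extended_half_limit_initial by metis
  obtain e where e: "e > 0" "\<And>z z'. z \<in> UNIV \<times> {0..<T + 3} \<Longrightarrow> z' \<in> UNIV \<times> {0..<T + 3} \<Longrightarrow> dist z' z < e \<Longrightarrow> dist (ubar z') (ubar z) < \<delta> / 4"
    using BUC \<open>\<delta> / 4 > 0\<close> unfolding BUC_on_def uniformly_continuous_on_def by metis
  have Be: "B z \<le> B z' + \<delta> / 4" if "0 \<le> snd z" "snd z \<le> T + 2" "0 \<le> snd z'" "snd z' \<le> T + 2" "dist z z' < e" for z z'
  proof -
    have "dist (ubar z) (ubar z') < \<delta> / 4"
      using that by (intro e(2)) (auto simp: mem_Times_iff)
    then have "\<bar>ubar z - ubar z'\<bar> < \<delta> / 4"
      by (simp add: dist_real_def)
    then show ?thesis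
      using sg unfolding B_def by (elim insertE emptyE) (simp_all only: mult_1_left mult_minus_left abs_less_iff, linarith+)
  qed
  \<comment> \<open>Points within \<open>r0\<close> have values of \<open>ubar\<close> within
    \<delta> / 4, and up to time \<open>r0\<close> the term \<open>C * t\<close> of the initial
    estimate is at most \<delta> / 4; together this excludes contact at time 0.\<close>
  define r0 where "r0 = min (e / 2) (min (1 / 2) (\<delta> / (4 * (C + 1))))"
  have "r0 \<le> e / 2" "r0 \<le> min (1 / 2) (\<delta> / (4 * (C + 1)))"
    unfolding r0_def by (rule min.cobounded1, rule min.cobounded2)
  then have r0: "r0 \<le> e / 2" "r0 \<le> 1 / 2" "r0 \<le> \<delta> / (4 * (C + 1))"
    unfolding min.bounded_iff by blast+
  have r0_pos: "r0 > 0"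
    using e(1) \<delta> C(1) by (simp add: r0_def)
  \<comment> \<open>\<alpha> stays fixed: |z - \<zeta>| <= r0 is enough, since the two values are
    related only through \<open>sg * ubar \<zeta> \<le> half_limit sg z\<close>. In this way
    \<open>p\<close> stays in a fixed ball.\<close>
  define \<alpha> where "\<alpha> = r0\<^sup>2 / (4 * M)"
  have \<alpha>: "\<alpha> > 0" "4 * M * \<alpha> = r0\<^sup>2"
    using r0_pos M by (auto simp: \<alpha>_def)
  \<comment> \<open>Bounds \<open>p\<close>, \<open>ubar \<zeta>\<close> and the half-limit before
    \<mu> and \<beta> are chosen, so that the choice of \<mu> may depend on
    \<open>CR\<close>.\<close>
  define R where "R = max M (r0 / \<alpha>)"
  obtain CR where CR: "CR \<ge> 0" "\<forall>sg \<mu> p r U0 z0 a K \<rho>0. sg \<in> {1, - 1} \<longrightarrow> 0 < \<mu> \<longrightarrow> \<mu> \<le> 1 / 2 \<longrightarrow> norm p \<le> R \<longrightarrow> \<bar>r\<bar> \<le> R \<longrightarrow> \<bar>U0\<bar> \<le> R \<longrightarrow>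
    sg * r \<le> U0 \<longrightarrow> 0 < snd z0 \<longrightarrow> norm (sg *\<^sub>R fst a - p) < \<mu> \<longrightarrow> 0 \<le> K \<longrightarrow> 0 < \<rho>0 \<longrightarrow>
    (\<forall>\<eta>>0. \<exists>\<epsilon>1>0. \<forall>\<epsilon> z k. 0 < \<epsilon> \<longrightarrow> \<epsilon> < \<epsilon>1 \<longrightarrow> dist z z0 \<le> \<rho>0 \<longrightarrow>
      sg * u \<epsilon> z $ k \<le> U0 + a \<bullet> (z - z0) + K * (norm (z - z0))\<^sup>2 + \<eta>) \<longrightarrow>
    (\<forall>\<rho>>0. \<exists>\<epsilon> z k. 0 < \<epsilon> \<and> \<epsilon> < \<rho> \<and> dist z z0 < \<rho> \<and> U0 - \<rho> \<le> sg * u \<epsilon> z $ k) \<longrightarrow>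
    snd a + sg * Hbar p r \<le> CR * \<mu>"
    using perturbed_test_function[of R] by (elim exE conjE) (rule that)
  define \<mu> where "\<mu> = min (1 / 2) (\<kappa> / (2 * (CR + 1)))"
  have \<mu>: "0 < \<mu>" "\<mu> \<le> 1 / 2" "CR * \<mu> < \<kappa>"
  proof -
    show "0 < \<mu>"
      using \<kappa>(1) CR(1) by (simp add: \<mu>_def)
    show "\<mu> \<le> 1 / 2"
      unfolding \<mu>_def by (rule min.cobounded1)
    have "CR * \<mu> \<le> CR * (\<kappa> / (2 * (CR + 1)))"
      using CR(1) by (intro mult_left_mono) (auto simp: \<mu>_def)
    also have "\<dots> < \<kappa>"
      using CR(1) \<kappa>(1) by (simp add: field_simps add_nonneg_pos)
    finally show "CR * \<mu> < \<kappa>" .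
  qed
  define \<beta> where "\<beta> = \<mu>\<^sup>2 / (16 * M)"
  have \<beta>: "\<beta> > 0" "8 * \<beta> * M < \<mu>\<^sup>2"
    using \<mu>(1) M by (auto simp: \<beta>_def)
  \<comment> \<open>Both penalties are calibrated to reach \<open>2 * M\<close>, the largest
    possible difference of the two functions: \<open>G\<close> at time \<open>T + 1\<close>, the
    localisation at radius \<open>Rx\<close>. Neither place can carry the maximum.\<close>
  define G where "G = 2 * M"
  define x1 where "x1 = fst z1"
  define Rx where "Rx = sqrt (2 * M / \<beta>)"
  have Rx: "Rx > 0" "\<beta> * Rx\<^sup>2 = 2 * M"
    using M \<beta>(1) by (auto simp: Rx_def)
  define pen where "pen z = \<beta> * (norm (fst z - x1))\<^sup>2 + \<kappa> * snd z + G * (max 0 (snd z - T))\<^sup>2" for z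
  define \<Phi> where "\<Phi> s = w (fst s) - B (snd s) - (norm (fst s - snd s))\<^sup>2 / (2 * \<alpha>) - pen (fst s)" for s
  define D where "D = (cball x1 Rx \<times> {0..T + 1}) \<times> (cball x1 (Rx + 1) \<times> {0..T + 2})"
  have "\<exists>s\<in>D. \<forall>s'\<in>D. \<Phi> s' \<le> \<Phi> s"
  proof (rule upper_semicontinuous_attains_sup)
    show "compact D"
      unfolding D_def by (intro compact_Times) auto
    have "(z1, z1) \<in> D"
      using T Rx(1) by (simp add: D_def mem_Times_iff x1_def T_def)
    then show "D \<noteq> {}"
      by auto
    fix s a assume s: "s \<in> D" and less: "\<Phi> s < a"
    define c where "c s = B (snd s) + (norm (fst s - snd s))\<^sup>2 / (2 * \<alpha>) + pen (fst s)" for s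
    have \<Phi>c: "\<Phi> s = w (fst s) - c s" for s
      by (simp add: \<Phi>_def c_def)
    have "continuous_on D (\<lambda>s. ubar (snd s))"
      by (rule continuous_on_compose2[OF ubar_cont]) (auto simp: D_def intro!: continuous_intros)
    then have contc: "continuous_on D c"
      unfolding c_def B_def pen_def using \<alpha>(1) by (intro continuous_intros) auto
    define \<eta> where "\<eta> = (a - \<Phi> s) / 2"
    have \<eta>: "\<eta> > 0"
      using less by (simp add: \<eta>_def)
    have "0 \<le> snd (fst s)"
      using s by (auto simp: D_def)
    then obtain \<rho> where \<rho>: "\<rho> > 0" "\<And>z'. dist z' (fst s) < \<rho> \<Longrightarrow> 0 \<le> snd z' \<Longrightarrow> w z' < w (fst s) + \<eta>"
      using extended_half_limit_usc[OF sg, of "fst s" "w (fst s) + \<eta>"] \<eta> unfolding w_def by auto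
    obtain r where r: "r > 0" "\<And>s'. s' \<in> D \<Longrightarrow> dist s' s < r \<Longrightarrow> dist (c s') (c s) < \<eta>"
      using contc s \<eta> unfolding continuous_on_iff by meson
    show "\<exists>U. open U \<and> s \<in> U \<and> (\<forall>s'\<in>D \<inter> U. \<Phi> s' < a)"
    proof (intro exI[of _ "ball s (min \<rho> r)"] conjI ballI)
      fix s' assume s': "s' \<in> D \<inter> ball s (min \<rho> r)"
      then have d: "dist s' s < \<rho>" "dist s' s < r"
        by (auto simp: dist_commute)
      have "w (fst s') < w (fst s) + \<eta>"
      proof (rule \<rho>(2))
        show "dist (fst s') (fst s) < \<rho>"
          using d(1) dist_fst_le[of s' s] by linarith
        show "0 \<le> snd (fst s')"
          using s' by (auto simp: D_def)
      qed
      moreover have "\<bar>c s' - c s\<bar> < \<eta>"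
        using r(2)[of s'] s' d(2) by (simp add: dist_real_def)
      ultimately show "\<Phi> s' < a"
        unfolding \<Phi>c \<eta>_def abs_less_iff by argo
    qed (use \<rho> r in auto)
  qed
  then obtain z \<zeta> where zD: "(z, \<zeta>) \<in> D" and max: "\<And>s'. s' \<in> D \<Longrightarrow> \<Phi> s' \<le> \<Phi> (z, \<zeta>)"
    by auto
  have zt: "0 \<le> snd z" "snd z \<le> T + 1" and \<zeta>t: "0 \<le> snd \<zeta>" "snd \<zeta> \<le> T + 2"
    using zD by (auto simp: D_def mem_Times_iff)
  have \<Phi>_ge: "2 * \<delta> \<le> \<Phi> (z, \<zeta>)"
  proof -
    have "(z1, z1) \<in> D"
      using T Rx(1) by (simp add: D_def mem_Times_iff x1_def T_def)
    moreover have "\<Phi> (z1, z1) = 2 * \<delta>"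
      using \<kappa>(2) by (simp add: \<Phi>_def pen_def x1_def T_def[symmetric] \<delta>_def)
    ultimately show ?thesis
      using max by metis
  qed
  define n where "n = norm (z - \<zeta>)"
  have pen_pos: "0 \<le> \<beta> * (norm (fst z - x1))\<^sup>2" "0 \<le> \<kappa> * snd z" "0 \<le> G * (max 0 (snd z - T))\<^sup>2" "0 \<le> n\<^sup>2 / (2 * \<alpha>)"
    using \<beta> \<kappa> zt M \<alpha> by (auto simp: G_def)
  have \<Phi>_eq: "\<Phi> (z, \<zeta>) = w z - B \<zeta> - n\<^sup>2 / (2 * \<alpha>) - (\<beta> * (norm (fst z - x1))\<^sup>2 + \<kappa> * snd z + G * (max 0 (snd z - T))\<^sup>2)"
    by (simp add: \<Phi>_def pen_def n_def)
  have wB: "w z - B \<zeta> \<le> 2 * M"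
    using wM[OF zt] BM[OF \<zeta>t] by linarith
  have n: "n \<le> r0"
  proof -
    have "n\<^sup>2 / (2 * \<alpha>) \<le> 2 * M"
      using \<Phi>_ge \<Phi>_eq \<delta> wB pen_pos by linarith
    then have "n\<^sup>2 \<le> r0\<^sup>2"
      using \<alpha> by (simp add: field_simps)
    then show ?thesis
      by (rule power2_le_imp_le) (use r0_pos in simp)
  qed
  have z_in: "norm (fst z - x1) < Rx"
  proof -
    have "\<beta> * (norm (fst z - x1))\<^sup>2 < \<beta> * Rx\<^sup>2"
      using \<Phi>_ge \<Phi>_eq \<delta> wB pen_pos unfolding Rx(2) by linarith
    then show ?thesis
      using \<beta>(1) Rx(1) by (intro power_less_imp_less_base[of "norm (fst z - x1)" 2 Rx]) auto
  qed
  have x_small: "norm ((2 * \<beta>) *\<^sub>R (fst z - x1)) < \<mu>"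
  proof -
    have "(norm ((2 * \<beta>) *\<^sub>R (fst z - x1)))\<^sup>2 = 4 * \<beta> * (\<beta> * (norm (fst z - x1))\<^sup>2)"
      by (simp add: power_mult_distrib power2_eq_square)
    also have "\<dots> \<le> 4 * \<beta> * (2 * M)"
      using \<Phi>_ge \<Phi>_eq \<delta> wB pen_pos \<beta>(1) by (intro mult_left_mono) linarith+
    also have "\<dots> < \<mu>\<^sup>2"
      using \<beta>(2) by simp
    finally show ?thesis
      using \<mu>(1) by (intro power_less_imp_less_base[of _ 2 \<mu>]) auto
  qed
  have zT: "snd z < T + 1"
  proof (rule ccontr)
    assume "\<not> ?thesis"
    then have "max 0 (snd z - T) = 1"
      using zt by simp
    then show False
      using \<Phi>_ge \<Phi>_eq \<delta> wB pen_pos by (simp add: G_def)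
  qed
  have n_time: "\<bar>snd z - snd \<zeta>\<bar> \<le> n" and n_space: "norm (fst z - fst \<zeta>) \<le> n"
    using dist_snd_le[of z \<zeta>] dist_fst_le[of z \<zeta>] by (auto simp: n_def dist_norm)
  have \<zeta>T: "snd \<zeta> < T + 2"
    using zT n_time n r0(2) by linarith
  have \<zeta>_in: "norm (fst \<zeta> - x1) < Rx + 1"
    using norm_triangle_ineq[of "fst \<zeta> - fst z" "fst z - x1"] z_in n_space n r0(2) by (simp add: norm_minus_commute)
  have ne: "dist z \<zeta> < e" "dist (fst z, 0) (fst \<zeta>, 0 :: real) < e"
    using n n_space r0(1) e(1) by (auto simp: n_def dist_norm norm_Pair)
  have B0: "B (x, 0) = sg * u0_min x" for x
    by (simp add: B_def ubar_initial u0_min_def)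
  have not_small: "\<delta> < w z - B \<zeta>"
    using \<Phi>_ge \<Phi>_eq \<delta> pen_pos by linarith
  have z0: "0 < snd z"
  proof (rule ccontr)
    assume "\<not> ?thesis"
    then have "w z = B (fst z, 0)" "z = (fst z, 0)"
      using zt by (auto simp: w_def extended_half_limit_def B0 prod_eq_iff)
    then have "w z = B z"
      by metis
    then show False
      using Be[OF zt(1) _ \<zeta>t ne(1)] zT not_small \<delta> by simp
  qed
  \<comment> \<open>With \<open>\<zeta>\<close> at time 0 the time of \<open>z\<close> is at most
    \<open>r0\<close>; the initial estimate and the modulus of \<open>ubar\<close> then leave a
    difference of at most 3 \<delta> / 4, less than the required \<delta>.\<close>
  have \<zeta>0: "0 < snd \<zeta>"
  proof (rule ccontr)
    assume "\<not> ?thesis"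
    then have \<zeta>0: "\<zeta> = (fst \<zeta>, 0)"
      using \<zeta>t by (auto simp: prod_eq_iff)
    then have t: "snd z \<le> r0"
      using n_time n by (metis abs_le_iff diff_zero order_trans snd_conv)
    have "w z \<le> B (fst z, 0) + \<delta> / 4 + C * snd z"
      unfolding w_def B0 using zt t r0(2) by (intro C(2) sg) auto
    moreover have "C * snd z \<le> \<delta> / 4"
    proof -
      have "C * snd z \<le> (C + 1) * (\<delta> / (4 * (C + 1)))"
        using C(1) zt t r0(3) by (intro mult_mono) auto
      also have "\<dots> = \<delta> / 4"
        using C(1) by (simp add: field_simps)
      finally show ?thesis .
    qed
    moreover have "B (fst z, 0) \<le> B \<zeta> + \<delta> / 4"
      using Be[of "(fst z, 0)" "(fst \<zeta>, 0)"] ne(2) T \<zeta>t \<zeta>0 by simp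
    ultimately show False
      using not_small \<delta> by linarith
  qed
  \<comment> \<open>Exactly the gradient at which the jet of \<open>ubar\<close> evaluates
    \<open>Hbar\<close>; all gradient errors are left to the side of the half-limit.\<close>
  define p where "p = (sg / \<alpha>) *\<^sub>R (fst z - fst \<zeta>)"
  have "- sg \<in> {1, - 1}"
    using sg by auto
  moreover have "upper_jet (\<lambda>\<zeta>. - sg * ubar \<zeta>) \<zeta> ((1 / \<alpha>) *\<^sub>R (\<zeta> - z)) (\<lambda>h. (1 / \<alpha>) *\<^sub>R h)"
  proof (rule upper_jet_localI)
    show "linear (\<lambda>h. (1 / \<alpha>) *\<^sub>R h)"
      by (intro linear_compose_scale_right linear_id[unfolded id_def])
    define r where "r = min (Rx + 1 - norm (fst \<zeta> - x1)) (min (snd \<zeta>) (T + 2 - snd \<zeta>))"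
    show "r > 0"
      using \<zeta>_in \<zeta>0 \<zeta>T by (simp add: r_def)
    fix h :: "(real ^ 'n) \<times> real" assume h: "norm h \<le> r"
    have h': "norm (fst h) \<le> r" "\<bar>snd h\<bar> \<le> r"
      using h norm_fst_le[of "fst h" "snd h"] norm_snd_le[of "snd h" "fst h"] by auto
    have "norm (fst \<zeta> + fst h - x1) \<le> Rx + 1"
      using norm_triangle_ineq[of "fst \<zeta> - x1" "fst h"] h'(1) by (simp add: r_def algebra_simps)
    then have "(z, \<zeta> + h) \<in> D"
      using zD h'(2) by (auto simp: D_def mem_Times_iff r_def dist_norm norm_minus_commute)
    from max[OF this] have "- B (\<zeta> + h) - (norm (z - (\<zeta> + h)))\<^sup>2 / (2 * \<alpha>) \<le> - B \<zeta> - (norm (z - \<zeta>))\<^sup>2 / (2 * \<alpha>)"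
      by (simp add: \<Phi>_def)
    moreover have "(norm (z - (\<zeta> + h)))\<^sup>2 = (norm (z - \<zeta>))\<^sup>2 + 2 * ((\<zeta> - z) \<bullet> h) + h \<bullet> h"
      by (simp add: power2_norm_eq_inner inner_diff_left inner_diff_right inner_add_left inner_add_right inner_commute)
    ultimately have "- B (\<zeta> + h) \<le> - B \<zeta> + (2 * ((\<zeta> - z) \<bullet> h) + h \<bullet> h) / (2 * \<alpha>)"
      by (simp add: add_divide_distrib)
    then show "- sg * ubar (\<zeta> + h) \<le> - sg * ubar \<zeta> + (1 / \<alpha>) *\<^sub>R (\<zeta> - z) \<bullet> h + (h \<bullet> (1 / \<alpha>) *\<^sub>R h) / 2"
      by (simp add: B_def add_divide_distrib)
  qed
  ultimately have jet: "snd ((1 / \<alpha>) *\<^sub>R (\<zeta> - z)) + - sg * Hbar (- sg *\<^sub>R fst ((1 / \<alpha>) *\<^sub>R (\<zeta> - z))) (ubar \<zeta>) \<le> 0"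
    using \<zeta>0 by (intro ubar_jet)
  have "- sg *\<^sub>R fst ((1 / \<alpha>) *\<^sub>R (\<zeta> - z)) = p"
    by (simp add: p_def scaleR_diff_right)
  then have jet': "(snd \<zeta> - snd z) / \<alpha> - sg * Hbar p (ubar \<zeta>) \<le> 0"
    using jet by simp
  \<comment> \<open>The space-time slope of the paraboloid touching the half-limit at
    \<open>z\<close>; its spatial part is \<open>sg *\<^sub>R p\<close> plus the small localisation
    gradient, its time part contains the strict term \<kappa>.\<close>
  define a where "a = (1 / \<alpha>) *\<^sub>R (z - \<zeta>) + ((2 * \<beta>) *\<^sub>R (fst z - x1), \<kappa> + 2 * G * max 0 (snd z - T))"
  define K where "K = 1 / (2 * \<alpha>) + \<beta> + G"
  have K: "K \<ge> 0"
    using \<alpha> \<beta> M by (simp add: K_def G_def)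
  define r where "r = min (Rx - norm (fst z - x1)) (min (snd z / 2) (T + 1 - snd z))"
  have r: "r > 0"
    using z_in z0 zT by (simp add: r_def)
  have touch: "half_limit sg z' \<le> half_limit sg z + a \<bullet> (z' - z) + K * (norm (z' - z))\<^sup>2" if "dist z' z \<le> r" for z'
  proof -
    define h where "h = z' - z"
    have h': "norm (fst h) \<le> r" "\<bar>snd h\<bar> \<le> r"
      using that dist_fst_le[of z' z] dist_snd_le[of z' z] by (auto simp: h_def dist_norm)
    have pos': "0 < snd (z + h)"
      using h'(2) z0 by (auto simp: r_def)
    have "norm (fst z + fst h - x1) \<le> Rx"
      using norm_triangle_ineq[of "fst z - x1" "fst h"] h'(1) by (simp add: r_def algebra_simps)
    then have "(z + h, \<zeta>) \<in> D"
      using zD h'(2) pos' by (auto simp: D_def mem_Times_iff r_def dist_norm norm_minus_commute)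
    from max[OF this] have 1: "w (z + h) \<le> w z + ((norm (z + h - \<zeta>))\<^sup>2 - (norm (z - \<zeta>))\<^sup>2) / (2 * \<alpha>) + (pen (z + h) - pen z)"
      by (simp add: \<Phi>_def diff_divide_distrib)
    have "(norm (z + h - \<zeta>))\<^sup>2 - (norm (z - \<zeta>))\<^sup>2 = 2 * ((z - \<zeta>) \<bullet> h) + (norm h)\<^sup>2"
      by (simp add: power2_norm_eq_inner inner_diff_left inner_diff_right inner_add_left inner_add_right inner_commute)
    then have 2: "((norm (z + h - \<zeta>))\<^sup>2 - (norm (z - \<zeta>))\<^sup>2) / (2 * \<alpha>) = ((1 / \<alpha>) *\<^sub>R (z - \<zeta>)) \<bullet> h + 1 / (2 * \<alpha>) * (norm h)\<^sup>2"
      by (simp add: add_divide_distrib)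
    have "(max 0 ((snd z - T) + snd h))\<^sup>2 \<le> (max 0 (snd z - T))\<^sup>2 + 2 * max 0 (snd z - T) * snd h + (snd h)\<^sup>2"
      by (rule pos_part_square_le)
    then have "G * (max 0 ((snd z - T) + snd h))\<^sup>2 \<le> G * ((max 0 (snd z - T))\<^sup>2 + 2 * max 0 (snd z - T) * snd h + (snd h)\<^sup>2)"
      using M by (intro mult_left_mono) (auto simp: G_def)
    then have 3: "pen (z + h) - pen z \<le> ((2 * \<beta>) *\<^sub>R (fst z - x1), \<kappa> + 2 * G * max 0 (snd z - T)) \<bullet> h + (\<beta> * (norm (fst h))\<^sup>2 + G * (snd h)\<^sup>2)"
      unfolding pen_def fst_add snd_add quadratic_increment by (simp add: inner_prod_def algebra_simps)
    have "(norm (fst h))\<^sup>2 \<le> (norm h)\<^sup>2" "(snd h)\<^sup>2 \<le> (norm h)\<^sup>2"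
      by (simp_all add: norm_prod_def)
    then have 4: "\<beta> * (norm (fst h))\<^sup>2 + G * (snd h)\<^sup>2 \<le> \<beta> * (norm h)\<^sup>2 + G * (norm h)\<^sup>2"
      using \<beta> M by (intro add_mono mult_left_mono) (auto simp: G_def)
    have "w (z + h) \<le> w z + a \<bullet> h + K * (norm h)\<^sup>2"
      using 1 3 4 unfolding 2 a_def K_def inner_add_left distrib_right by linarith
    then show ?thesis
      using pos' z0 by (simp add: w_def extended_half_limit_def h_def)
  qed
  have "snd a + sg * Hbar p (ubar \<zeta>) \<le> CR * \<mu>"
  proof (rule CR(2)[rule_format, OF sg \<mu>(1,2)])
    have "norm p = norm (fst z - fst \<zeta>) / \<alpha>"
      using sg \<alpha>(1) by (auto simp: p_def)
    also have "\<dots> \<le> r0 / \<alpha>"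
      using n_space n \<alpha>(1) by (intro divide_right_mono) auto
    finally show "norm p \<le> R"
      by (simp add: R_def)
    show "\<bar>ubar \<zeta>\<bar> \<le> R" "\<bar>half_limit sg z\<bar> \<le> R"
      using ubarM[OF \<zeta>t] wM[OF zt] z0 by (auto simp: R_def w_def extended_half_limit_def)
    show "sg * ubar \<zeta> \<le> half_limit sg z"
      using not_small \<delta> z0 by (simp add: w_def extended_half_limit_def B_def)
    show "0 < snd z" "0 \<le> K" "0 < r"
      by fact+
    have "sg *\<^sub>R fst a - p = sg *\<^sub>R ((2 * \<beta>) *\<^sub>R (fst z - x1))"
      by (simp add: a_def p_def scaleR_add_right)
    moreover have "norm (sg *\<^sub>R ((2 * \<beta>) *\<^sub>R (fst z - x1))) = norm ((2 * \<beta>) *\<^sub>R (fst z - x1))"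
      using sg by auto
    ultimately show "norm (sg *\<^sub>R fst a - p) < \<mu>"
      using x_small by metis
  next
    fix \<eta> :: real assume \<eta>: "\<eta> > 0"
    obtain \<rho> where \<rho>: "\<rho> > 0" "\<And>\<epsilon> z' k. 0 < \<epsilon> \<Longrightarrow> \<epsilon> < \<rho> \<Longrightarrow> z' \<in> cball z r \<Longrightarrow>
        sg * u \<epsilon> z' $ k < half_limit sg z + a \<bullet> (z' - z) + K * (norm (z' - z))\<^sup>2 + \<eta>"
    proof (rule half_limit_uniform[OF sg compact_cball, of z r "\<lambda>z'. half_limit sg z + a \<bullet> (z' - z) + K * (norm (z' - z))\<^sup>2 + \<eta>"])
      show "0 < snd z'" if "z' \<in> cball z r" for z'
      proof -
        have "\<bar>snd z' - snd z\<bar> \<le> r"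
          using that dist_snd_le[of z' z] by (auto simp: dist_commute dist_real_def)
        moreover have "r \<le> snd z / 2"
          unfolding r_def by (rule order_trans[OF min.cobounded2 min.cobounded1])
        ultimately show ?thesis
          using z0 by linarith
      qed
      show "continuous_on (cball z r) (\<lambda>z'. half_limit sg z + a \<bullet> (z' - z) + K * (norm (z' - z))\<^sup>2 + \<eta>)"
        by (intro continuous_intros)
      show "half_limit sg z' < half_limit sg z + a \<bullet> (z' - z) + K * (norm (z' - z))\<^sup>2 + \<eta>" if "z' \<in> cball z r" for z'
        using touch[of z'] that \<eta> by (simp add: dist_commute)
    qed (rule that)
    then show "\<exists>\<epsilon>1>0. \<forall>\<epsilon> z' k. 0 < \<epsilon> \<longrightarrow> \<epsilon> < \<epsilon>1 \<longrightarrow> dist z' z \<le> r \<longrightarrow>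
        sg * u \<epsilon> z' $ k \<le> half_limit sg z + a \<bullet> (z' - z) + K * (norm (z' - z))\<^sup>2 + \<eta>"
      by (intro exI[of _ \<rho>]) (auto simp: dist_commute intro: less_imp_le)
  next
    fix \<rho> :: real assume "\<rho> > 0"
    then show "\<exists>\<epsilon> z' k. 0 < \<epsilon> \<and> \<epsilon> < \<rho> \<and> dist z' z < \<rho> \<and> half_limit sg z - \<rho> \<le> sg * u \<epsilon> z' $ k"
      using half_limit_greaterD[OF sg zt(1), of "half_limit sg z - \<rho>" \<rho>] by (force intro: less_imp_le)
  qed
  moreover have "snd a = (snd z - snd \<zeta>) / \<alpha> + (\<kappa> + 2 * G * max 0 (snd z - T))"
    by (simp add: a_def)
  moreover have "0 \<le> 2 * G * max 0 (snd z - T)"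
    using M by (simp add: G_def)
  ultimately show False
    using jet' \<mu>(3) by (simp add: diff_divide_distrib)
qed

end

text \<open>The two signs bound \<open>u\<close> by \<open>ubar\<close> from above and from below;
  the room \<open>e\<close> provides the strict inequality that the compactness argument requires on
  \<open>K\<close>.\<close>

theorem (in homogenization) locally_uniform_convergence:
  "locally_uniform_limit (UNIV \<times> {0<..}) (\<lambda>\<epsilon> z. u \<epsilon> z $ k) ubar (at_right 0)"
  unfolding locally_uniform_limit_def
proof (intro allI impI)
  fix K :: "((real ^ 'n) \<times> real) set" assume K: "compact K" "K \<subseteq> UNIV \<times> {0<..}"
  have pos: "0 < snd z" if "z \<in> K" for z
    using K(2) that by (auto simp: mem_Times_iff)
  show "uniform_limit K (\<lambda>\<epsilon> z. u \<epsilon> z $ k) ubar (at_right 0)"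
    unfolding uniform_limit_iff
  proof (intro allI impI)
    fix e :: real assume e: "e > 0"
    have "\<exists>\<rho>>0. \<forall>\<epsilon> z. 0 < \<epsilon> \<longrightarrow> \<epsilon> < \<rho> \<longrightarrow> z \<in> K \<longrightarrow> sg * u \<epsilon> z $ k < sg * ubar z + e" if sg: "sg \<in> {1, - 1}" for sg
    proof -
      obtain \<rho> where "\<rho> > 0" "\<And>\<epsilon> z k. 0 < \<epsilon> \<Longrightarrow> \<epsilon> < \<rho> \<Longrightarrow> z \<in> K \<Longrightarrow> sg * u \<epsilon> z $ k < sg * ubar z + e"
      proof (rule half_limit_uniform[OF sg K(1) pos, of "\<lambda>z. sg * ubar z + e"])
        have "continuous_on K ubar"
          using K(2) by (intro continuous_on_subset[OF ubar_cont]) auto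
        then show "continuous_on K (\<lambda>z. sg * ubar z + e)"
          by (intro continuous_intros)
        show "half_limit sg z < sg * ubar z + e" if "z \<in> K" for z
          using half_limit_le_ubar[OF sg pos[OF that]] e by simp
      qed (assumption, rule that)
      then show ?thesis
        by (intro exI[of _ \<rho>]) simp
    qed
    from this[of 1] this[of "- 1"] obtain \<rho>1 \<rho>2 where \<rho>: "\<rho>1 > 0" "\<rho>2 > 0"
      "\<And>\<epsilon> z. 0 < \<epsilon> \<Longrightarrow> \<epsilon> < \<rho>1 \<Longrightarrow> z \<in> K \<Longrightarrow> 1 * u \<epsilon> z $ k < 1 * ubar z + e"
      "\<And>\<epsilon> z. 0 < \<epsilon> \<Longrightarrow> \<epsilon> < \<rho>2 \<Longrightarrow> z \<in> K \<Longrightarrow> - 1 * u \<epsilon> z $ k < - 1 * ubar z + e"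
      by auto
    have "dist (u \<epsilon> z $ k) (ubar z) < e" if "0 < \<epsilon>" "\<epsilon> < min \<rho>1 \<rho>2" "z \<in> K" for \<epsilon> z
      using \<rho>(3)[of \<epsilon> z] \<rho>(4)[of \<epsilon> z] that unfolding dist_real_def abs_less_iff by simp
    then show "\<forall>\<^sub>F \<epsilon> in at_right 0. \<forall>z\<in>K. dist (u \<epsilon> z $ k) (ubar z) < e"
      unfolding eventually_at_right_field using \<rho>(1,2) by (intro exI[of _ "min \<rho>1 \<rho>2"]) auto
  qed
qed

section \<open>Application to the given environment\<close>

theorem proposition9p8:
  fixes M :: "'w measure"
    and \<tau> :: "real ^ 'n::finite \<Rightarrow> 'w \<Rightarrow> 'w"
    and A :: "'m::finite \<Rightarrow> real ^ 'n \<Rightarrow> 'w \<Rightarrow> real ^ 'n ^ 'n"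
    and H :: "'m \<Rightarrow> real ^ 'n \<Rightarrow> real ^ 'm \<Rightarrow> real ^ 'm \<Rightarrow> real ^ 'n \<Rightarrow> 'w \<Rightarrow> real"
    and \<gamma> :: "'m \<Rightarrow> real"
    and u0 :: "real ^ 'n \<Rightarrow> real ^ 'm"
    and v :: "real ^ 'n \<Rightarrow> real \<Rightarrow> real \<Rightarrow> 'w \<Rightarrow> real ^ 'n \<Rightarrow> real ^ 'm"
    and i1 :: 'm
    and Hbar :: "real ^ 'n \<Rightarrow> real \<Rightarrow> real"
    and \<Omega>3 :: "'w set"
    and \<omega> :: 'w
    and u :: "real \<Rightarrow> (real ^ 'n) \<times> real \<Rightarrow> real ^ 'm"
    and ubar :: "(real ^ 'n) \<times> real \<Rightarrow> real"
  assumes standing: "hj_system M \<tau> A H \<gamma>"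
    and u0: "BUC_on UNIV u0"
    and corrector: "\<And>p r \<delta> \<omega>'. \<delta> > 0 \<Longrightarrow> \<omega>' \<in> space M \<Longrightarrow>
      approx_corrector A H p r \<delta> \<omega>' (v p r \<delta> \<omega>')"
    and effective: "effective_Hamiltonian M v i1 Hbar"
    and Omega3_full: "\<Omega>3 \<in> sets M" "measure M \<Omega>3 = 1"
    and Omega3: "\<And>\<omega>' R p r. \<omega>' \<in> \<Omega>3 \<Longrightarrow> R > 0 \<Longrightarrow>
      ((\<lambda>\<delta>. SUP y\<in>ball 0 (R / \<delta>). \<bar>\<delta> * v p r \<delta> \<omega>' y $ i1 + Hbar p r\<bar>) \<longlongrightarrow> 0) (at_right 0)"
    and omega: "\<omega> \<in> \<Omega>3"
    and u: "\<And>\<epsilon>. \<epsilon> > 0 \<Longrightarrow> solves_system A H u0 \<epsilon> \<omega> (u \<epsilon>)"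
    and ubar: "solves_effective Hbar (\<lambda>x. Min (range (\<lambda>k. u0 x $ k))) ubar"
  shows "\<forall>k. locally_uniform_limit (UNIV \<times> {0<..}) (\<lambda>\<epsilon> z. u \<epsilon> z $ k) ubar (at_right 0)"
proof -
  have \<omega>: "\<omega> \<in> space M"
    using omega Omega3_full(1) sets.sets_into_space by blast
  obtain \<sigma> d CA where coeff: "hj_coefficients \<sigma> d (\<lambda>k p r s y. H k p r s y \<omega>) CA"
    and A_eq: "\<And>k y. A k y \<omega> = (\<chi> a b. \<Sum>j<d k. \<sigma> k y j $ a * \<sigma> k y j $ b)"
    by (rule hj_system.hj_coefficients_at[OF standing \<omega>]) (rule that)
  interpret C: hj_coefficients \<sigma> d "\<lambda>k p r s y. H k p r s y \<omega>" CA
    by (rule coeff)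
  \<comment> \<open>What remains is translation: each viscosity equation is read as two jet
    inequalities, one for each sign, with the columns of the factorisation of \<open>A\<close> at
    this environment.\<close>
  interpret homogenization \<sigma> d "\<lambda>k p r s y. H k p r s y \<omega>" CA u0 "\<lambda>p r \<delta>. v p r \<delta> \<omega>" i1 Hbar u ubar
  proof
    show "BUC_on UNIV u0"
      by (rule u0)
    show "C.corrector p r \<delta> (v p r \<delta> \<omega>)" if "\<delta> > 0" for p r \<delta>
      unfolding C.corrector_def
    proof (intro conjI ballI allI)
      note ac = corrector[OF that \<omega>, of p r, unfolded approx_corrector_def]
      show "bounded (range (v p r \<delta> \<omega>))" "\<exists>L. L-lipschitz_on UNIV (v p r \<delta> \<omega>)"
        using ac by auto
      fix sg :: real and k assume sg: "sg \<in> {1, - 1}"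
      have "visc_eq_zero UNIV (\<lambda>y L B. \<delta> * v p r \<delta> \<omega> y $ k - trace (A k y \<omega> ** hessian B)
          + H k (p + grad L) (vec r) (gap k (v p r \<delta> \<omega> y)) y \<omega>) (\<lambda>y. v p r \<delta> \<omega> y $ k)"
        using ac unfolding gap_def by blast
      then show "jet_subsolution UNIV (\<lambda>y. sg * v p r \<delta> \<omega> y $ k)
          (\<lambda>y Q. sg * (\<delta> * v p r \<delta> \<omega> y $ k + H k (p + sg *\<^sub>R Q) (vec r) (gap k (v p r \<delta> \<omega> y)) y \<omega>)) (\<lambda>j y. \<sigma> k y j) (d k)"
        by (rule visc_elliptic_jet_subsolution[OF _ A_eq sg,
              where h = "\<lambda>y Q. H k (p + Q) (vec r) (gap k (v p r \<delta> \<omega> y)) y \<omega>"])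
    qed
    show "((\<lambda>\<delta>. SUP y\<in>ball 0 (R / \<delta>). \<bar>\<delta> * v p r \<delta> \<omega> y $ i1 + Hbar p r\<bar>) \<longlongrightarrow> 0) (at_right 0)" if "R > 0" for R p r
      by (rule Omega3[OF omega that])
    show "BUC_on (UNIV \<times> {0..<T}) (u \<epsilon>)" if "\<epsilon> > 0" "T > 0" for \<epsilon> T
      using u[OF that(1)] that(2) by (simp add: solves_system_def)
    show "u \<epsilon> (x, 0) = u0 x" if "\<epsilon> > 0" for \<epsilon> x
      using u[OF that] by (simp add: solves_system_def)
    show "jet_subsolution (UNIV \<times> {0<..}) (\<lambda>z. sg * u \<epsilon> z $ k)
        (\<lambda>z P. snd P + sg * H k (sg *\<^sub>R fst P) (u \<epsilon> z) (gap k (u \<epsilon> z) /\<^sub>R \<epsilon>) (fst z /\<^sub>R \<epsilon>) \<omega>)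
        (\<lambda>j z. (sqrt \<epsilon> *\<^sub>R \<sigma> k (fst z /\<^sub>R \<epsilon>) j, 0)) (d k)" if "\<epsilon> > 0" and sg: "sg \<in> {1, - 1}" for \<epsilon> sg k
    proof -
      have "gap k w /\<^sub>R \<epsilon> = (\<chi> j. (w $ k - w $ j) / \<epsilon>)" for w
        by (simp add: vec_eq_iff divide_inverse mult.commute)
      then have "visc_eq_zero (UNIV \<times> {0<..}) (\<lambda>z L B. time_deriv L - \<epsilon> * trace (A k (fst z /\<^sub>R \<epsilon>) \<omega> ** space_hessian B)
           + H k (space_grad L) (u \<epsilon> z) (gap k (u \<epsilon> z) /\<^sub>R \<epsilon>) (fst z /\<^sub>R \<epsilon>) \<omega>) (\<lambda>z. u \<epsilon> z $ k)"
        using u[OF that(1)] by (simp add: solves_system_def)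
      then show ?thesis
        by (rule visc_parabolic_jet_subsolution[OF _ A_eq less_imp_le[OF that(1)] sg,
              where h = "\<lambda>z P. H k P (u \<epsilon> z) (gap k (u \<epsilon> z) /\<^sub>R \<epsilon>) (fst z /\<^sub>R \<epsilon>) \<omega>"])
    qed
    show "BUC_on (UNIV \<times> {0..<T}) ubar" if "T > 0" for T
      using ubar that by (simp add: solves_effective_def)
    show "ubar (x, 0) = Min (range (\<lambda>k. u0 x $ k))" for x
      using ubar by (simp add: solves_effective_def)
    show "snd P + sg * Hbar (sg *\<^sub>R fst P) (ubar z) \<le> 0"
      if "sg \<in> {1, - 1}" "0 < snd z" "upper_jet (\<lambda>z. sg * ubar z) z P X" for sg z P X
    proof (rule visc_first_order_jet[where S = "UNIV \<times> {0<..}" and h = "\<lambda>z P. Hbar P (ubar z)"])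
      show "visc_eq_zero (UNIV \<times> {0<..}) (\<lambda>z L B. time_deriv L + Hbar (space_grad L) (ubar z)) ubar"
        using ubar by (simp add: solves_effective_def)
      show "z \<in> UNIV \<times> {0<..}"
        using that(2) by (simp add: mem_Times_iff)
    qed (rule that)+
  qed
  show ?thesis
    using locally_uniform_convergence by blast
qed

end
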